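(* Let $k$ be a field and let $H$ be a finite dimensional weak Hopf algebra over $k$. Let $A$ be a right $H$-comodule algebra and let $\mathfrak{E}$ be the $A$-coring associated to the corresponding right-right weak entwining map $\psi_R:H\otimes A\to A\otimes H$, $h\otimes a\mapsto\sum a_{[0]}\otimes ha_{[1]}$. Let $B=A^{\mathrm{co}H}$. If the map $$\widetilde{\mathrm{can}}_A:A\otimes A\to\mathfrak{E},\qquad a\otimes b\mapsto\sum ab_{[0]}\otimes b_{[1]}$$ is surjective, then $B\subseteq A$ is a weak Hopf-Galois $H$-extension and $A$ is projective as a left (and right) $B$-module.
   Context: Algebras are associative unital $k$-algebras, coalgebras are coassociative counital $k$-coalgebras, $\otimes=\otimes_k$, $\Delta(h)=\sum h_{(1)}\otimes h_{(2)}$. A weak bialgebra $H$ is a $k$-module with an algebra and a coalgebra structure $(\Delta,\varepsilon)$ such that $\Delta$ is multiplicative, $(\Delta\otimes H)\Delta(1)=\sum1_{(1)}\otimes1_{(2)}1_{(1')}\otimes1_{(2')}=\sum1_{(1)}\otimes1_{(1')}1_{(2)}\otimes1_{(2')}$ (with $\Delta(1)=\sum1_{(1)}\otimes1_{(2)}=\sum1_{(1')}\otimes1_{(2')}$) and $\varepsilon(hkl)=\sum\varepsilon(hk_{(1)})\varepsilon(k_{(2)}l)=\sum\varepsilon(hk_{(2)})\varepsilon(k_{(1)}l)$. Put $\Pi^L(h)=\sum\varepsilon(1_{(1)}h)1_{(2)}$, $\Pi^R(h)=\sum\varepsilon(h1_{(2)})1_{(1)}$. A weak Hopf algebra is a weak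 bialgebra with a $k$-linear antipode $S:H\to H$ satisfying $\sum h_{(1)}S(h_{(2)})=\Pi^L(h)$, $\sum S(h_{(1)})h_{(2)}=\Pi^R(h)$, $\sum S(h_{(1)})h_{(2)}S(h_{(3)})=S(h)$. A right $H$-comodule algebra is an algebra $A$ with a right $H$-coaction $\varrho:A\to A\otimes H$, $\varrho(a)=\sum a_{[0]}\otimes a_{[1]}$, such that $\varrho(ab)=\varrho(a)\varrho(b)$ and $\sum a_{[0]}\otimes\Pi^L(a_{[1]})=\sum1_{[0]}a\otimes1_{[1]}$ for all $a,b\in A$. The coring $\mathfrak{E}$ is the image of the projection $p_R:A\otimes H\to A\otimes H$, $a\otimes h\mapsto\sum a1_{[0]}\otimes h1_{[1]}$, with bimodule structure $b'(\sum a1_{[0]}\otimes h1_{[1]})b=\sum b'ab_{[0]}\otimes hb_{[1]}$, coproduct $p_R(a\otimes h)\mapsto\sum p_R(a\otimes h_{(1)})\otimes_Ap_R(1\otimes h_{(2)})$ and counit $\sum a\otimes h\mapsto\sum a\varepsilon(h)$ restricted to $\mathfrak{E}$. Coinvariants: $A^{\mathrm{co}H}=\{b\in A\mid\forall a\in A,\ \varrho(ba)=b\varrho(a)\}$. With $B=A^{\mathrm{co}H}$, $B\subseteq A$ is a weak Hopf-Galois $H$-extension if $\mathrm{can}_A:A\otimes_BA\to\mathfrak{E}$, $a\otimes_Bb\mapsto\sum ab_{[0]}\otimes b_{[1]}$ is an isomorphism of $A$-corings, where $A\otimes_BA$ is the Sweedler coring with coproduct $a\otimes a'\mapsto(a\otimes1)\otimes_A(1\otimes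 a')$ and counit $a\otimes a'\mapsto aa'$. *)

theory Defs
  imports "HOL-Algebra.Algebra" "Jordan_Normal_Form.Missing_VectorSpace"
begin

section \<open>Modules over noncommutative rings\<close>

text \<open>The locale \<^locale>\<open>module\<close> of the library requires a commutative ring of scalars.  Over an
  arbitrary ring the underlying abelian group and the action are kept apart: only the additive part
  of the record \<open>M\<close> is used.\<close>

locale left_module = R?: ring R + M?: abelian_group M
  for R (structure) and M (structure) +
  fixes act :: "'a \<Rightarrow> 'c \<Rightarrow> 'c"
  assumes act_closed: "r \<in> carrier R \<Longrightarrow> x \<in> carrier M \<Longrightarrow> act r x \<in> carrier M"
    and act_l_distr: "r \<in> carrier R \<Longrightarrow> s \<in> carrier R \<Longrightarrow> x \<in> carrier M \<Longrightarrow>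
      act (r \<oplus> s) x = act r x \<oplus>\<^bsub>M\<^esub> act s x"
    and act_r_distr: "r \<in> carrier R \<Longrightarrow> x \<in> carrier M \<Longrightarrow> y \<in> carrier M \<Longrightarrow>
      act r (x \<oplus>\<^bsub>M\<^esub> y) = act r x \<oplus>\<^bsub>M\<^esub> act r y"
    and act_assoc: "r \<in> carrier R \<Longrightarrow> s \<in> carrier R \<Longrightarrow> x \<in> carrier M \<Longrightarrow>
      act (r \<otimes> s) x = act r (act s x)"
    and act_one: "x \<in> carrier M \<Longrightarrow> act \<one> x = x"

locale right_module = R?: ring R + M?: abelian_group M
  for R (structure) and M (structure) +
  fixes act :: "'c \<Rightarrow> 'a \<Rightarrow> 'c"
  assumes ract_closed: "r \<in> carrier R \<Longrightarrow> x \<in> carrier M \<Longrightarrow> act x r \<in> carrier M"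
    and ract_r_distr: "r \<in> carrier R \<Longrightarrow> s \<in> carrier R \<Longrightarrow> x \<in> carrier M \<Longrightarrow>
      act x (r \<oplus> s) = act x r \<oplus>\<^bsub>M\<^esub> act x s"
    and ract_l_distr: "r \<in> carrier R \<Longrightarrow> x \<in> carrier M \<Longrightarrow> y \<in> carrier M \<Longrightarrow>
      act (x \<oplus>\<^bsub>M\<^esub> y) r = act x r \<oplus>\<^bsub>M\<^esub> act y r"
    and ract_assoc: "r \<in> carrier R \<Longrightarrow> s \<in> carrier R \<Longrightarrow> x \<in> carrier M \<Longrightarrow>
      act x (r \<otimes> s) = act (act x r) s"
    and ract_one: "x \<in> carrier M \<Longrightarrow> act x \<one> = x"

definition left_module_hom ::
    "('r, 'x) ring_scheme \<Rightarrow> ('m, 'y) ring_scheme \<Rightarrow> ('r \<Rightarrow> 'm \<Rightarrow> 'm) \<Rightarrow>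
     ('n, 'z) ring_scheme \<Rightarrow> ('r \<Rightarrow> 'n \<Rightarrow> 'n) \<Rightarrow> ('m \<Rightarrow> 'n) set" where
  "left_module_hom R M act N act' =
     {f \<in> hom (add_monoid M) (add_monoid N).
        \<forall>r \<in> carrier R. \<forall>x \<in> carrier M. f (act r x) = act' r (f x)}"

definition right_module_hom ::
    "('r, 'x) ring_scheme \<Rightarrow> ('m, 'y) ring_scheme \<Rightarrow> ('m \<Rightarrow> 'r \<Rightarrow> 'm) \<Rightarrow>
     ('n, 'z) ring_scheme \<Rightarrow> ('n \<Rightarrow> 'r \<Rightarrow> 'n) \<Rightarrow> ('m \<Rightarrow> 'n) set" where
  "right_module_hom R M act N act' =
     {f \<in> hom (add_monoid M) (add_monoid N).
        \<forall>r \<in> carrier R. \<forall>x \<in> carrier M. f (act x r) = act' (f x) r}"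

text \<open>Projectivity is the lifting property against all surjections \<open>M \<rightarrow> N\<close>.  HOL cannot quantify
  over types inside a definition, so the types of the elements of \<open>M\<close> and \<open>N\<close> are parameters; a
  theorem in which \<open>'m\<close> and \<open>'n\<close> are free type variables asserts lifting against all modules.\<close>

definition projective_left_module ::
    "'m itself \<Rightarrow> 'n itself \<Rightarrow> ('r, 'x) ring_scheme \<Rightarrow> ('p, 'y) ring_scheme \<Rightarrow>
     ('r \<Rightarrow> 'p \<Rightarrow> 'p) \<Rightarrow> bool" where
  "projective_left_module TM TN R P actP \<longleftrightarrow>
     left_module R P actP \<and>
     (\<forall>(M :: 'm ring) actM (N :: 'n ring) actN.
        \<forall>g \<in> left_module_hom R M actM N actN. \<forall>f \<in> left_module_hom R P actP N actN.
          left_module R M actM \<and> left_module R N actN \<and> g ` carrier M = carrier N \<longrightarrow>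
          (\<exists>h \<in> left_module_hom R P actP M actM. \<forall>p \<in> carrier P. g (h p) = f p))"

definition projective_right_module ::
    "'m itself \<Rightarrow> 'n itself \<Rightarrow> ('r, 'x) ring_scheme \<Rightarrow> ('p, 'y) ring_scheme \<Rightarrow>
     ('p \<Rightarrow> 'r \<Rightarrow> 'p) \<Rightarrow> bool" where
  "projective_right_module TM TN R P actP \<longleftrightarrow>
     right_module R P actP \<and>
     (\<forall>(M :: 'm ring) actM (N :: 'n ring) actN.
        \<forall>g \<in> right_module_hom R M actM N actN. \<forall>f \<in> right_module_hom R P actP N actN.
          right_module R M actM \<and> right_module R N actN \<and> g ` carrier M = carrier N \<longrightarrow>
          (\<exists>h \<in> right_module_hom R P actP M actM. \<forall>p \<in> carrier P. g (h p) = f p))"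

record ('a, 'b) bimodule = "('a, 'b) module" +
  rsmult :: "['b, 'a] \<Rightarrow> 'b" (infixl \<open>\<star>\<index>\<close> 70)

locale bimodule = left_module A C "(\<odot>\<^bsub>C\<^esub>)" + right_module A C "(\<star>\<^bsub>C\<^esub>)"
  for A :: "('a, 'x) ring_scheme" (structure)
    and C :: "('a, 'c, 'y) bimodule_scheme" (structure) +
  assumes smult_rsmult: "a \<in> carrier A \<Longrightarrow> b \<in> carrier A \<Longrightarrow> x \<in> carrier C \<Longrightarrow>
    (a \<odot>\<^bsub>C\<^esub> x) \<star>\<^bsub>C\<^esub> b = a \<odot>\<^bsub>C\<^esub> (x \<star>\<^bsub>C\<^esub> b)"

definition bimodule_hom ::
    "('a, 'x) ring_scheme \<Rightarrow> ('a, 'c, 'y) bimodule_scheme \<Rightarrow> ('a, 'd, 'z) bimodule_scheme \<Rightarrow>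
     ('c \<Rightarrow> 'd) set" where
  "bimodule_hom A C D =
     left_module_hom A C (smult C) D (smult D) \<inter> right_module_hom A C (rsmult C) D (rsmult D)"

definition regular_bimodule :: "('a, 'x) ring_scheme \<Rightarrow> ('a, 'a) bimodule" where
  "regular_bimodule R =
     \<lparr>carrier = carrier R, monoid.mult = monoid.mult R, one = one R, ring.zero = ring.zero R, ring.add = ring.add R,
      smult = monoid.mult R, rsmult = monoid.mult R\<rparr>"


section \<open>Tensor products\<close>

text \<open>\<open>M \<otimes>\<^sub>R N\<close> is the free abelian group on \<open>M \<times> N\<close> modulo the usual relations, so a tensor is a
  coset of formal integer combinations of pairs.  The fields \<open>mult\<close> and \<open>one\<close> of the record play no
  role.\<close>

type_synonym ('m, 'n) tensor = "('m \<times> 'n \<Rightarrow>\<^sub>0 int) set"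

definition tensor_relations ::
    "('r, 'x) ring_scheme \<Rightarrow> ('m, 'y) ring_scheme \<Rightarrow> ('m \<Rightarrow> 'r \<Rightarrow> 'm) \<Rightarrow>
     ('n, 'z) ring_scheme \<Rightarrow> ('r \<Rightarrow> 'n \<Rightarrow> 'n) \<Rightarrow> ('m \<times> 'n \<Rightarrow>\<^sub>0 int) set" where
  "tensor_relations R M ract N lact =
     {frag_of (x \<oplus>\<^bsub>M\<^esub> x', y) - frag_of (x, y) - frag_of (x', y) | x x' y.
        x \<in> carrier M \<and> x' \<in> carrier M \<and> y \<in> carrier N} \<union>
     {frag_of (x, y \<oplus>\<^bsub>N\<^esub> y') - frag_of (x, y) - frag_of (x, y') | x y y'.
        x \<in> carrier M \<and> y \<in> carrier N \<and> y' \<in> carrier N} \<union>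
     {frag_of (ract x r, y) - frag_of (x, lact r y) | x r y.
        x \<in> carrier M \<and> r \<in> carrier R \<and> y \<in> carrier N}"

definition tensor_product ::
    "('r, 'x) ring_scheme \<Rightarrow> ('m, 'y) ring_scheme \<Rightarrow> ('m \<Rightarrow> 'r \<Rightarrow> 'm) \<Rightarrow>
     ('n, 'z) ring_scheme \<Rightarrow> ('r \<Rightarrow> 'n \<Rightarrow> 'n) \<Rightarrow> ('m, 'n) tensor ring" where
  "tensor_product R M ract N lact =
     (let F = free_Abelian_group (carrier M \<times> carrier N);
          Q = F Mod generate F (tensor_relations R M ract N lact)
      in \<lparr>carrier = carrier Q, monoid.mult = undefined, one = undefined,
          ring.zero = \<one>\<^bsub>Q\<^esub>, ring.add = (\<lambda>s t. s \<otimes>\<^bsub>Q\<^esub> t)\<rparr>)"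

text \<open>The elementary tensor \<open>x \<otimes> y\<close>: the zero of a tensor product \<open>T\<close> is the subgroup generated by
  the relations, so this is the coset of the generator \<open>(x, y)\<close>.\<close>

definition pure_tensor ::
    "(('m, 'n) tensor, 'x) ring_scheme \<Rightarrow> 'm \<Rightarrow> 'n \<Rightarrow> ('m, 'n) tensor" where
  "pure_tensor T x y = (\<lambda>c. c + frag_of (x, y)) ` \<zero>\<^bsub>T\<^esub>"

text \<open>\<open>tensor_sum G t f\<close> is the element \<open>\<Sum> f x y\<close> of \<open>G\<close> for \<open>t = \<Sum> x \<otimes> y\<close>, as in Sweedler's notation.
  It does not depend on the representative of \<open>t\<close> as soon as \<open>f\<close> is biadditive and balanced, which
  is the case at every use below.\<close>

definition tensor_sum ::
    "('g, 'x) ring_scheme \<Rightarrow> ('m, 'n) tensor \<Rightarrow> ('m \<Rightarrow> 'n \<Rightarrow> 'g) \<Rightarrow> 'g" where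
  "tensor_sum G t f =
     (let c = (SOME c. c \<in> t)
      in (\<Oplus>\<^bsub>G\<^esub>z\<in>Poly_Mapping.keys c. [Poly_Mapping.lookup c z] \<cdot>\<^bsub>G\<^esub> f (fst z) (snd z)))"

definition ktensor ::
    "('k, 'x) ring_scheme \<Rightarrow> ('k, 'm, 'y) module_scheme \<Rightarrow> ('k, 'n, 'z) module_scheme \<Rightarrow>
     ('k, ('m, 'n) tensor) module" where
  "ktensor K M N =
     (let T = tensor_product K M (\<lambda>x c. c \<odot>\<^bsub>M\<^esub> x) N (smult N)
      in \<lparr>carrier = carrier T, monoid.mult = monoid.mult T, one = one T,
          ring.zero = ring.zero T, ring.add = ring.add T,
          smult = (\<lambda>c t. tensor_sum T t (\<lambda>x y. pure_tensor T (c \<odot>\<^bsub>M\<^esub> x) y))\<rparr>)"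

text \<open>The outer actions of \<open>M\<close> (left) and \<open>N\<close> (right) on \<open>M \<otimes>\<^sub>R N\<close> survive, also when \<open>R\<close> is only a
  subring of the ring acting on \<open>M\<close> and \<open>N\<close>.\<close>

definition bitensor ::
    "('a, 'x) ring_scheme \<Rightarrow> ('a, 'm, 'y) bimodule_scheme \<Rightarrow> ('a, 'n, 'z) bimodule_scheme \<Rightarrow>
     ('a, ('m, 'n) tensor) bimodule" where
  "bitensor R M N =
     (let T = tensor_product R M (rsmult M) N (smult N)
      in \<lparr>carrier = carrier T, monoid.mult = monoid.mult T, one = one T,
          ring.zero = ring.zero T, ring.add = ring.add T,
          smult = (\<lambda>a t. tensor_sum T t (\<lambda>x y. pure_tensor T (a \<odot>\<^bsub>M\<^esub> x) y)),
          rsmult = (\<lambda>t a. tensor_sum T t (\<lambda>x y. pure_tensor T x (y \<star>\<^bsub>N\<^esub> a)))\<rparr>)"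


section \<open>Corings\<close>

locale coring = bimodule A C
  for A :: "('a, 'x) ring_scheme" (structure)
    and C :: "('a, 'c, 'y) bimodule_scheme" (structure) +
  fixes \<Delta> :: "'c \<Rightarrow> ('c, 'c) tensor" and \<epsilon> :: "'c \<Rightarrow> 'a"
  assumes comult_hom: "\<Delta> \<in> bimodule_hom A C (bitensor A C C)"
    and counit_hom: "\<epsilon> \<in> bimodule_hom A C (regular_bimodule A)"
    and coassoc: "c \<in> carrier C \<Longrightarrow>
      tensor_sum (bitensor A (bitensor A C C) C) (\<Delta> c)
        (\<lambda>x y. pure_tensor (bitensor A (bitensor A C C) C) (\<Delta> x) y) =
      tensor_sum (bitensor A (bitensor A C C) C) (\<Delta> c)
        (\<lambda>x y. tensor_sum (bitensor A (bitensor A C C) C) (\<Delta> y)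
          (\<lambda>u v. pure_tensor (bitensor A (bitensor A C C) C)
            (pure_tensor (bitensor A C C) x u) v))"
    and counit_left: "c \<in> carrier C \<Longrightarrow> tensor_sum C (\<Delta> c) (\<lambda>x y. \<epsilon> x \<odot>\<^bsub>C\<^esub> y) = c"
    and counit_right: "c \<in> carrier C \<Longrightarrow> tensor_sum C (\<Delta> c) (\<lambda>x y. x \<star>\<^bsub>C\<^esub> \<epsilon> y) = c"

definition coring_iso ::
    "('a, 'x) ring_scheme \<Rightarrow>
     ('a, 'c, 'y) bimodule_scheme \<Rightarrow> ('c \<Rightarrow> ('c, 'c) tensor) \<Rightarrow> ('c \<Rightarrow> 'a) \<Rightarrow>
     ('a, 'd, 'z) bimodule_scheme \<Rightarrow> ('d \<Rightarrow> ('d, 'd) tensor) \<Rightarrow> ('d \<Rightarrow> 'a) \<Rightarrow>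
     ('c \<Rightarrow> 'd) \<Rightarrow> bool" where
  "coring_iso A C \<Delta>C \<epsilon>C D \<Delta>D \<epsilon>D f \<longleftrightarrow>
     coring A C \<Delta>C \<epsilon>C \<and> coring A D \<Delta>D \<epsilon>D \<and>
     f \<in> bimodule_hom A C D \<and> bij_betw f (carrier C) (carrier D) \<and>
     (\<forall>c \<in> carrier C.
        \<Delta>D (f c) = tensor_sum (bitensor A D D) (\<Delta>C c)
                       (\<lambda>x y. pure_tensor (bitensor A D D) (f x) (f y)) \<and>
        \<epsilon>D (f c) = \<epsilon>C c)"

text \<open>The Sweedler coring \<open>A \<otimes>\<^sub>B A\<close> of a subring \<open>B\<close> of \<open>A\<close>.\<close>

definition sweedler_bimodule ::
    "('a, 'x) ring_scheme \<Rightarrow> 'a set \<Rightarrow> ('a, ('a, 'a) tensor) bimodule" where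
  "sweedler_bimodule A B =
     bitensor (A\<lparr>carrier := B\<rparr>) (regular_bimodule A) (regular_bimodule A)"

definition sweedler_comult ::
    "('a, 'x) ring_scheme \<Rightarrow> 'a set \<Rightarrow>
     ('a, 'a) tensor \<Rightarrow> (('a, 'a) tensor, ('a, 'a) tensor) tensor" where
  "sweedler_comult A B t =
     (let C = sweedler_bimodule A B; CC = bitensor A C C
      in tensor_sum CC t (\<lambda>a a'. pure_tensor CC (pure_tensor C a \<one>\<^bsub>A\<^esub>) (pure_tensor C \<one>\<^bsub>A\<^esub> a')))"

definition sweedler_counit :: "('a, 'x) ring_scheme \<Rightarrow> ('a, 'a) tensor \<Rightarrow> 'a" where
  "sweedler_counit A t = tensor_sum A t (\<lambda>a a'. a \<otimes>\<^bsub>A\<^esub> a')"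


section \<open>Weak Hopf algebras\<close>

locale assoc_algebra = module K A + ring A
  for K :: "('k, 'x) ring_scheme" (structure)
    and A :: "('k, 'a, 'y) module_scheme" (structure) +
  assumes smult_mult_left: "c \<in> carrier K \<Longrightarrow> x \<in> carrier A \<Longrightarrow> y \<in> carrier A \<Longrightarrow>
      (c \<odot>\<^bsub>A\<^esub> x) \<otimes>\<^bsub>A\<^esub> y = c \<odot>\<^bsub>A\<^esub> (x \<otimes>\<^bsub>A\<^esub> y)"
    and smult_mult_right: "c \<in> carrier K \<Longrightarrow> x \<in> carrier A \<Longrightarrow> y \<in> carrier A \<Longrightarrow>
      x \<otimes>\<^bsub>A\<^esub> (c \<odot>\<^bsub>A\<^esub> y) = c \<odot>\<^bsub>A\<^esub> (x \<otimes>\<^bsub>A\<^esub> y)"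

locale coalgebra = module K C
  for K :: "('k, 'x) ring_scheme" (structure)
    and C :: "('k, 'c, 'y) module_scheme" (structure) +
  fixes \<Delta> :: "'c \<Rightarrow> ('c, 'c) tensor" and \<epsilon> :: "'c \<Rightarrow> 'k"
  assumes comult_linear: "\<Delta> \<in> module_hom K C (ktensor K C C)"
    and counit_linear: "\<epsilon> \<in> module_hom K C (regular_bimodule K)"
    and coassoc: "c \<in> carrier C \<Longrightarrow>
      tensor_sum (ktensor K (ktensor K C C) C) (\<Delta> c)
        (\<lambda>x y. pure_tensor (ktensor K (ktensor K C C) C) (\<Delta> x) y) =
      tensor_sum (ktensor K (ktensor K C C) C) (\<Delta> c)
        (\<lambda>x y. tensor_sum (ktensor K (ktensor K C C) C) (\<Delta> y)
          (\<lambda>u v. pure_tensor (ktensor K (ktensor K C C) C)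
            (pure_tensor (ktensor K C C) x u) v))"
    and counit_left: "c \<in> carrier C \<Longrightarrow> tensor_sum C (\<Delta> c) (\<lambda>x y. \<epsilon> x \<odot>\<^bsub>C\<^esub> y) = c"
    and counit_right: "c \<in> carrier C \<Longrightarrow> tensor_sum C (\<Delta> c) (\<lambda>x y. \<epsilon> y \<odot>\<^bsub>C\<^esub> x) = c"

locale weak_bialgebra = assoc_algebra K H + coalgebra K H \<Delta> \<epsilon>
  for K :: "('k, 'x) ring_scheme" (structure)
    and H :: "('k, 'h, 'y) module_scheme" (structure)
    and \<Delta> :: "'h \<Rightarrow> ('h, 'h) tensor" and \<epsilon> :: "'h \<Rightarrow> 'k" +
  assumes comult_mult: "g \<in> carrier H \<Longrightarrow> h \<in> carrier H \<Longrightarrow>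
      \<Delta> (g \<otimes>\<^bsub>H\<^esub> h) =
      tensor_sum (ktensor K H H) (\<Delta> g) (\<lambda>g1 g2.
        tensor_sum (ktensor K H H) (\<Delta> h) (\<lambda>h1 h2.
          pure_tensor (ktensor K H H) (g1 \<otimes>\<^bsub>H\<^esub> h1) (g2 \<otimes>\<^bsub>H\<^esub> h2)))"
    and comult_one:
      "tensor_sum (ktensor K (ktensor K H H) H) (\<Delta> \<one>\<^bsub>H\<^esub>)
         (\<lambda>x y. pure_tensor (ktensor K (ktensor K H H) H) (\<Delta> x) y) =
       tensor_sum (ktensor K (ktensor K H H) H) (\<Delta> \<one>\<^bsub>H\<^esub>) (\<lambda>x y.
         tensor_sum (ktensor K (ktensor K H H) H) (\<Delta> \<one>\<^bsub>H\<^esub>) (\<lambda>x' y'.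
           pure_tensor (ktensor K (ktensor K H H) H)
             (pure_tensor (ktensor K H H) x (y \<otimes>\<^bsub>H\<^esub> x')) y'))"
    and comult_one':
      "tensor_sum (ktensor K (ktensor K H H) H) (\<Delta> \<one>\<^bsub>H\<^esub>)
         (\<lambda>x y. pure_tensor (ktensor K (ktensor K H H) H) (\<Delta> x) y) =
       tensor_sum (ktensor K (ktensor K H H) H) (\<Delta> \<one>\<^bsub>H\<^esub>) (\<lambda>x y.
         tensor_sum (ktensor K (ktensor K H H) H) (\<Delta> \<one>\<^bsub>H\<^esub>) (\<lambda>x' y'.
           pure_tensor (ktensor K (ktensor K H H) H)
             (pure_tensor (ktensor K H H) x (x' \<otimes>\<^bsub>H\<^esub> y)) y'))"
    and counit_mult:
      "g \<in> carrier H \<Longrightarrow> h \<in> carrier H \<Longrightarrow> l \<in> carrier H \<Longrightarrow>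
       \<epsilon> (g \<otimes>\<^bsub>H\<^esub> h \<otimes>\<^bsub>H\<^esub> l) =
       tensor_sum K (\<Delta> h) (\<lambda>h1 h2. \<epsilon> (g \<otimes>\<^bsub>H\<^esub> h1) \<otimes>\<^bsub>K\<^esub> \<epsilon> (h2 \<otimes>\<^bsub>H\<^esub> l))"
    and counit_mult':
      "g \<in> carrier H \<Longrightarrow> h \<in> carrier H \<Longrightarrow> l \<in> carrier H \<Longrightarrow>
       \<epsilon> (g \<otimes>\<^bsub>H\<^esub> h \<otimes>\<^bsub>H\<^esub> l) =
       tensor_sum K (\<Delta> h) (\<lambda>h1 h2. \<epsilon> (g \<otimes>\<^bsub>H\<^esub> h2) \<otimes>\<^bsub>K\<^esub> \<epsilon> (h1 \<otimes>\<^bsub>H\<^esub> l))"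

definition PiL ::
    "('k, 'h, 'y) module_scheme \<Rightarrow> ('h \<Rightarrow> ('h, 'h) tensor) \<Rightarrow> ('h \<Rightarrow> 'k) \<Rightarrow> 'h \<Rightarrow> 'h" where
  "PiL H \<Delta> \<epsilon> h = tensor_sum H (\<Delta> \<one>\<^bsub>H\<^esub>) (\<lambda>x y. \<epsilon> (x \<otimes>\<^bsub>H\<^esub> h) \<odot>\<^bsub>H\<^esub> y)"

definition PiR ::
    "('k, 'h, 'y) module_scheme \<Rightarrow> ('h \<Rightarrow> ('h, 'h) tensor) \<Rightarrow> ('h \<Rightarrow> 'k) \<Rightarrow> 'h \<Rightarrow> 'h" where
  "PiR H \<Delta> \<epsilon> h = tensor_sum H (\<Delta> \<one>\<^bsub>H\<^esub>) (\<lambda>x y. \<epsilon> (h \<otimes>\<^bsub>H\<^esub> y) \<odot>\<^bsub>H\<^esub> x)"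

locale weak_hopf_algebra = weak_bialgebra K H \<Delta> \<epsilon>
  for K :: "('k, 'x) ring_scheme" (structure)
    and H :: "('k, 'h, 'y) module_scheme" (structure)
    and \<Delta> :: "'h \<Rightarrow> ('h, 'h) tensor" and \<epsilon> :: "'h \<Rightarrow> 'k" +
  fixes S :: "'h \<Rightarrow> 'h"
  assumes antipode_linear: "S \<in> module_hom K H H"
    and antipode_left: "h \<in> carrier H \<Longrightarrow>
      tensor_sum H (\<Delta> h) (\<lambda>h1 h2. h1 \<otimes>\<^bsub>H\<^esub> S h2) = PiL H \<Delta> \<epsilon> h"
    and antipode_right: "h \<in> carrier H \<Longrightarrow>
      tensor_sum H (\<Delta> h) (\<lambda>h1 h2. S h1 \<otimes>\<^bsub>H\<^esub> h2) = PiR H \<Delta> \<epsilon> h"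
    and antipode_both: "h \<in> carrier H \<Longrightarrow>
      tensor_sum H (\<Delta> h) (\<lambda>h1 x. tensor_sum H (\<Delta> x) (\<lambda>h2 h3.
        S h1 \<otimes>\<^bsub>H\<^esub> h2 \<otimes>\<^bsub>H\<^esub> S h3)) = S h"


section \<open>Comodule algebras and weak Hopf-Galois extensions\<close>

text \<open>\<open>a (\<Sum> x \<otimes> y) = \<Sum> a x \<otimes> y\<close> on \<open>A \<otimes> H\<close>.\<close>

definition tensor_lmult ::
    "('k, 'x) ring_scheme \<Rightarrow> ('k, 'h, 'y) module_scheme \<Rightarrow> ('k, 'a, 'z) module_scheme \<Rightarrow>
     'a \<Rightarrow> ('a, 'h) tensor \<Rightarrow> ('a, 'h) tensor" where
  "tensor_lmult K H A a t =
     tensor_sum (ktensor K A H) t (\<lambda>x y. pure_tensor (ktensor K A H) (a \<otimes>\<^bsub>A\<^esub> x) y)"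

locale comodule_algebra = H: weak_bialgebra K H \<Delta> \<epsilon> + A: assoc_algebra K A
  for K :: "('k, 'x) ring_scheme" (structure)
    and H :: "('k, 'h, 'y) module_scheme" (structure)
    and \<Delta> :: "'h \<Rightarrow> ('h, 'h) tensor" and \<epsilon> :: "'h \<Rightarrow> 'k"
    and A :: "('k, 'a, 'z) module_scheme" (structure) +
  fixes \<rho> :: "'a \<Rightarrow> ('a, 'h) tensor"
  assumes coaction_linear: "\<rho> \<in> module_hom K A (ktensor K A H)"
    and coaction_coassoc: "a \<in> carrier A \<Longrightarrow>
      tensor_sum (ktensor K (ktensor K A H) H) (\<rho> a)
        (\<lambda>x y. pure_tensor (ktensor K (ktensor K A H) H) (\<rho> x) y) =
      tensor_sum (ktensor K (ktensor K A H) H) (\<rho> a)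
        (\<lambda>x y. tensor_sum (ktensor K (ktensor K A H) H) (\<Delta> y)
          (\<lambda>u v. pure_tensor (ktensor K (ktensor K A H) H)
            (pure_tensor (ktensor K A H) x u) v))"
    and coaction_counit: "a \<in> carrier A \<Longrightarrow> tensor_sum A (\<rho> a) (\<lambda>x y. \<epsilon> y \<odot>\<^bsub>A\<^esub> x) = a"
    and coaction_mult: "a \<in> carrier A \<Longrightarrow> b \<in> carrier A \<Longrightarrow>
      \<rho> (a \<otimes>\<^bsub>A\<^esub> b) =
      tensor_sum (ktensor K A H) (\<rho> a) (\<lambda>a0 a1.
        tensor_sum (ktensor K A H) (\<rho> b) (\<lambda>b0 b1.
          pure_tensor (ktensor K A H) (a0 \<otimes>\<^bsub>A\<^esub> b0) (a1 \<otimes>\<^bsub>H\<^esub> b1)))"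
    and coaction_one: "a \<in> carrier A \<Longrightarrow>
      tensor_sum (ktensor K A H) (\<rho> a)
        (\<lambda>a0 a1. pure_tensor (ktensor K A H) a0 (PiL H \<Delta> \<epsilon> a1)) =
      tensor_sum (ktensor K A H) (\<rho> \<one>\<^bsub>A\<^esub>)
        (\<lambda>x y. pure_tensor (ktensor K A H) (x \<otimes>\<^bsub>A\<^esub> a) y)"

definition coinvariants ::
    "('k, 'x) ring_scheme \<Rightarrow> ('k, 'h, 'y) module_scheme \<Rightarrow> ('k, 'a, 'z) module_scheme \<Rightarrow>
     ('a \<Rightarrow> ('a, 'h) tensor) \<Rightarrow> 'a set" where
  "coinvariants K H A \<rho> =
     {b \<in> carrier A. \<forall>a \<in> carrier A. \<rho> (b \<otimes>\<^bsub>A\<^esub> a) = tensor_lmult K H A b (\<rho> a)}"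

text \<open>The weak entwining map \<open>\<psi>\<^sub>R (h \<otimes> a) = \<Sum> a\<^bsub>[0]\<^esub> \<otimes> h a\<^bsub>[1]\<^esub>\<close> and the projection
  \<open>p\<^sub>R (a \<otimes> h) = a \<psi>\<^sub>R (h \<otimes> 1) = \<Sum> a 1\<^bsub>[0]\<^esub> \<otimes> h 1\<^bsub>[1]\<^esub>\<close>.\<close>

definition psiR ::
    "('k, 'x) ring_scheme \<Rightarrow> ('k, 'h, 'y) module_scheme \<Rightarrow> ('k, 'a, 'z) module_scheme \<Rightarrow>
     ('a \<Rightarrow> ('a, 'h) tensor) \<Rightarrow> 'h \<Rightarrow> 'a \<Rightarrow> ('a, 'h) tensor" where
  "psiR K H A \<rho> h a =
     tensor_sum (ktensor K A H) (\<rho> a) (\<lambda>a0 a1. pure_tensor (ktensor K A H) a0 (h \<otimes>\<^bsub>H\<^esub> a1))"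

definition pR ::
    "('k, 'x) ring_scheme \<Rightarrow> ('k, 'h, 'y) module_scheme \<Rightarrow> ('k, 'a, 'z) module_scheme \<Rightarrow>
     ('a \<Rightarrow> ('a, 'h) tensor) \<Rightarrow> ('a, 'h) tensor \<Rightarrow> ('a, 'h) tensor" where
  "pR K H A \<rho> t =
     tensor_sum (ktensor K A H) t (\<lambda>a h. tensor_lmult K H A a (psiR K H A \<rho> h \<one>\<^bsub>A\<^esub>))"

text \<open>The coring \<open>E\<close> of \<open>\<psi>\<^sub>R\<close>.  The right action is \<open>(a \<otimes> h) b = a \<psi>\<^sub>R (h \<otimes> b) = \<Sum> a b\<^bsub>[0]\<^esub> \<otimes> h b\<^bsub>[1]\<^esub>\<close>;
  on \<open>p\<^sub>R (a \<otimes> h)\<close> it yields the same value as on \<open>a \<otimes> h\<close>, because \<open>\<rho> 1 \<rho> b = \<rho> b\<close>.  Likewise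
  the formula \<open>a \<otimes> h \<mapsto> \<Sum> p\<^sub>R (a \<otimes> h\<^bsub>(1)\<^esub>) \<otimes>\<^sub>A p\<^sub>R (1 \<otimes> h\<^bsub>(2)\<^esub>)\<close> takes the same value at \<open>t\<close> and at
  \<open>p\<^sub>R t\<close>, so its restriction to \<open>E\<close> sends \<open>p\<^sub>R (a \<otimes> h)\<close> to
  \<open>\<Sum> p\<^sub>R (a \<otimes> h\<^bsub>(1)\<^esub>) \<otimes>\<^sub>A p\<^sub>R (1 \<otimes> h\<^bsub>(2)\<^esub>)\<close>.\<close>

definition entwining_bimodule ::
    "('k, 'x) ring_scheme \<Rightarrow> ('k, 'h, 'y) module_scheme \<Rightarrow> ('k, 'a, 'z) module_scheme \<Rightarrow>
     ('a \<Rightarrow> ('a, 'h) tensor) \<Rightarrow> ('a, ('a, 'h) tensor) bimodule" where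
  "entwining_bimodule K H A \<rho> =
     (let T = ktensor K A H
      in \<lparr>carrier = pR K H A \<rho> ` carrier T, monoid.mult = monoid.mult T, one = one T,
          ring.zero = ring.zero T, ring.add = ring.add T,
          smult = tensor_lmult K H A,
          rsmult = (\<lambda>t b. tensor_sum T t (\<lambda>a h. tensor_lmult K H A a (psiR K H A \<rho> h b)))\<rparr>)"

definition entwining_comult ::
    "('k, 'x) ring_scheme \<Rightarrow> ('k, 'h, 'y) module_scheme \<Rightarrow> ('h \<Rightarrow> ('h, 'h) tensor) \<Rightarrow>
     ('k, 'a, 'z) module_scheme \<Rightarrow> ('a \<Rightarrow> ('a, 'h) tensor) \<Rightarrow>
     ('a, 'h) tensor \<Rightarrow> (('a, 'h) tensor, ('a, 'h) tensor) tensor" where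
  "entwining_comult K H \<Delta> A \<rho> t =
     (let T = ktensor K A H; E = entwining_bimodule K H A \<rho>; EE = bitensor A E E
      in tensor_sum EE t (\<lambda>a h. tensor_sum EE (\<Delta> h) (\<lambda>h1 h2.
           pure_tensor EE (pR K H A \<rho> (pure_tensor T a h1))
                          (pR K H A \<rho> (pure_tensor T \<one>\<^bsub>A\<^esub> h2)))))"

definition entwining_counit ::
    "('k, 'a, 'z) module_scheme \<Rightarrow> ('h \<Rightarrow> 'k) \<Rightarrow> ('a, 'h) tensor \<Rightarrow> 'a" where
  "entwining_counit A \<epsilon> t = tensor_sum A t (\<lambda>a h. \<epsilon> h \<odot>\<^bsub>A\<^esub> a)"

text \<open>The map \<open>a \<otimes> b \<mapsto> \<Sum> a b\<^bsub>[0]\<^esub> \<otimes> b\<^bsub>[1]\<^esub>\<close>.  As tensors over \<open>k\<close> and over \<open>B\<close> are both sets of formal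
  combinations of pairs, this constant serves for the map on \<open>A \<otimes> A\<close> as well as for the canonical
  map on \<open>A \<otimes>\<^sub>B A\<close>.\<close>

definition can_map ::
    "('k, 'x) ring_scheme \<Rightarrow> ('k, 'h, 'y) module_scheme \<Rightarrow> ('k, 'a, 'z) module_scheme \<Rightarrow>
     ('a \<Rightarrow> ('a, 'h) tensor) \<Rightarrow> ('a, 'a) tensor \<Rightarrow> ('a, 'h) tensor" where
  "can_map K H A \<rho> t = tensor_sum (ktensor K A H) t (\<lambda>a b. tensor_lmult K H A a (\<rho> b))"

definition weak_hopf_galois_extension ::
    "('k, 'x) ring_scheme \<Rightarrow> ('k, 'h, 'y) module_scheme \<Rightarrow> ('h \<Rightarrow> ('h, 'h) tensor) \<Rightarrow>
     ('h \<Rightarrow> 'k) \<Rightarrow> ('k, 'a, 'z) module_scheme \<Rightarrow> ('a \<Rightarrow> ('a, 'h) tensor) \<Rightarrow> bool" where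
  "weak_hopf_galois_extension K H \<Delta> \<epsilon> A \<rho> \<longleftrightarrow>
     (let B = coinvariants K H A \<rho>
      in coring_iso A
           (sweedler_bimodule A B) (sweedler_comult A B) (sweedler_counit A)
           (entwining_bimodule K H A \<rho>) (entwining_comult K H \<Delta> A \<rho>) (entwining_counit A \<epsilon>)
           (can_map K H A \<rho>))"

end

theory Submission
  imports Defs
begin

text \<open>Everything rests on a dual basis of \<open>A\<close> over \<open>B\<close>.  If \<open>e\<^sub>j\<close> is a basis of \<open>H\<close>, partial traces of
  \<open>h \<mapsto> \<Delta> (x S\<^sup>2 h)\<close> give functionals \<open>t\<^sub>j\<close> with \<open>\<Sum>\<^sub>j t\<^sub>j (x S e\<^sub>j) = \<epsilon> x\<close> and
  \<open>\<Sum> x\<^bsub>(1)\<^esub> t\<^sub>j (x\<^bsub>(2)\<^esub>) \<in> \<Pi>\<^sup>L H\<close>; the latter makes \<open>\<tau>\<^sub>j a = \<Sum> a\<^bsub>[0]\<^esub> t\<^sub>j (a\<^bsub>[1]\<^esub>)\<close> a \<open>B\<close>-bilinear map \<open>A \<rightarrow> B\<close>.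
  By surjectivity \<open>p\<^sub>R (1 \<otimes> e\<^sub>j)\<close> is the image of some \<open>\<Sum> b \<otimes> c\<close>, and then \<open>y = \<Sum>\<^sub>j \<Sum> \<tau>\<^sub>j (y b) c\<close> for all \<open>y\<close>,
  so \<open>A\<close> is a projective left \<open>B\<close>-module.  The same identity shows that
  \<open>a \<otimes> h \<mapsto> \<Sum>\<^sub>j \<Sum> a b\<^bsub>[0]\<^esub> t\<^sub>j (h b\<^bsub>[1]\<^esub>) \<otimes>\<^sub>B c\<close> is a left inverse of the canonical map on \<open>A \<otimes>\<^sub>B A\<close>.
  For the right module structure the functionals are built from the opposite algebra, which is a weak
  Hopf algebra because \<open>S\<close> is bijective: by Fitting's lemma some power of \<open>S\<^sup>2\<close> splits off its
  image, and the resulting projection is the identity since \<open>S\<close> is an epimorphism.  Finally, a coring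
  generated by \<open>g\<close> with \<open>\<Delta> (a g b) = a g \<otimes> g b\<close> and \<open>\<epsilon> (a g b) = a b\<close> is determined by its bimodule, so
  the canonical map, which sends \<open>1 \<otimes> 1\<close> to \<open>\<rho> 1\<close>, respects the coring structures.\<close>

section \<open>Sums over tensors\<close>

text \<open>Tensors are cosets, and the axioms equate elements of threefold tensor products, which
  makes substitution inside a Sweedler formula awkward. Every identity is therefore tested against
  an arbitrary multilinear \<open>F\<close> with values in an arbitrary module \<open>G\<close>:
  \<open>sw G h F\<close> and \<open>rs G a F\<close> take the place of \<Delta> h and of the
  coaction, and an equation for all \<open>F\<close> can be applied inside any nested sum. The price
  is a goal of bilinearity or trilinearity at each rewriting step. A family of functionals, one for
  each basis element, replaces a non-degenerate integral, so no Frobenius property of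
  \<open>H\<close> has to be established; traces over a dual basis are enough. Surjectivity enters
  twice: it supplies the dual basis of \<open>A\<close>, and it shows that \<open>E\<close> is
  spanned by the elements \<open>a \<rho>(b)\<close>, on which the bimodule and coring structures
  are explicit. Comments write \<open>h_1 \<otimes> h_2\<close> for \<Delta> h,
  \<open>a_0 \<otimes> a_1\<close> for the coaction at \<open>a\<close>, and
  \<open>1_1 \<otimes> 1_2\<close> for \<Delta> 1.\<close>

definition balanced_map ::
    "('r, 'x) ring_scheme \<Rightarrow> ('m, 'y) ring_scheme \<Rightarrow> ('m \<Rightarrow> 'r \<Rightarrow> 'm) \<Rightarrow>
     ('n, 'z) ring_scheme \<Rightarrow> ('r \<Rightarrow> 'n \<Rightarrow> 'n) \<Rightarrow> ('g, 'w) ring_scheme \<Rightarrow> ('m \<Rightarrow> 'n \<Rightarrow> 'g) \<Rightarrow> bool" where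
  "balanced_map R M ract N lact G f \<longleftrightarrow>
     (\<forall>x\<in>carrier M. \<forall>y\<in>carrier N. f x y \<in> carrier G) \<and>
     (\<forall>x\<in>carrier M. \<forall>x'\<in>carrier M. \<forall>y\<in>carrier N. f (x \<oplus>\<^bsub>M\<^esub> x') y = f x y \<oplus>\<^bsub>G\<^esub> f x' y) \<and>
     (\<forall>x\<in>carrier M. \<forall>y\<in>carrier N. \<forall>y'\<in>carrier N. f x (y \<oplus>\<^bsub>N\<^esub> y') = f x y \<oplus>\<^bsub>G\<^esub> f x y') \<and>
     (\<forall>x\<in>carrier M. \<forall>r\<in>carrier R. \<forall>y\<in>carrier N. f (ract x r) y = f x (lact r y))"

lemma balanced_mapI:
  assumes "\<And>x y. x \<in> carrier M \<Longrightarrow> y \<in> carrier N \<Longrightarrow> f x y \<in> carrier G"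
    and "\<And>x x' y. x \<in> carrier M \<Longrightarrow> x' \<in> carrier M \<Longrightarrow> y \<in> carrier N \<Longrightarrow>
           f (x \<oplus>\<^bsub>M\<^esub> x') y = f x y \<oplus>\<^bsub>G\<^esub> f x' y"
    and "\<And>x y y'. x \<in> carrier M \<Longrightarrow> y \<in> carrier N \<Longrightarrow> y' \<in> carrier N \<Longrightarrow>
           f x (y \<oplus>\<^bsub>N\<^esub> y') = f x y \<oplus>\<^bsub>G\<^esub> f x y'"
    and "\<And>x r y. x \<in> carrier M \<Longrightarrow> r \<in> carrier R \<Longrightarrow> y \<in> carrier N \<Longrightarrow>
           f (ract x r) y = f x (lact r y)"
  shows "balanced_map R M ract N lact G f"
  using assms unfolding balanced_map_def by blast

text \<open>The right-hand side is, written multiplicatively, the formula of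
  \<open>tensor_sum\<close>. A homomorphism on formal sums that extends \<open>f\<close> therefore
  computes the sums of \<open>f\<close>.\<close>

lemma hom_free_Abelian_group_expand:
  assumes G: "comm_group G" and h: "h \<in> hom (free_Abelian_group S) G"
    and c: "Poly_Mapping.keys c \<subseteq> S"
  shows "h c = finprod G (\<lambda>z. h (frag_of z) [^]\<^bsub>G\<^esub> Poly_Mapping.lookup c z) (Poly_Mapping.keys c)"
proof -
  interpret G: comm_group G by (rule G)
  interpret hh: group_hom "free_Abelian_group S" G h
    using h by (simp add: group_hom_def group_hom_axioms_def G.is_group)
  \<comment> \<open>The coefficients \<open>k\<close> are a free function, so that the induction
    over the finite set leaves them untouched; only at the end do they become those of
    \<open>c\<close>.\<close>
  have *: "h (\<Sum>z\<in>A. frag_cmul (k z) (frag_of z)) = finprod G (\<lambda>z. h (frag_of z) [^]\<^bsub>G\<^esub> (k z :: int)) A"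
    if "finite A" "A \<subseteq> S" for A k
    using that
  proof (induction A rule: finite_induct)
    case empty
    then show ?case using hh.hom_one by simp
  next
    case (insert a A)
    have keys: "Poly_Mapping.keys (frag_cmul (k a) (frag_of a)) \<subseteq> S"
      using insert.prems keys_cmul[of "k a" "frag_of a"] by (auto simp: keys_frag_of)
    have keys': "(\<Sum>z\<in>A. frag_cmul (k z) (frag_of z)) \<in> carrier (free_Abelian_group S)"
      using insert.prems by (intro sum_closed_free_Abelian_group) (auto split: if_splits)
    have cl: "h (frag_of z) \<in> carrier G" if "z \<in> S" for z
      using that hh.hom_closed[of "frag_of z"] by simp
    have pow: "h (frag_cmul (k a) (frag_of a)) = h (frag_of a) [^]\<^bsub>G\<^esub> k a"
      using insert.prems hh.hom_int_pow[of "frag_of a" "k a"]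
      by (simp add: int_pow_free_Abelian_group keys_frag_of)
    have "h (\<Sum>z\<in>insert a A. frag_cmul (k z) (frag_of z)) =
        h (frag_cmul (k a) (frag_of a) \<otimes>\<^bsub>free_Abelian_group S\<^esub> (\<Sum>z\<in>A. frag_cmul (k z) (frag_of z)))"
      using insert.hyps by simp
    also have "\<dots> = h (frag_of a) [^]\<^bsub>G\<^esub> k a \<otimes>\<^bsub>G\<^esub> h (\<Sum>z\<in>A. frag_cmul (k z) (frag_of z))"
      using keys keys' by (simp only: hh.hom_mult carrier_free_Abelian_group_iff pow)
    also have "\<dots> = finprod G (\<lambda>z. h (frag_of z) [^]\<^bsub>G\<^esub> k z) (insert a A)"
      using insert cl by (subst G.finprod_insert) auto
    finally show ?case .
  qed
  have "c = (\<Sum>z\<in>Poly_Mapping.keys c. frag_cmul (Poly_Mapping.lookup c z) (frag_of z))"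
    using frag_expansion[of c] by (simp add: frag_extend_def)
  then show ?thesis
    using *[of "Poly_Mapping.keys c" "Poly_Mapping.lookup c"] c by simp
qed

lemma additive_finsum:
  assumes "abelian_group G" "abelian_group G'" "f \<in> hom (add_monoid G) (add_monoid G')" "finite I"
    and "\<And>i. i \<in> I \<Longrightarrow> k i \<in> carrier G"
  shows "f (\<Oplus>\<^bsub>G\<^esub>i\<in>I. k i) = (\<Oplus>\<^bsub>G'\<^esub>i\<in>I. f (k i))"
proof -
  interpret G: abelian_group G by fact
  interpret G': abelian_group G' by fact
  interpret h: group_hom "add_monoid G" "add_monoid G'" f
    using assms(3) G.a_group G'.a_group by (simp add: group_hom_def group_hom_axioms_def)
  show ?thesis
    using assms(4,5)
  proof (induction I rule: finite_induct)
    case empty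
    show ?case using h.hom_one by simp
  next
    case (insert a J)
    then show ?case
      using h.hom_mult[of "k a" "\<Oplus>\<^bsub>G\<^esub>i\<in>J. k i"] h.hom_closed by (simp add: Pi_iff)
  qed
qed

text \<open>Closure under the two actions is what places the relations in the free group. The locale
  serves tensor products over \<open>K\<close>, over \<open>A\<close> and over the subring of
  coinvariants alike.\<close>

locale tensor_factors = M: abelian_group M + N: abelian_group N
  for R :: "('r, 'x) ring_scheme" and M :: "('m, 'y) ring_scheme" and ract :: "'m \<Rightarrow> 'r \<Rightarrow> 'm"
    and N :: "('n, 'z) ring_scheme" and lact :: "'r \<Rightarrow> 'n \<Rightarrow> 'n" +
  assumes ract_carrier: "x \<in> carrier M \<Longrightarrow> r \<in> carrier R \<Longrightarrow> ract x r \<in> carrier M"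
    and lact_carrier: "r \<in> carrier R \<Longrightarrow> y \<in> carrier N \<Longrightarrow> lact r y \<in> carrier N"
begin

abbreviation "Fr \<equiv> free_Abelian_group (carrier M \<times> carrier N)"
abbreviation "Rel \<equiv> tensor_relations R M ract N lact"
abbreviation "T \<equiv> tensor_product R M ract N lact"

lemma relations_carrier: "Rel \<subseteq> carrier Fr"
proof -
  have "Poly_Mapping.keys (frag_of a - frag_of b - frag_of c) \<subseteq> {a, b, c}" for a b c :: "'m \<times> 'n"
    using keys_diff[of "frag_of a - frag_of b" "frag_of c"] keys_diff[of "frag_of a" "frag_of b"]
    by (auto simp: keys_frag_of)
  moreover have "Poly_Mapping.keys (frag_of a - frag_of b) \<subseteq> {a, b}" for a b :: "'m \<times> 'n"
    using keys_diff[of "frag_of a" "frag_of b"] by (auto simp: keys_frag_of)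
  ultimately show ?thesis
    unfolding tensor_relations_def using ract_carrier lact_carrier
    by (fastforce simp: subset_iff)
qed

lemma subgroup_relations: "subgroup (generate Fr Rel) Fr"
  by (rule group.generate_is_subgroup[OF group_free_Abelian_group relations_carrier])

lemma normal_relations: "generate Fr Rel \<lhd> Fr"
  by (simp add: comm_group.normal_iff_subgroup[OF abelian_free_Abelian_group] subgroup_relations)

lemma T_simps:
  "carrier T = carrier (Fr Mod generate Fr Rel)" "\<zero>\<^bsub>T\<^esub> = generate Fr Rel"
  "s \<oplus>\<^bsub>T\<^esub> t = s \<otimes>\<^bsub>Fr Mod generate Fr Rel\<^esub> t"
  by (simp_all add: tensor_product_def Let_def FactGroup_def)

lemma abelian_group_tensor: "abelian_group T"
proof -
  have cg: "comm_group (Fr Mod generate Fr Rel)"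
    by (rule comm_group.abelian_FactGroup[OF abelian_free_Abelian_group subgroup_relations])
  then interpret Q: comm_group "Fr Mod generate Fr Rel" .
  have c: "carrier T = carrier (Fr Mod generate Fr Rel)" and z: "\<zero>\<^bsub>T\<^esub> = \<one>\<^bsub>Fr Mod generate Fr Rel\<^esub>"
    and a: "s \<oplus>\<^bsub>T\<^esub> t = s \<otimes>\<^bsub>Fr Mod generate Fr Rel\<^esub> t" for s t
    by (simp_all add: tensor_product_def Let_def)
  show ?thesis
    by (rule abelian_groupI; (unfold c z a)?)
      (rule Q.m_closed Q.one_closed Q.m_assoc Q.m_comm Q.l_one Q.l_inv_ex; assumption?)+
qed

sublocale T: abelian_group T by (rule abelian_group_tensor)

lemma carrier_tensor: "carrier T = {generate Fr Rel #>\<^bsub>Fr\<^esub> c |c. c \<in> carrier Fr}"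
  by (auto simp: T_simps FactGroup_def RCOSETS_def)

lemma coset_add:
  assumes "c \<in> carrier Fr" "d \<in> carrier Fr"
  shows "(generate Fr Rel #>\<^bsub>Fr\<^esub> c) \<oplus>\<^bsub>T\<^esub> (generate Fr Rel #>\<^bsub>Fr\<^esub> d) = generate Fr Rel #>\<^bsub>Fr\<^esub> (c + d)"
  using normal.rcos_sum[OF normal_relations assms] by (simp add: T_simps FactGroup_def)

lemma pure_tensor_coset: "pure_tensor T x y = generate Fr Rel #>\<^bsub>Fr\<^esub> frag_of (x, y)"
  by (auto simp: pure_tensor_def T_simps r_coset_def)

lemma pure_carrier:
  "x \<in> carrier M \<Longrightarrow> y \<in> carrier N \<Longrightarrow> pure_tensor T x y \<in> carrier T"
  unfolding pure_tensor_coset carrier_tensor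
  by (rule CollectI, rule exI[of _ "frag_of (x, y)"]) simp

lemma coset_eqI:
  assumes "c \<in> carrier Fr" "d \<in> carrier Fr" "c - d \<in> generate Fr Rel"
  shows "generate Fr Rel #>\<^bsub>Fr\<^esub> c = generate Fr Rel #>\<^bsub>Fr\<^esub> d"
proof -
  have "c \<in> generate Fr Rel #>\<^bsub>Fr\<^esub> d"
    unfolding r_coset_def using assms(3) by (force simp: algebra_simps)
  then show ?thesis
    using group.repr_independence[OF group_free_Abelian_group _ assms(2) subgroup_relations] by metis
qed

lemma coset_mem:
  assumes "t \<in> carrier T" "c \<in> t"
  shows "c \<in> carrier Fr" "t = generate Fr Rel #>\<^bsub>Fr\<^esub> c"
proof -
  obtain d where d: "d \<in> carrier Fr" "t = generate Fr Rel #>\<^bsub>Fr\<^esub> d"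
    using assms(1) carrier_tensor by auto
  then show "t = generate Fr Rel #>\<^bsub>Fr\<^esub> c"
    using group.repr_independence[OF group_free_Abelian_group _ d(1) subgroup_relations] assms(2) by metis
  show "c \<in> carrier Fr"
    using d assms(2) monoid.r_coset_subset_G[OF group.is_monoid[OF group_free_Abelian_group]
        subgroup.subset[OF subgroup_relations] d(1)] by blast
qed

lemma some_rep:
  assumes "t \<in> carrier T"
  shows "(SOME c. c \<in> t) \<in> t"
proof -
  obtain d where d: "d \<in> carrier Fr" "t = generate Fr Rel #>\<^bsub>Fr\<^esub> d"
    using assms(1) carrier_tensor by auto
  then have "d \<in> t"
    using group.rcos_self[OF group_free_Abelian_group d(1) subgroup_relations] by simp
  then show ?thesis by (rule someI)
qed

lemma relation_in: "a - b \<in> Rel \<Longrightarrow> a \<in> carrier Fr \<Longrightarrow> b \<in> carrier Fr \<Longrightarrow>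
  generate Fr Rel #>\<^bsub>Fr\<^esub> a = generate Fr Rel #>\<^bsub>Fr\<^esub> b"
  by (rule coset_eqI) (auto intro: generate.incl)

lemma pure_add_left:
  assumes "x \<in> carrier M" "x' \<in> carrier M" "y \<in> carrier N"
  shows "pure_tensor T (x \<oplus>\<^bsub>M\<^esub> x') y = pure_tensor T x y \<oplus>\<^bsub>T\<^esub> pure_tensor T x' y"
proof -
  have *: "Poly_Mapping.keys (frag_of (x, y) + frag_of (x', y)) \<subseteq> carrier M \<times> carrier N"
    using keys_add[of "frag_of (x, y)" "frag_of (x', y)"] assms by (auto simp: keys_frag_of)
  have "generate Fr Rel #>\<^bsub>Fr\<^esub> frag_of (x \<oplus>\<^bsub>M\<^esub> x', y) =
      generate Fr Rel #>\<^bsub>Fr\<^esub> (frag_of (x, y) + frag_of (x', y))"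
    by (rule relation_in)
      (use assms * in \<open>force simp: tensor_relations_def keys_frag_of diff_diff_eq[symmetric]\<close>)+
  then show ?thesis
    using assms by (simp add: pure_tensor_coset coset_add)
qed

lemma pure_add_right:
  assumes "x \<in> carrier M" "y \<in> carrier N" "y' \<in> carrier N"
  shows "pure_tensor T x (y \<oplus>\<^bsub>N\<^esub> y') = pure_tensor T x y \<oplus>\<^bsub>T\<^esub> pure_tensor T x y'"
proof -
  have *: "Poly_Mapping.keys (frag_of (x, y) + frag_of (x, y')) \<subseteq> carrier M \<times> carrier N"
    using keys_add[of "frag_of (x, y)" "frag_of (x, y')"] assms by (auto simp: keys_frag_of)
  have "generate Fr Rel #>\<^bsub>Fr\<^esub> frag_of (x, y \<oplus>\<^bsub>N\<^esub> y') =
      generate Fr Rel #>\<^bsub>Fr\<^esub> (frag_of (x, y) + frag_of (x, y'))"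
    by (rule relation_in)
      (use assms * in \<open>force simp: tensor_relations_def keys_frag_of diff_diff_eq[symmetric]\<close>)+
  then show ?thesis
    using assms by (simp add: pure_tensor_coset coset_add)
qed

lemma pure_balanced:
  assumes "x \<in> carrier M" "r \<in> carrier R" "y \<in> carrier N"
  shows "pure_tensor T (ract x r) y = pure_tensor T x (lact r y)"
  unfolding pure_tensor_coset
  by (rule relation_in)
    (use assms ract_carrier lact_carrier in \<open>force simp: tensor_relations_def keys_frag_of\<close>)+

lemma balanced_pure: "balanced_map R M ract N lact T (pure_tensor T)"
  by (rule balanced_mapI) (auto simp: pure_carrier pure_add_left pure_add_right pure_balanced)

text \<open>Formal sums arise from generators by subtraction, which covers negative coefficients
  too. Zero needs no case of its own: it is the difference of a pure tensor with itself.\<close>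

lemma tensor_induct [consumes 1, case_names pure minus]:
  assumes "t \<in> carrier T"
    and "\<And>x y. x \<in> carrier M \<Longrightarrow> y \<in> carrier N \<Longrightarrow> P (pure_tensor T x y)"
    and "\<And>s t. s \<in> carrier T \<Longrightarrow> t \<in> carrier T \<Longrightarrow> P s \<Longrightarrow> P t \<Longrightarrow> P (s \<ominus>\<^bsub>T\<^esub> t)"
  shows "P t"
proof (cases "carrier M \<times> carrier N = {}")
  case True
  then show ?thesis using M.zero_closed N.zero_closed by auto
next
  case False
  then obtain x0 y0 where xy0: "x0 \<in> carrier M" "y0 \<in> carrier N" by auto
  have P0: "P \<zero>\<^bsub>T\<^esub>"
    using assms(3)[OF pure_carrier[OF xy0] pure_carrier[OF xy0] assms(2)[OF xy0] assms(2)[OF xy0]]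
      pure_carrier[OF xy0] by (simp add: T.minus_eq T.r_neg)
  obtain d where d: "d \<in> carrier Fr" "t = generate Fr Rel #>\<^bsub>Fr\<^esub> d"
    using assms(1) carrier_tensor by auto
  have "Poly_Mapping.keys d \<subseteq> carrier M \<times> carrier N" using d(1) by simp
  then have "P (generate Fr Rel #>\<^bsub>Fr\<^esub> d)"
  proof (induction d rule: free_Abelian_group_induct[consumes 1, case_names zero diff one])
    case zero
    have "generate Fr Rel #>\<^bsub>Fr\<^esub> 0 = \<zero>\<^bsub>T\<^esub>"
      by (simp add: T_simps r_coset_def)
    then show ?case using P0 by simp
  next
    case (diff x y)
    have *: "Poly_Mapping.keys (x - y) \<subseteq> carrier M \<times> carrier N"
      using diff keys_diff[of x y] by blast
    have cx: "(generate Fr Rel #>\<^bsub>Fr\<^esub> x) \<in> carrier T" "(generate Fr Rel #>\<^bsub>Fr\<^esub> y) \<in> carrier T"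
      "(generate Fr Rel #>\<^bsub>Fr\<^esub> (x - y)) \<in> carrier T"
      using diff * by (auto simp: carrier_tensor)
    have "(generate Fr Rel #>\<^bsub>Fr\<^esub> (x - y)) \<oplus>\<^bsub>T\<^esub> (generate Fr Rel #>\<^bsub>Fr\<^esub> y) = generate Fr Rel #>\<^bsub>Fr\<^esub> x"
      using diff * by (simp add: coset_add)
    then have "generate Fr Rel #>\<^bsub>Fr\<^esub> (x - y) =
        (generate Fr Rel #>\<^bsub>Fr\<^esub> x) \<ominus>\<^bsub>T\<^esub> (generate Fr Rel #>\<^bsub>Fr\<^esub> y)"
      using cx by (metis T.a_inv_closed T.a_assoc T.minus_eq T.r_neg T.r_zero)
    then show ?case using assms(3)[OF cx(1,2)] diff by simp
  next
    case (one a)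
    then show ?case using assms(2) by (cases a) (auto simp: pure_tensor_coset)
  qed
  then show ?thesis using d by simp
qed

text \<open>Well-definedness of \<open>tensor_sum\<close>: \<open>f\<close> extends to a
  homomorphism \<open>h\<close> on formal sums, balancedness puts the relations into its kernel, and
  the representative chosen by \<open>SOME\<close> differs from \<open>c\<close> by an element of
  that kernel.\<close>

lemma tensor_sum_hom:
  assumes G: "abelian_group G" and f: "balanced_map R M ract N lact G f"
  obtains h where "h \<in> hom Fr (add_monoid G)"
    "\<And>x y. x \<in> carrier M \<Longrightarrow> y \<in> carrier N \<Longrightarrow> h (frag_of (x, y)) = f x y"
    "\<And>c. c \<in> carrier Fr \<Longrightarrow> tensor_sum G (generate Fr Rel #>\<^bsub>Fr\<^esub> c) f = h c"
proof -
  interpret G: abelian_group G by (rule G)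
  have cl: "f x y \<in> carrier G" if "x \<in> carrier M" "y \<in> carrier N" for x y
    using f that by (simp add: balanced_map_def)
  have cg: "comm_group (add_monoid G)" by (rule G.a_comm_group)
  have sub: "(\<lambda>z. f (fst z) (snd z)) ` (carrier M \<times> carrier N) \<subseteq> carrier (add_monoid G)"
    using cl by auto
  obtain h where h: "h \<in> hom Fr (add_monoid G)"
    "\<And>z. z \<in> carrier M \<times> carrier N \<Longrightarrow> h (frag_of z) = f (fst z) (snd z)"
    using comm_group.free_Abelian_group_universal[OF cg sub] by metis
  have hxy: "h (frag_of (x, y)) = f x y" if "x \<in> carrier M" "y \<in> carrier N" for x y
    using h(2)[of "(x, y)"] that by simp
  interpret hh: group_hom Fr "add_monoid G" h
    using h(1) G.a_group by (simp add: group_hom_def group_hom_axioms_def)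
  have hadd: "h (a + b) = h a \<oplus>\<^bsub>G\<^esub> h b" if "a \<in> carrier Fr" "b \<in> carrier Fr" for a b
    using hh.hom_mult[OF that] by simp
  have hcl: "h a \<in> carrier G" if "a \<in> carrier Fr" for a
    using hh.hom_closed[OF that] by simp
  have kd: "a - b \<in> carrier Fr" if "a \<in> carrier Fr" "b \<in> carrier Fr" for a b
    using keys_diff[of a b] that by auto
  have hdiff: "h (a - b) = h a \<ominus>\<^bsub>G\<^esub> h b" if "a \<in> carrier Fr" "b \<in> carrier Fr" for a b
  proof -
    have "h (a - b) \<oplus>\<^bsub>G\<^esub> h b = h a" using hadd[OF kd[OF that] that(2)] by simp
    then show ?thesis
      using hcl[OF kd[OF that]] hcl[OF that(1)] hcl[OF that(2)]
      by (metis G.a_inv_closed G.a_assoc G.minus_eq G.r_neg G.r_zero)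
  qed
  have Gz: "a \<oplus>\<^bsub>G\<^esub> b \<ominus>\<^bsub>G\<^esub> a \<ominus>\<^bsub>G\<^esub> b = \<zero>\<^bsub>G\<^esub>" if "a \<in> carrier G" "b \<in> carrier G" for a b
    using that by (metis G.a_comm G.add.inv_closed G.add.m_closed G.minus_eq G.minus_minus G.r_neg G.r_neg2)
  have "Rel \<subseteq> kernel Fr (add_monoid G) h"
  proof
    fix r assume r: "r \<in> Rel"
    then have rc: "r \<in> carrier Fr" using relations_carrier by blast
    consider (1) x x' y where "r = frag_of (x \<oplus>\<^bsub>M\<^esub> x', y) - frag_of (x, y) - frag_of (x', y)"
        "x \<in> carrier M" "x' \<in> carrier M" "y \<in> carrier N"
      | (2) x y y' where "r = frag_of (x, y \<oplus>\<^bsub>N\<^esub> y') - frag_of (x, y) - frag_of (x, y')"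
        "x \<in> carrier M" "y \<in> carrier N" "y' \<in> carrier N"
      | (3) x s y where "r = frag_of (ract x s, y) - frag_of (x, lact s y)"
        "x \<in> carrier M" "s \<in> carrier R" "y \<in> carrier N"
      using r unfolding tensor_relations_def by blast
    then have "h r = \<zero>\<^bsub>G\<^esub>"
    proof cases
      case 1
      have "h r = f (x \<oplus>\<^bsub>M\<^esub> x') y \<ominus>\<^bsub>G\<^esub> f x y \<ominus>\<^bsub>G\<^esub> f x' y"
        using 1 by (simp only: hdiff[OF kd] hdiff frag_of_in_free_Abelian_group mem_Sigma_iff
            M.a_closed hxy)
      then show ?thesis using 1 f cl Gz by (simp add: balanced_map_def)
    next
      case 2
      have "h r = f x (y \<oplus>\<^bsub>N\<^esub> y') \<ominus>\<^bsub>G\<^esub> f x y \<ominus>\<^bsub>G\<^esub> f x y'"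
        using 2 by (simp only: hdiff[OF kd] hdiff frag_of_in_free_Abelian_group mem_Sigma_iff
            N.a_closed hxy)
      then show ?thesis using 2 f cl Gz by (simp add: balanced_map_def)
    next
      case 3
      have "h r = f (ract x s) y \<ominus>\<^bsub>G\<^esub> f x (lact s y)"
        using 3 ract_carrier lact_carrier
        by (simp only: hdiff frag_of_in_free_Abelian_group mem_Sigma_iff hxy)
      then show ?thesis using 3 f cl[OF 3(2) lact_carrier[OF 3(3,4)]]
        by (simp add: balanced_map_def G.minus_eq G.r_neg)
    qed
    then show "r \<in> kernel Fr (add_monoid G) h" using rc by (simp add: kernel_def)
  qed
  then have ker: "generate Fr Rel \<subseteq> kernel Fr (add_monoid G) h"
    by (rule group.generate_subgroup_incl[OF group_free_Abelian_group _ hh.subgroup_kernel])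
  have val: "tensor_sum G (generate Fr Rel #>\<^bsub>Fr\<^esub> c) f = h c" if c: "c \<in> carrier Fr" for c
  proof -
    let ?t = "generate Fr Rel #>\<^bsub>Fr\<^esub> c"
    define d where "d = (SOME c. c \<in> ?t)"
    have t: "?t \<in> carrier T" using c carrier_tensor by auto
    have d: "d \<in> ?t" unfolding d_def by (rule some_rep[OF t])
    then have dF: "d \<in> carrier Fr" using coset_mem[OF t] by blast
    obtain q where q: "q \<in> generate Fr Rel" "d = q + c"
      using d by (auto simp: r_coset_def)
    have "q \<in> carrier Fr" "h q = \<zero>\<^bsub>G\<^esub>" using q(1) ker by (auto simp: kernel_def)
    then have hd: "h d = h c" using q c hadd[of q c] hcl[OF c] by simp
    have "h d = finprod (add_monoid G)
        (\<lambda>z. h (frag_of z) [^]\<^bsub>add_monoid G\<^esub> Poly_Mapping.lookup d z) (Poly_Mapping.keys d)"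
      using dF by (intro hom_free_Abelian_group_expand[OF cg h(1)]) simp
    also have "\<dots> = (\<Oplus>\<^bsub>G\<^esub>z\<in>Poly_Mapping.keys d.
        [Poly_Mapping.lookup d z] \<cdot>\<^bsub>G\<^esub> f (fst z) (snd z))"
      unfolding finsum_def add_pow_def
    proof (rule comm_monoid.finprod_cong')
      show "comm_monoid (add_monoid G)" by (rule G.a_comm_monoid)
      have "z \<in> Poly_Mapping.keys d \<Longrightarrow> f (fst z) (snd z) \<in> carrier G" for z
        using dF cl by (cases z) (auto simp: subset_iff)
      then show "(\<lambda>z. f (fst z) (snd z) [^]\<^bsub>add_monoid G\<^esub> poly_mapping.lookup d z) \<in>
          Poly_Mapping.keys d \<rightarrow> carrier (add_monoid G)"
        using group.int_pow_closed[OF G.a_group] by fastforce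
    qed (use dF h(2) in \<open>auto simp: subset_iff\<close>)
    finally show ?thesis using hd by (simp add: tensor_sum_def Let_def d_def)
  qed
  show ?thesis by (rule that[OF h(1) hxy val])
qed

lemma tensor_sum_pure:
  assumes "abelian_group G" "balanced_map R M ract N lact G f" "x \<in> carrier M" "y \<in> carrier N"
  shows "tensor_sum G (pure_tensor T x y) f = f x y"
proof -
  obtain h where h: "h \<in> hom Fr (add_monoid G)"
    "\<And>x y. x \<in> carrier M \<Longrightarrow> y \<in> carrier N \<Longrightarrow> h (frag_of (x, y)) = f x y"
    "\<And>c. c \<in> carrier Fr \<Longrightarrow> tensor_sum G (generate Fr Rel #>\<^bsub>Fr\<^esub> c) f = h c"
    using tensor_sum_hom[OF assms(1,2)] by metis
  show ?thesis
    using assms h(2) h(3)[of "frag_of (x, y)"] by (simp add: pure_tensor_coset)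
qed

lemma tensor_sum_add:
  assumes "abelian_group G" "balanced_map R M ract N lact G f" "s \<in> carrier T" "t \<in> carrier T"
  shows "tensor_sum G (s \<oplus>\<^bsub>T\<^esub> t) f = tensor_sum G s f \<oplus>\<^bsub>G\<^esub> tensor_sum G t f"
proof -
  obtain h where h: "h \<in> hom Fr (add_monoid G)"
    "\<And>x y. x \<in> carrier M \<Longrightarrow> y \<in> carrier N \<Longrightarrow> h (frag_of (x, y)) = f x y"
    "\<And>c. c \<in> carrier Fr \<Longrightarrow> tensor_sum G (generate Fr Rel #>\<^bsub>Fr\<^esub> c) f = h c"
    using tensor_sum_hom[OF assms(1,2)] by metis
  obtain c d where cd: "c \<in> carrier Fr" "d \<in> carrier Fr"
    "s = generate Fr Rel #>\<^bsub>Fr\<^esub> c" "t = generate Fr Rel #>\<^bsub>Fr\<^esub> d"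
    using assms(3,4) carrier_tensor by auto
  have "c + d \<in> carrier Fr" using cd keys_add[of c d] by auto
  then show ?thesis
    using hom_mult[OF h(1) cd(1,2)] cd by (simp only: coset_add h(3)) simp
qed

text \<open>The chosen representative involves only pairs from the carriers, so closure, congruence
  and additivity of tensor sums in the summand follow from those of finite sums, for any
  \<open>f\<close>.\<close>

lemma keys_some_rep:
  "t \<in> carrier T \<Longrightarrow> z \<in> Poly_Mapping.keys (SOME c. c \<in> t) \<Longrightarrow> fst z \<in> carrier M \<and> snd z \<in> carrier N"
  using coset_mem(1)[OF _ some_rep, of t] by (cases z) (auto simp: subset_iff)

lemma tensor_sum_closed:
  assumes "abelian_group G" "t \<in> carrier T"
    and "\<And>x y. x \<in> carrier M \<Longrightarrow> y \<in> carrier N \<Longrightarrow> f x y \<in> carrier G"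
  shows "tensor_sum G t f \<in> carrier G"
proof -
  interpret G: abelian_group G by (rule assms(1))
  show ?thesis
    unfolding tensor_sum_def Let_def
    by (rule G.finsum_closed) (use keys_some_rep[OF assms(2)] assms(3) in auto)
qed

lemma tensor_sum_cong:
  assumes "abelian_group G" "t \<in> carrier T"
    and "\<And>x y. x \<in> carrier M \<Longrightarrow> y \<in> carrier N \<Longrightarrow> f x y = g x y"
    and "\<And>x y. x \<in> carrier M \<Longrightarrow> y \<in> carrier N \<Longrightarrow> g x y \<in> carrier G"
  shows "tensor_sum G t f = tensor_sum G t g"
proof -
  interpret G: abelian_group G by (rule assms(1))
  show ?thesis
    unfolding tensor_sum_def Let_def
    by (rule G.finsum_cong') (use keys_some_rep[OF assms(2)] assms(3,4) in auto)
qed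

lemma tensor_sum_additive:
  assumes "abelian_group G" "abelian_group G'" "t \<in> carrier T"
    and "\<phi> \<in> hom (add_monoid G) (add_monoid G')"
    and "\<And>x y. x \<in> carrier M \<Longrightarrow> y \<in> carrier N \<Longrightarrow> f x y \<in> carrier G"
  shows "\<phi> (tensor_sum G t f) = tensor_sum G' t (\<lambda>x y. \<phi> (f x y))"
proof -
  interpret G: abelian_group G by (rule assms(1))
  interpret G': abelian_group G' by (rule assms(2))
  interpret h: group_hom "add_monoid G" "add_monoid G'" \<phi>
    using assms(4) G.a_group G'.a_group by (simp add: group_hom_def group_hom_axioms_def)
  have cl: "\<phi> a \<in> carrier G'" if "a \<in> carrier G" for a using h.hom_closed that by simp
  have pow: "\<phi> (add_pow G (n::int) a) = add_pow G' n (\<phi> a)" if "a \<in> carrier G" for a n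
    using h.hom_int_pow[of a n] that by (simp add: add_pow_def)
  have k: "z \<in> Poly_Mapping.keys (SOME c. c \<in> t) \<Longrightarrow> f (fst z) (snd z) \<in> carrier G" for z
    using keys_some_rep[OF assms(3)] assms(5) by auto
  show ?thesis
    unfolding tensor_sum_def Let_def
    apply (subst additive_finsum[OF assms(1,2,4)])
      apply simp
     apply (use k in simp)
    apply (rule G'.finsum_cong')
      apply simp
    using k cl pow by auto
qed

lemma tensor_sum_distrib:
  assumes "abelian_group G" "t \<in> carrier T"
    and "\<And>x y. x \<in> carrier M \<Longrightarrow> y \<in> carrier N \<Longrightarrow> f x y \<in> carrier G"
    and "\<And>x y. x \<in> carrier M \<Longrightarrow> y \<in> carrier N \<Longrightarrow> g x y \<in> carrier G"
  shows "tensor_sum G t (\<lambda>x y. f x y \<oplus>\<^bsub>G\<^esub> g x y) = tensor_sum G t f \<oplus>\<^bsub>G\<^esub> tensor_sum G t g"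
proof -
  interpret G: abelian_group G by (rule assms(1))
  have k: "f (fst z) (snd z) \<in> carrier G" "g (fst z) (snd z) \<in> carrier G"
    if "z \<in> Poly_Mapping.keys (SOME c. c \<in> t)" for z
    using keys_some_rep[OF assms(2)] assms(3,4) that by auto
  show ?thesis
    unfolding tensor_sum_def Let_def
    apply (subst G.finsum_addf[symmetric])
      apply (use k in auto)[2]
    apply (rule G.finsum_cong')
    using k by (auto simp: G.add.int_pow_distrib)
qed

lemma tensor_sum_finsum:
  assumes "abelian_group G" "t \<in> carrier T" "finite Z"
    and "\<And>z x y. z \<in> Z \<Longrightarrow> x \<in> carrier M \<Longrightarrow> y \<in> carrier N \<Longrightarrow> f z x y \<in> carrier G"
  shows "tensor_sum G t (\<lambda>x y. \<Oplus>\<^bsub>G\<^esub>z\<in>Z. f z x y) = (\<Oplus>\<^bsub>G\<^esub>z\<in>Z. tensor_sum G t (f z))"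
  using assms(3,4)
proof (induction Z rule: finite_induct)
  case empty
  interpret G: abelian_group G by (rule assms(1))
  show ?case by (simp add: tensor_sum_def Let_def G.add.int_pow_one)
next
  case (insert a Z)
  interpret G: abelian_group G by (rule assms(1))
  have "tensor_sum G t (\<lambda>x y. \<Oplus>\<^bsub>G\<^esub>z\<in>insert a Z. f z x y) =
      tensor_sum G t (\<lambda>x y. f a x y \<oplus>\<^bsub>G\<^esub> (\<Oplus>\<^bsub>G\<^esub>z\<in>Z. f z x y))"
    using insert by (intro tensor_sum_cong[OF assms(1,2)]) (auto simp: Pi_iff)
  also have "\<dots> = tensor_sum G t (f a) \<oplus>\<^bsub>G\<^esub> (\<Oplus>\<^bsub>G\<^esub>z\<in>Z. tensor_sum G t (f z))"
    using insert by (subst tensor_sum_distrib[OF assms(1,2)]) (auto simp: Pi_iff)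
  also have "\<dots> = (\<Oplus>\<^bsub>G\<^esub>z\<in>insert a Z. tensor_sum G t (f z))"
    using insert by (subst G.finsum_insert) (auto simp: Pi_iff intro: tensor_sum_closed[OF assms(1,2)])
  finally show ?case .
qed

lemma tensor_sum_self:
  assumes "t \<in> carrier T"
  shows "tensor_sum T t (pure_tensor T) = t"
  using assms
proof (induction t rule: tensor_induct)
  case (pure x y)
  then show ?case by (rule tensor_sum_pure[OF abelian_group_tensor balanced_pure])
next
  case (minus s t)
  have m: "tensor_sum T (s \<ominus>\<^bsub>T\<^esub> t) (pure_tensor T) \<in> carrier T"
    using minus by (intro tensor_sum_closed[OF abelian_group_tensor]) (auto intro: pure_carrier)
  have "(s \<ominus>\<^bsub>T\<^esub> t) \<oplus>\<^bsub>T\<^esub> t = s"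
    using minus by (simp add: T.minus_eq T.a_assoc T.l_neg)
  then have "tensor_sum T (s \<ominus>\<^bsub>T\<^esub> t) (pure_tensor T) \<oplus>\<^bsub>T\<^esub> t = s"
    using tensor_sum_add[OF abelian_group_tensor balanced_pure, of "s \<ominus>\<^bsub>T\<^esub> t" t] minus by simp
  then show ?case
    using m minus by (metis T.a_inv_closed T.a_assoc T.minus_eq T.r_neg T.r_zero)
qed

end

text \<open>The outer sum is opened into a finite sum over the chosen representative, which passes
  through the inner sum by additivity.\<close>

lemma tensor_sum_swap:
  assumes T1: "tensor_factors R M ract N lact" and T2: "tensor_factors R' M' ract' N' lact'"
    and G: "abelian_group G"
    and s: "s \<in> carrier (tensor_product R M ract N lact)"
    and t: "t \<in> carrier (tensor_product R' M' ract' N' lact')"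
    and cl: "\<And>x y u v. x \<in> carrier M \<Longrightarrow> y \<in> carrier N \<Longrightarrow> u \<in> carrier M' \<Longrightarrow> v \<in> carrier N' \<Longrightarrow>
      f x y u v \<in> carrier G"
  shows "tensor_sum G s (\<lambda>x y. tensor_sum G t (\<lambda>u v. f x y u v)) =
    tensor_sum G t (\<lambda>u v. tensor_sum G s (\<lambda>x y. f x y u v))"
proof -
  interpret G: abelian_group G by (rule G)
  interpret A: tensor_factors R M ract N lact by (rule T1)
  interpret B: tensor_factors R' M' ract' N' lact' by (rule T2)
  define n where "n z = Poly_Mapping.lookup (SOME c. c \<in> s) z" for z
  define Z where "Z = Poly_Mapping.keys (SOME c. c \<in> s)"
  have Z: "finite Z" "z \<in> Z \<Longrightarrow> fst z \<in> carrier M \<and> snd z \<in> carrier N" for z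
    using A.keys_some_rep[OF s] by (auto simp: Z_def)
  have sum: "tensor_sum G s g = (\<Oplus>\<^bsub>G\<^esub>z\<in>Z. add_pow G (n z) (g (fst z) (snd z)))" for g
    by (simp add: tensor_sum_def Let_def Z_def n_def)
  have pow: "(\<lambda>a. add_pow G (k::int) a) \<in> hom (add_monoid G) (add_monoid G)" for k
    by (auto intro!: homI simp: G.add.int_pow_distrib)
  have "tensor_sum G s (\<lambda>x y. tensor_sum G t (\<lambda>u v. f x y u v)) =
      (\<Oplus>\<^bsub>G\<^esub>z\<in>Z. tensor_sum G t (\<lambda>u v. add_pow G (n z) (f (fst z) (snd z) u v)))"
    unfolding sum
  proof (rule G.finsum_cong')
    show "(\<lambda>z. tensor_sum G t (\<lambda>u v. add_pow G (n z) (f (fst z) (snd z) u v))) \<in> Z \<rightarrow> carrier G"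
      using Z cl by (auto intro!: B.tensor_sum_closed[OF G t])
    show "add_pow G (n z) (tensor_sum G t (f (fst z) (snd z))) =
        tensor_sum G t (\<lambda>u v. add_pow G (n z) (f (fst z) (snd z) u v))" if "z \<in> Z" for z
      using that Z cl by (intro B.tensor_sum_additive[OF G G t pow]) auto
  qed simp
  also have "\<dots> = tensor_sum G t (\<lambda>u v. \<Oplus>\<^bsub>G\<^esub>z\<in>Z. add_pow G (n z) (f (fst z) (snd z) u v))"
    using Z cl by (intro B.tensor_sum_finsum[OF G t, symmetric]) auto
  finally show ?thesis unfolding sum .
qed

section \<open>Linear and bilinear maps\<close>

text \<open>The same notion as \<open>module_hom\<close>, kept folded so that linearity of a
  composite expression is settled by the simplifier with closure rules such as
  \<open>lin_rules\<close>.\<close>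

definition lin ::
    "('k, 'x) ring_scheme \<Rightarrow> ('k, 'm, 'y) module_scheme \<Rightarrow> ('k, 'n, 'z) module_scheme \<Rightarrow> ('m \<Rightarrow> 'n) \<Rightarrow> bool" where
  "lin K M N f \<longleftrightarrow> f \<in> module_hom K M N"

definition bil ::
    "('k, 'x) ring_scheme \<Rightarrow> ('k, 'm, 'y) module_scheme \<Rightarrow> ('k, 'n, 'z) module_scheme \<Rightarrow>
     ('k, 'g, 'w) module_scheme \<Rightarrow> ('m \<Rightarrow> 'n \<Rightarrow> 'g) \<Rightarrow> bool" where
  "bil K M N G F \<longleftrightarrow>
     (\<forall>x\<in>carrier M. lin K N G (F x)) \<and> (\<forall>y\<in>carrier N. lin K M G (\<lambda>x. F x y))"

lemma lin_closed: "lin K M N f \<Longrightarrow> x \<in> carrier M \<Longrightarrow> f x \<in> carrier N"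
  and lin_add: "lin K M N f \<Longrightarrow> x \<in> carrier M \<Longrightarrow> y \<in> carrier M \<Longrightarrow> f (x \<oplus>\<^bsub>M\<^esub> y) = f x \<oplus>\<^bsub>N\<^esub> f y"
  and lin_smult: "lin K M N f \<Longrightarrow> c \<in> carrier K \<Longrightarrow> x \<in> carrier M \<Longrightarrow> f (c \<odot>\<^bsub>M\<^esub> x) = c \<odot>\<^bsub>N\<^esub> f x"
  by (auto simp: lin_def module_hom_def)

lemma linI:
  assumes "\<And>x. x \<in> carrier M \<Longrightarrow> f x \<in> carrier N"
    and "\<And>x y. x \<in> carrier M \<Longrightarrow> y \<in> carrier M \<Longrightarrow> f (x \<oplus>\<^bsub>M\<^esub> y) = f x \<oplus>\<^bsub>N\<^esub> f y"
    and "\<And>c x. c \<in> carrier K \<Longrightarrow> x \<in> carrier M \<Longrightarrow> f (c \<odot>\<^bsub>M\<^esub> x) = c \<odot>\<^bsub>N\<^esub> f x"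
  shows "lin K M N f"
  using assms by (auto simp: lin_def module_hom_def)

lemma lin_hom: "lin K M N f \<Longrightarrow> f \<in> hom (add_monoid M) (add_monoid N)"
  by (auto intro!: homI simp: lin_closed lin_add)

lemma bil_lin: "bil K M N G F \<Longrightarrow> x \<in> carrier M \<Longrightarrow> lin K N G (F x)"
  "bil K M N G F \<Longrightarrow> y \<in> carrier N \<Longrightarrow> lin K M G (\<lambda>x. F x y)"
  by (auto simp: bil_def)

lemma bil_closed: "bil K M N G F \<Longrightarrow> x \<in> carrier M \<Longrightarrow> y \<in> carrier N \<Longrightarrow> F x y \<in> carrier G"
  by (blast dest: bil_lin lin_closed)

lemma lin_id: "lin K M M (\<lambda>x. x)"
  by (rule linI) auto

lemma lin_compose:
  assumes "lin K N G g" "lin K M N f"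
  shows "lin K M G (\<lambda>x. g (f x))"
  by (rule linI) (use lin_closed[OF assms(1)] lin_add[OF assms(1)] lin_smult[OF assms(1)]
    lin_closed[OF assms(2)] lin_add[OF assms(2)] lin_smult[OF assms(2)] in auto)

lemma regular_simps [simp]:
  "carrier (regular_bimodule K) = carrier K" "x \<oplus>\<^bsub>regular_bimodule K\<^esub> y = x \<oplus>\<^bsub>K\<^esub> y"
  "x \<odot>\<^bsub>regular_bimodule K\<^esub> y = x \<otimes>\<^bsub>K\<^esub> y" "x \<star>\<^bsub>regular_bimodule K\<^esub> y = x \<otimes>\<^bsub>K\<^esub> y"
  "\<zero>\<^bsub>regular_bimodule K\<^esub> = \<zero>\<^bsub>K\<^esub>" "x \<otimes>\<^bsub>regular_bimodule K\<^esub> y = x \<otimes>\<^bsub>K\<^esub> y"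
  "\<one>\<^bsub>regular_bimodule K\<^esub> = \<one>\<^bsub>K\<^esub>"
  by (simp_all add: regular_bimodule_def)

lemma module_regular:
  assumes "cring K"
  shows "module K (regular_bimodule K)"
proof -
  interpret K: cring K by fact
  have "abelian_group (regular_bimodule K)"
    by (rule abelian_groupI) (auto simp: K.a_ac intro: K.l_neg)
  then show ?thesis
    by (rule moduleI[OF assms]) (auto simp: K.m_assoc K.l_distr K.r_distr)
qed

text \<open>Finite sums and integer multiples see only the additive group of the target. Hence sums
  may be moved between records over the same group: \<open>K\<close> and its regular bimodule,
  \<open>ktensor\<close> and \<open>tensor_product\<close>, an algebra and its opposite.\<close>

lemma tensor_sum_target_cong:
  fixes G :: "('g, 'x) ring_scheme" and G' :: "('g, 'y) ring_scheme" and t :: "('m, 'n) tensor"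
  assumes "carrier G = carrier G'" "\<zero>\<^bsub>G\<^esub> = \<zero>\<^bsub>G'\<^esub>" "ring.add G = ring.add G'"
  shows "tensor_sum G t f = tensor_sum G' t f"
proof -
  have inv: "inv\<^bsub>add_monoid G\<^esub> x = inv\<^bsub>add_monoid G'\<^esub> x" for x
    using assms by (simp add: m_inv_def)
  have npow: "pow (add_monoid G) x (n::nat) = pow (add_monoid G') x n" for x n
    using assms by (simp add: nat_pow_def)
  have *: "pow (add_monoid G) x (n::int) = pow (add_monoid G') x n" for x n
    by (simp only: int_pow_def2 npow inv)
  have "finprod (add_monoid G) h Z = finprod (add_monoid G') h Z" for h :: "'m \<times> 'n \<Rightarrow> 'g" and Z
    using assms by (simp add: finprod_def)
  then show ?thesis by (simp add: tensor_sum_def finsum_def add_pow_def *)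
qed

lemma tensor_sum_regular: "tensor_sum (regular_bimodule K) t f = tensor_sum K t f"
  by (rule tensor_sum_target_cong) (simp_all add: regular_bimodule_def)

lemma lin_smult_fun:
  assumes "lin K M G f" "c \<in> carrier K" "module K G"
  shows "lin K M G (\<lambda>x. c \<odot>\<^bsub>G\<^esub> f x)"
proof -
  interpret G: module K G by fact
  show ?thesis
    by (rule linI) (use assms lin_closed[OF assms(1)] lin_add[OF assms(1)] lin_smult[OF assms(1)] in
        \<open>auto simp: G.smult_r_distr G.R.m_comm simp flip: G.smult_assoc1\<close>)
qed

lemma lin_smult_scalar:
  assumes "lin K M (regular_bimodule K) f" "v \<in> carrier G" "module K G"
  shows "lin K M G (\<lambda>x. f x \<odot>\<^bsub>G\<^esub> v)"
proof -
  interpret G: module K G by fact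
  have cl: "x \<in> carrier M \<Longrightarrow> f x \<in> carrier K" for x using lin_closed[OF assms(1)] by simp
  show ?thesis
    by (rule linI) (use assms cl lin_add[OF assms(1)] lin_smult[OF assms(1)] in
        \<open>auto simp: G.smult_l_distr G.smult_assoc1\<close>)
qed

lemma lin_kmult:
  assumes "lin K M (regular_bimodule K) f" "c \<in> carrier K" "cring K"
  shows "lin K M (regular_bimodule K) (\<lambda>x. c \<otimes>\<^bsub>K\<^esub> f x)" "lin K M (regular_bimodule K) (\<lambda>x. f x \<otimes>\<^bsub>K\<^esub> c)"
proof -
  show "lin K M (regular_bimodule K) (\<lambda>x. c \<otimes>\<^bsub>K\<^esub> f x)"
    using lin_smult_fun[OF assms(1,2) module_regular[OF assms(3)]] by simp
  show "lin K M (regular_bimodule K) (\<lambda>x. f x \<otimes>\<^bsub>K\<^esub> c)"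
    using lin_smult_scalar[OF assms(1) _ module_regular[OF assms(3)], of c] assms by simp
qed

lemma lin_amult:
  assumes "lin K M A f" "a \<in> carrier A" "assoc_algebra K A"
  shows "lin K M A (\<lambda>x. a \<otimes>\<^bsub>A\<^esub> f x)" "lin K M A (\<lambda>x. f x \<otimes>\<^bsub>A\<^esub> a)"
proof -
  interpret A: assoc_algebra K A by fact
  show "lin K M A (\<lambda>x. a \<otimes>\<^bsub>A\<^esub> f x)" "lin K M A (\<lambda>x. f x \<otimes>\<^bsub>A\<^esub> a)"
    by (rule linI; use assms lin_closed[OF assms(1)] lin_add[OF assms(1)] lin_smult[OF assms(1)] in
        \<open>auto simp: A.r_distr A.l_distr A.smult_mult_left A.smult_mult_right\<close>)+
qed

section \<open>Tensor products over the ground field as modules\<close>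

lemma ktensor_simps:
  "carrier (ktensor K M N) = carrier (tensor_product K M (\<lambda>x c. c \<odot>\<^bsub>M\<^esub> x) N (smult N))"
  "\<zero>\<^bsub>ktensor K M N\<^esub> = \<zero>\<^bsub>tensor_product K M (\<lambda>x c. c \<odot>\<^bsub>M\<^esub> x) N (smult N)\<^esub>"
  "ring.add (ktensor K M N) = ring.add (tensor_product K M (\<lambda>x c. c \<odot>\<^bsub>M\<^esub> x) N (smult N))"
  "pure_tensor (ktensor K M N) = pure_tensor (tensor_product K M (\<lambda>x c. c \<odot>\<^bsub>M\<^esub> x) N (smult N))"
  by (auto simp: ktensor_def Let_def pure_tensor_def fun_eq_iff)

lemma tensor_sum_ktensor:
  "tensor_sum (ktensor K M N) t f = tensor_sum (tensor_product K M (\<lambda>x c. c \<odot>\<^bsub>M\<^esub> x) N (smult N)) t f"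
  by (rule tensor_sum_target_cong) (simp_all add: ktensor_simps)

lemma ktensor_smult:
  "c \<odot>\<^bsub>ktensor K M N\<^esub> t =
   tensor_sum (ktensor K M N) t (\<lambda>x y. pure_tensor (ktensor K M N) (c \<odot>\<^bsub>M\<^esub> x) y)"
  unfolding tensor_sum_ktensor ktensor_simps by (simp add: ktensor_def Let_def)

lemma tensor_factors_ktensor:
  assumes "module K M" "module K N"
  shows "tensor_factors K M (\<lambda>x c. c \<odot>\<^bsub>M\<^esub> x) N (smult N)"
proof -
  interpret M: module K M by fact
  interpret N: module K N by fact
  show ?thesis by unfold_locales auto
qed

lemma abelian_group_target:
  assumes "abelian_group G" "carrier G = carrier G'" "\<zero>\<^bsub>G\<^esub> = \<zero>\<^bsub>G'\<^esub>" "ring.add G = ring.add G'"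
  shows "abelian_group G'"
  using abelian_groupE[OF assms(1)] unfolding assms(2-4) by (rule abelian_groupI)

lemma abelian_group_ktensor:
  assumes "module K M" "module K N"
  shows "abelian_group (ktensor K M N)"
  by (rule abelian_group_target[OF tensor_factors.abelian_group_tensor[OF tensor_factors_ktensor[OF assms]]])
    (simp_all add: ktensor_simps)

lemma bil_balanced:
  assumes "bil K M N G F"
  shows "balanced_map K M (\<lambda>x c. c \<odot>\<^bsub>M\<^esub> x) N (smult N) G F"
  by (rule balanced_mapI)
    (use bil_lin[OF assms] in \<open>simp_all add: bil_closed[OF assms] lin_add[of K N G "F _"]
      lin_add[of K M G "\<lambda>x. F x _"] lin_smult[of K N G "F _"] lin_smult[of K M G "\<lambda>x. F x _"]\<close>)

lemma additive_diff:
  assumes "abelian_group G" "abelian_group G'" "\<And>x. x \<in> carrier G \<Longrightarrow> f x \<in> carrier G'"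
    and "\<And>x y. x \<in> carrier G \<Longrightarrow> y \<in> carrier G \<Longrightarrow> f (x \<oplus>\<^bsub>G\<^esub> y) = f x \<oplus>\<^bsub>G'\<^esub> f y"
    and "x \<in> carrier G" "y \<in> carrier G"
  shows "f (x \<ominus>\<^bsub>G\<^esub> y) = f x \<ominus>\<^bsub>G'\<^esub> f y"
proof -
  interpret G: abelian_group G by fact
  interpret G': abelian_group G' by fact
  have "f (x \<ominus>\<^bsub>G\<^esub> y) \<oplus>\<^bsub>G'\<^esub> f y = f x"
    using assms(4)[of "x \<ominus>\<^bsub>G\<^esub> y" y] assms(5,6) by (simp add: G.minus_eq G.a_assoc G.l_neg)
  then show ?thesis
    using assms(3)[OF assms(6)] assms(3)[of "x \<ominus>\<^bsub>G\<^esub> y"] assms(5,6)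
    by (metis G'.a_assoc G'.a_inv_closed G'.minus_eq G'.r_neg G'.r_zero G.minus_closed)
qed

context
  fixes K :: "('k, 'x) ring_scheme" and M :: "('k, 'm, 'y) module_scheme" and N :: "('k, 'n, 'z) module_scheme"
  assumes M: "module K M" and N: "module K N"
begin

interpretation M: module K M by (rule M)
interpretation N: module K N by (rule N)
interpretation tensor_factors K M "\<lambda>x c. c \<odot>\<^bsub>M\<^esub> x" N "smult N"
  by (rule tensor_factors_ktensor[OF M N])

lemma ktensor_pure_closed: "x \<in> carrier M \<Longrightarrow> y \<in> carrier N \<Longrightarrow> pure_tensor (ktensor K M N) x y \<in> carrier (ktensor K M N)"
  and ktensor_pure_add_left: "x \<in> carrier M \<Longrightarrow> x' \<in> carrier M \<Longrightarrow> y \<in> carrier N \<Longrightarrow>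
    pure_tensor (ktensor K M N) (x \<oplus>\<^bsub>M\<^esub> x') y =
    pure_tensor (ktensor K M N) x y \<oplus>\<^bsub>ktensor K M N\<^esub> pure_tensor (ktensor K M N) x' y"
  and ktensor_pure_add_right: "x \<in> carrier M \<Longrightarrow> y \<in> carrier N \<Longrightarrow> y' \<in> carrier N \<Longrightarrow>
    pure_tensor (ktensor K M N) x (y \<oplus>\<^bsub>N\<^esub> y') =
    pure_tensor (ktensor K M N) x y \<oplus>\<^bsub>ktensor K M N\<^esub> pure_tensor (ktensor K M N) x y'"
  and ktensor_pure_smult_right: "x \<in> carrier M \<Longrightarrow> c \<in> carrier K \<Longrightarrow> y \<in> carrier N \<Longrightarrow>
    pure_tensor (ktensor K M N) x (c \<odot>\<^bsub>N\<^esub> y) = pure_tensor (ktensor K M N) (c \<odot>\<^bsub>M\<^esub> x) y"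
  by (simp_all add: ktensor_simps pure_carrier pure_add_left pure_add_right pure_balanced[symmetric])

lemma ktensor_induct [consumes 1, case_names pure minus]:
  assumes "t \<in> carrier (ktensor K M N)"
    and "\<And>x y. x \<in> carrier M \<Longrightarrow> y \<in> carrier N \<Longrightarrow> P (pure_tensor (ktensor K M N) x y)"
    and "\<And>s t. s \<in> carrier (ktensor K M N) \<Longrightarrow> t \<in> carrier (ktensor K M N) \<Longrightarrow> P s \<Longrightarrow> P t \<Longrightarrow>
      P (s \<ominus>\<^bsub>ktensor K M N\<^esub> t)"
  shows "P t"
proof -
  have minus: "s \<ominus>\<^bsub>ktensor K M N\<^esub> t = s \<ominus>\<^bsub>T\<^esub> t" for s t
    by (simp add: a_minus_def a_inv_def m_inv_def ktensor_simps)
  show ?thesis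
    by (rule tensor_induct[of t P]) (use assms in \<open>simp_all add: ktensor_simps minus\<close>)
qed

lemma balanced_smult:
  "c \<in> carrier K \<Longrightarrow> balanced_map K M (\<lambda>x c. c \<odot>\<^bsub>M\<^esub> x) N (smult N) (ktensor K M N)
    (\<lambda>x y. pure_tensor (ktensor K M N) (c \<odot>\<^bsub>M\<^esub> x) y)"
  by (rule balanced_mapI)
    (auto simp: ktensor_pure_closed ktensor_pure_add_left ktensor_pure_add_right ktensor_pure_smult_right
      M.smult_r_distr M.R.m_comm simp flip: M.smult_assoc1)

lemma ktensor_smult_pure:
  "c \<in> carrier K \<Longrightarrow> x \<in> carrier M \<Longrightarrow> y \<in> carrier N \<Longrightarrow>
    c \<odot>\<^bsub>ktensor K M N\<^esub> pure_tensor (ktensor K M N) x y = pure_tensor (ktensor K M N) (c \<odot>\<^bsub>M\<^esub> x) y"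
  unfolding ktensor_smult
  using tensor_sum_pure[OF abelian_group_ktensor[OF M N] balanced_smult, of c x y]
  by (simp add: ktensor_simps)

lemma ktensor_smult_closed:
  "c \<in> carrier K \<Longrightarrow> t \<in> carrier (ktensor K M N) \<Longrightarrow> c \<odot>\<^bsub>ktensor K M N\<^esub> t \<in> carrier (ktensor K M N)"
  unfolding ktensor_smult
  by (rule tensor_sum_closed[OF abelian_group_ktensor[OF M N]])
    (auto simp: ktensor_pure_closed simp flip: ktensor_simps)

lemma ktensor_smult_add:
  "c \<in> carrier K \<Longrightarrow> s \<in> carrier (ktensor K M N) \<Longrightarrow> t \<in> carrier (ktensor K M N) \<Longrightarrow>
    c \<odot>\<^bsub>ktensor K M N\<^esub> (s \<oplus>\<^bsub>ktensor K M N\<^esub> t) =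
    (c \<odot>\<^bsub>ktensor K M N\<^esub> s) \<oplus>\<^bsub>ktensor K M N\<^esub> (c \<odot>\<^bsub>ktensor K M N\<^esub> t)"
  unfolding ktensor_smult
  using tensor_sum_add[OF abelian_group_ktensor[OF M N] balanced_smult, of c s t]
  by (simp add: ktensor_simps)

text \<open>Each law holds on pure tensors and survives differences, because the scalar action is
  additive.\<close>

lemma module_ktensor: "module K (ktensor K M N)"
proof -
  interpret Tk: abelian_group "ktensor K M N" by (rule abelian_group_ktensor[OF M N])
  have diff: "c \<odot>\<^bsub>ktensor K M N\<^esub> (s \<ominus>\<^bsub>ktensor K M N\<^esub> t) =
      (c \<odot>\<^bsub>ktensor K M N\<^esub> s) \<ominus>\<^bsub>ktensor K M N\<^esub> (c \<odot>\<^bsub>ktensor K M N\<^esub> t)"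
    if "c \<in> carrier K" "s \<in> carrier (ktensor K M N)" "t \<in> carrier (ktensor K M N)" for c s t
    by (rule additive_diff[where f = "smult (ktensor K M N) c", OF Tk.abelian_group_axioms Tk.abelian_group_axioms])
      (use that in \<open>auto simp: ktensor_smult_closed ktensor_smult_add\<close>)
  have ac: "(a \<ominus>\<^bsub>ktensor K M N\<^esub> b) \<oplus>\<^bsub>ktensor K M N\<^esub> (c \<ominus>\<^bsub>ktensor K M N\<^esub> d) =
      (a \<oplus>\<^bsub>ktensor K M N\<^esub> c) \<ominus>\<^bsub>ktensor K M N\<^esub> (b \<oplus>\<^bsub>ktensor K M N\<^esub> d)"
    if "a \<in> carrier (ktensor K M N)" "b \<in> carrier (ktensor K M N)"
      "c \<in> carrier (ktensor K M N)" "d \<in> carrier (ktensor K M N)" for a b c d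
    using that by (simp add: Tk.minus_eq Tk.minus_add Tk.add.m_ac)
  show ?thesis
  proof (rule moduleI)
    fix a b t assume a: "a \<in> carrier K" and b: "b \<in> carrier K" and t: "t \<in> carrier (ktensor K M N)"
    show "(a \<oplus>\<^bsub>K\<^esub> b) \<odot>\<^bsub>ktensor K M N\<^esub> t =
        (a \<odot>\<^bsub>ktensor K M N\<^esub> t) \<oplus>\<^bsub>ktensor K M N\<^esub> (b \<odot>\<^bsub>ktensor K M N\<^esub> t)"
      using t
    proof (induction t rule: ktensor_induct)
      case (minus s t)
      then show ?case using a b
        by (simp add: diff ac ktensor_smult_closed)
    qed (use a b in \<open>simp add: ktensor_smult_pure M.smult_l_distr ktensor_pure_add_left\<close>)
    show "(a \<otimes>\<^bsub>K\<^esub> b) \<odot>\<^bsub>ktensor K M N\<^esub> t = a \<odot>\<^bsub>ktensor K M N\<^esub> (b \<odot>\<^bsub>ktensor K M N\<^esub> t)"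
      using t
    proof (induction t rule: ktensor_induct)
      case (minus s t)
      then show ?case using a b by (simp add: diff ktensor_smult_closed)
    qed (use a b in \<open>simp add: ktensor_smult_pure M.smult_assoc1\<close>)
  next
    fix t assume t: "t \<in> carrier (ktensor K M N)"
    show "\<one>\<^bsub>K\<^esub> \<odot>\<^bsub>ktensor K M N\<^esub> t = t"
      using t
    proof (induction t rule: ktensor_induct)
      case (minus s t)
      then show ?case by (simp add: diff)
    qed (simp add: ktensor_smult_pure)
  qed (auto simp: ktensor_smult_closed ktensor_smult_add M.is_cring Tk.abelian_group_axioms)
qed

lemma bil_pure: "bil K M N (ktensor K M N) (pure_tensor (ktensor K M N))"
  unfolding bil_def
  by (auto intro!: linI simp: ktensor_pure_closed ktensor_pure_add_left ktensor_pure_add_right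
      ktensor_pure_smult_right ktensor_smult_pure)

lemma ktensor_sum_pure:
  "module K G \<Longrightarrow> bil K M N G F \<Longrightarrow> x \<in> carrier M \<Longrightarrow> y \<in> carrier N \<Longrightarrow>
    tensor_sum G (pure_tensor (ktensor K M N) x y) F = F x y"
  unfolding ktensor_simps by (rule tensor_sum_pure[OF _ bil_balanced]) (auto simp: module_def)

text \<open>Universal property of the tensor product over \<open>K\<close>: a bilinear map induces a
  linear one. Additivity is known from balanced maps; homogeneity is checked on pure
  tensors.\<close>

lemma ktensor_sum_lin:
  assumes G: "module K G" and F: "bil K M N G F"
  shows "lin K (ktensor K M N) G (\<lambda>t. tensor_sum G t F)"
proof -
  interpret G: module K G by (rule G)
  interpret Tk: module K "ktensor K M N" by (rule module_ktensor)
  have cl: "tensor_sum G t F \<in> carrier G" if "t \<in> carrier (ktensor K M N)" for t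
    using that bil_closed[OF F] by (intro tensor_sum_closed[OF G.M.abelian_group_axioms])
      (auto simp: ktensor_simps)
  have add: "tensor_sum G (s \<oplus>\<^bsub>ktensor K M N\<^esub> t) F = tensor_sum G s F \<oplus>\<^bsub>G\<^esub> tensor_sum G t F"
    if "s \<in> carrier (ktensor K M N)" "t \<in> carrier (ktensor K M N)" for s t
    using tensor_sum_add[OF G.M.abelian_group_axioms bil_balanced[OF F]] that by (simp add: ktensor_simps)
  show ?thesis
  proof (rule linI)
    fix c t assume c: "c \<in> carrier K" and t: "t \<in> carrier (ktensor K M N)"
    show "tensor_sum G (c \<odot>\<^bsub>ktensor K M N\<^esub> t) F = c \<odot>\<^bsub>G\<^esub> tensor_sum G t F"
      using t
    proof (induction t rule: ktensor_induct)
      case (pure x y)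
      then show ?case
        using c by (simp add: ktensor_smult_pure ktensor_sum_pure[OF G F] lin_smult[OF bil_lin(2)[OF F]])
    next
      case (minus s t)
      have d: "c \<odot>\<^bsub>ktensor K M N\<^esub> (s \<ominus>\<^bsub>ktensor K M N\<^esub> t) =
          (c \<odot>\<^bsub>ktensor K M N\<^esub> s) \<ominus>\<^bsub>ktensor K M N\<^esub> (c \<odot>\<^bsub>ktensor K M N\<^esub> t)"
        by (rule additive_diff[where f = "smult (ktensor K M N) c", OF Tk.M.abelian_group_axioms Tk.M.abelian_group_axioms])
          (use c minus in \<open>auto simp: Tk.smult_r_distr\<close>)
      have d': "tensor_sum G (s \<ominus>\<^bsub>ktensor K M N\<^esub> t) F = tensor_sum G s F \<ominus>\<^bsub>G\<^esub> tensor_sum G t F"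
        if "s \<in> carrier (ktensor K M N)" "t \<in> carrier (ktensor K M N)" for s t
        by (rule additive_diff[where f = "\<lambda>t. tensor_sum G t F", OF Tk.M.abelian_group_axioms G.M.abelian_group_axioms])
          (use that cl add in auto)
      have d'': "c \<odot>\<^bsub>G\<^esub> (u \<ominus>\<^bsub>G\<^esub> v) = c \<odot>\<^bsub>G\<^esub> u \<ominus>\<^bsub>G\<^esub> c \<odot>\<^bsub>G\<^esub> v" if "u \<in> carrier G" "v \<in> carrier G" for u v
        by (rule additive_diff[where f = "smult G c", OF G.M.abelian_group_axioms G.M.abelian_group_axioms])
          (use c that in \<open>auto simp: G.smult_r_distr\<close>)
      show ?case using minus c cl by (simp add: d d' d'')
    qed
  qed (use cl add in auto)
qed

lemma ktensor_sum_closed: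
  assumes "module K G" "t \<in> carrier (ktensor K M N)"
    and "\<And>x y. x \<in> carrier M \<Longrightarrow> y \<in> carrier N \<Longrightarrow> F x y \<in> carrier G"
  shows "tensor_sum G t F \<in> carrier G"
  using assms by (intro tensor_sum_closed) (auto simp: ktensor_simps module_def)

lemma ktensor_sum_cong:
  assumes "module K G" "t \<in> carrier (ktensor K M N)"
    and "\<And>x y. x \<in> carrier M \<Longrightarrow> y \<in> carrier N \<Longrightarrow> F x y = F' x y"
    and "\<And>x y. x \<in> carrier M \<Longrightarrow> y \<in> carrier N \<Longrightarrow> F' x y \<in> carrier G"
  shows "tensor_sum G t F = tensor_sum G t F'"
  using assms by (intro tensor_sum_cong) (auto simp: ktensor_simps module_def)

lemma ktensor_sum_add_fun:
  assumes "module K G" "t \<in> carrier (ktensor K M N)"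
    and "\<And>x y. x \<in> carrier M \<Longrightarrow> y \<in> carrier N \<Longrightarrow> F x y \<in> carrier G"
    and "\<And>x y. x \<in> carrier M \<Longrightarrow> y \<in> carrier N \<Longrightarrow> F' x y \<in> carrier G"
  shows "tensor_sum G t (\<lambda>x y. F x y \<oplus>\<^bsub>G\<^esub> F' x y) = tensor_sum G t F \<oplus>\<^bsub>G\<^esub> tensor_sum G t F'"
  using assms by (intro tensor_sum_distrib) (auto simp: ktensor_simps module_def)

lemma lin_ktensor_sum:
  assumes "module K G" "module K G'" "lin K G G' \<phi>" "t \<in> carrier (ktensor K M N)"
    and "\<And>x y. x \<in> carrier M \<Longrightarrow> y \<in> carrier N \<Longrightarrow> F x y \<in> carrier G"
  shows "\<phi> (tensor_sum G t F) = tensor_sum G' t (\<lambda>x y. \<phi> (F x y))"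
  using assms by (intro tensor_sum_additive) (auto simp: ktensor_simps module_def lin_hom)

lemma ktensor_sum_self:
  "t \<in> carrier (ktensor K M N) \<Longrightarrow> tensor_sum (ktensor K M N) t (pure_tensor (ktensor K M N)) = t"
  unfolding tensor_sum_ktensor ktensor_simps by (rule tensor_sum_self)

lemma lin_ktensor_sum_fun:
  assumes G: "module K G" and t: "t \<in> carrier (ktensor K M N)"
    and F: "\<And>x y. x \<in> carrier M \<Longrightarrow> y \<in> carrier N \<Longrightarrow> lin K P G (\<lambda>p. F p x y)"
  shows "lin K P G (\<lambda>p. tensor_sum G t (F p))"
proof -
  interpret G: module K G by (rule G)
  have cl: "F p x y \<in> carrier G" if "p \<in> carrier P" "x \<in> carrier M" "y \<in> carrier N" for p x y
    using lin_closed[OF F[OF that(2,3)] that(1)] .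
  show ?thesis
  proof (rule linI)
    fix p q assume pq: "p \<in> carrier P" "q \<in> carrier P"
    have "tensor_sum G t (F (p \<oplus>\<^bsub>P\<^esub> q)) = tensor_sum G t (\<lambda>x y. F p x y \<oplus>\<^bsub>G\<^esub> F q x y)"
      by (rule ktensor_sum_cong[OF G t]) (use pq cl lin_add[OF F] in auto)
    also have "\<dots> = tensor_sum G t (F p) \<oplus>\<^bsub>G\<^esub> tensor_sum G t (F q)"
      by (rule ktensor_sum_add_fun[OF G t]) (use pq cl in auto)
    finally show "tensor_sum G t (F (p \<oplus>\<^bsub>P\<^esub> q)) = tensor_sum G t (F p) \<oplus>\<^bsub>G\<^esub> tensor_sum G t (F q)" .
  next
    fix c p assume c: "c \<in> carrier K" and p: "p \<in> carrier P"
    have "tensor_sum G t (F (c \<odot>\<^bsub>P\<^esub> p)) = tensor_sum G t (\<lambda>x y. c \<odot>\<^bsub>G\<^esub> F p x y)"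
      by (rule ktensor_sum_cong[OF G t]) (use c p cl lin_smult[OF F] in auto)
    also have "\<dots> = c \<odot>\<^bsub>G\<^esub> tensor_sum G t (F p)"
      by (rule lin_ktensor_sum[OF G G _ t, symmetric])
        (use c p cl lin_smult_fun[OF lin_id c G] in auto)
    finally show "tensor_sum G t (F (c \<odot>\<^bsub>P\<^esub> p)) = c \<odot>\<^bsub>G\<^esub> tensor_sum G t (F p)" .
  qed (use cl in \<open>auto intro: ktensor_sum_closed[OF G t]\<close>)
qed

end

lemma ktensor_sum_swap:
  assumes "module K M" "module K N" "module K M'" "module K N'" "module K G"
    and "s \<in> carrier (ktensor K M N)" "t \<in> carrier (ktensor K M' N')"
    and "\<And>x y u v. x \<in> carrier M \<Longrightarrow> y \<in> carrier N \<Longrightarrow> u \<in> carrier M' \<Longrightarrow> v \<in> carrier N' \<Longrightarrow>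
      F x y u v \<in> carrier G"
  shows "tensor_sum G s (\<lambda>x y. tensor_sum G t (\<lambda>u v. F x y u v)) =
    tensor_sum G t (\<lambda>u v. tensor_sum G s (\<lambda>x y. F x y u v))"
  by (rule tensor_sum_swap[OF tensor_factors_ktensor[OF assms(1,2)] tensor_factors_ktensor[OF assms(3,4)]])
    (use assms in \<open>auto simp: ktensor_simps module_def\<close>)

section \<open>Congruence of sums\<close>

lemma foldSetD_cong:
  assumes "(A, y) \<in> foldSetD D f e" "\<And>x. x \<in> A \<Longrightarrow> f x = g x"
  shows "(A, y) \<in> foldSetD D g e"
  using assms
proof (induction rule: foldSetD.induct)
  case emptyI
  show ?case by (rule foldSetD.emptyI[OF emptyI(1)])
next
  case (insertI x A y)
  then have "(A, y) \<in> foldSetD D g e" "g x y \<in> D" "f x y = g x y" by auto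
  then show ?case using insertI(1) by (metis foldSetD.insertI)
qed

text \<open>A finite sum is a fold along \<open>A\<close>, so agreement on \<open>A\<close> suffices
  wherever the values lie. This frees rewriting under sums from closure conditions.\<close>

lemma finsum_cong_raw:
  assumes "\<And>x. x \<in> A \<Longrightarrow> f x = g x"
  shows "finsum G f A = finsum G g A"
proof -
  have "foldSetD D ((\<oplus>\<^bsub>G\<^esub>) \<circ> f) e `` {A} = foldSetD D ((\<oplus>\<^bsub>G\<^esub>) \<circ> g) e `` {A}" for D e
    using foldSetD_cong[of A _ D "(\<oplus>\<^bsub>G\<^esub>) \<circ> f" e "(\<oplus>\<^bsub>G\<^esub>) \<circ> g"]
      foldSetD_cong[of A _ D "(\<oplus>\<^bsub>G\<^esub>) \<circ> g" e "(\<oplus>\<^bsub>G\<^esub>) \<circ> f"] assms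
    by (auto simp: Image_singleton)
  then have "(\<lambda>y. (A, y) \<in> foldSetD D ((\<oplus>\<^bsub>G\<^esub>) \<circ> f) e) = (\<lambda>y. (A, y) \<in> foldSetD D ((\<oplus>\<^bsub>G\<^esub>) \<circ> g) e)" for D e
    by (auto simp: set_eq_iff Image_singleton fun_eq_iff)
  then show ?thesis
    by (simp add: finsum_def finprod_def foldD_def)
qed

lemma ktensor_sum_cong_raw:
  assumes "module K M" "module K N" "t \<in> carrier (ktensor K M N)"
    and "\<And>x y. x \<in> carrier M \<Longrightarrow> y \<in> carrier N \<Longrightarrow> F x y = F' x y"
  shows "tensor_sum G t F = tensor_sum G t F'"
  unfolding tensor_sum_def Let_def
  using tensor_factors.keys_some_rep[OF tensor_factors_ktensor[OF assms(1,2)]] assms(3,4)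
  by (intro finsum_cong_raw) (auto simp: ktensor_simps)

section \<open>Trilinear maps on threefold tensor products\<close>

definition tri ::
    "('k, 'x) ring_scheme \<Rightarrow> ('k, 'l, 'u) module_scheme \<Rightarrow> ('k, 'm, 'y) module_scheme \<Rightarrow>
     ('k, 'n, 'z) module_scheme \<Rightarrow> ('k, 'g, 'w) module_scheme \<Rightarrow> ('l \<Rightarrow> 'm \<Rightarrow> 'n \<Rightarrow> 'g) \<Rightarrow> bool" where
  "tri K L M N G F \<longleftrightarrow>
     (\<forall>x\<in>carrier L. \<forall>y\<in>carrier M. lin K N G (F x y)) \<and>
     (\<forall>x\<in>carrier L. \<forall>z\<in>carrier N. lin K M G (\<lambda>y. F x y z)) \<and>
     (\<forall>y\<in>carrier M. \<forall>z\<in>carrier N. lin K L G (\<lambda>x. F x y z))"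

lemma bil_lin_fun:
  assumes "bil K M N G F"
  shows "y \<in> carrier N \<Longrightarrow> lin K P M f \<Longrightarrow> lin K P G (\<lambda>p. F (f p) y)"
    and "x \<in> carrier M \<Longrightarrow> lin K P N g \<Longrightarrow> lin K P G (\<lambda>p. F x (g p))"
  using lin_compose[OF bil_lin(2)[OF assms]] lin_compose[OF bil_lin(1)[OF assms]] by blast+

context
  fixes K :: "('k, 'x) ring_scheme" and L :: "('k, 'l, 'u) module_scheme"
    and M :: "('k, 'm, 'y) module_scheme" and N :: "('k, 'n, 'z) module_scheme"
    and G :: "('k, 'g, 'w) module_scheme" and F :: "'l \<Rightarrow> 'm \<Rightarrow> 'n \<Rightarrow> 'g"
  assumes L: "module K L" and M: "module K M" and N: "module K N" and G: "module K G"
    and F: "tri K L M N G F"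
begin

lemma tri_bil: "bil K (ktensor K L M) N G (\<lambda>t z. tensor_sum G t (\<lambda>u v. F u v z))"
  unfolding bil_def
proof safe
  fix t assume t: "t \<in> carrier (ktensor K L M)"
  show "lin K N G (\<lambda>z. tensor_sum G t (\<lambda>u v. F u v z))"
    by (rule lin_ktensor_sum_fun[OF L M G t]) (use F in \<open>auto simp: tri_def\<close>)
next
  fix z assume z: "z \<in> carrier N"
  show "lin K (ktensor K L M) G (\<lambda>t. tensor_sum G t (\<lambda>u v. F u v z))"
    by (rule ktensor_sum_lin[OF L M G]) (use F z in \<open>auto simp: tri_def bil_def\<close>)
qed

text \<open>The linear map on the threefold tensor product that \<open>F\<close> induces. Applied to
  an axiom that equates threefold tensors, it yields the form of the axiom tested against
  \<open>F\<close>.\<close>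

lemma tri_lin:
  "lin K (ktensor K (ktensor K L M) N) G (\<lambda>Y. tensor_sum G Y (\<lambda>t z. tensor_sum G t (\<lambda>u v. F u v z)))"
  by (rule ktensor_sum_lin[OF module_ktensor[OF L M] N G tri_bil])

lemma tri_eval_pure:
  "t \<in> carrier (ktensor K L M) \<Longrightarrow> z \<in> carrier N \<Longrightarrow>
   tensor_sum G (pure_tensor (ktensor K (ktensor K L M) N) t z) (\<lambda>t z. tensor_sum G t (\<lambda>u v. F u v z)) =
   tensor_sum G t (\<lambda>u v. F u v z)"
  by (rule ktensor_sum_pure[OF module_ktensor[OF L M] N G tri_bil])

lemma tri_eval_inner:
  "x \<in> carrier L \<Longrightarrow> y \<in> carrier M \<Longrightarrow> z \<in> carrier N \<Longrightarrow>
   tensor_sum G (pure_tensor (ktensor K L M) x y) (\<lambda>u v. F u v z) = F x y z"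
  by (rule ktensor_sum_pure[OF L M G]) (use F in \<open>auto simp: tri_def bil_def\<close>)

end

section \<open>Weak bialgebras\<close>

context coalgebra
begin

text \<open>\<open>sw G h F\<close> is \<open>\<Sum> F h\<^bsub>(1)\<^esub> h\<^bsub>(2)\<^esub>\<close>, computed in \<open>G\<close>.\<close>

definition sw :: "('k, 'g, 'w) module_scheme \<Rightarrow> 'c \<Rightarrow> ('c \<Rightarrow> 'c \<Rightarrow> 'g) \<Rightarrow> 'g" where
  "sw G h F = tensor_sum G (\<Delta> h) F"

lemma cring_K: "cring K" by (rule R.is_cring)

lemma module_C [simp]: "module K C" by (rule module_axioms)

lemma module_KK [simp]: "module K (regular_bimodule K)" by (rule module_regular[OF cring_K])

lemma lin_comult: "lin K C (ktensor K C C) \<Delta>"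
  using comult_linear by (simp add: lin_def)

lemma comult_closed [simp]: "h \<in> carrier C \<Longrightarrow> \<Delta> h \<in> carrier (ktensor K C C)"
  by (rule lin_closed[OF lin_comult])

lemma counit_lin: "lin K C (regular_bimodule K) \<epsilon>"
  using counit_linear by (simp add: lin_def module_hom_def)

lemma counit_closed [simp]: "h \<in> carrier C \<Longrightarrow> \<epsilon> h \<in> carrier K"
  using lin_closed[OF counit_lin] by simp

lemma lin_counit_fun: "lin K M C f \<Longrightarrow> lin K M (regular_bimodule K) (\<lambda>x. \<epsilon> (f x))"
  by (rule lin_compose[OF counit_lin])

lemma sw_cong:
  "h = h' \<Longrightarrow> h' \<in> carrier C \<Longrightarrow>
   (\<And>x y. x \<in> carrier C \<Longrightarrow> y \<in> carrier C \<Longrightarrow> F x y = F' x y) \<Longrightarrow> sw G h F = sw G h' F'"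
  unfolding sw_def by (simp, rule ktensor_sum_cong_raw[OF module_C module_C comult_closed]) auto

lemma sw_closed [simp]:
  "module K G \<Longrightarrow> h \<in> carrier C \<Longrightarrow> (\<And>x y. x \<in> carrier C \<Longrightarrow> y \<in> carrier C \<Longrightarrow> F x y \<in> carrier G) \<Longrightarrow>
   sw G h F \<in> carrier G"
  unfolding sw_def by (rule ktensor_sum_closed[OF module_C module_C]) auto

lemma lin_sw_arg:
  assumes "lin K M C f" "bil K C C G F" "module K G"
  shows "lin K M G (\<lambda>x. sw G (f x) F)"
  unfolding sw_def
  by (rule lin_compose[OF ktensor_sum_lin[OF module_C module_C assms(3,2)] lin_compose[OF lin_comult assms(1)]])

lemma lin_sw_fun:
  assumes "h \<in> carrier C" "\<And>x y. x \<in> carrier C \<Longrightarrow> y \<in> carrier C \<Longrightarrow> lin K M G (\<lambda>p. F p x y)" "module K G"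
  shows "lin K M G (\<lambda>p. sw G h (F p))"
  unfolding sw_def
  by (rule lin_ktensor_sum_fun[OF module_C module_C assms(3)]) (use assms in auto)

lemma sw_push:
  assumes "lin K G G' \<phi>" "module K G" "module K G'" "h \<in> carrier C"
    and "\<And>x y. x \<in> carrier C \<Longrightarrow> y \<in> carrier C \<Longrightarrow> F x y \<in> carrier G"
  shows "\<phi> (sw G h F) = sw G' h (\<lambda>x y. \<phi> (F x y))"
  unfolding sw_def
  by (rule lin_ktensor_sum[OF module_C module_C]) (use assms in auto)

lemma sw_swap:
  assumes "module K G" "g \<in> carrier C" "h \<in> carrier C"
    and "\<And>x y u v. x \<in> carrier C \<Longrightarrow> y \<in> carrier C \<Longrightarrow> u \<in> carrier C \<Longrightarrow> v \<in> carrier C \<Longrightarrow>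
      F x y u v \<in> carrier G"
  shows "sw G g (\<lambda>x y. sw G h (\<lambda>u v. F x y u v)) = sw G h (\<lambda>u v. sw G g (\<lambda>x y. F x y u v))"
  unfolding sw_def
  by (rule ktensor_sum_swap[OF module_C module_C module_C module_C]) (use assms in auto)

text \<open>The map of \<open>tri_lin\<close> is applied to both sides of the coassociativity axiom
  and pushed through the sums.\<close>

lemma sw_coassoc:
  assumes "module K G" "h \<in> carrier C" "tri K C C C G F"
  shows "sw G h (\<lambda>x y. sw G x (\<lambda>u v. F u v y)) = sw G h (\<lambda>x y. sw G y (\<lambda>u v. F x u v))"
proof -
  let ?T = "ktensor K (ktensor K C C) C"
  have mT: "module K ?T" by (intro module_ktensor) simp_all
  note pc = ktensor_pure_closed[OF module_ktensor[OF module_C module_C] module_C]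
    ktensor_pure_closed[OF module_C module_C]
  note ev = lin_ktensor_sum[OF module_C module_C mT assms(1)
      tri_lin[OF module_C module_C module_C assms(1,3)]]
  note ep = tri_eval_pure[OF module_C module_C module_C assms(1,3)]
    tri_eval_inner[OF module_C module_C module_C assms(1,3)]
  let ?ev = "\<lambda>Y. tensor_sum G Y (\<lambda>t z. tensor_sum G t (\<lambda>u v. F u v z))"
  have "sw G h (\<lambda>x y. sw G x (\<lambda>u v. F u v y)) =
      ?ev (tensor_sum ?T (\<Delta> h) (\<lambda>x y. pure_tensor ?T (\<Delta> x) y))"
    unfolding sw_def using assms(2)
    by (subst ev) (auto simp: pc ep intro!: ktensor_sum_cong_raw[OF module_C module_C])
  also have "\<dots> = ?ev (tensor_sum ?T (\<Delta> h)
        (\<lambda>x y. tensor_sum ?T (\<Delta> y) (\<lambda>u v. pure_tensor ?T (pure_tensor (ktensor K C C) x u) v)))"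
    using coassoc[OF assms(2)] by simp
  also have "\<dots> = sw G h (\<lambda>x y. sw G y (\<lambda>u v. F x u v))"
    unfolding sw_def
    apply (subst ev)
      apply (use assms(2) in \<open>auto simp: pc intro!: ktensor_sum_closed[OF module_C module_C mT]\<close>)[2]
    apply (rule ktensor_sum_cong_raw[OF module_C module_C])
     apply (use assms(2) in simp)
    apply (subst ev)
      apply (auto simp: pc ep intro!: ktensor_sum_cong_raw[OF module_C module_C])
    done
  finally show ?thesis .
qed

lemma sw_counit_left:
  assumes "module K G" "lin K C G f" "h \<in> carrier C"
  shows "sw G h (\<lambda>x y. \<epsilon> x \<odot>\<^bsub>G\<^esub> f y) = f h"
proof -
  have "f h = f (sw C h (\<lambda>x y. \<epsilon> x \<odot>\<^bsub>C\<^esub> y))"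
    using counit_left[OF assms(3)] by (simp add: sw_def)
  also have "\<dots> = sw G h (\<lambda>x y. f (\<epsilon> x \<odot>\<^bsub>C\<^esub> y))"
    by (rule sw_push) (use assms in auto)
  also have "\<dots> = sw G h (\<lambda>x y. \<epsilon> x \<odot>\<^bsub>G\<^esub> f y)"
    by (rule sw_cong) (use assms in \<open>auto simp: lin_smult[OF assms(2)]\<close>)
  finally show ?thesis ..
qed

lemma sw_counit_right:
  assumes "module K G" "lin K C G f" "h \<in> carrier C"
  shows "sw G h (\<lambda>x y. \<epsilon> y \<odot>\<^bsub>G\<^esub> f x) = f h"
proof -
  have "f h = f (sw C h (\<lambda>x y. \<epsilon> y \<odot>\<^bsub>C\<^esub> x))"
    using counit_right[OF assms(3)] by (simp add: sw_def)
  also have "\<dots> = sw G h (\<lambda>x y. f (\<epsilon> y \<odot>\<^bsub>C\<^esub> x))"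
    by (rule sw_push) (use assms in auto)
  also have "\<dots> = sw G h (\<lambda>x y. \<epsilon> y \<odot>\<^bsub>G\<^esub> f x)"
    by (rule sw_cong) (use assms in \<open>auto simp: lin_smult[OF assms(2)]\<close>)
  finally show ?thesis ..
qed

end

context weak_bialgebra
begin

abbreviation hmul (infixl "\<bullet>" 70) where "x \<bullet> y \<equiv> x \<otimes>\<^bsub>H\<^esub> y"
abbreviation KK where "KK \<equiv> regular_bimodule K"

lemma ring_H: "ring H" by unfold_locales

lemma assoc_algebra_H [simp]: "assoc_algebra K H" by unfold_locales

lemma H_mult_closed [simp]: "x \<in> carrier H \<Longrightarrow> y \<in> carrier H \<Longrightarrow> x \<bullet> y \<in> carrier H"
  and H_one_closed [simp]: "\<one>\<^bsub>H\<^esub> \<in> carrier H"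
  and H_one_left [simp]: "x \<in> carrier H \<Longrightarrow> \<one>\<^bsub>H\<^esub> \<bullet> x = x"
  and H_one_right [simp]: "x \<in> carrier H \<Longrightarrow> x \<bullet> \<one>\<^bsub>H\<^esub> = x"
  and H_assoc: "x \<in> carrier H \<Longrightarrow> y \<in> carrier H \<Longrightarrow> z \<in> carrier H \<Longrightarrow> (x \<bullet> y) \<bullet> z = x \<bullet> (y \<bullet> z)"
  using ring.ring_simprules[OF ring_H] by auto

lemma lin_hmul:
  "lin K M H f \<Longrightarrow> a \<in> carrier H \<Longrightarrow> lin K M H (\<lambda>x. a \<bullet> f x)"
  "lin K M H f \<Longrightarrow> a \<in> carrier H \<Longrightarrow> lin K M H (\<lambda>x. f x \<bullet> a)"
  by (rule lin_amult; simp)+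

lemmas lin_rules = lin_id lin_hmul lin_counit_fun lin_smult_fun lin_smult_scalar
  lin_sw_arg lin_sw_fun lin_kmult[OF _ _ cring_K]

lemma module_smult_closed: "module K G \<Longrightarrow> c \<in> carrier K \<Longrightarrow> x \<in> carrier G \<Longrightarrow> c \<odot>\<^bsub>G\<^esub> x \<in> carrier G"
  by (rule module.smult_closed)

lemma sw_mult:
  assumes G: "module K G" and g: "g \<in> carrier H" and h: "h \<in> carrier H" and F: "bil K H H G F"
  shows "sw G (g \<bullet> h) F = sw G g (\<lambda>x y. sw G h (\<lambda>u v. F (x \<bullet> u) (y \<bullet> v)))"
proof -
  let ?T = "ktensor K H H"
  have mT: "module K ?T" by (intro module_ktensor) simp_all
  note pc = ktensor_pure_closed[OF module_C module_C]
  note ev = lin_ktensor_sum[OF module_C module_C mT G ktensor_sum_lin[OF module_C module_C G F]]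
  show ?thesis
    unfolding sw_def comult_mult[OF g h]
    apply (subst ev)
      apply (use g h in \<open>auto simp: pc intro!: ktensor_sum_closed[OF module_C module_C mT]\<close>)[2]
    apply (rule ktensor_sum_cong_raw[OF module_C module_C])
     apply (use g in simp)
    apply (subst ev)
      apply (use h in \<open>auto simp: pc ktensor_sum_pure[OF module_C module_C G F]
        intro!: ktensor_sum_cong_raw[OF module_C module_C]\<close>)
    done
qed

lemma sw_one_split:
  assumes G: "module K G" and F: "tri K H H H G F"
  shows "sw G \<one>\<^bsub>H\<^esub> (\<lambda>x y. sw G x (\<lambda>u v. F u v y)) =
      sw G \<one>\<^bsub>H\<^esub> (\<lambda>x y. sw G \<one>\<^bsub>H\<^esub> (\<lambda>u v. F x (y \<bullet> u) v))"
    and "sw G \<one>\<^bsub>H\<^esub> (\<lambda>x y. sw G x (\<lambda>u v. F u v y)) =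
      sw G \<one>\<^bsub>H\<^esub> (\<lambda>x y. sw G \<one>\<^bsub>H\<^esub> (\<lambda>u v. F x (u \<bullet> y) v))"
proof -
  let ?T = "ktensor K (ktensor K H H) H"
  have mT: "module K ?T" by (intro module_ktensor) simp_all
  note pc = ktensor_pure_closed[OF module_ktensor[OF module_C module_C] module_C]
    ktensor_pure_closed[OF module_C module_C]
  note ev = lin_ktensor_sum[OF module_C module_C mT G tri_lin[OF module_C module_C module_C G F]]
  note ep = tri_eval_pure[OF module_C module_C module_C G F]
    tri_eval_inner[OF module_C module_C module_C G F]
  let ?ev = "\<lambda>Y. tensor_sum G Y (\<lambda>t z. tensor_sum G t (\<lambda>u v. F u v z))"
  have 1: "sw G \<one>\<^bsub>H\<^esub> (\<lambda>x y. sw G x (\<lambda>u v. F u v y)) =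
      ?ev (tensor_sum ?T (\<Delta> \<one>\<^bsub>H\<^esub>) (\<lambda>x y. pure_tensor ?T (\<Delta> x) y))"
    unfolding sw_def
    by (subst ev) (auto simp: pc ep intro!: ktensor_sum_cong_raw[OF module_C module_C])
  \<comment> \<open>The product of the two middle legs is a parameter \<open>m\<close>, so that one
    evaluation serves both axioms on \<Delta> 1.\<close>
  have 2: "?ev (tensor_sum ?T (\<Delta> \<one>\<^bsub>H\<^esub>) (\<lambda>x y. tensor_sum ?T (\<Delta> \<one>\<^bsub>H\<^esub>)
        (\<lambda>u v. pure_tensor ?T (pure_tensor (ktensor K H H) x (m y u)) v))) =
      sw G \<one>\<^bsub>H\<^esub> (\<lambda>x y. sw G \<one>\<^bsub>H\<^esub> (\<lambda>u v. F x (m y u) v))"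
    if m: "\<And>x y. x \<in> carrier H \<Longrightarrow> y \<in> carrier H \<Longrightarrow> m x y \<in> carrier H" for m
    unfolding sw_def
    apply (subst ev)
      apply (auto simp: pc m intro!: ktensor_sum_closed[OF module_C module_C mT])[2]
    apply (rule ktensor_sum_cong_raw[OF module_C module_C])
     apply simp
    apply (subst ev)
      apply (auto simp: pc ep m intro!: ktensor_sum_cong_raw[OF module_C module_C])
    done
  show "sw G \<one>\<^bsub>H\<^esub> (\<lambda>x y. sw G x (\<lambda>u v. F u v y)) =
      sw G \<one>\<^bsub>H\<^esub> (\<lambda>x y. sw G \<one>\<^bsub>H\<^esub> (\<lambda>u v. F x (y \<bullet> u) v))"
    unfolding 1 comult_one by (rule 2) simp
  show "sw G \<one>\<^bsub>H\<^esub> (\<lambda>x y. sw G x (\<lambda>u v. F u v y)) =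
      sw G \<one>\<^bsub>H\<^esub> (\<lambda>x y. sw G \<one>\<^bsub>H\<^esub> (\<lambda>u v. F x (u \<bullet> y) v))"
    unfolding 1 comult_one' by (rule 2[of "\<lambda>y u. u \<bullet> y"]) simp
qed

lemma sw_counit_mult:
  assumes "g \<in> carrier H" "h \<in> carrier H" "l \<in> carrier H"
  shows "sw KK h (\<lambda>x y. \<epsilon> (g \<bullet> x) \<otimes>\<^bsub>K\<^esub> \<epsilon> (y \<bullet> l)) = \<epsilon> (g \<bullet> h \<bullet> l)"
    and "sw KK h (\<lambda>x y. \<epsilon> (g \<bullet> y) \<otimes>\<^bsub>K\<^esub> \<epsilon> (x \<bullet> l)) = \<epsilon> (g \<bullet> h \<bullet> l)"
  using counit_mult[OF assms] counit_mult'[OF assms] by (simp_all add: sw_def tensor_sum_regular)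

section \<open>Counital maps and their images\<close>

abbreviation "PL \<equiv> PiL H \<Delta> \<epsilon>"
abbreviation "PR \<equiv> PiR H \<Delta> \<epsilon>"

text \<open>The map \<open>\<Pi>\<^sup>L\<close> of the opposite algebra.\<close>

definition PB where "PB h = sw H \<one>\<^bsub>H\<^esub> (\<lambda>x y. \<epsilon> (h \<bullet> x) \<odot>\<^bsub>H\<^esub> y)"

lemma PiL_sw: "PL h = sw H \<one>\<^bsub>H\<^esub> (\<lambda>x y. \<epsilon> (x \<bullet> h) \<odot>\<^bsub>H\<^esub> y)"
  and PiR_sw: "PR h = sw H \<one>\<^bsub>H\<^esub> (\<lambda>x y. \<epsilon> (h \<bullet> y) \<odot>\<^bsub>H\<^esub> x)"
  by (simp_all add: PiL_def PiR_def sw_def)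

lemmas lsimps = bil_def tri_def lin_rules module_smult_closed

lemma lin_PL: "lin K H H PL" and lin_PR: "lin K H H PR" and lin_PB: "lin K H H PB"
  unfolding PiL_sw[abs_def] PiR_sw[abs_def] PB_def[abs_def] by (simp_all add: lsimps)

lemmas lin_P = lin_compose[OF lin_PL] lin_compose[OF lin_PR] lin_compose[OF lin_PB]

lemma P_closed [simp]: "h \<in> carrier H \<Longrightarrow> PL h \<in> carrier H" "h \<in> carrier H \<Longrightarrow> PR h \<in> carrier H"
  "h \<in> carrier H \<Longrightarrow> PB h \<in> carrier H"
  by (auto intro: lin_closed[OF lin_PL] lin_closed[OF lin_PR] lin_closed[OF lin_PB])

text \<open>\<open>h_1 \<otimes> PL h_2 = 1_1 h \<otimes> 1_2\<close>. The trick is to write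
  \<open>h\<close> as \<open>1 h\<close> before expanding: the new copy of \<Delta> 1 and the one
  inside \<open>PL\<close> fuse by \<open>sw_one_split\<close>, their first two legs become a
  coproduct that merges with that of \<open>h\<close>, and the counit removes a leg.\<close>

lemma sw_PL_right:
  assumes G [simp]: "module K G" and h [simp]: "h \<in> carrier H" and F: "bil K H H G F"
  shows "sw G h (\<lambda>x y. F x (PL y)) = sw G \<one>\<^bsub>H\<^esub> (\<lambda>u v. F (u \<bullet> h) v)"
proof -
  note [simp] = bil_closed[OF F] and FF = bil_lin_fun[OF F]
  note push = sw_push[OF bil_lin(1)[OF F]] lin_smult[OF bil_lin(1)[OF F]]
  have "sw G h (\<lambda>x y. F x (PL y)) = sw G h (\<lambda>x y. sw G \<one>\<^bsub>H\<^esub> (\<lambda>u v. \<epsilon> (u \<bullet> y) \<odot>\<^bsub>G\<^esub> F x v))"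
    by (simp add: PiL_sw push module_smult_closed cong: sw_cong)
  also have "\<dots> = sw G (\<one>\<^bsub>H\<^esub> \<bullet> h) (\<lambda>x y. sw G \<one>\<^bsub>H\<^esub> (\<lambda>u v. \<epsilon> (u \<bullet> y) \<odot>\<^bsub>G\<^esub> F x v))"
    by simp
  also have "\<dots> = sw G \<one>\<^bsub>H\<^esub> (\<lambda>p q. sw G h (\<lambda>x y. sw G \<one>\<^bsub>H\<^esub> (\<lambda>u v. \<epsilon> (u \<bullet> (q \<bullet> y)) \<odot>\<^bsub>G\<^esub> F (p \<bullet> x) v)))"
    by (rule sw_mult) (simp_all add: lsimps FF)
  also have "\<dots> = sw G h (\<lambda>x y. sw G \<one>\<^bsub>H\<^esub> (\<lambda>p q. sw G \<one>\<^bsub>H\<^esub> (\<lambda>u v. \<epsilon> ((u \<bullet> q) \<bullet> y) \<odot>\<^bsub>G\<^esub> F (p \<bullet> x) v)))"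
    by (subst sw_swap) (simp_all add: module_smult_closed H_assoc cong: sw_cong)
  also have "\<dots> = sw G h (\<lambda>x y. sw G \<one>\<^bsub>H\<^esub> (\<lambda>p q. sw G p (\<lambda>u v. \<epsilon> (v \<bullet> y) \<odot>\<^bsub>G\<^esub> F (u \<bullet> x) q)))"
    by (intro sw_cong refl h sw_one_split(2)[symmetric]) (simp_all add: lsimps FF)
  also have "\<dots> = sw G \<one>\<^bsub>H\<^esub> (\<lambda>p q. sw G p (\<lambda>u v. sw G h (\<lambda>x y. \<epsilon> (v \<bullet> y) \<odot>\<^bsub>G\<^esub> F (u \<bullet> x) q)))"
    by (subst sw_swap, simp_all add: module_smult_closed, intro sw_cong refl H_one_closed sw_swap)
      (simp_all add: module_smult_closed)
  also have "\<dots> = sw G \<one>\<^bsub>H\<^esub> (\<lambda>p q. sw G (p \<bullet> h) (\<lambda>x y. \<epsilon> y \<odot>\<^bsub>G\<^esub> F x q))"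
    by (intro sw_cong refl H_one_closed sw_mult[symmetric]) (simp_all add: lsimps FF)
  also have "\<dots> = sw G \<one>\<^bsub>H\<^esub> (\<lambda>p q. F (p \<bullet> h) q)"
    by (intro sw_cong refl H_one_closed sw_counit_right) (simp_all add: lsimps FF)
  finally show ?thesis .
qed

text \<open>The mirror image of \<open>sw_PL_right\<close>, with the unit inserted on the right. One
  use of coassociativity is added, since \<open>sw_one_split\<close> splits the first leg while here
  the second one must be split.\<close>

lemma sw_PR_left:
  assumes G [simp]: "module K G" and h [simp]: "h \<in> carrier H" and F: "bil K H H G F"
  shows "sw G h (\<lambda>x y. F (PR x) y) = sw G \<one>\<^bsub>H\<^esub> (\<lambda>u v. F u (h \<bullet> v))"
proof -
  note [simp] = bil_closed[OF F] and FF = bil_lin_fun[OF F]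
  note push = sw_push[OF bil_lin(2)[OF F]] lin_smult[OF bil_lin(2)[OF F]]
  have "sw G h (\<lambda>x y. F (PR x) y) = sw G h (\<lambda>x y. sw G \<one>\<^bsub>H\<^esub> (\<lambda>u v. \<epsilon> (x \<bullet> v) \<odot>\<^bsub>G\<^esub> F u y))"
    by (simp add: PiR_sw push module_smult_closed cong: sw_cong)
  also have "\<dots> = sw G (h \<bullet> \<one>\<^bsub>H\<^esub>) (\<lambda>x y. sw G \<one>\<^bsub>H\<^esub> (\<lambda>u v. \<epsilon> (x \<bullet> v) \<odot>\<^bsub>G\<^esub> F u y))"
    by simp
  also have "\<dots> = sw G h (\<lambda>x y. sw G \<one>\<^bsub>H\<^esub> (\<lambda>p q. sw G \<one>\<^bsub>H\<^esub> (\<lambda>u v. \<epsilon> ((x \<bullet> p) \<bullet> v) \<odot>\<^bsub>G\<^esub> F u (y \<bullet> q))))"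
    by (rule sw_mult) (simp_all add: lsimps FF)
  also have "\<dots> = sw G h (\<lambda>x y. sw G \<one>\<^bsub>H\<^esub> (\<lambda>u v. sw G \<one>\<^bsub>H\<^esub> (\<lambda>p q. \<epsilon> (x \<bullet> (p \<bullet> v)) \<odot>\<^bsub>G\<^esub> F u (y \<bullet> q))))"
    by (rule sw_cong[OF refl h], subst sw_swap) (simp_all add: module_smult_closed H_assoc cong: sw_cong)
  also have "\<dots> = sw G h (\<lambda>x y. sw G \<one>\<^bsub>H\<^esub> (\<lambda>p q. sw G p (\<lambda>u v. \<epsilon> (x \<bullet> v) \<odot>\<^bsub>G\<^esub> F u (y \<bullet> q))))"
    by (intro sw_cong refl h sw_one_split(2)[symmetric]) (simp_all add: lsimps FF)
  also have "\<dots> = sw G h (\<lambda>x y. sw G \<one>\<^bsub>H\<^esub> (\<lambda>p q. sw G q (\<lambda>u v. \<epsilon> (x \<bullet> u) \<odot>\<^bsub>G\<^esub> F p (y \<bullet> v))))"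
    by (intro sw_cong refl h sw_coassoc) (simp_all add: lsimps FF)
  also have "\<dots> = sw G \<one>\<^bsub>H\<^esub> (\<lambda>p q. sw G h (\<lambda>x y. sw G q (\<lambda>u v. \<epsilon> (x \<bullet> u) \<odot>\<^bsub>G\<^esub> F p (y \<bullet> v))))"
    by (rule sw_swap) (simp_all add: module_smult_closed)
  also have "\<dots> = sw G \<one>\<^bsub>H\<^esub> (\<lambda>p q. sw G (h \<bullet> q) (\<lambda>x y. \<epsilon> x \<odot>\<^bsub>G\<^esub> F p y))"
    by (intro sw_cong refl H_one_closed sw_mult[symmetric]) (simp_all add: lsimps FF)
  also have "\<dots> = sw G \<one>\<^bsub>H\<^esub> (\<lambda>p q. F p (h \<bullet> q))"
    by (intro sw_cong refl H_one_closed sw_counit_left) (simp_all add: lsimps FF)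
  finally show ?thesis .
qed

lemma sw_PB_right:
  assumes G [simp]: "module K G" and h [simp]: "h \<in> carrier H" and F: "bil K H H G F"
  shows "sw G h (\<lambda>x y. F x (PB y)) = sw G \<one>\<^bsub>H\<^esub> (\<lambda>u v. F (h \<bullet> u) v)"
proof -
  note [simp] = bil_closed[OF F] and FF = bil_lin_fun[OF F]
  note push = sw_push[OF bil_lin(1)[OF F]] lin_smult[OF bil_lin(1)[OF F]]
  have "sw G h (\<lambda>x y. F x (PB y)) = sw G h (\<lambda>x y. sw G \<one>\<^bsub>H\<^esub> (\<lambda>u v. \<epsilon> (y \<bullet> u) \<odot>\<^bsub>G\<^esub> F x v))"
    by (simp add: PB_def push module_smult_closed cong: sw_cong)
  also have "\<dots> = sw G (h \<bullet> \<one>\<^bsub>H\<^esub>) (\<lambda>x y. sw G \<one>\<^bsub>H\<^esub> (\<lambda>u v. \<epsilon> (y \<bullet> u) \<odot>\<^bsub>G\<^esub> F x v))"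
    by simp
  also have "\<dots> = sw G h (\<lambda>x y. sw G \<one>\<^bsub>H\<^esub> (\<lambda>p q. sw G \<one>\<^bsub>H\<^esub> (\<lambda>u v. \<epsilon> ((y \<bullet> q) \<bullet> u) \<odot>\<^bsub>G\<^esub> F (x \<bullet> p) v)))"
    by (rule sw_mult) (simp_all add: lsimps FF)
  also have "\<dots> = sw G h (\<lambda>x y. sw G \<one>\<^bsub>H\<^esub> (\<lambda>p q. sw G \<one>\<^bsub>H\<^esub> (\<lambda>u v. \<epsilon> (y \<bullet> (q \<bullet> u)) \<odot>\<^bsub>G\<^esub> F (x \<bullet> p) v)))"
    by (simp add: H_assoc cong: sw_cong)
  also have "\<dots> = sw G h (\<lambda>x y. sw G \<one>\<^bsub>H\<^esub> (\<lambda>p q. sw G p (\<lambda>u v. \<epsilon> (y \<bullet> v) \<odot>\<^bsub>G\<^esub> F (x \<bullet> u) q)))"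
    by (intro sw_cong refl h sw_one_split(1)[symmetric]) (simp_all add: lsimps FF)
  also have "\<dots> = sw G \<one>\<^bsub>H\<^esub> (\<lambda>p q. sw G h (\<lambda>x y. sw G p (\<lambda>u v. \<epsilon> (y \<bullet> v) \<odot>\<^bsub>G\<^esub> F (x \<bullet> u) q)))"
    by (rule sw_swap) (simp_all add: module_smult_closed)
  also have "\<dots> = sw G \<one>\<^bsub>H\<^esub> (\<lambda>p q. sw G (h \<bullet> p) (\<lambda>x y. \<epsilon> y \<odot>\<^bsub>G\<^esub> F x q))"
    by (intro sw_cong refl H_one_closed sw_mult[symmetric]) (simp_all add: lsimps FF)
  also have "\<dots> = sw G \<one>\<^bsub>H\<^esub> (\<lambda>p q. F (h \<bullet> p) q)"
    by (intro sw_cong refl H_one_closed sw_counit_right) (simp_all add: lsimps FF)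
  finally show ?thesis .
qed

text \<open>The case \<open>h = 1\<close> of the two preceding formulas: the legs of \<Delta> 1 lie
  in the images of \<open>PR\<close> and \<open>PL\<close>. Replacing them by their images is how
  the antipode, so far known only on these images, is brought to act on \<Delta> 1.\<close>

lemma sw_one_P:
  assumes G [simp]: "module K G" and F: "bil K H H G F"
  shows "sw G \<one>\<^bsub>H\<^esub> (\<lambda>x y. F x (PL y)) = sw G \<one>\<^bsub>H\<^esub> F" "sw G \<one>\<^bsub>H\<^esub> (\<lambda>x y. F (PR x) y) = sw G \<one>\<^bsub>H\<^esub> F"
  by (simp_all add: sw_PL_right[OF G _ F] sw_PR_left[OF G _ F] cong: sw_cong)

lemma sw_of_PL_aux:
  assumes G [simp]: "module K G" and h [simp]: "h \<in> carrier H" and F: "bil K H H G F"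
  shows "sw G (PL h) F = sw G \<one>\<^bsub>H\<^esub> (\<lambda>x y. sw G x (\<lambda>u v. \<epsilon> (u \<bullet> h) \<odot>\<^bsub>G\<^esub> F v y))"
proof -
  note [simp] = bil_closed[OF F] and FF = bil_lin_fun[OF F]
  have L: "lin K H G (\<lambda>y. sw G y F)" by (simp add: lsimps FF bil_lin[OF F])
  have "sw G (PL h) F = sw G \<one>\<^bsub>H\<^esub> (\<lambda>x y. \<epsilon> (x \<bullet> h) \<odot>\<^bsub>G\<^esub> sw G y F)"
    by (simp add: PiL_sw sw_push[OF L] lin_smult[OF L] module_smult_closed cong: sw_cong)
  also have "\<dots> = sw G \<one>\<^bsub>H\<^esub> (\<lambda>x y. sw G y (\<lambda>u v. \<epsilon> (x \<bullet> h) \<odot>\<^bsub>G\<^esub> F u v))"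
    by (intro sw_cong refl H_one_closed sw_push) (simp_all add: lsimps)
  also have "\<dots> = sw G \<one>\<^bsub>H\<^esub> (\<lambda>x y. sw G x (\<lambda>u v. \<epsilon> (u \<bullet> h) \<odot>\<^bsub>G\<^esub> F v y))"
    by (rule sw_coassoc[symmetric]) (simp_all add: lsimps FF)
  finally show ?thesis .
qed

text \<open>For \<open>z\<close> in the image of \<open>PL\<close> the coproduct is
  \<open>z 1_1 \<otimes> 1_2 = 1_1 z \<otimes> 1_2\<close>; the two orders come from the two axioms
  on \<Delta> 1.\<close>

lemma sw_of_PL:
  assumes G [simp]: "module K G" and h [simp]: "h \<in> carrier H" and F: "bil K H H G F"
  shows "sw G (PL h) F = sw G \<one>\<^bsub>H\<^esub> (\<lambda>u v. F (PL h \<bullet> u) v)"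
    and "sw G (PL h) F = sw G \<one>\<^bsub>H\<^esub> (\<lambda>u v. F (u \<bullet> PL h) v)"
proof -
  note [simp] = bil_closed[OF F] and FF = bil_lin_fun[OF F]
  have L: "lin K H G (\<lambda>y. F (y \<bullet> u) v)" "lin K H G (\<lambda>y. F (u \<bullet> y) v)" if "u \<in> carrier H" "v \<in> carrier H" for u v
    using that by (simp_all add: lsimps FF)
  have "sw G (PL h) F = sw G \<one>\<^bsub>H\<^esub> (\<lambda>x y. sw G \<one>\<^bsub>H\<^esub> (\<lambda>u v. \<epsilon> (x \<bullet> h) \<odot>\<^bsub>G\<^esub> F (y \<bullet> u) v))"
    unfolding sw_of_PL_aux[OF assms] by (rule sw_one_split) (simp_all add: lsimps FF)
  also have "\<dots> = sw G \<one>\<^bsub>H\<^esub> (\<lambda>u v. sw G \<one>\<^bsub>H\<^esub> (\<lambda>x y. \<epsilon> (x \<bullet> h) \<odot>\<^bsub>G\<^esub> F (y \<bullet> u) v))"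
    by (rule sw_swap) (simp_all add: lsimps)
  also have "\<dots> = sw G \<one>\<^bsub>H\<^esub> (\<lambda>u v. F (PL h \<bullet> u) v)"
    by (simp add: PiL_sw sw_push[OF L(1)] lin_smult[OF L(1)] module_smult_closed cong: sw_cong)
  finally show "sw G (PL h) F = sw G \<one>\<^bsub>H\<^esub> (\<lambda>u v. F (PL h \<bullet> u) v)" .
  have "sw G (PL h) F = sw G \<one>\<^bsub>H\<^esub> (\<lambda>x y. sw G \<one>\<^bsub>H\<^esub> (\<lambda>u v. \<epsilon> (x \<bullet> h) \<odot>\<^bsub>G\<^esub> F (u \<bullet> y) v))"
    unfolding sw_of_PL_aux[OF assms] by (rule sw_one_split) (simp_all add: lsimps FF)
  also have "\<dots> = sw G \<one>\<^bsub>H\<^esub> (\<lambda>u v. sw G \<one>\<^bsub>H\<^esub> (\<lambda>x y. \<epsilon> (x \<bullet> h) \<odot>\<^bsub>G\<^esub> F (u \<bullet> y) v))"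
    by (rule sw_swap) (simp_all add: lsimps)
  also have "\<dots> = sw G \<one>\<^bsub>H\<^esub> (\<lambda>u v. F (u \<bullet> PL h) v)"
    by (simp add: PiL_sw sw_push[OF L(2)] lin_smult[OF L(2)] module_smult_closed cong: sw_cong)
  finally show "sw G (PL h) F = sw G \<one>\<^bsub>H\<^esub> (\<lambda>u v. F (u \<bullet> PL h) v)" .
qed

lemma sw_of_PR_aux:
  assumes G [simp]: "module K G" and h [simp]: "h \<in> carrier H" and F: "bil K H H G F"
  shows "sw G (PR h) F = sw G \<one>\<^bsub>H\<^esub> (\<lambda>x y. sw G x (\<lambda>u v. \<epsilon> (h \<bullet> y) \<odot>\<^bsub>G\<^esub> F u v))"
proof -
  note [simp] = bil_closed[OF F] and FF = bil_lin_fun[OF F]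
  have L: "lin K H G (\<lambda>y. sw G y F)" by (simp add: lsimps FF bil_lin[OF F])
  have "sw G (PR h) F = sw G \<one>\<^bsub>H\<^esub> (\<lambda>x y. \<epsilon> (h \<bullet> y) \<odot>\<^bsub>G\<^esub> sw G x F)"
    by (simp add: PiR_sw sw_push[OF L] lin_smult[OF L] module_smult_closed cong: sw_cong)
  also have "\<dots> = sw G \<one>\<^bsub>H\<^esub> (\<lambda>x y. sw G x (\<lambda>u v. \<epsilon> (h \<bullet> y) \<odot>\<^bsub>G\<^esub> F u v))"
    by (intro sw_cong refl H_one_closed sw_push) (simp_all add: lsimps)
  finally show ?thesis .
qed

lemma sw_of_PR:
  assumes G [simp]: "module K G" and h [simp]: "h \<in> carrier H" and F: "bil K H H G F"
  shows "sw G (PR h) F = sw G \<one>\<^bsub>H\<^esub> (\<lambda>u v. F u (v \<bullet> PR h))"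
    and "sw G (PR h) F = sw G \<one>\<^bsub>H\<^esub> (\<lambda>u v. F u (PR h \<bullet> v))"
proof -
  note [simp] = bil_closed[OF F] and FF = bil_lin_fun[OF F]
  have L: "lin K H G (\<lambda>y. F u (y \<bullet> v))" "lin K H G (\<lambda>y. F u (v \<bullet> y))" if "u \<in> carrier H" "v \<in> carrier H" for u v
    using that by (simp_all add: lsimps FF)
  have "sw G (PR h) F = sw G \<one>\<^bsub>H\<^esub> (\<lambda>x y. sw G \<one>\<^bsub>H\<^esub> (\<lambda>u v. \<epsilon> (h \<bullet> v) \<odot>\<^bsub>G\<^esub> F x (y \<bullet> u)))"
    unfolding sw_of_PR_aux[OF assms] by (rule sw_one_split) (simp_all add: lsimps FF)
  also have "\<dots> = sw G \<one>\<^bsub>H\<^esub> (\<lambda>u v. F u (v \<bullet> PR h))"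
    by (simp add: PiR_sw sw_push[OF L(2)] lin_smult[OF L(2)] module_smult_closed cong: sw_cong)
  finally show "sw G (PR h) F = sw G \<one>\<^bsub>H\<^esub> (\<lambda>u v. F u (v \<bullet> PR h))" .
  have "sw G (PR h) F = sw G \<one>\<^bsub>H\<^esub> (\<lambda>x y. sw G \<one>\<^bsub>H\<^esub> (\<lambda>u v. \<epsilon> (h \<bullet> v) \<odot>\<^bsub>G\<^esub> F x (u \<bullet> y)))"
    unfolding sw_of_PR_aux[OF assms] by (rule sw_one_split) (simp_all add: lsimps FF)
  also have "\<dots> = sw G \<one>\<^bsub>H\<^esub> (\<lambda>u v. F u (PR h \<bullet> v))"
    by (simp add: PiR_sw sw_push[OF L(1)] lin_smult[OF L(1)] module_smult_closed cong: sw_cong)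
  finally show "sw G (PR h) F = sw G \<one>\<^bsub>H\<^esub> (\<lambda>u v. F u (PR h \<bullet> v))" .
qed

lemma sw_mult_PL:
  assumes G [simp]: "module K G" and g [simp]: "g \<in> carrier H" and h [simp]: "h \<in> carrier H" and F: "bil K H H G F"
  shows "sw G (g \<bullet> PL h) F = sw G g (\<lambda>x y. F (x \<bullet> PL h) y)"
    and "sw G (PL h \<bullet> g) F = sw G g (\<lambda>x y. F (PL h \<bullet> x) y)"
proof -
  note [simp] = bil_closed[OF F] and FF = bil_lin_fun[OF F] bil_lin[OF F]
  have "sw G (g \<bullet> PL h) F = sw G g (\<lambda>x y. sw G (PL h) (\<lambda>u v. F (x \<bullet> u) (y \<bullet> v)))"
    by (rule sw_mult) (simp_all add: F)
  also have "\<dots> = sw G g (\<lambda>x y. sw G \<one>\<^bsub>H\<^esub> (\<lambda>u v. F ((x \<bullet> u) \<bullet> PL h) (y \<bullet> v)))"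
    by (rule sw_cong[OF refl g], subst sw_of_PL(2)) (simp_all add: lsimps FF H_assoc cong: sw_cong)
  also have "\<dots> = sw G (g \<bullet> \<one>\<^bsub>H\<^esub>) (\<lambda>x y. F (x \<bullet> PL h) y)"
    by (rule sw_mult[symmetric]) (simp_all add: lsimps FF)
  finally show "sw G (g \<bullet> PL h) F = sw G g (\<lambda>x y. F (x \<bullet> PL h) y)" by simp
  have "sw G (PL h \<bullet> g) F = sw G (PL h) (\<lambda>u v. sw G g (\<lambda>x y. F (u \<bullet> x) (v \<bullet> y)))"
    by (rule sw_mult) (simp_all add: F)
  also have "\<dots> = sw G \<one>\<^bsub>H\<^esub> (\<lambda>u v. sw G g (\<lambda>x y. F (PL h \<bullet> (u \<bullet> x)) (v \<bullet> y)))"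
    by (subst sw_of_PL(1)) (simp_all add: lsimps FF H_assoc cong: sw_cong)
  also have "\<dots> = sw G (\<one>\<^bsub>H\<^esub> \<bullet> g) (\<lambda>x y. F (PL h \<bullet> x) y)"
    by (rule sw_mult[symmetric]) (simp_all add: lsimps FF)
  finally show "sw G (PL h \<bullet> g) F = sw G g (\<lambda>x y. F (PL h \<bullet> x) y)" by simp
qed

lemma sw_mult_PR:
  assumes G [simp]: "module K G" and g [simp]: "g \<in> carrier H" and h [simp]: "h \<in> carrier H" and F: "bil K H H G F"
  shows "sw G (g \<bullet> PR h) F = sw G g (\<lambda>x y. F x (y \<bullet> PR h))"
    and "sw G (PR h \<bullet> g) F = sw G g (\<lambda>x y. F x (PR h \<bullet> y))"
proof -
  note [simp] = bil_closed[OF F] and FF = bil_lin_fun[OF F] bil_lin[OF F]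
  have "sw G (g \<bullet> PR h) F = sw G g (\<lambda>x y. sw G (PR h) (\<lambda>u v. F (x \<bullet> u) (y \<bullet> v)))"
    by (rule sw_mult) (simp_all add: F)
  also have "\<dots> = sw G g (\<lambda>x y. sw G \<one>\<^bsub>H\<^esub> (\<lambda>u v. F (x \<bullet> u) ((y \<bullet> v) \<bullet> PR h)))"
    by (rule sw_cong[OF refl g], subst sw_of_PR(1)) (simp_all add: lsimps FF H_assoc cong: sw_cong)
  also have "\<dots> = sw G (g \<bullet> \<one>\<^bsub>H\<^esub>) (\<lambda>x y. F x (y \<bullet> PR h))"
    by (rule sw_mult[symmetric]) (simp_all add: lsimps FF)
  finally show "sw G (g \<bullet> PR h) F = sw G g (\<lambda>x y. F x (y \<bullet> PR h))" by simp
  have "sw G (PR h \<bullet> g) F = sw G (PR h) (\<lambda>u v. sw G g (\<lambda>x y. F (u \<bullet> x) (v \<bullet> y)))"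
    by (rule sw_mult) (simp_all add: F)
  also have "\<dots> = sw G \<one>\<^bsub>H\<^esub> (\<lambda>u v. sw G g (\<lambda>x y. F (u \<bullet> x) (PR h \<bullet> (v \<bullet> y))))"
    by (subst sw_of_PR(2)) (simp_all add: lsimps FF H_assoc cong: sw_cong)
  also have "\<dots> = sw G (\<one>\<^bsub>H\<^esub> \<bullet> g) (\<lambda>x y. F x (PR h \<bullet> y))"
    by (rule sw_mult[symmetric]) (simp_all add: lsimps FF)
  finally show "sw G (PR h \<bullet> g) F = sw G g (\<lambda>x y. F x (PR h \<bullet> y))" by simp
qed

lemma K_comm: "a \<in> carrier K \<Longrightarrow> b \<in> carrier K \<Longrightarrow> a \<otimes>\<^bsub>K\<^esub> b = b \<otimes>\<^bsub>K\<^esub> a"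
  using cring_K by (simp add: cring.cring_simprules)

lemma counit_lin_mult: "a \<in> carrier H \<Longrightarrow> lin K H KK (\<lambda>x. \<epsilon> (a \<bullet> x))"
  "a \<in> carrier H \<Longrightarrow> lin K H KK (\<lambda>x. \<epsilon> (x \<bullet> a))"
  by (simp_all add: lsimps)

lemma lin_scalar: "module K G \<Longrightarrow> v \<in> carrier G \<Longrightarrow> lin K KK G (\<lambda>c. c \<odot>\<^bsub>G\<^esub> v)"
  by (simp add: lsimps)

text \<open>The second counit axiom with the unit in the middle.\<close>

lemma counit_PL: "g \<in> carrier H \<Longrightarrow> h \<in> carrier H \<Longrightarrow> \<epsilon> (g \<bullet> PL h) = \<epsilon> (g \<bullet> h)"
  unfolding PiL_sw
  using sw_counit_mult(2)[of g "\<one>\<^bsub>H\<^esub>" h]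
  by (simp add: sw_push[OF counit_lin_mult(1)] lin_smult[OF counit_lin_mult(1)] module_smult_closed
      K_comm cong: sw_cong)

lemma counit_PR: "g \<in> carrier H \<Longrightarrow> h \<in> carrier H \<Longrightarrow> \<epsilon> (PR g \<bullet> h) = \<epsilon> (g \<bullet> h)"
  unfolding PiR_sw
  using sw_counit_mult(2)[of g "\<one>\<^bsub>H\<^esub>" h]
  by (simp add: sw_push[OF counit_lin_mult(2)] lin_smult[OF counit_lin_mult(2)] module_smult_closed
      cong: sw_cong)

lemma PL_mult_PL: "g \<in> carrier H \<Longrightarrow> h \<in> carrier H \<Longrightarrow> PL (g \<bullet> PL h) = PL (g \<bullet> h)"
  by (simp add: PiL_sw[of "g \<bullet> _"] counit_PL H_assoc[symmetric] cong: sw_cong)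

lemma PR_PR_mult: "g \<in> carrier H \<Longrightarrow> h \<in> carrier H \<Longrightarrow> PR (PR g \<bullet> h) = PR (g \<bullet> h)"
  by (simp add: PiR_sw[of "_ \<bullet> h"] counit_PR H_assoc cong: sw_cong)

lemma PL_PL: "h \<in> carrier H \<Longrightarrow> PL (PL h) = PL h"
  using PL_mult_PL[of "\<one>\<^bsub>H\<^esub>" h] by simp

lemma P_one: "PL \<one>\<^bsub>H\<^esub> = \<one>\<^bsub>H\<^esub>" "PR \<one>\<^bsub>H\<^esub> = \<one>\<^bsub>H\<^esub>"
  using sw_counit_left[OF module_C lin_id, of "\<one>\<^bsub>H\<^esub>"] sw_counit_right[OF module_C lin_id, of "\<one>\<^bsub>H\<^esub>"]
  by (simp_all add: PiL_sw PiR_sw cong: sw_cong)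

text \<open>Apply the counit to the first leg of \<open>sw_of_PL\<close>. Thus
  \<open>PL z = z\<close> implies \<open>PB z = z\<close>, the form in which coinvariance is tested
  later.\<close>

lemma PB_PL: "h \<in> carrier H \<Longrightarrow> PB (PL h) = PL h"
  using sw_of_PL(1)[OF module_C, of h "\<lambda>x y. \<epsilon> x \<odot>\<^bsub>H\<^esub> y"] sw_counit_left[OF module_C lin_id, of "PL h"]
  by (simp add: PB_def lsimps)

text \<open>Pair the outer legs of the iterated coproduct of 1 with
  \<open>\<epsilon> (_ \<bullet> g)\<close> and \<open>\<epsilon> (h \<bullet> _)\<close>: the two
  expressions for it leave the two products in the middle leg.\<close>

lemma PL_PR_comm: "g \<in> carrier H \<Longrightarrow> h \<in> carrier H \<Longrightarrow> PL g \<bullet> PR h = PR h \<bullet> PL g"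
proof -
  assume g [simp]: "g \<in> carrier H" and h [simp]: "h \<in> carrier H"
  let ?F = "\<lambda>x r v. \<epsilon> (x \<bullet> g) \<odot>\<^bsub>H\<^esub> (\<epsilon> (h \<bullet> v) \<odot>\<^bsub>H\<^esub> r)"
  have L: "lin K H H (\<lambda>x. x \<bullet> a)" "lin K H H (\<lambda>x. a \<bullet> x)" if "a \<in> carrier H" for a
    using that by (simp_all add: lsimps)
  have F: "tri K H H H H ?F" by (simp add: lsimps)
  have comm: "\<epsilon> (h \<bullet> v) \<odot>\<^bsub>H\<^esub> (\<epsilon> (x \<bullet> g) \<odot>\<^bsub>H\<^esub> r) = ?F x r v"
    if "x \<in> carrier H" "r \<in> carrier H" "v \<in> carrier H" for x r v
    using that by (simp add: K_comm flip: smult_assoc1)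
  have "PL g \<bullet> PR h = sw H \<one>\<^bsub>H\<^esub> (\<lambda>u v. sw H \<one>\<^bsub>H\<^esub> (\<lambda>x y. ?F x (y \<bullet> u) v))"
    by (simp add: comm PiL_sw PiR_sw sw_push[OF L(1)] sw_push[OF L(2)] lin_smult[OF L(1)] lin_smult[OF L(2)]
        sw_push[OF lin_smult_fun[OF lin_id]] module_smult_closed cong: sw_cong)
  also have "\<dots> = sw H \<one>\<^bsub>H\<^esub> (\<lambda>x y. sw H \<one>\<^bsub>H\<^esub> (\<lambda>u v. ?F x (y \<bullet> u) v))"
    by (rule sw_swap) (simp_all add: module_smult_closed)
  also have "\<dots> = sw H \<one>\<^bsub>H\<^esub> (\<lambda>x y. sw H \<one>\<^bsub>H\<^esub> (\<lambda>u v. ?F x (u \<bullet> y) v))"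
    using sw_one_split[OF module_C F] by simp
  also have "\<dots> = PR h \<bullet> PL g"
    by (simp add: PiL_sw PiR_sw sw_push[OF L(1)] sw_push[OF L(2)] lin_smult[OF L(1)] lin_smult[OF L(2)]
        sw_push[OF lin_smult_fun[OF lin_id]] module_smult_closed cong: sw_cong)
  finally show ?thesis .
qed

lemma sw_hmul: 
  assumes "h \<in> carrier H" "\<And>x y. x \<in> carrier H \<Longrightarrow> y \<in> carrier H \<Longrightarrow> F x y \<in> carrier H" "a \<in> carrier H"
  shows "a \<bullet> sw H h F = sw H h (\<lambda>x y. a \<bullet> F x y)" "sw H h F \<bullet> a = sw H h (\<lambda>x y. F x y \<bullet> a)"
proof -
  have "lin K H H (\<lambda>x. a \<bullet> x)" "lin K H H (\<lambda>x. x \<bullet> a)" using assms(3) by (simp_all add: lsimps)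
  then show "a \<bullet> sw H h F = sw H h (\<lambda>x y. a \<bullet> F x y)" "sw H h F \<bullet> a = sw H h (\<lambda>x y. F x y \<bullet> a)"
    using sw_push[of H H _ h F] assms by auto
qed

text \<open>Expand \<open>h = 1 h\<close> and apply the counit to the first leg;
  \<open>sw_mult_PR'\<close> does the same with \<open>h = h 1\<close>.\<close>

lemma sw_PL_mult: "h \<in> carrier H \<Longrightarrow> sw H h (\<lambda>x y. PL x \<bullet> y) = h"
proof -
  assume h [simp]: "h \<in> carrier H"
  have "h = sw H (\<one>\<^bsub>H\<^esub> \<bullet> h) (\<lambda>x y. \<epsilon> x \<odot>\<^bsub>H\<^esub> y)"
    using sw_counit_left[OF module_C lin_id h] by simp
  also have "\<dots> = sw H \<one>\<^bsub>H\<^esub> (\<lambda>u v. sw H h (\<lambda>x y. \<epsilon> (u \<bullet> x) \<odot>\<^bsub>H\<^esub> (v \<bullet> y)))"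
    by (rule sw_mult) (simp_all add: lsimps)
  also have "\<dots> = sw H h (\<lambda>x y. sw H \<one>\<^bsub>H\<^esub> (\<lambda>u v. \<epsilon> (u \<bullet> x) \<odot>\<^bsub>H\<^esub> (v \<bullet> y)))"
    by (rule sw_swap) simp_all
  also have "\<dots> = sw H h (\<lambda>x y. PL x \<bullet> y)"
    by (simp add: PiL_sw sw_hmul smult_mult_left cong: sw_cong)
  finally show ?thesis ..
qed

lemma sw_mult_PR': "h \<in> carrier H \<Longrightarrow> sw H h (\<lambda>x y. x \<bullet> PR y) = h"
proof -
  assume h [simp]: "h \<in> carrier H"
  have "h = sw H (h \<bullet> \<one>\<^bsub>H\<^esub>) (\<lambda>x y. \<epsilon> y \<odot>\<^bsub>H\<^esub> x)"
    using sw_counit_right[OF module_C lin_id h] by simp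
  also have "\<dots> = sw H h (\<lambda>x y. sw H \<one>\<^bsub>H\<^esub> (\<lambda>u v. \<epsilon> (y \<bullet> v) \<odot>\<^bsub>H\<^esub> (x \<bullet> u)))"
    by (rule sw_mult) (simp_all add: lsimps)
  also have "\<dots> = sw H h (\<lambda>x y. x \<bullet> PR y)"
    by (simp add: PiR_sw sw_hmul smult_mult_right cong: sw_cong)
  finally show ?thesis ..
qed

end

section \<open>The antipode\<close>

context weak_hopf_algebra
begin

lemma lin_S: "lin K H H S"
  using antipode_linear by (simp add: lin_def)

lemma S_closed [simp]: "h \<in> carrier H \<Longrightarrow> S h \<in> carrier H"
  by (rule lin_closed[OF lin_S])

lemmas lin_S_fun = lin_compose[OF lin_S]
lemmas S_sw = sw_push[OF lin_S module_C module_C]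
lemmas S_smult = lin_smult[OF lin_S]

lemma sw_mult_S: "h \<in> carrier H \<Longrightarrow> sw H h (\<lambda>x y. x \<bullet> S y) = PL h"
  and sw_S_mult: "h \<in> carrier H \<Longrightarrow> sw H h (\<lambda>x y. S x \<bullet> y) = PR h"
  using antipode_left antipode_right by (simp_all add: sw_def)

lemmas hsimps = lsimps lin_S_fun lin_P

lemma S_PL: "h \<in> carrier H \<Longrightarrow> sw H h (\<lambda>x y. S x \<bullet> PL y) = S h"
proof -
  assume h [simp]: "h \<in> carrier H"
  have "S h = sw H h (\<lambda>x z. sw H z (\<lambda>u v. S x \<bullet> u \<bullet> S v))"
    using antipode_both[OF h] by (simp add: sw_def)
  also have "\<dots> = sw H h (\<lambda>x y. S x \<bullet> PL y)"
    by (simp add: sw_mult_S[symmetric] sw_hmul H_assoc cong: sw_cong)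
  finally show ?thesis ..
qed

lemma PR_S: "h \<in> carrier H \<Longrightarrow> sw H h (\<lambda>x y. PR x \<bullet> S y) = S h"
proof -
  assume h [simp]: "h \<in> carrier H"
  have "S h = sw H h (\<lambda>x z. sw H z (\<lambda>u v. S x \<bullet> u \<bullet> S v))"
    using antipode_both[OF h] by (simp add: sw_def)
  also have "\<dots> = sw H h (\<lambda>z v. sw H z (\<lambda>x u. S x \<bullet> u \<bullet> S v))"
    by (rule sw_coassoc[symmetric]) (simp_all add: hsimps)
  also have "\<dots> = sw H h (\<lambda>x y. PR x \<bullet> S y)"
    by (simp add: sw_S_mult[symmetric] sw_hmul cong: sw_cong)
  finally show ?thesis ..
qed

text \<open>\<open>PL (g h)\<close> depends on \<open>h\<close> only through \<open>PL h\<close>,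
  and the coproduct of \<open>g PL h\<close> carries the second factor in its first leg
  only.\<close>

lemma PL_mult_expand:
  assumes g [simp]: "g \<in> carrier H" and h [simp]: "h \<in> carrier H"
  shows "PL (g \<bullet> h) = sw H g (\<lambda>p q. p \<bullet> PL h \<bullet> S q)"
  unfolding PL_mult_PL[OF g h, symmetric] sw_mult_S[OF H_mult_closed[OF g P_closed(1)[OF h]], symmetric]
  by (rule sw_mult_PL) (simp_all add: hsimps)

lemma PR_mult_expand:
  assumes g [simp]: "g \<in> carrier H" and h [simp]: "h \<in> carrier H"
  shows "PR (g \<bullet> h) = sw H h (\<lambda>p q. S p \<bullet> (PR g \<bullet> q))"
  unfolding PR_PR_mult[OF g h, symmetric] sw_S_mult[OF H_mult_closed[OF P_closed(2)[OF g] h], symmetric]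
  by (rule sw_mult_PR) (simp_all add: hsimps)

text \<open>The uniqueness argument for convolution inverses, with \<open>PL\<close> and
  \<open>PR\<close> in place of units. \<open>S (gh)\<close> becomes
  \<open>S (g_1 h_1) g_2 h_2 S(h_3) S(g_3)\<close>; the first four factors collapse to
  \<open>PR (g_1 h_1)\<close>, whose expansion contains \<open>PR\<close> of a leg of
  \<open>g\<close>. Since this commutes with the \<open>PL\<close> made from legs of
  \<open>h\<close>, the factors separate into \<open>S h\<close> and \<open>S g\<close>.\<close>

lemma S_mult:
  assumes g [simp]: "g \<in> carrier H" and h [simp]: "h \<in> carrier H"
  shows "S (g \<bullet> h) = S h \<bullet> S g"
proof -
  have "S (g \<bullet> h) = sw H (g \<bullet> h) (\<lambda>x y. S x \<bullet> PL y)" by (simp add: S_PL)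
  also have "\<dots> = sw H g (\<lambda>g1 g2. sw H h (\<lambda>h1 h2. S (g1 \<bullet> h1) \<bullet> PL (g2 \<bullet> h2)))"
    by (rule sw_mult) (simp_all add: hsimps)
  also have "\<dots> = sw H g (\<lambda>g1 g2. sw H h (\<lambda>h1 h2. sw H g2 (\<lambda>p q. S (g1 \<bullet> h1) \<bullet> (p \<bullet> (PL h2 \<bullet> S q)))))"
    by (simp add: PL_mult_expand sw_hmul H_assoc cong: sw_cong)
  also have "\<dots> = sw H g (\<lambda>g1 g2. sw H h (\<lambda>h1 h2. sw H g2 (\<lambda>p q. sw H h2 (\<lambda>u v.
      S (g1 \<bullet> h1) \<bullet> (p \<bullet> (u \<bullet> (S v \<bullet> S q)))))))"
    by (simp add: sw_mult_S[symmetric] sw_hmul H_assoc cong: sw_cong)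
  also have "\<dots> = sw H g (\<lambda>g1 g2. sw H g2 (\<lambda>p q. sw H h (\<lambda>h1 h2. sw H h2 (\<lambda>u v.
      S (g1 \<bullet> h1) \<bullet> (p \<bullet> (u \<bullet> (S v \<bullet> S q)))))))"
    by (intro sw_cong refl g sw_swap) simp_all
  also have "\<dots> = sw H g (\<lambda>g1 g2. sw H g2 (\<lambda>p q. sw H h (\<lambda>x v. sw H x (\<lambda>h1 u.
      S (g1 \<bullet> h1) \<bullet> (p \<bullet> (u \<bullet> (S v \<bullet> S q)))))))"
    by (intro sw_cong refl g sw_coassoc[symmetric]) (simp_all add: hsimps)
  also have "\<dots> = sw H g (\<lambda>y q. sw H y (\<lambda>g1 p. sw H h (\<lambda>x v. sw H x (\<lambda>h1 u.
      S (g1 \<bullet> h1) \<bullet> (p \<bullet> (u \<bullet> (S v \<bullet> S q)))))))"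
    by (rule sw_coassoc[symmetric]) (simp_all add: hsimps)
  also have "\<dots> = sw H g (\<lambda>y q. sw H h (\<lambda>x v. sw H y (\<lambda>g1 p. sw H x (\<lambda>h1 u.
      S (g1 \<bullet> h1) \<bullet> (p \<bullet> (u \<bullet> (S v \<bullet> S q)))))))"
    by (intro sw_cong refl g sw_swap) simp_all
  also have "\<dots> = sw H g (\<lambda>y q. sw H h (\<lambda>x v. sw H (y \<bullet> x) (\<lambda>a b. S a \<bullet> (b \<bullet> (S v \<bullet> S q)))))"
    by (rule sw_cong[OF refl g], rule sw_cong[OF refl h], subst sw_mult) (simp_all add: hsimps H_assoc cong: sw_cong)
  also have "\<dots> = sw H g (\<lambda>y q. sw H h (\<lambda>x v. PR (y \<bullet> x) \<bullet> (S v \<bullet> S q)))"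
    by (simp add: sw_S_mult[symmetric] sw_hmul H_assoc cong: sw_cong)
  also have "\<dots> = sw H g (\<lambda>y q. sw H h (\<lambda>x v. sw H x (\<lambda>p w. S p \<bullet> (PR y \<bullet> (w \<bullet> (S v \<bullet> S q))))))"
    by (simp add: PR_mult_expand sw_hmul H_assoc cong: sw_cong)
  also have "\<dots> = sw H g (\<lambda>y q. sw H h (\<lambda>p x. sw H x (\<lambda>w v. S p \<bullet> (PR y \<bullet> (w \<bullet> (S v \<bullet> S q))))))"
    by (intro sw_cong refl g sw_coassoc) (simp_all add: hsimps)
  also have "\<dots> = sw H g (\<lambda>y q. sw H h (\<lambda>p x. S p \<bullet> (PR y \<bullet> PL x \<bullet> S q)))"
    by (simp add: sw_mult_S[symmetric] sw_hmul H_assoc cong: sw_cong)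
  also have "\<dots> = sw H g (\<lambda>y q. sw H h (\<lambda>p x. S p \<bullet> PL x \<bullet> (PR y \<bullet> S q)))"
    by (simp add: PL_PR_comm[symmetric] H_assoc cong: sw_cong)
  also have "\<dots> = sw H g (\<lambda>y q. S h \<bullet> (PR y \<bullet> S q))"
    by (simp add: S_PL[of h, symmetric] sw_hmul cong: sw_cong)
  also have "\<dots> = S h \<bullet> S g"
    by (simp add: PR_S[of g, symmetric] sw_hmul cong: sw_cong)
  finally show ?thesis .
qed

text \<open>For \<open>z = PL h\<close> the coproduct \<open>1_1 z \<otimes> 1_2\<close> turns
  \<open>S z_1 z_2\<close> into \<open>S z\<close> times \<open>S 1_1 1_2\<close>, which is
  \<open>PR 1 = 1\<close>. The other half is symmetric.\<close>

lemma S_P: "h \<in> carrier H \<Longrightarrow> S (PL h) = PR (PL h)" "h \<in> carrier H \<Longrightarrow> S (PR h) = PL (PR h)"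
proof -
  assume h [simp]: "h \<in> carrier H"
  have "PR (PL h) = sw H (PL h) (\<lambda>x y. S x \<bullet> y)" by (simp add: sw_S_mult)
  also have "\<dots> = sw H \<one>\<^bsub>H\<^esub> (\<lambda>u v. S (u \<bullet> PL h) \<bullet> v)"
    by (rule sw_of_PL(2)) (simp_all add: hsimps)
  also have "\<dots> = S (PL h) \<bullet> PR \<one>\<^bsub>H\<^esub>"
    by (simp add: S_mult sw_S_mult[symmetric] sw_hmul H_assoc cong: sw_cong)
  finally show "S (PL h) = PR (PL h)" by (simp add: P_one)
  have "PL (PR h) = sw H (PR h) (\<lambda>x y. x \<bullet> S y)" by (simp add: sw_mult_S)
  also have "\<dots> = sw H \<one>\<^bsub>H\<^esub> (\<lambda>u v. u \<bullet> S (PR h \<bullet> v))"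
    by (rule sw_of_PR(2)) (simp_all add: hsimps)
  also have "\<dots> = PL \<one>\<^bsub>H\<^esub> \<bullet> S (PR h)"
    by (simp add: S_mult sw_mult_S[symmetric] sw_hmul H_assoc cong: sw_cong)
  finally show "S (PR h) = PL (PR h)" by (simp add: P_one)
qed

text \<open>On the images of \<open>PL\<close> and \<open>PR\<close>, where the legs of \<Delta> 1
  lie, the antipode is given by \<open>S_P\<close>. It remains to see that
  \<open>PR 1_2 \<otimes> PL 1_1\<close> is \<Delta> 1, a statement about counits alone.\<close>

lemma sw_one_S:
  assumes G [simp]: "module K G" and F: "bil K H H G F"
  shows "sw G \<one>\<^bsub>H\<^esub> (\<lambda>x y. F (S y) (S x)) = sw G \<one>\<^bsub>H\<^esub> F"
proof -
  note [simp] = bil_closed[OF F] and FF = bil_lin_fun[OF F] bil_lin[OF F]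
  have "sw G \<one>\<^bsub>H\<^esub> (\<lambda>x y. F (S y) (S x)) = sw G \<one>\<^bsub>H\<^esub> (\<lambda>x y. F (S (PL y)) (S x))"
    by (rule sw_one_P(1)[symmetric]) (simp_all add: hsimps FF)
  also have "\<dots> = sw G \<one>\<^bsub>H\<^esub> (\<lambda>x y. F (S (PL y)) (S (PR x)))"
    by (rule sw_one_P(2)[symmetric]) (simp_all add: hsimps FF)
  also have "\<dots> = sw G \<one>\<^bsub>H\<^esub> (\<lambda>x y. F (PR (PL y)) (PL (PR x)))"
    by (simp add: S_P cong: sw_cong)
  also have "\<dots> = sw G \<one>\<^bsub>H\<^esub> (\<lambda>x y. F (PR (PL y)) (PL x))"
    by (rule sw_one_P(2)) (simp_all add: hsimps FF)
  also have "\<dots> = sw G \<one>\<^bsub>H\<^esub> (\<lambda>x y. F (PR y) (PL x))"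
    by (rule sw_one_P(1)) (simp_all add: hsimps FF)
  also have "\<dots> = sw G \<one>\<^bsub>H\<^esub> (\<lambda>x y. sw G \<one>\<^bsub>H\<^esub> (\<lambda>p q. \<epsilon> (y \<bullet> q) \<odot>\<^bsub>G\<^esub> F p (PL x)))"
    by (simp add: PiR_sw sw_push[OF bil_lin(2)[OF F]] lin_smult[OF bil_lin(2)[OF F]] module_smult_closed cong: sw_cong)
  also have "\<dots> = sw G \<one>\<^bsub>H\<^esub> (\<lambda>p q. sw G \<one>\<^bsub>H\<^esub> (\<lambda>x y. \<epsilon> (y \<bullet> q) \<odot>\<^bsub>G\<^esub> F p (PL x)))"
    by (rule sw_swap) (simp_all add: module_smult_closed)
  also have "\<dots> = sw G \<one>\<^bsub>H\<^esub> (\<lambda>p q. F p (PL q))"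
  proof (rule sw_cong[OF refl H_one_closed])
    fix p q assume [simp]: "p \<in> carrier H" "q \<in> carrier H"
    have L: "lin K H G (\<lambda>x. F p (PL x))" by (simp add: hsimps FF)
    have "F p (PL q) = F p (sw H \<one>\<^bsub>H\<^esub> (\<lambda>r s. \<epsilon> (r \<bullet> q) \<odot>\<^bsub>H\<^esub> s))"
      by (simp add: PiL_sw)
    also have "\<dots> = sw G \<one>\<^bsub>H\<^esub> (\<lambda>r s. \<epsilon> (r \<bullet> q) \<odot>\<^bsub>G\<^esub> F p s)"
      by (simp add: sw_push[OF bil_lin(1)[OF F]] lin_smult[OF bil_lin(1)[OF F]] module_smult_closed cong: sw_cong)
    \<comment> \<open>The counit axiom splits \<open>\<epsilon> (r q)\<close> at an inserted unit;
      summing over \<open>r\<close> and \<open>s\<close> first then recovers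
      \<open>PL x\<close>.\<close>
    also have "\<dots> = sw G \<one>\<^bsub>H\<^esub> (\<lambda>r s. sw KK \<one>\<^bsub>H\<^esub> (\<lambda>x y. \<epsilon> (r \<bullet> x) \<otimes>\<^bsub>K\<^esub> \<epsilon> (y \<bullet> q)) \<odot>\<^bsub>G\<^esub> F p s)"
      by (simp add: sw_counit_mult cong: sw_cong)
    also have "\<dots> = sw G \<one>\<^bsub>H\<^esub> (\<lambda>r s. sw G \<one>\<^bsub>H\<^esub> (\<lambda>x y. \<epsilon> (y \<bullet> q) \<odot>\<^bsub>G\<^esub> (\<epsilon> (r \<bullet> x) \<odot>\<^bsub>G\<^esub> F p s)))"
      by (simp add: sw_push[OF lin_scalar] K_comm module.smult_assoc1[OF G, symmetric] cong: sw_cong)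
    also have "\<dots> = sw G \<one>\<^bsub>H\<^esub> (\<lambda>x y. sw G \<one>\<^bsub>H\<^esub> (\<lambda>r s. \<epsilon> (y \<bullet> q) \<odot>\<^bsub>G\<^esub> (\<epsilon> (r \<bullet> x) \<odot>\<^bsub>G\<^esub> F p s)))"
      by (rule sw_swap) (simp_all add: module_smult_closed)
    also have "\<dots> = sw G \<one>\<^bsub>H\<^esub> (\<lambda>x y. \<epsilon> (y \<bullet> q) \<odot>\<^bsub>G\<^esub> F p (PL x))"
      by (simp add: PiL_sw sw_push[OF bil_lin(1)[OF F]] lin_smult[OF bil_lin(1)[OF F]]
          sw_push[OF lin_smult_fun[OF lin_id]] module_smult_closed cong: sw_cong)
    finally show "sw G \<one>\<^bsub>H\<^esub> (\<lambda>x y. \<epsilon> (y \<bullet> q) \<odot>\<^bsub>G\<^esub> F p (PL x)) = F p (PL q)" ..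
  qed
  also have "\<dots> = sw G \<one>\<^bsub>H\<^esub> F"
    by (rule sw_one_P(1)[OF G F])
  finally show ?thesis .
qed

text \<open>The second leg of \<Delta> 1 lies in the image of \<open>PL\<close>, where
  \<open>S\<close> agrees with \<open>PR\<close>; afterwards the two counits fuse. In particular the
  image of \<open>PR\<close> lies in the range of \<open>S\<close>.\<close>

lemma S_PB: "h \<in> carrier H \<Longrightarrow> S (PB h) = PR h"
proof -
  assume h [simp]: "h \<in> carrier H"
  have "S (PB h) = sw H \<one>\<^bsub>H\<^esub> (\<lambda>x y. \<epsilon> (h \<bullet> x) \<odot>\<^bsub>H\<^esub> S y)"
    by (simp add: PB_def S_sw S_smult cong: sw_cong)
  also have "\<dots> = sw H \<one>\<^bsub>H\<^esub> (\<lambda>x y. \<epsilon> (h \<bullet> x) \<odot>\<^bsub>H\<^esub> S (PL y))"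
    by (rule sw_one_P(1)[symmetric]) (simp_all add: hsimps)
  also have "\<dots> = sw H \<one>\<^bsub>H\<^esub> (\<lambda>x y. \<epsilon> (h \<bullet> x) \<odot>\<^bsub>H\<^esub> PR (PL y))"
    by (simp add: S_P cong: sw_cong)
  also have "\<dots> = sw H \<one>\<^bsub>H\<^esub> (\<lambda>x y. \<epsilon> (h \<bullet> x) \<odot>\<^bsub>H\<^esub> PR y)"
    by (rule sw_one_P(1)) (simp_all add: hsimps)
  also have "\<dots> = sw H \<one>\<^bsub>H\<^esub> (\<lambda>x y. sw H \<one>\<^bsub>H\<^esub> (\<lambda>p q. (\<epsilon> (h \<bullet> x) \<otimes>\<^bsub>K\<^esub> \<epsilon> (y \<bullet> q)) \<odot>\<^bsub>H\<^esub> p))"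
    by (simp add: PiR_sw sw_push[OF lin_smult_fun[OF lin_id]] smult_assoc1 cong: sw_cong)
  also have "\<dots> = sw H \<one>\<^bsub>H\<^esub> (\<lambda>p q. sw H \<one>\<^bsub>H\<^esub> (\<lambda>x y. (\<epsilon> (h \<bullet> x) \<otimes>\<^bsub>K\<^esub> \<epsilon> (y \<bullet> q)) \<odot>\<^bsub>H\<^esub> p))"
    by (rule sw_swap) simp_all
  also have "\<dots> = PR h"
    using sw_counit_mult(1)[of h "\<one>\<^bsub>H\<^esub>"]
    by (simp add: PiR_sw sw_push[OF lin_scalar, symmetric] cong: sw_cong)
  finally show ?thesis .
qed

text \<open>The preimage is read off from \<open>sw_one_S\<close>: reversing \<Delta> 1 exhibits its
  second leg as a value of \<open>S\<close>.\<close>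

lemma PL_in_range: "h \<in> carrier H \<Longrightarrow> PL h = S (sw H \<one>\<^bsub>H\<^esub> (\<lambda>x y. \<epsilon> (S y \<bullet> h) \<odot>\<^bsub>H\<^esub> x))"
  using sw_one_S[OF module_C, of "\<lambda>x y. \<epsilon> (x \<bullet> h) \<odot>\<^bsub>H\<^esub> y"]
  by (simp add: S_sw S_smult PiL_sw hsimps cong: sw_cong)

text \<open>The coproduct of \<open>h_1 S h_2\<close> as it would be if \<open>S\<close> reversed
  coproducts, obtained without that property: \<open>h_2 S h_3\<close> collapses to a
  \<open>PL\<close>, and \<open>sw_PL_right\<close> reduces the rest to the coproduct on the image
  of \<open>PL\<close>. It feeds the proof of \<open>sw_S\<close>.\<close>

lemma sw_PL_S:
  assumes G [simp]: "module K G" and h [simp]: "h \<in> carrier H" and F: "bil K H H G F"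
  shows "sw G (PL h) F = sw G h (\<lambda>a b. sw G a (\<lambda>p q. sw G b (\<lambda>r s. F (p \<bullet> S s) (q \<bullet> S r))))"
proof -
  note [simp] = bil_closed[OF F] and FF = bil_lin_fun[OF F] bil_lin[OF F]
  have "sw G h (\<lambda>a b. sw G a (\<lambda>p q. sw G b (\<lambda>r s. F (p \<bullet> S s) (q \<bullet> S r)))) =
      sw G h (\<lambda>p z. sw G z (\<lambda>q b. sw G b (\<lambda>r s. F (p \<bullet> S s) (q \<bullet> S r))))"
    by (rule sw_coassoc) (simp_all add: hsimps FF)
  also have "\<dots> = sw G h (\<lambda>p z. sw G z (\<lambda>w s. sw G w (\<lambda>q r. F (p \<bullet> S s) (q \<bullet> S r))))"
    by (intro sw_cong refl h sw_coassoc[symmetric]) (simp_all add: hsimps FF)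
  also have "\<dots> = sw G h (\<lambda>p z. sw G z (\<lambda>w s. F (p \<bullet> S s) (PL w)))"
    by (simp add: sw_mult_S[symmetric] sw_push[OF bil_lin(1)[OF F]] cong: sw_cong)
  also have "\<dots> = sw G h (\<lambda>x s. sw G x (\<lambda>p w. F (p \<bullet> S s) (PL w)))"
    by (rule sw_coassoc[symmetric]) (simp_all add: hsimps FF)
  also have "\<dots> = sw G h (\<lambda>x s. sw G \<one>\<^bsub>H\<^esub> (\<lambda>u v. F ((u \<bullet> x) \<bullet> S s) v))"
    by (intro sw_cong refl h sw_PL_right) (simp_all add: hsimps FF)
  also have "\<dots> = sw G \<one>\<^bsub>H\<^esub> (\<lambda>u v. sw G h (\<lambda>x s. F ((u \<bullet> x) \<bullet> S s) v))"
    by (rule sw_swap) simp_all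
  also have "\<dots> = sw G \<one>\<^bsub>H\<^esub> (\<lambda>u v. F (u \<bullet> PL h) v)"
    by (simp add: sw_mult_S[symmetric] sw_hmul sw_push[OF bil_lin(2)[OF F]] H_assoc cong: sw_cong)
  also have "\<dots> = sw G (PL h) F"
    by (rule sw_of_PL(2)[OF G h F, symmetric])
  finally show ?thesis ..
qed

text \<open>Again uniqueness of convolution inverses, now with values in the tensor square. In
  \<Delta> of \<open>S h_1 PL h_2\<close> the second factor is expanded by \<open>sw_PL_S\<close>;
  the coproducts of \<open>S h_1\<close> and \<open>h_2\<close> then multiply to that of
  \<open>PR\<close>, which \<open>sw_of_PR\<close> removes at the cost of one copy of \<Delta>
  1.\<close>

lemma sw_S:
  assumes G [simp]: "module K G" and h [simp]: "h \<in> carrier H" and F: "bil K H H G F"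
  shows "sw G (S h) F = sw G h (\<lambda>x y. F (S y) (S x))"
proof -
  note [simp] = bil_closed[OF F] and FF = bil_lin_fun[OF F] bil_lin[OF F]
  have L: "lin K H G (\<lambda>y. sw G y F)" by (simp add: hsimps FF)
  have "sw G (S h) F = sw G h (\<lambda>x y. sw G (S x \<bullet> PL y) F)"
    by (subst S_PL[OF h, symmetric], subst sw_push[OF L]) simp_all
  also have "\<dots> = sw G h (\<lambda>x y. sw G (S x) (\<lambda>u v. sw G (PL y) (\<lambda>p q. F (u \<bullet> p) (v \<bullet> q))))"
    by (intro sw_cong refl h sw_mult F) simp_all
  also have "\<dots> = sw G h (\<lambda>x y. sw G (S x) (\<lambda>u v. sw G y (\<lambda>a b. sw G a (\<lambda>p q. sw G b (\<lambda>r s.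
      F (u \<bullet> (p \<bullet> S s)) (v \<bullet> (q \<bullet> S r)))))))"
    by (rule sw_cong[OF refl h], rule sw_cong[OF refl], simp, rule sw_PL_S) (simp_all add: hsimps FF)
  also have "\<dots> = sw G h (\<lambda>x y. sw G y (\<lambda>a b. sw G (S x) (\<lambda>u v. sw G a (\<lambda>p q. sw G b (\<lambda>r s.
      F ((u \<bullet> p) \<bullet> S s) ((v \<bullet> q) \<bullet> S r))))))"
    by (rule sw_cong[OF refl h], subst sw_swap) (simp_all add: H_assoc cong: sw_cong)
  also have "\<dots> = sw G h (\<lambda>z b. sw G z (\<lambda>x a. sw G (S x) (\<lambda>u v. sw G a (\<lambda>p q. sw G b (\<lambda>r s.
      F ((u \<bullet> p) \<bullet> S s) ((v \<bullet> q) \<bullet> S r))))))"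
    by (rule sw_coassoc[symmetric]) (simp_all add: hsimps FF)
  also have "\<dots> = sw G h (\<lambda>z b. sw G z (\<lambda>x a. sw G (S x \<bullet> a) (\<lambda>m n. sw G b (\<lambda>r s.
      F (m \<bullet> S s) (n \<bullet> S r)))))"
    by (rule sw_cong[OF refl h], rule sw_cong[OF refl], simp, rule sw_mult[symmetric]) (simp_all add: hsimps FF)
  also have "\<dots> = sw G h (\<lambda>z b. sw G (PR z) (\<lambda>m n. sw G b (\<lambda>r s. F (m \<bullet> S s) (n \<bullet> S r))))"
  proof (rule sw_cong[OF refl h])
    fix z b assume [simp]: "z \<in> carrier H" "b \<in> carrier H"
    have L: "lin K H G (\<lambda>y. sw G y (\<lambda>m n. sw G b (\<lambda>r s. F (m \<bullet> S s) (n \<bullet> S r))))"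
      by (simp add: hsimps FF)
    show "sw G z (\<lambda>x a. sw G (S x \<bullet> a) (\<lambda>m n. sw G b (\<lambda>r s. F (m \<bullet> S s) (n \<bullet> S r)))) =
      sw G (PR z) (\<lambda>m n. sw G b (\<lambda>r s. F (m \<bullet> S s) (n \<bullet> S r)))"
      by (subst sw_S_mult[symmetric], simp, subst sw_push[OF L]) simp_all
  qed
  also have "\<dots> = sw G h (\<lambda>z b. sw G \<one>\<^bsub>H\<^esub> (\<lambda>m n. sw G b (\<lambda>r s. F (m \<bullet> S s) (n \<bullet> (PR z \<bullet> S r)))))"
    by (rule sw_cong[OF refl h], subst sw_of_PR(1)) (simp_all add: hsimps FF H_assoc cong: sw_cong)
  also have "\<dots> = sw G \<one>\<^bsub>H\<^esub> (\<lambda>m n. sw G h (\<lambda>z b. sw G b (\<lambda>r s. F (m \<bullet> S s) (n \<bullet> (PR z \<bullet> S r)))))"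
    by (rule sw_swap) simp_all
  also have "\<dots> = sw G \<one>\<^bsub>H\<^esub> (\<lambda>m n. sw G h (\<lambda>w s. sw G w (\<lambda>z r. F (m \<bullet> S s) (n \<bullet> (PR z \<bullet> S r)))))"
    by (intro sw_cong refl H_one_closed sw_coassoc[symmetric]) (simp_all add: hsimps FF)
  also have "\<dots> = sw G \<one>\<^bsub>H\<^esub> (\<lambda>m n. sw G h (\<lambda>w s. F (m \<bullet> S s) (n \<bullet> S w)))"
  proof (rule sw_cong[OF refl H_one_closed], rule sw_cong[OF refl h])
    fix m n w s assume [simp]: "m \<in> carrier H" "n \<in> carrier H" "w \<in> carrier H" "s \<in> carrier H"
    have L: "lin K H G (\<lambda>z. F (m \<bullet> S s) (n \<bullet> z))" by (simp add: hsimps FF)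
    show "sw G w (\<lambda>z r. F (m \<bullet> S s) (n \<bullet> (PR z \<bullet> S r))) = F (m \<bullet> S s) (n \<bullet> S w)"
      using sw_push[OF L, of w "\<lambda>z r. PR z \<bullet> S r"] by (simp add: PR_S)
  qed
  also have "\<dots> = sw G h (\<lambda>w s. sw G \<one>\<^bsub>H\<^esub> (\<lambda>m n. F (m \<bullet> S s) (n \<bullet> S w)))"
    by (rule sw_swap) simp_all
  \<comment> \<open>The remaining copy of \<Delta> 1 is turned round by \<open>sw_one_S\<close>, so
    that it can be absorbed into the coproduct of \<open>h 1\<close>.\<close>
  also have "\<dots> = sw G h (\<lambda>w s. sw G \<one>\<^bsub>H\<^esub> (\<lambda>m n. F (S n \<bullet> S s) (S m \<bullet> S w)))"
    by (rule sw_cong[OF refl h], rule sw_one_S[symmetric]) (simp_all add: hsimps FF)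
  also have "\<dots> = sw G (h \<bullet> \<one>\<^bsub>H\<^esub>) (\<lambda>x y. F (S y) (S x))"
    by (subst sw_mult) (simp_all add: hsimps FF S_mult cong: sw_cong)
  finally show ?thesis by simp
qed

text \<open>\<open>S\<close> is an epimorphism even before it is known to be onto: the range of \<open>S\<close> contains those of \<open>\<Pi>\<^sup>L\<close> and \<open>\<Pi>\<^sup>R\<close>,
  hence \<open>f h = f (h\<^bsub>(1)\<^esub> S h\<^bsub>(2)\<^esub> h\<^bsub>(3)\<^esub>) = g h\<^bsub>(1)\<^esub> f (S h\<^bsub>(2)\<^esub> h\<^bsub>(3)\<^esub>) = g h\<close>.\<close>

lemma S_epi:
  assumes m: "bil K H H H m"
    and assoc: "\<And>x y z. x \<in> carrier H \<Longrightarrow> y \<in> carrier H \<Longrightarrow> z \<in> carrier H \<Longrightarrow> m (m x y) z = m x (m y z)"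
    and f: "lin K H H f" "\<And>x y. x \<in> carrier H \<Longrightarrow> y \<in> carrier H \<Longrightarrow> f (x \<bullet> y) = m (f x) (f y)"
    and g: "lin K H H g" "\<And>x y. x \<in> carrier H \<Longrightarrow> y \<in> carrier H \<Longrightarrow> g (x \<bullet> y) = m (g x) (g y)"
    and S: "\<And>x. x \<in> carrier H \<Longrightarrow> f (S x) = g (S x)"
    and h [simp]: "h \<in> carrier H"
  shows "f h = g h"
proof -
  note [simp] = bil_closed[OF m] lin_closed[OF f(1)] lin_closed[OF g(1)]
  note mm = bil_lin_fun[OF m] lin_compose[OF f(1)] lin_compose[OF g(1)] f(1) g(1)
  have PL: "f (PL x) = g (PL x)" and PR: "f (PR x) = g (PR x)" if "x \<in> carrier H" for x
    using that S[of "PB x"] S[of "sw H \<one>\<^bsub>H\<^esub> (\<lambda>p y. \<epsilon> (S y \<bullet> x) \<odot>\<^bsub>H\<^esub> p)"]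
    by (simp_all add: S_PB flip: PL_in_range)
  have "f h = f (sw H h (\<lambda>x y. PL x \<bullet> y))" by (simp add: sw_PL_mult)
  also have "\<dots> = sw H h (\<lambda>x y. m (g (PL x)) (f y))"
    by (simp add: sw_push[OF f(1)] f(2) PL cong: sw_cong)
  also have "\<dots> = sw H h (\<lambda>x y. sw H x (\<lambda>a b. m (g a) (m (f (S b)) (f y))))"
    by (simp add: sw_mult_S[symmetric] sw_push[OF g(1)] sw_push[OF bil_lin(2)[OF m]] g(2) S assoc cong: sw_cong)
  also have "\<dots> = sw H h (\<lambda>a x. sw H x (\<lambda>b y. m (g a) (m (f (S b)) (f y))))"
    by (rule sw_coassoc) (simp_all add: hsimps mm)
  also have "\<dots> = sw H h (\<lambda>a x. m (g a) (f (PR x)))"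
    by (simp add: sw_S_mult[symmetric] sw_push[OF f(1)] sw_push[OF bil_lin(1)[OF m]] f(2) cong: sw_cong)
  also have "\<dots> = g (sw H h (\<lambda>x y. x \<bullet> PR y))"
    by (simp add: sw_push[OF g(1)] g(2) PR cong: sw_cong)
  also have "\<dots> = g h" by (simp add: sw_mult_PR')
  finally show ?thesis .
qed

text \<open>\<open>S_epi\<close> used twice. The maps \<open>f o S\<close> and \<open>g o S\<close>
  are multiplicative for the reversed product, which is the reason why \<open>S_epi\<close> allows
  an arbitrary product \<open>m\<close> on the target.\<close>

lemma S2_epi:
  assumes f: "lin K H H f" "\<And>x y. x \<in> carrier H \<Longrightarrow> y \<in> carrier H \<Longrightarrow> f (x \<bullet> y) = f x \<bullet> f y"
    and g: "lin K H H g" "\<And>x y. x \<in> carrier H \<Longrightarrow> y \<in> carrier H \<Longrightarrow> g (x \<bullet> y) = g x \<bullet> g y"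
    and S: "\<And>x. x \<in> carrier H \<Longrightarrow> f (S (S x)) = g (S (S x))"
    and h: "h \<in> carrier H"
  shows "f h = g h"
proof (rule S_epi[OF _ _ f g _ h])
  \<comment> \<open>The inner application compares \<open>f o S\<close> and \<open>g o S\<close>,
    which agree on the range of \<open>S\<close> by hypothesis.\<close>
  fix x assume x: "x \<in> carrier H"
  show "f (S x) = g (S x)"
    by (rule S_epi[of "\<lambda>x y. y \<bullet> x" "\<lambda>x. f (S x)" "\<lambda>x. g (S x)", OF _ _ _ _ _ _ S x])
      (simp_all add: hsimps H_assoc S_mult f g lin_compose[OF f(1)] lin_compose[OF g(1)])
qed (simp_all add: hsimps H_assoc)

end

section \<open>Bijectivity of the antipode\<close>

lemma linear_map_lin:
  assumes "vectorspace K V" "vectorspace K W" "lin K V W f"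
  shows "linear_map K V W f"
proof -
  interpret V: vectorspace K V by fact
  interpret W: vectorspace K W by fact
  show ?thesis by unfold_locales (use assms(3) in \<open>simp add: lin_def\<close>)
qed

text \<open>An injective map carries a basis to an independent set of \<open>dim\<close> many
  elements, which is a basis again.\<close>

lemma (in vectorspace) inj_endo_surj:
  assumes T: "lin K V V T" and inj: "inj_on T (carrier V)" and fd: fin_dim
  shows "T ` carrier V = carrier V"
proof -
  interpret L: linear_map K V V T
    by (rule linear_map_lin[OF vectorspace_axioms vectorspace_axioms T])
  obtain B where B: "finite B" "basis B" using finite_basis_exists[OF fd] by blast
  have BV: "B \<subseteq> carrier V" using B(2) by (simp add: basis_def)
  have TB: "T ` B \<subseteq> carrier V" using BV lin_closed[OF T] by auto
  have card: "card (T ` B) = card B" by (rule card_image) (rule inj_on_subset[OF inj BV])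
  have li: "lin_indpt (T ` B)"
  proof (rule finite_lin_indpt2)
    fix a assume a: "a \<in> T ` B \<rightarrow> carrier K" and z: "lincomb a (T ` B) = \<zero>\<^bsub>V\<^esub>"
    have "T (lincomb (a \<circ> T) B) = \<zero>\<^bsub>V\<^esub>"
      using L.lincomb_linear_image[OF inj BV a B(1)] z by simp
    moreover have aT: "a \<circ> T \<in> B \<rightarrow> carrier K" using a by (auto simp: Pi_iff)
    moreover have "lincomb (a \<circ> T) B \<in> carrier V" by (rule lincomb_closed[OF BV aT])
    ultimately have "lincomb (a \<circ> T) B = \<zero>\<^bsub>V\<^esub>"
      using inj_onD[OF inj, of _ "\<zero>\<^bsub>V\<^esub>"] L.f0_is_0 by simp
    then have "\<And>v. v \<in> B \<Longrightarrow> (a \<circ> T) v = \<zero>\<^bsub>K\<^esub>"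
      using not_lindepD[of B B "a \<circ> T"] B aT by (auto simp: basis_def Pi_iff)
    then show "\<forall>v\<in>T ` B. a v = \<zero>\<^bsub>K\<^esub>" by auto
  qed (use B(1) TB in auto)
  have "basis (T ` B)"
    by (rule dim_li_is_basis[OF fd _ TB li]) (use B dim_basis in \<open>auto simp: card\<close>)
  then have gen: "span (T ` B) = carrier V" by (simp add: basis_def)
  show ?thesis
  proof
    show "carrier V \<subseteq> T ` carrier V"
    proof
      fix v assume "v \<in> carrier V"
      then obtain a where a: "a \<in> T ` B \<rightarrow> carrier K" "lincomb a (T ` B) = v"
        unfolding gen[symmetric] finite_span[OF finite_imageI[OF B(1)] TB] by blast
      then have "v = T (lincomb (a \<circ> T) B)" using L.lincomb_linear_image[OF inj BV a(1) B(1)] by simp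
      moreover have "a \<circ> T \<in> B \<rightarrow> carrier K" using a by (auto simp: Pi_iff)
      then have "lincomb (a \<circ> T) B \<in> carrier V" by (rule lincomb_closed[OF BV])
      ultimately show "v \<in> T ` carrier V" by blast
    qed
  qed (use lin_closed[OF T] in auto)
qed

lemma (in vectorspace) dim_zero_trivial:
  assumes fin_dim "dim = 0"
  shows "carrier V = {\<zero>\<^bsub>V\<^esub>}"
proof -
  obtain B where B: "finite B" "basis B" using finite_basis_exists[OF assms(1)] by blast
  then have "B = {}" using dim_basis[OF B] assms(2) by simp
  then show ?thesis using B(2) span_empty by (simp add: basis_def)
qed

lemma lin_funpow: "lin K V V T \<Longrightarrow> lin K V V (T ^^ n)"
proof (induction n)
  case (Suc n)
  then show ?case using lin_compose[of K V V T V "T ^^ n"] by (simp add: comp_def)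
qed (simp add: lin_id[unfolded lin_def] lin_def id_def)

lemma lin_onto:
  assumes "vectorspace K V" "vectorspace K W" "lin K V W f" "f ` carrier V = carrier W"
    and "vectorspace.fin_dim K V"
  shows "vectorspace.fin_dim K W"
    and "vectorspace.dim K W + vectorspace.dim K (V\<lparr>carrier := {v \<in> carrier V. f v = \<zero>\<^bsub>W\<^esub>}\<rparr>) = vectorspace.dim K V"
    and "subspace K {v \<in> carrier V. f v = \<zero>\<^bsub>W\<^esub>} V"
proof -
  interpret linear_map K V W f by (rule linear_map_lin) fact+
  show "vectorspace.fin_dim K W" by (rule surj_fin_dim) fact+
  show "vectorspace.dim K W + vectorspace.dim K (V\<lparr>carrier := {v \<in> carrier V. f v = \<zero>\<^bsub>W\<^esub>}\<rparr>) = vectorspace.dim K V"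
    using rank_nullity[OF assms(5)] assms(4) by (simp add: im_def ker_def)
  show "subspace K {v \<in> carrier V. f v = \<zero>\<^bsub>W\<^esub>} V"
    using kerT_is_subspace by (simp add: ker_def)
qed

lemma (in vectorspace) subspace_image:
  assumes "lin K V V T"
  shows "subspace K (T ` carrier V) V"
proof -
  interpret linear_map K V V T by (rule linear_map_lin[OF vectorspace_axioms vectorspace_axioms assms])
  show ?thesis using imT_is_subspace by (simp add: im_def)
qed

lemma (in vectorspace) inj_of_same_dim:
  assumes W: "vectorspace K W" and f: "lin K V W f" "f ` carrier V = carrier W"
    and fd: fin_dim and d: "dim \<le> vectorspace.dim K W"
  shows "inj_on f (carrier V)"
proof -
  let ?k = "{v \<in> carrier V. f v = \<zero>\<^bsub>W\<^esub>}"
  interpret W: vectorspace K W by (rule W)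
  note r = lin_onto[OF vectorspace_axioms W f fd]
  interpret k: vectorspace K "vs ?k" by (rule subspace_is_vs[OF r(3)])
  have "vectorspace.dim K (vs ?k) = 0" using r(2) d by simp
  \<comment> \<open>Dimension 0 forces the kernel to be trivial only once it is known to be finite
    dimensional. Otherwise it would contain independent sets of every size, hence one with more than
    \<open>dim\<close> elements.\<close>
  moreover have "k.fin_dim"
  proof (rule ccontr)
    assume nf: "\<not> k.fin_dim"
    have ex: "\<exists>A. finite A \<and> A \<subseteq> ?k \<and> card A = n \<and> \<not> k.lin_dep A" for n
    proof (induction n)
      case 0
      have "\<not> k.lin_dep {}" unfolding k.lin_dep_def by blast
      then show ?case by (intro exI[of _ "{}"]) simp
    next
      case (Suc n)
      then obtain A where A: "finite A" "A \<subseteq> ?k" "card A = n" "\<not> k.lin_dep A" by blast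
      have A': "A \<subseteq> carrier (vs ?k)" using A(2) by simp
      have "k.span A \<noteq> carrier (vs ?k)" using nf A(1) A' unfolding k.fin_dim_def by blast
      then obtain v where v: "v \<in> carrier (vs ?k)" "v \<notin> k.span A"
        using k.span_is_subset2[OF A'] by blast
      have vA: "v \<notin> A" using k.in_own_span[OF A'] v(2) by blast
      have "\<not> k.lin_dep (A \<union> {v})"
        using k.lin_dep_iff_in_span[OF A' A(4) v(1) vA] v(2) by blast
      moreover have "A \<union> {v} \<subseteq> ?k" using A(2) v(1) by simp
      moreover have "card (A \<union> {v}) = Suc n" using A(1,3) vA by simp
      ultimately show ?case using A(1) by (intro exI[of _ "A \<union> {v}"]) simp
    qed
    obtain A where A: "A \<subseteq> ?k" "card A = Suc dim" "\<not> k.lin_dep A" using ex by blast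
    have sm: "submodule K ?k V" using r(3) by (rule subspace.submod)
    have "\<not> lin_dep A" using span_li_not_depend(2)[OF A(1) sm] A(3) by (rule subst)
    moreover have "A \<subseteq> carrier V" using A(1) by blast
    ultimately have "card A \<le> dim" using li_le_dim(2)[OF fd] by blast
    then show False using A(2) by linarith
  qed
  ultimately have triv: "?k = {\<zero>\<^bsub>V\<^esub>}" by (rule k.dim_zero_trivial[unfolded carrier_vs_is_self, simplified, rotated])
  show ?thesis
  proof (rule inj_onI)
    fix x y assume xy: "x \<in> carrier V" "y \<in> carrier V" "f x = f y"
    have "f (x \<ominus>\<^bsub>V\<^esub> y) = f x \<ominus>\<^bsub>W\<^esub> f y"
      by (rule additive_diff[of V W f, OF M.abelian_group_axioms W.M.abelian_group_axioms
            lin_closed[OF f(1)] lin_add[OF f(1)] xy(1,2)])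
    then have "x \<ominus>\<^bsub>V\<^esub> y \<in> ?k"
      using xy lin_closed[OF f(1) xy(1)] lin_closed[OF f(1) xy(2)] by (simp add: W.M.minus_eq W.M.r_neg)
    then have "x \<ominus>\<^bsub>V\<^esub> y = \<zero>\<^bsub>V\<^esub>" using triv by blast
    moreover have "(x \<ominus>\<^bsub>V\<^esub> y) \<oplus>\<^bsub>V\<^esub> y = x" using xy by (simp add: M.minus_eq M.a_assoc M.l_neg)
    ultimately show "x = y" using xy by simp
  qed
qed

text \<open>Choose \<open>n\<close> so that the image of \<open>T ^^ n\<close> has least dimension.
  Then \<open>T ^^ n\<close> maps this image onto a space of no smaller dimension, hence
  injectively, and that space lies inside it again.\<close>

lemma (in vectorspace) fitting:
  assumes T: "lin K V V T" and fd: fin_dim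
  obtains n where "0 < n" "inj_on (T ^^ n) ((T ^^ n) ` carrier V)"
    "(T ^^ n) ` (T ^^ n) ` carrier V = (T ^^ n) ` carrier V"
proof -
  define I where "I k = (T ^^ k) ` carrier V" for k
  define d where "d k = vectorspace.dim K (vs (I k))" for k
  \<comment> \<open>The minimum is taken over positive powers: \<open>0 < n\<close> is needed later
    to conclude from injectivity of a power to that of \<open>S\<close>.\<close>
  obtain m where m: "\<And>k. d (Suc m) \<le> d (Suc k)"
    using ex_has_least_nat[of "\<lambda>_. True" _ "\<lambda>k. d (Suc k)"] by blast
  define n where "n = Suc m"
  have dn: "d n \<le> d (n + n)" using m[of "m + n"] by (simp add: n_def)
  have Tk: "lin K V V (T ^^ k)" for k by (rule lin_funpow[OF T])
  have vs: "vectorspace K (vs (I k))" for k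
    unfolding I_def by (rule subspace_is_vs[OF subspace_image[OF Tk]])
  have II: "(T ^^ n) ` I k = I (n + k)" for k by (simp add: I_def image_image funpow_add)
  have I_sub: "I k \<subseteq> carrier V" for k using lin_closed[OF Tk] by (auto simp: I_def)
  have "lin K V (vs (I n)) (T ^^ n)"
    by (rule linI) (use lin_add[OF Tk] lin_smult[OF Tk] in \<open>auto simp: I_def\<close>)
  then have fdn: "vectorspace.fin_dim K (vs (I n))"
    using lin_onto(1)[OF vectorspace_axioms vs[of n] _ _ fd] by (simp add: I_def)
  have "lin K (vs (I n)) (vs (I (n + n))) (T ^^ n)"
    by (rule linI) (use subsetD[OF I_sub[of n]] lin_add[OF Tk] lin_smult[OF Tk] II[of n] in auto)
  then have inj: "inj_on (T ^^ n) (I n)"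
    using vectorspace.inj_of_same_dim[OF vs[of n] vs[of "n + n"] _ _ fdn] II[of n] dn by (simp add: d_def)
  have "I (n + n) \<subseteq> (T ^^ n) ` carrier V" using image_mono[OF I_sub[of n], of "T ^^ n"] II[of n] by simp
  then have sub: "I (n + n) \<subseteq> I n" unfolding I_def[of n] .
  have "lin K (vs (I n)) (vs (I n)) (T ^^ n)"
    by (rule linI) (use subsetD[OF I_sub[of n]] lin_add[OF Tk] lin_smult[OF Tk] II[of n] sub in auto)
  then have "(T ^^ n) ` I n = I n"
    using vectorspace.inj_endo_surj[OF vs[of n] _ _ fdn] inj by simp
  then show ?thesis using that[of n] inj by (simp add: I_def n_def)
qed

context weak_hopf_algebra
begin

text \<open>With \<open>I\<close> the stable image of \<open>T = S o S\<close>, the map \<beta> is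
  the projection of \<open>H\<close> onto \<open>I\<close> along the kernel of
  \<open>T ^^ n\<close>. It is an algebra map on which the epimorphism property can act, and once it
  is the identity \<open>T ^^ n\<close> is injective on all of \<open>H\<close>.\<close>

lemma S_bij:
  assumes K: "field K" and fd: "vectorspace.fin_dim K H"
  shows "bij_betw S (carrier H) (carrier H)"
proof -
  interpret V: vectorspace K H
    using K by (simp add: vectorspace_def module_C)
  define T where "T = (\<lambda>x. S (S x))"
  have T: "lin K H H T" unfolding T_def by (intro lin_S_fun lin_S)
  have T_mult: "T (x \<bullet> y) = T x \<bullet> T y" if "x \<in> carrier H" "y \<in> carrier H" for x y
    using that by (simp add: T_def S_mult)
  note Tk = lin_funpow[OF T]
  note Tc [simp] = lin_closed[OF Tk]
  have Tk_mult: "(T ^^ k) (x \<bullet> y) = (T ^^ k) x \<bullet> (T ^^ k) y" if "x \<in> carrier H" "y \<in> carrier H" for k x y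
    by (induction k) (use that T_mult in auto)
  obtain n where n: "0 < n" "inj_on (T ^^ n) ((T ^^ n) ` carrier H)"
    "(T ^^ n) ` (T ^^ n) ` carrier H = (T ^^ n) ` carrier H"
    by (rule V.fitting[OF T fd])
  define I where "I = (T ^^ n) ` carrier H"
  \<comment> \<open>The inverse of \<open>T ^^ n\<close> on \<open>I\<close>, after
    \<open>T ^^ n\<close>. As \<open>I\<close> is closed under sums, products and scalars,
    uniqueness of preimages in \<open>I\<close> makes \<beta> linear and multiplicative.\<close>
  define \<beta> where "\<beta> x = inv_into I (T ^^ n) ((T ^^ n) x)" for x
  have IH: "x \<in> I \<Longrightarrow> x \<in> carrier H" for x by (auto simp: I_def)
  have \<beta>: "\<beta> x \<in> I" "(T ^^ n) (\<beta> x) = (T ^^ n) x" if "x \<in> carrier H" for x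
  proof -
    have "(T ^^ n) x \<in> (T ^^ n) ` I" using that n(3) by (simp add: I_def)
    then show "\<beta> x \<in> I" "(T ^^ n) (\<beta> x) = (T ^^ n) x"
      unfolding \<beta>_def by (rule inv_into_into, rule f_inv_into_f)
  qed
  have \<beta>_eq: "\<beta> x = p" if "x \<in> carrier H" "p \<in> I" "(T ^^ n) p = (T ^^ n) x" for x p
    using inj_onD[OF n(2), of "\<beta> x" p] \<beta>[OF that(1)] that by (simp add: I_def)
  have I_add: "a \<oplus>\<^bsub>H\<^esub> b \<in> I" and I_mult: "a \<bullet> b \<in> I" if "a \<in> I" "b \<in> I" for a b
    using that unfolding I_def by (auto simp: Tk_mult[symmetric] lin_add[OF Tk, symmetric])
  have I_smult: "c \<odot>\<^bsub>H\<^esub> a \<in> I" if "a \<in> I" "c \<in> carrier K" for a c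
    using that unfolding I_def by (auto simp: lin_smult[OF Tk, symmetric])
  note I_closed = I_add I_mult I_smult
  have \<beta>_lin: "lin K H H \<beta>"
    by (rule linI; (rule \<beta>_eq)?) (use \<beta> IH I_closed in \<open>auto simp: lin_add[OF Tk] lin_smult[OF Tk]\<close>)
  have \<beta>_mult: "\<beta> (x \<bullet> y) = \<beta> x \<bullet> \<beta> y" if "x \<in> carrier H" "y \<in> carrier H" for x y
    by (rule \<beta>_eq) (use that \<beta> IH I_closed in \<open>auto simp: Tk_mult\<close>)
  have \<beta>c: "x \<in> carrier H \<Longrightarrow> \<beta> x \<in> carrier H" for x using \<beta> IH by blast
  have base: "\<beta> ((T ^^ n) x) = (T ^^ n) x" if "x \<in> carrier H" for x
    by (rule \<beta>_eq) (use that in \<open>auto simp: I_def\<close>)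
  have Tsuc: "(T ^^ Suc k) z = (T ^^ k) (S (S z))" for k z
    by (simp add: funpow_Suc_right T_def del: funpow.simps(2))
  \<comment> \<open>From \<beta> o \<open>T ^^ k\<close> = \<open>T ^^ k\<close>, one factor
    \<open>S o S\<close> is cancelled on the right at a time, until \<open>k = 0\<close>.\<close>
  have down: "x \<in> carrier H \<Longrightarrow> (\<And>x. x \<in> carrier H \<Longrightarrow> \<beta> ((T ^^ k) x) = (T ^^ k) x) \<Longrightarrow> \<beta> x = x" for k x
  proof (induction k arbitrary: x)
    case (Suc k)
    have "\<beta> ((T ^^ k) x) = (T ^^ k) x" if x: "x \<in> carrier H" for x
    proof (rule S2_epi[OF lin_compose[OF \<beta>_lin Tk] _ Tk _ _ x])
      fix y assume "y \<in> carrier H"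
      then show "\<beta> ((T ^^ k) (S (S y))) = (T ^^ k) (S (S y))"
        using Suc.prems(2)[of y] by (simp add: Tsuc del: funpow.simps(2))
    qed (use \<beta>_mult Tk_mult in auto)
    then show ?case using Suc.IH Suc.prems(1) by blast
  qed simp
  have id: "\<beta> x = x" if "x \<in> carrier H" for x using down[OF that base] .
  have "I = carrier H" using id \<beta>(1) IH by force
  then have inj: "inj_on (T ^^ n) (carrier H)" using n(2) by (simp add: I_def)
  have "inj_on S (carrier H)"
  proof (rule inj_onI)
    fix x y assume xy: "x \<in> carrier H" "y \<in> carrier H" "S x = S y"
    obtain m where m: "n = Suc m" using n(1) gr0_implies_Suc by blast
    have "(T ^^ n) x = (T ^^ n) y" using xy(3) by (simp add: m Tsuc del: funpow.simps(2))
    then show "x = y" using inj xy by (auto dest: inj_onD)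
  qed
  then show ?thesis
    using V.inj_endo_surj[OF lin_S _ fd] by (simp add: bij_betw_def)
qed

end

section \<open>The opposite weak Hopf algebra\<close>

definition opposite :: "('k, 'a, 'y) module_scheme \<Rightarrow> ('k, 'a, 'y) module_scheme" where
  "opposite A = A\<lparr>monoid.mult := (\<lambda>x y. y \<otimes>\<^bsub>A\<^esub> x)\<rparr>"

lemma opposite_simps [simp]:
  "carrier (opposite A) = carrier A" "x \<otimes>\<^bsub>opposite A\<^esub> y = y \<otimes>\<^bsub>A\<^esub> x" "\<one>\<^bsub>opposite A\<^esub> = \<one>\<^bsub>A\<^esub>"
  "\<zero>\<^bsub>opposite A\<^esub> = \<zero>\<^bsub>A\<^esub>" "ring.add (opposite A) = ring.add A" "smult (opposite A) = smult A"
  by (simp_all add: opposite_def)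

lemma ktensor_opposite: "ktensor K (opposite A) N = ktensor K A N" "ktensor K M (opposite A) = ktensor K M A"
  by (simp_all add: ktensor_def tensor_product_def tensor_relations_def)

lemma tensor_sum_opposite: "tensor_sum (opposite A) t f = tensor_sum A t f"
  by (rule tensor_sum_target_cong) simp_all

lemma assoc_algebra_opposite:
  assumes "assoc_algebra K A"
  shows "assoc_algebra K (opposite A)"
proof -
  interpret A: assoc_algebra K A by fact
  have r: "ring A" by unfold_locales
  have ab: "abelian_group (opposite A)"
    by (rule abelian_group_target[OF A.M.abelian_group_axioms]) simp_all
  have "module K (opposite A)"
    by (rule moduleI) (use ab A.R.is_cring in \<open>auto simp: A.smult_l_distr A.smult_r_distr A.smult_assoc1\<close>)
  moreover have "ring (opposite A)"
    by (rule ringI) (use ab ring.ring_simprules[OF r] in \<open>auto intro!: monoidI\<close>)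
  ultimately show ?thesis
    by (simp add: assoc_algebra_def assoc_algebra_axioms_def A.smult_mult_left A.smult_mult_right)
qed

context weak_hopf_algebra
begin

definition S_inv where "S_inv h = inv_into (carrier H) S h"

text \<open>The argument of \<open>S\<close> is the \<open>PiR\<close> of the opposite algebra. The
  computation is that of \<open>S_PB\<close> with left and right exchanged.\<close>

lemma sw_S_PR': "h \<in> carrier H \<Longrightarrow> S (sw H \<one>\<^bsub>H\<^esub> (\<lambda>x y. \<epsilon> (y \<bullet> h) \<odot>\<^bsub>H\<^esub> x)) = PL h"
proof -
  assume h [simp]: "h \<in> carrier H"
  have "S (sw H \<one>\<^bsub>H\<^esub> (\<lambda>x y. \<epsilon> (y \<bullet> h) \<odot>\<^bsub>H\<^esub> x)) = sw H \<one>\<^bsub>H\<^esub> (\<lambda>x y. \<epsilon> (y \<bullet> h) \<odot>\<^bsub>H\<^esub> S x)"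
    by (simp add: S_sw S_smult cong: sw_cong)
  also have "\<dots> = sw H \<one>\<^bsub>H\<^esub> (\<lambda>x y. \<epsilon> (y \<bullet> h) \<odot>\<^bsub>H\<^esub> S (PR x))"
    by (rule sw_one_P(2)[symmetric]) (simp_all add: hsimps)
  also have "\<dots> = sw H \<one>\<^bsub>H\<^esub> (\<lambda>x y. \<epsilon> (y \<bullet> h) \<odot>\<^bsub>H\<^esub> PL (PR x))"
    by (simp add: S_P cong: sw_cong)
  also have "\<dots> = sw H \<one>\<^bsub>H\<^esub> (\<lambda>x y. \<epsilon> (y \<bullet> h) \<odot>\<^bsub>H\<^esub> PL x)"
    by (rule sw_one_P(2)) (simp_all add: hsimps)
  also have "\<dots> = sw H \<one>\<^bsub>H\<^esub> (\<lambda>x y. sw H \<one>\<^bsub>H\<^esub> (\<lambda>r s. (\<epsilon> (r \<bullet> x) \<otimes>\<^bsub>K\<^esub> \<epsilon> (y \<bullet> h)) \<odot>\<^bsub>H\<^esub> s))"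
    by (simp add: PiL_sw sw_push[OF lin_smult_fun[OF lin_id]] K_comm smult_assoc1[symmetric] cong: sw_cong)
  also have "\<dots> = sw H \<one>\<^bsub>H\<^esub> (\<lambda>r s. sw H \<one>\<^bsub>H\<^esub> (\<lambda>x y. (\<epsilon> (r \<bullet> x) \<otimes>\<^bsub>K\<^esub> \<epsilon> (y \<bullet> h)) \<odot>\<^bsub>H\<^esub> s))"
    by (rule sw_swap) simp_all
  also have "\<dots> = PL h"
    using sw_counit_mult(1)[of _ "\<one>\<^bsub>H\<^esub>" h]
    by (simp add: PiL_sw sw_push[OF lin_scalar, symmetric] cong: sw_cong)
  finally show ?thesis .
qed

text \<open>Products are reversed while \<Delta> is kept. Each antipode axiom for
  \<open>S_inv\<close> is verified after applying the injective map \<open>S\<close>, which by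
  \<open>S_mult\<close> turns it into a known identity for \<open>S\<close>.\<close>

lemma weak_hopf_opposite:
  assumes bij: "bij_betw S (carrier H) (carrier H)"
  shows "weak_hopf_algebra K (opposite H) \<Delta> \<epsilon> S_inv"
proof -
  have Si [simp]: "S_inv h \<in> carrier H" "S (S_inv h) = h" if "h \<in> carrier H" for h
    using bij_betw_inv_into_right[OF bij that] bij_betw_apply[OF bij_betw_inv_into[OF bij] that]
    by (simp_all add: S_inv_def)
  have Seq: "a = b" if "S a = S b" "a \<in> carrier H" "b \<in> carrier H" for a b
    using bij that by (auto simp: bij_betw_def dest: inj_onD)
  have Si_lin: "lin K H H S_inv"
    by (rule linI; (rule Seq)?) (simp_all add: lin_add[OF lin_S] S_smult)
  have aa: "assoc_algebra K (opposite H)" by (rule assoc_algebra_opposite[OF assoc_algebra_H])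
  then have mo: "module K (opposite H)" by (simp add: assoc_algebra_def)
  have co: "coalgebra K (opposite H) \<Delta> \<epsilon>"
    by (rule coalgebra.intro[OF mo], unfold_locales)
      (use comult_linear counit_linear coassoc counit_left counit_right in
        \<open>auto simp: ktensor_opposite tensor_sum_opposite module_hom_def\<close>)
  note kc = ktensor_sum_cong_raw[OF module_C module_C] ktensor_pure_closed[OF module_C module_C]
  have mul: "\<Delta> (h \<bullet> g) = tensor_sum (ktensor K H H) (\<Delta> g) (\<lambda>g1 g2.
      tensor_sum (ktensor K H H) (\<Delta> h) (\<lambda>h1 h2. pure_tensor (ktensor K H H) (h1 \<bullet> g1) (h2 \<bullet> g2)))"
    if "g \<in> carrier H" "h \<in> carrier H" for g h
    unfolding comult_mult[OF that(2,1)]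
    by (rule ktensor_sum_swap[OF module_C module_C module_C module_C module_ktensor[OF module_C module_C]])
      (use that kc(2) in auto)
  have eps: "tensor_sum K (\<Delta> h) (\<lambda>x y. \<epsilon> (y \<bullet> g) \<otimes>\<^bsub>K\<^esub> \<epsilon> (l \<bullet> x)) = \<epsilon> (l \<bullet> h \<bullet> g)"
    "tensor_sum K (\<Delta> h) (\<lambda>x y. \<epsilon> (x \<bullet> g) \<otimes>\<^bsub>K\<^esub> \<epsilon> (l \<bullet> y)) = \<epsilon> (l \<bullet> h \<bullet> g)"
    if [simp]: "g \<in> carrier H" "h \<in> carrier H" "l \<in> carrier H" for g h l
  proof -
    have "sw KK h (\<lambda>x y. \<epsilon> (y \<bullet> g) \<otimes>\<^bsub>K\<^esub> \<epsilon> (l \<bullet> x)) = sw KK h (\<lambda>x y. \<epsilon> (l \<bullet> x) \<otimes>\<^bsub>K\<^esub> \<epsilon> (y \<bullet> g))"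
      "sw KK h (\<lambda>x y. \<epsilon> (x \<bullet> g) \<otimes>\<^bsub>K\<^esub> \<epsilon> (l \<bullet> y)) = sw KK h (\<lambda>x y. \<epsilon> (l \<bullet> y) \<otimes>\<^bsub>K\<^esub> \<epsilon> (x \<bullet> g))"
      by (intro sw_cong refl; simp add: K_comm)+
    then show "tensor_sum K (\<Delta> h) (\<lambda>x y. \<epsilon> (y \<bullet> g) \<otimes>\<^bsub>K\<^esub> \<epsilon> (l \<bullet> x)) = \<epsilon> (l \<bullet> h \<bullet> g)"
      "tensor_sum K (\<Delta> h) (\<lambda>x y. \<epsilon> (x \<bullet> g) \<otimes>\<^bsub>K\<^esub> \<epsilon> (l \<bullet> y)) = \<epsilon> (l \<bullet> h \<bullet> g)"
      using sw_counit_mult[of l h g] by (simp_all add: sw_def tensor_sum_regular)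
  qed
  have "weak_bialgebra K (opposite H) \<Delta> \<epsilon>"
    by (intro weak_bialgebra.intro aa co, unfold_locales)
      (simp_all add: mul comult_one comult_one'[symmetric] eps ktensor_opposite tensor_sum_opposite
        H_assoc[symmetric])
  moreover have PL: "PiL (opposite H) \<Delta> \<epsilon> h = PB h" for h
    by (simp add: PiL_def PB_def sw_def tensor_sum_opposite)
  moreover have PR: "PiR (opposite H) \<Delta> \<epsilon> h = sw H \<one>\<^bsub>H\<^esub> (\<lambda>x y. \<epsilon> (y \<bullet> h) \<odot>\<^bsub>H\<^esub> x)" for h
    by (simp add: PiR_def sw_def tensor_sum_opposite)
  moreover have "sw H h (\<lambda>x y. S_inv y \<bullet> x) = PB h" if "h \<in> carrier H" for h
    by (rule Seq) (use that in \<open>simp_all add: S_PB S_sw S_mult sw_S_mult cong: sw_cong\<close>)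
  moreover have "sw H h (\<lambda>x y. y \<bullet> S_inv x) = sw H \<one>\<^bsub>H\<^esub> (\<lambda>x y. \<epsilon> (y \<bullet> h) \<odot>\<^bsub>H\<^esub> x)" if "h \<in> carrier H" for h
  proof (rule Seq)
    have "S (sw H h (\<lambda>x y. y \<bullet> S_inv x)) = PL h"
      using that by (simp add: S_sw S_mult sw_mult_S cong: sw_cong)
    then show "S (sw H h (\<lambda>x y. y \<bullet> S_inv x)) = S (sw H \<one>\<^bsub>H\<^esub> (\<lambda>x y. \<epsilon> (y \<bullet> h) \<odot>\<^bsub>H\<^esub> x))"
      using sw_S_PR'[OF that] by simp
  qed (use that in simp_all)
  moreover have "sw H h (\<lambda>x z. sw H z (\<lambda>u v. S_inv v \<bullet> (u \<bullet> S_inv x))) = S_inv h" if h [simp]: "h \<in> carrier H" for h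
  proof (rule Seq)
    have "S (sw H h (\<lambda>x z. sw H z (\<lambda>u v. S_inv v \<bullet> (u \<bullet> S_inv x)))) =
        sw H h (\<lambda>x z. sw H z (\<lambda>u v. x \<bullet> S u \<bullet> v))"
      by (simp add: S_sw S_mult cong: sw_cong)
    also have "\<dots> = sw H h (\<lambda>z v. sw H z (\<lambda>x u. x \<bullet> S u \<bullet> v))"
      by (rule sw_coassoc[symmetric]) (simp_all add: hsimps)
    also have "\<dots> = h"
      using sw_PL_mult[OF h] by (simp add: sw_mult_S[symmetric] sw_hmul cong: sw_cong)
    finally show "S (sw H h (\<lambda>x z. sw H z (\<lambda>u v. S_inv v \<bullet> (u \<bullet> S_inv x)))) = S (S_inv h)"
      by simp
  qed simp_all
  ultimately show ?thesis
    by (intro weak_hopf_algebra.intro weak_hopf_algebra_axioms.intro)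
      (use Si_lin in \<open>simp_all add: lin_def module_hom_def tensor_sum_opposite sw_def\<close>)
qed

end

section \<open>Integrals\<close>

lemma lin_finsum_push:
  assumes f: "lin K G G' f" and G: "module K G" and G': "module K G'" and fin: "finite B"
    and F: "\<And>k. k \<in> B \<Longrightarrow> F k \<in> carrier G"
  shows "f (\<Oplus>\<^bsub>G\<^esub>k\<in>B. F k) = (\<Oplus>\<^bsub>G'\<^esub>k\<in>B. f (F k))"
  by (rule additive_finsum) (use assms in \<open>auto simp: lin_hom module_def\<close>)

lemma lin_finsum:
  assumes G: "module K G" and fin: "finite B" and F: "\<And>k. k \<in> B \<Longrightarrow> lin K M G (F k)"
  shows "lin K M G (\<lambda>x. \<Oplus>\<^bsub>G\<^esub>k\<in>B. F k x)"
proof -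
  interpret G: module K G by (rule G)
  have cl: "F k x \<in> carrier G" if "k \<in> B" "x \<in> carrier M" for k x
    by (rule lin_closed[OF F]) fact+
  show ?thesis
  proof (rule linI)
    fix x y assume xy: "x \<in> carrier M" "y \<in> carrier M"
    have "(\<Oplus>\<^bsub>G\<^esub>k\<in>B. F k (x \<oplus>\<^bsub>M\<^esub> y)) = (\<Oplus>\<^bsub>G\<^esub>k\<in>B. F k x \<oplus>\<^bsub>G\<^esub> F k y)"
      by (rule finsum_cong_raw) (use lin_add[OF F] xy in simp)
    also have "\<dots> = (\<Oplus>\<^bsub>G\<^esub>k\<in>B. F k x) \<oplus>\<^bsub>G\<^esub> (\<Oplus>\<^bsub>G\<^esub>k\<in>B. F k y)"
      by (rule G.M.finsum_addf) (use cl xy in auto)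
    finally show "(\<Oplus>\<^bsub>G\<^esub>k\<in>B. F k (x \<oplus>\<^bsub>M\<^esub> y)) = (\<Oplus>\<^bsub>G\<^esub>k\<in>B. F k x) \<oplus>\<^bsub>G\<^esub> (\<Oplus>\<^bsub>G\<^esub>k\<in>B. F k y)" .
  next
    fix c x assume cx: "c \<in> carrier K" "x \<in> carrier M"
    have "(\<Oplus>\<^bsub>G\<^esub>k\<in>B. F k (c \<odot>\<^bsub>M\<^esub> x)) = (\<Oplus>\<^bsub>G\<^esub>k\<in>B. c \<odot>\<^bsub>G\<^esub> F k x)"
      by (rule finsum_cong_raw) (use lin_smult[OF F] cx in simp)
    also have "\<dots> = c \<odot>\<^bsub>G\<^esub> (\<Oplus>\<^bsub>G\<^esub>k\<in>B. F k x)"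
      by (rule lin_finsum_push[OF lin_smult_fun[OF lin_id] G G fin, symmetric]) (use cl cx G in auto)
    finally show "(\<Oplus>\<^bsub>G\<^esub>k\<in>B. F k (c \<odot>\<^bsub>M\<^esub> x)) = c \<odot>\<^bsub>G\<^esub> (\<Oplus>\<^bsub>G\<^esub>k\<in>B. F k x)" .
  qed (use cl in auto)
qed

lemma (in abelian_group) finsum_swap:
  assumes "finite A" "finite B" "\<And>i j. i \<in> A \<Longrightarrow> j \<in> B \<Longrightarrow> f i j \<in> carrier G"
  shows "(\<Oplus>i\<in>A. \<Oplus>j\<in>B. f i j) = (\<Oplus>j\<in>B. \<Oplus>i\<in>A. f i j)"
  using assms(1,3)
proof (induction A rule: finite_induct)
  case empty
  show ?case by simp
next
  case (insert a A)
  have "(\<Oplus>i\<in>insert a A. \<Oplus>j\<in>B. f i j) = (\<Oplus>j\<in>B. f a j) \<oplus> (\<Oplus>j\<in>B. \<Oplus>i\<in>A. f i j)"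
    using insert by (simp add: Pi_iff)
  also have "\<dots> = (\<Oplus>j\<in>B. f a j \<oplus> (\<Oplus>i\<in>A. f i j))"
    using insert by (intro finsum_addf[symmetric]) (auto simp: Pi_iff)
  also have "\<dots> = (\<Oplus>j\<in>B. \<Oplus>i\<in>insert a A. f i j)"
    using insert by (intro finsum_cong_raw) (simp add: Pi_iff)
  finally show ?case .
qed

text \<open>The functionals are the coordinates with respect to a basis; their linearity follows
  from uniqueness of coordinates.\<close>

lemma (in vectorspace) dual_basis:
  assumes fin_dim
  obtains B \<phi> where "finite B" "B \<subseteq> carrier V" "\<And>b. b \<in> B \<Longrightarrow> lin K V (regular_bimodule K) (\<phi> b)"
    "\<And>v. v \<in> carrier V \<Longrightarrow> (\<Oplus>\<^bsub>V\<^esub>b\<in>B. \<phi> b v \<odot>\<^bsub>V\<^esub> b) = v"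
proof -
  obtain B where B: "finite B" "basis B" using finite_basis_exists[OF assms] by blast
  have BV: "B \<subseteq> carrier V" using B(2) by (simp add: basis_def)
  have ex1: "\<exists>!a. a \<in> B \<rightarrow>\<^sub>E carrier K \<and> lincomb a B = v" if "v \<in> carrier V" for v
    using basis_criterion[OF B(1) BV] B(2) that by blast
  define c where "c v = (THE a. a \<in> B \<rightarrow>\<^sub>E carrier K \<and> lincomb a B = v)" for v
  have c: "c v \<in> B \<rightarrow>\<^sub>E carrier K" "lincomb (c v) B = v" if "v \<in> carrier V" for v
    using theI'[OF ex1[OF that]] by (simp_all add: c_def)
  \<comment> \<open>The basis criterion gives uniqueness among extensional coefficient functions;
    restriction extends it to all.\<close>
  have uniq: "c v b = a b" if "a \<in> B \<rightarrow> carrier K" "lincomb a B = v" "b \<in> B" for a v b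
  proof -
    have v: "v \<in> carrier V" using lincomb_closed[OF BV that(1)] that(2) by simp
    have "lincomb (restrict a B) B = v"
      using that(1,2) BV unfolding lincomb_def by (auto intro!: M.finsum_cong' simp: Pi_iff subset_iff)
    moreover have "restrict a B \<in> B \<rightarrow>\<^sub>E carrier K" using that(1) by auto
    ultimately have "c v = restrict a B" using c[OF v] ex1[OF v] by blast
    then show ?thesis using that(3) by simp
  qed
  have cK: "c v b \<in> carrier K" if "v \<in> carrier V" "b \<in> B" for v b using c(1)[OF that(1)] that(2) by auto
  show ?thesis
  proof (rule that[of B "\<lambda>b v. c v b"])
    fix b assume b: "b \<in> B"
    show "lin K V (regular_bimodule K) (\<lambda>v. c v b)"
    proof (rule linI)
      fix x y assume xy: "x \<in> carrier V" "y \<in> carrier V"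
      have "lincomb (\<lambda>b. c x b \<oplus>\<^bsub>K\<^esub> c y b) B = (\<Oplus>\<^bsub>V\<^esub>b\<in>B. c x b \<odot>\<^bsub>V\<^esub> b \<oplus>\<^bsub>V\<^esub> c y b \<odot>\<^bsub>V\<^esub> b)"
        unfolding lincomb_def by (rule finsum_cong_raw) (use xy cK BV in \<open>auto simp: smult_l_distr\<close>)
      also have "\<dots> = lincomb (c x) B \<oplus>\<^bsub>V\<^esub> lincomb (c y) B"
        unfolding lincomb_def by (rule M.finsum_addf) (use xy cK BV in auto)
      finally have "lincomb (\<lambda>b. c x b \<oplus>\<^bsub>K\<^esub> c y b) B = lincomb (c x) B \<oplus>\<^bsub>V\<^esub> lincomb (c y) B" .
      then show "c (x \<oplus>\<^bsub>V\<^esub> y) b = c x b \<oplus>\<^bsub>regular_bimodule K\<^esub> c y b"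
        using xy c cK b by (subst uniq[of "\<lambda>b. c x b \<oplus>\<^bsub>K\<^esub> c y b"]) auto
    next
      fix r x assume rx: "r \<in> carrier K" "x \<in> carrier V"
      have "r \<odot>\<^bsub>V\<^esub> lincomb (c x) B = (\<Oplus>\<^bsub>V\<^esub>b\<in>B. r \<odot>\<^bsub>V\<^esub> (c x b \<odot>\<^bsub>V\<^esub> b))"
        unfolding lincomb_def
        by (rule lin_finsum_push[OF lin_smult_fun[OF lin_id] module_axioms module_axioms B(1)])
          (use rx cK BV module_axioms in auto)
      also have "\<dots> = lincomb (\<lambda>b. r \<otimes>\<^bsub>K\<^esub> c x b) B"
        unfolding lincomb_def using rx cK BV
        by (auto intro!: M.finsum_cong' simp: smult_assoc1 Pi_iff subset_iff)
      finally show "c (r \<odot>\<^bsub>V\<^esub> x) b = r \<odot>\<^bsub>regular_bimodule K\<^esub> c x b"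
        using rx c cK b by (subst uniq[of "\<lambda>b. r \<otimes>\<^bsub>K\<^esub> c x b"]) auto
    qed (use cK b in auto)
  next
    fix v assume v: "v \<in> carrier V"
    then show "(\<Oplus>\<^bsub>V\<^esub>b\<in>B. c v b \<odot>\<^bsub>V\<^esub> b) = v" using c(2)[OF v] by (simp add: lincomb_def)
  qed (fact B(1) BV)+
qed

context coalgebra
begin

lemma sw_finsum:
  assumes "module K G" "h \<in> carrier C" "finite B"
    and "\<And>k x y. k \<in> B \<Longrightarrow> x \<in> carrier C \<Longrightarrow> y \<in> carrier C \<Longrightarrow> F k x y \<in> carrier G"
  shows "(\<Oplus>\<^bsub>G\<^esub>k\<in>B. sw G h (F k)) = sw G h (\<lambda>x y. \<Oplus>\<^bsub>G\<^esub>k\<in>B. F k x y)"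
proof -
  have G: "abelian_group G" using assms(1) by (simp add: module_def)
  show ?thesis
    unfolding sw_def
    by (rule tensor_factors.tensor_sum_finsum[OF tensor_factors_ktensor[OF module_C module_C] G _ assms(3), symmetric])
      (use assms(2,4) comult_closed[OF assms(2)] in \<open>auto simp: ktensor_simps\<close>)
qed

end

context weak_hopf_algebra
begin

lemma PR_S_eq: "h \<in> carrier H \<Longrightarrow> PR (S h) = S (PL h)"
proof -
  assume h [simp]: "h \<in> carrier H"
  have "PR (S h) = sw H (S h) (\<lambda>x y. S x \<bullet> y)" by (simp add: sw_S_mult)
  also have "\<dots> = sw H h (\<lambda>x y. S (S y) \<bullet> S x)" by (rule sw_S) (simp_all add: hsimps)
  also have "\<dots> = S (PL h)" by (simp add: sw_mult_S[symmetric] S_sw S_mult cong: sw_cong)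
  finally show ?thesis .
qed

text \<open>\<open>x_1 \<otimes> x_2 S h = x_1 PR h_2 \<otimes> x_2 S h_1\<close>. Read from right
  to left: write \<open>PR\<close> as \<open>S o PB\<close>, trade \<open>PB\<close> for a copy of
  \<Delta> 1 by \<open>sw_PB_right\<close>, turn that copy round with \<open>sw_one_S\<close>, and
  absorb it into the coproduct of \<open>x\<close>.\<close>

lemma sw_mult_S_split:
  assumes G [simp]: "module K G" and x [simp]: "x \<in> carrier H" and h [simp]: "h \<in> carrier H" and F: "bil K H H G F"
  shows "sw G x (\<lambda>a b. F a (b \<bullet> S h)) = sw G h (\<lambda>p q. sw G x (\<lambda>a b. F (a \<bullet> PR q) (b \<bullet> S p)))"
proof -
  note [simp] = bil_closed[OF F] and FF = bil_lin_fun[OF F] bil_lin[OF F]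
  have "sw G h (\<lambda>p q. sw G x (\<lambda>a b. F (a \<bullet> PR q) (b \<bullet> S p))) =
      sw G h (\<lambda>p q. sw G x (\<lambda>a b. F (a \<bullet> S (PB q)) (b \<bullet> S p)))"
    by (simp add: S_PB cong: sw_cong)
  also have "\<dots> = sw G \<one>\<^bsub>H\<^esub> (\<lambda>p q. sw G x (\<lambda>a b. F (a \<bullet> S q) (b \<bullet> S (h \<bullet> p))))"
    by (rule sw_PB_right) (simp_all add: hsimps FF)
  also have "\<dots> = sw G \<one>\<^bsub>H\<^esub> (\<lambda>p q. sw G x (\<lambda>a b. F (a \<bullet> S q) ((b \<bullet> S p) \<bullet> S h)))"
    by (simp add: S_mult H_assoc cong: sw_cong)
  also have "\<dots> = sw G \<one>\<^bsub>H\<^esub> (\<lambda>p q. sw G x (\<lambda>a b. F (a \<bullet> p) ((b \<bullet> q) \<bullet> S h)))"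
    by (rule sw_one_S) (simp_all add: hsimps FF)
  also have "\<dots> = sw G x (\<lambda>a b. sw G \<one>\<^bsub>H\<^esub> (\<lambda>p q. F (a \<bullet> p) ((b \<bullet> q) \<bullet> S h)))"
    by (rule sw_swap) simp_all
  also have "\<dots> = sw G (x \<bullet> \<one>\<^bsub>H\<^esub>) (\<lambda>a b. F a (b \<bullet> S h))"
    by (rule sw_mult[symmetric]) (simp_all add: hsimps FF)
  finally show ?thesis by simp
qed

text \<open>In a partial trace the factor \<open>S (S h)\<close> stands in the second leg only; this
  moves it inside the coproduct of \<open>x\<close>, with a correction \<open>S h_1\<close> in the
  first leg. The correction cancels because \<open>S (S h_2) S h_1\<close> is
  \<open>S (h_1 S h_2) = PR (S h_1)\<close> up to renumbering of legs, a term that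
  \<open>sw_mult_S_split\<close> produces.\<close>

lemma sw_mult_SS_split:
  assumes G [simp]: "module K G" and x [simp]: "x \<in> carrier H" and h [simp]: "h \<in> carrier H" and F: "bil K H H G F"
  shows "sw G x (\<lambda>a b. F a (b \<bullet> S (S h))) = sw G h (\<lambda>p q. sw G (x \<bullet> S (S q)) (\<lambda>a b. F (a \<bullet> S p) b))"
proof -
  note [simp] = bil_closed[OF F] and FF = bil_lin_fun[OF F] bil_lin[OF F]
  have "sw G h (\<lambda>p q. sw G (x \<bullet> S (S q)) (\<lambda>a b. F (a \<bullet> S p) b)) =
      sw G h (\<lambda>p q. sw G x (\<lambda>a b. sw G (S (S q)) (\<lambda>u v. F ((a \<bullet> u) \<bullet> S p) (b \<bullet> v))))"
    by (rule sw_cong[OF refl h], rule sw_mult) (simp_all add: hsimps FF)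
  also have "\<dots> = sw G h (\<lambda>p q. sw G x (\<lambda>a b. sw G (S q) (\<lambda>u v. F ((a \<bullet> S v) \<bullet> S p) (b \<bullet> S u))))"
    by (rule sw_cong[OF refl h], rule sw_cong[OF refl x], rule sw_S) (simp_all add: hsimps FF)
  also have "\<dots> = sw G h (\<lambda>p q. sw G x (\<lambda>a b. sw G q (\<lambda>u v. F ((a \<bullet> S (S u)) \<bullet> S p) (b \<bullet> S (S v)))))"
    by (rule sw_cong[OF refl h], rule sw_cong[OF refl x], rule sw_S) (simp_all add: hsimps FF)
  also have "\<dots> = sw G h (\<lambda>p q. sw G q (\<lambda>u v. sw G x (\<lambda>a b. F (a \<bullet> S (p \<bullet> S u)) (b \<bullet> S (S v)))))"
    by (rule sw_cong[OF refl h], subst sw_swap) (simp_all add: H_assoc S_mult cong: sw_cong)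
  also have "\<dots> = sw G h (\<lambda>q v. sw G q (\<lambda>p u. sw G x (\<lambda>a b. F (a \<bullet> S (p \<bullet> S u)) (b \<bullet> S (S v)))))"
    by (rule sw_coassoc[symmetric]) (simp_all add: hsimps FF)
  also have "\<dots> = sw G h (\<lambda>q v. sw G x (\<lambda>a b. F (a \<bullet> PR (S q)) (b \<bullet> S (S v))))"
  proof (rule sw_cong[OF refl h])
    fix q v assume [simp]: "q \<in> carrier H" "v \<in> carrier H"
    have L: "lin K H G (\<lambda>z. sw G x (\<lambda>a b. F (a \<bullet> S z) (b \<bullet> S (S v))))" by (simp add: hsimps FF)
    show "sw G q (\<lambda>p u. sw G x (\<lambda>a b. F (a \<bullet> S (p \<bullet> S u)) (b \<bullet> S (S v)))) =
        sw G x (\<lambda>a b. F (a \<bullet> PR (S q)) (b \<bullet> S (S v)))"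
      using sw_push[OF L, of q "\<lambda>p u. p \<bullet> S u"] by (simp add: PR_S_eq sw_mult_S)
  qed
  also have "\<dots> = sw G (S h) (\<lambda>p q. sw G x (\<lambda>a b. F (a \<bullet> PR q) (b \<bullet> S p)))"
    by (rule sw_S[symmetric]) (simp_all add: hsimps FF)
  also have "\<dots> = sw G x (\<lambda>a b. F a (b \<bullet> S (S h)))"
    by (rule sw_mult_S_split[symmetric]) (simp_all add: F)
  finally show ?thesis ..
qed

section \<open>Integrals as partial traces\<close>

context
  fixes B :: "'h set" and \<phi> :: "'h \<Rightarrow> 'h \<Rightarrow> 'k"
  assumes B: "finite B" "B \<subseteq> carrier H" and \<phi>: "\<And>b. b \<in> B \<Longrightarrow> lin K H KK (\<phi> b)"
    and expand: "\<And>v. v \<in> carrier H \<Longrightarrow> (\<Oplus>\<^bsub>H\<^esub>b\<in>B. \<phi> b v \<odot>\<^bsub>H\<^esub> b) = v"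
begin

text \<open>The \<open>j\<close>-th integral is the partial trace of \<open>h \<mapsto> \<Delta> (x S\<^sup>2 h)\<close> against \<open>\<phi> j\<close>; this is the projection
  \<open>m \<mapsto> \<Sum> m\<^bsub>[0]\<^esub> S m\<^bsub>[1]\<^esub>\<close> onto the coinvariants of the Hopf module dual to \<open>H\<close>.\<close>

definition trace_integral :: "'h \<Rightarrow> 'h \<Rightarrow> 'k" where
  "trace_integral j x = (\<Oplus>\<^bsub>KK\<^esub>k\<in>B. sw KK (x \<bullet> S (S k)) (\<lambda>u v. \<phi> k u \<otimes>\<^bsub>K\<^esub> \<phi> j v))"

lemma B_closed [simp]: "b \<in> B \<Longrightarrow> b \<in> carrier H" using B(2) by blast

lemma phi_closed [simp]: "b \<in> B \<Longrightarrow> x \<in> carrier H \<Longrightarrow> \<phi> b x \<in> carrier K"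
  using lin_closed[OF \<phi>] by simp

lemma phi_lin_fun: "b \<in> B \<Longrightarrow> lin K M H f \<Longrightarrow> lin K M KK (\<lambda>x. \<phi> b (f x))"
  using lin_compose[OF \<phi>] by blast

lemma expand_lin:
  assumes "module K G" "lin K H G f" "v \<in> carrier H"
  shows "f v = (\<Oplus>\<^bsub>G\<^esub>b\<in>B. \<phi> b v \<odot>\<^bsub>G\<^esub> f b)"
proof -
  interpret G: module K G by fact
  have "f v = f (\<Oplus>\<^bsub>H\<^esub>b\<in>B. \<phi> b v \<odot>\<^bsub>H\<^esub> b)" using expand[OF assms(3)] by simp
  also have "\<dots> = (\<Oplus>\<^bsub>G\<^esub>b\<in>B. f (\<phi> b v \<odot>\<^bsub>H\<^esub> b))"
    by (rule lin_finsum_push[OF assms(2) module_C assms(1) B(1)]) (use assms in auto)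
  also have "\<dots> = (\<Oplus>\<^bsub>G\<^esub>b\<in>B. \<phi> b v \<odot>\<^bsub>G\<^esub> f b)"
    by (rule finsum_cong_raw) (use assms in \<open>simp add: lin_smult[OF assms(2)]\<close>)
  finally show ?thesis .
qed

lemma trace_integral_lin: "j \<in> B \<Longrightarrow> lin K H KK (trace_integral j)"
  unfolding trace_integral_def
  by (intro lin_finsum[OF module_KK B(1)]) (simp add: hsimps phi_lin_fun \<phi>)

lemma module_abelian_group: "module K G \<Longrightarrow> abelian_group G"
  by (simp add: module_def)

lemma sum_swap:
  assumes "module K G" "\<And>i j. i \<in> B \<Longrightarrow> j \<in> B \<Longrightarrow> f i j \<in> carrier G"
  shows "(\<Oplus>\<^bsub>G\<^esub>i\<in>B. \<Oplus>\<^bsub>G\<^esub>j\<in>B. f i j) = (\<Oplus>\<^bsub>G\<^esub>j\<in>B. \<Oplus>\<^bsub>G\<^esub>i\<in>B. f i j)"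
  by (rule abelian_group.finsum_swap[OF module_abelian_group[OF assms(1)] B(1) B(1) assms(2)])

lemma sum_closed: "module K G \<Longrightarrow> (\<And>i. i \<in> B \<Longrightarrow> f i \<in> carrier G) \<Longrightarrow> (\<Oplus>\<^bsub>G\<^esub>i\<in>B. f i) \<in> carrier G"
  by (rule abelian_monoid.finsum_closed)
    (auto dest: module_abelian_group simp: abelian_group_def)

text \<open>For \<open>Z u v = x S (S u v)\<close>, a map from the tensor square to
  \<open>H\<close>, the sum over \<open>j\<close> is the trace of \<Delta> o \<open>Z\<close>. By
  cyclicity it is the trace of \<open>Z\<close> o \<Delta>, and \<open>Z\<close> collapses on
  coproducts: the map is \<open>h\<close> to \<open>x S (PR h)\<close>.\<close>

lemma trace_integral_sum:
  assumes x [simp]: "x \<in> carrier H"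
  shows "(\<Oplus>\<^bsub>KK\<^esub>j\<in>B. trace_integral j (x \<bullet> S j)) = \<epsilon> x"
proof -
  define Z where "Z u v = x \<bullet> S (S u \<bullet> v)" for u v
  have Zc [simp]: "u \<in> carrier H \<Longrightarrow> v \<in> carrier H \<Longrightarrow> Z u v \<in> carrier H" for u v by (simp add: Z_def)
  have ZL: "v \<in> carrier H \<Longrightarrow> lin K H H (\<lambda>u. Z u v)" "u \<in> carrier H \<Longrightarrow> lin K H H (\<lambda>v. Z u v)" for u v
    by (simp_all add: Z_def hsimps)
  let ?T = "\<lambda>i j k u v. \<phi> i (Z k j) \<otimes>\<^bsub>K\<^esub> (\<phi> k u \<otimes>\<^bsub>K\<^esub> \<phi> j v)"
  have Km [simp]: "a \<in> carrier K \<Longrightarrow> b \<in> carrier K \<Longrightarrow> a \<otimes>\<^bsub>K\<^esub> b \<in> carrier K" for a b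
    using cring_K by (simp add: cring.cring_simprules)
  have swK: "sw KK h F \<in> carrier K"
    if "h \<in> carrier H" "\<And>x y. x \<in> carrier H \<Longrightarrow> y \<in> carrier H \<Longrightarrow> F x y \<in> carrier K" for h F
    using sw_closed[OF module_KK, of h F] that by simp
  have "(\<Oplus>\<^bsub>KK\<^esub>j\<in>B. trace_integral j (x \<bullet> S j)) =
      (\<Oplus>\<^bsub>KK\<^esub>j\<in>B. \<Oplus>\<^bsub>KK\<^esub>k\<in>B. sw KK (Z k j) (\<lambda>u v. \<phi> k u \<otimes>\<^bsub>K\<^esub> \<phi> j v))"
    by (intro finsum_cong_raw) (simp add: trace_integral_def Z_def S_mult H_assoc cong: finsum_cong_raw)
  \<comment> \<open>Cyclicity by hand: the value \<open>Z k j\<close> is expanded in the basis, the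
    three sums are exchanged, and the sums over \<open>j\<close> and \<open>k\<close> are then
    contracted instead.\<close>
  also have "\<dots> = (\<Oplus>\<^bsub>KK\<^esub>j\<in>B. \<Oplus>\<^bsub>KK\<^esub>k\<in>B. \<Oplus>\<^bsub>KK\<^esub>i\<in>B. sw KK i (?T i j k))"
  proof (intro finsum_cong_raw)
    fix j k assume [simp]: "j \<in> B" "k \<in> B"
    have L: "lin K H KK (\<lambda>z. sw KK z (\<lambda>u v. \<phi> k u \<otimes>\<^bsub>K\<^esub> \<phi> j v))" by (simp add: hsimps phi_lin_fun \<phi>)
    have "sw KK (Z k j) (\<lambda>u v. \<phi> k u \<otimes>\<^bsub>K\<^esub> \<phi> j v) =
        (\<Oplus>\<^bsub>KK\<^esub>i\<in>B. \<phi> i (Z k j) \<otimes>\<^bsub>K\<^esub> sw KK i (\<lambda>u v. \<phi> k u \<otimes>\<^bsub>K\<^esub> \<phi> j v))"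
      using expand_lin[OF module_KK L, of "Z k j"] by simp
    also have "\<dots> = (\<Oplus>\<^bsub>KK\<^esub>i\<in>B. sw KK i (?T i j k))"
      by (intro finsum_cong_raw sw_push[where \<phi> = "\<lambda>c. a \<otimes>\<^bsub>K\<^esub> c" for a, of KK KK])
        (simp_all add: lsimps)
    finally show "sw KK (Z k j) (\<lambda>u v. \<phi> k u \<otimes>\<^bsub>K\<^esub> \<phi> j v) = (\<Oplus>\<^bsub>KK\<^esub>i\<in>B. sw KK i (?T i j k))" .
  qed
  also have "\<dots> = (\<Oplus>\<^bsub>KK\<^esub>j\<in>B. \<Oplus>\<^bsub>KK\<^esub>i\<in>B. \<Oplus>\<^bsub>KK\<^esub>k\<in>B. sw KK i (?T i j k))"
    by (rule finsum_cong_raw, rule sum_swap) (simp_all add: swK)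
  also have "\<dots> = (\<Oplus>\<^bsub>KK\<^esub>i\<in>B. \<Oplus>\<^bsub>KK\<^esub>j\<in>B. \<Oplus>\<^bsub>KK\<^esub>k\<in>B. sw KK i (?T i j k))"
    by (rule sum_swap) (auto intro!: sum_closed[where G = KK, simplified] swK)
  also have "\<dots> = (\<Oplus>\<^bsub>KK\<^esub>i\<in>B. sw KK i (\<lambda>u v. \<Oplus>\<^bsub>KK\<^esub>j\<in>B. \<Oplus>\<^bsub>KK\<^esub>k\<in>B. ?T i j k u v))"
    by (intro finsum_cong_raw) (simp add: sw_finsum B(1) sum_closed[where G = KK, simplified] cong: finsum_cong_raw)
  also have "\<dots> = (\<Oplus>\<^bsub>KK\<^esub>i\<in>B. sw KK i (\<lambda>u v. \<phi> i (Z u v)))"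
  proof (intro finsum_cong_raw sw_cong refl)
    fix i u v assume [simp]: "i \<in> B" "u \<in> carrier H" "v \<in> carrier H"
    have "\<phi> i (Z u v) = (\<Oplus>\<^bsub>KK\<^esub>j\<in>B. \<phi> j v \<otimes>\<^bsub>K\<^esub> \<phi> i (Z u j))"
      using expand_lin[OF module_KK, of "\<lambda>v. \<phi> i (Z u v)" v] by (simp add: phi_lin_fun ZL)
    also have "\<dots> = (\<Oplus>\<^bsub>KK\<^esub>j\<in>B. \<phi> j v \<otimes>\<^bsub>K\<^esub> (\<Oplus>\<^bsub>KK\<^esub>k\<in>B. \<phi> k u \<otimes>\<^bsub>K\<^esub> \<phi> i (Z k j)))"
      using expand_lin[OF module_KK, of "\<lambda>u. \<phi> i (Z u _)" u]
      by (intro finsum_cong_raw) (simp add: phi_lin_fun ZL)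
    also have "\<dots> = (\<Oplus>\<^bsub>KK\<^esub>j\<in>B. \<Oplus>\<^bsub>KK\<^esub>k\<in>B. ?T i j k u v)"
    proof (intro finsum_cong_raw)
      fix j assume [simp]: "j \<in> B"
      have "\<phi> j v \<otimes>\<^bsub>K\<^esub> (\<Oplus>\<^bsub>KK\<^esub>k\<in>B. \<phi> k u \<otimes>\<^bsub>K\<^esub> \<phi> i (Z k j)) =
          (\<Oplus>\<^bsub>KK\<^esub>k\<in>B. \<phi> j v \<otimes>\<^bsub>K\<^esub> (\<phi> k u \<otimes>\<^bsub>K\<^esub> \<phi> i (Z k j)))"
        by (rule lin_finsum_push[OF _ module_KK module_KK B(1)]) (simp_all add: lsimps)
      also have "\<dots> = (\<Oplus>\<^bsub>KK\<^esub>k\<in>B. ?T i j k u v)"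
        using cring.cring_simprules(11,14,24)[OF cring_K]
        by (intro finsum_cong_raw) (simp add: cring.cring_simprules[OF cring_K])
      finally show "\<phi> j v \<otimes>\<^bsub>K\<^esub> (\<Oplus>\<^bsub>KK\<^esub>k\<in>B. \<phi> k u \<otimes>\<^bsub>K\<^esub> \<phi> i (Z k j)) = (\<Oplus>\<^bsub>KK\<^esub>k\<in>B. ?T i j k u v)" .
    qed
    finally show "(\<Oplus>\<^bsub>KK\<^esub>j\<in>B. \<Oplus>\<^bsub>KK\<^esub>k\<in>B. ?T i j k u v) = \<phi> i (Z u v)" ..
  qed simp
  also have "\<dots> = (\<Oplus>\<^bsub>KK\<^esub>i\<in>B. sw KK \<one>\<^bsub>H\<^esub> (\<lambda>p q. \<epsilon> (i \<bullet> q) \<otimes>\<^bsub>K\<^esub> \<phi> i (x \<bullet> S p)))"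
  proof (intro finsum_cong_raw)
    fix i assume [simp]: "i \<in> B"
    have L: "lin K H KK (\<lambda>z. \<phi> i (x \<bullet> S z))" by (simp add: phi_lin_fun hsimps)
    have "sw KK i (\<lambda>u v. \<phi> i (Z u v)) = \<phi> i (x \<bullet> S (PR i))"
      using sw_push[OF L, of i "\<lambda>u v. S u \<bullet> v"] by (simp add: Z_def sw_S_mult)
    also have "\<dots> = sw KK \<one>\<^bsub>H\<^esub> (\<lambda>p q. \<epsilon> (i \<bullet> q) \<otimes>\<^bsub>K\<^esub> \<phi> i (x \<bullet> S p))"
      unfolding PiR_sw using sw_push[OF L, of "\<one>\<^bsub>H\<^esub>" "\<lambda>p q. \<epsilon> (i \<bullet> q) \<odot>\<^bsub>H\<^esub> p"]
      by (simp add: lin_smult[OF L, simplified] cong: sw_cong)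
    finally show "sw KK i (\<lambda>u v. \<phi> i (Z u v)) = sw KK \<one>\<^bsub>H\<^esub> (\<lambda>p q. \<epsilon> (i \<bullet> q) \<otimes>\<^bsub>K\<^esub> \<phi> i (x \<bullet> S p))" .
  qed
  also have "\<dots> = sw KK \<one>\<^bsub>H\<^esub> (\<lambda>p q. \<Oplus>\<^bsub>KK\<^esub>i\<in>B. \<epsilon> (i \<bullet> q) \<otimes>\<^bsub>K\<^esub> \<phi> i (x \<bullet> S p))"
    by (rule sw_finsum) (simp_all add: B)
  \<comment> \<open>For fixed \<open>p\<close> and \<open>q\<close> this is the trace of the
    rank-one map \<open>h\<close> to \<open>\<epsilon> (h q) x S p\<close>, hence the value of the
    functional at the vector.\<close>
  also have "\<dots> = sw KK \<one>\<^bsub>H\<^esub> (\<lambda>p q. \<epsilon> (x \<bullet> (S p \<bullet> q)))"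
  proof (intro sw_cong refl H_one_closed)
    fix p q assume [simp]: "p \<in> carrier H" "q \<in> carrier H"
    have "\<epsilon> ((x \<bullet> S p) \<bullet> q) = (\<Oplus>\<^bsub>KK\<^esub>i\<in>B. \<phi> i (x \<bullet> S p) \<otimes>\<^bsub>K\<^esub> \<epsilon> (i \<bullet> q))"
      using expand_lin[OF module_KK counit_lin_mult(2), of q "x \<bullet> S p"] by simp
    then show "(\<Oplus>\<^bsub>KK\<^esub>i\<in>B. \<epsilon> (i \<bullet> q) \<otimes>\<^bsub>K\<^esub> \<phi> i (x \<bullet> S p)) = \<epsilon> (x \<bullet> (S p \<bullet> q))"
      by (simp add: K_comm H_assoc cong: finsum_cong_raw)
  qed
  also have "\<dots> = \<epsilon> (x \<bullet> PR \<one>\<^bsub>H\<^esub>)"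
    using sw_push[OF counit_lin_mult(1)[OF x], of "\<one>\<^bsub>H\<^esub>" "\<lambda>p q. S p \<bullet> q"] by (simp add: sw_S_mult)
  finally show ?thesis by (simp add: P_one)
qed

text \<open>It suffices to write the element as a linear combination of values of \<open>PL\<close>,
  which are fixed by idempotency. After \<open>sw_mult_SS_split\<close> the sum over
  \<open>k\<close> can be contracted, and coassociativity brings a leg and its neighbour together as
  \<open>a S p\<close>, which is a value of \<open>PL\<close>.\<close>

lemma trace_integral_PL:
  assumes j [simp]: "j \<in> B" and x [simp]: "x \<in> carrier H"
  shows "PL (sw H x (\<lambda>u v. trace_integral j v \<odot>\<^bsub>H\<^esub> u)) = sw H x (\<lambda>u v. trace_integral j v \<odot>\<^bsub>H\<^esub> u)"
proof -
  define \<gamma> where "\<gamma> k z = sw KK z (\<lambda>u v. \<phi> k u \<otimes>\<^bsub>K\<^esub> \<phi> j v)" for k z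
  have Km [simp]: "a \<in> carrier K \<Longrightarrow> b \<in> carrier K \<Longrightarrow> a \<otimes>\<^bsub>K\<^esub> b \<in> carrier K" for a b
    using cring_K by (simp add: cring.cring_simprules)
  have \<gamma>L: "k \<in> B \<Longrightarrow> lin K H KK (\<gamma> k)" for k unfolding \<gamma>_def by (simp add: hsimps phi_lin_fun \<phi>)
  have \<gamma>c [simp]: "k \<in> B \<Longrightarrow> z \<in> carrier H \<Longrightarrow> \<gamma> k z \<in> carrier K" for k z using lin_closed[OF \<gamma>L] by simp
  note \<gamma>_fun = lin_compose[OF \<gamma>L]
  \<comment> \<open>What the summand for the basis element \<open>m\<close> becomes: scalars times
    values of \<open>PL\<close>.\<close>
  define R where "R m = sw H (x \<bullet> S (S m)) (\<lambda>y v. \<phi> j v \<odot>\<^bsub>H\<^esub> sw H y (\<lambda>z q. \<phi> m q \<odot>\<^bsub>H\<^esub> PL z))" for m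
  have Rc [simp]: "m \<in> B \<Longrightarrow> R m \<in> carrier H" for m by (simp add: R_def)
  let ?Q = "\<lambda>k p m. sw H (x \<bullet> S (S m)) (\<lambda>a b. \<gamma> k b \<odot>\<^bsub>H\<^esub> (a \<bullet> S p))"
  have "sw H x (\<lambda>u v. trace_integral j v \<odot>\<^bsub>H\<^esub> u) =
      sw H x (\<lambda>u v. \<Oplus>\<^bsub>H\<^esub>k\<in>B. \<gamma> k (v \<bullet> S (S k)) \<odot>\<^bsub>H\<^esub> u)"
    unfolding trace_integral_def \<gamma>_def[symmetric]
    by (intro sw_cong refl x lin_finsum_push[OF lin_scalar module_KK module_C B(1)]) simp_all
  also have "\<dots> = (\<Oplus>\<^bsub>H\<^esub>k\<in>B. sw H x (\<lambda>u v. \<gamma> k (v \<bullet> S (S k)) \<odot>\<^bsub>H\<^esub> u))"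
    by (rule sw_finsum[symmetric]) (simp_all add: B)
  also have "\<dots> = (\<Oplus>\<^bsub>H\<^esub>k\<in>B. sw H k (\<lambda>p q. ?Q k p q))"
    by (intro finsum_cong_raw sw_mult_SS_split[where F = "\<lambda>a b. \<gamma> k b \<odot>\<^bsub>H\<^esub> a" for k])
      (simp_all add: hsimps \<gamma>_fun \<gamma>L)
  \<comment> \<open>The second leg of \<open>k\<close> sits inside the coproduct of
    \<open>x S (S q)\<close>. Expanding it in the basis fixes that coproduct, so that it can be
    taken before the sum over \<open>k\<close>.\<close>
  also have "\<dots> = (\<Oplus>\<^bsub>H\<^esub>k\<in>B. sw H k (\<lambda>p q. \<Oplus>\<^bsub>H\<^esub>m\<in>B. \<phi> m q \<odot>\<^bsub>H\<^esub> ?Q k p m))"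
    by (intro finsum_cong_raw sw_cong refl expand_lin) (simp_all add: hsimps \<gamma>_fun \<gamma>L)
  also have "\<dots> = (\<Oplus>\<^bsub>H\<^esub>k\<in>B. \<Oplus>\<^bsub>H\<^esub>m\<in>B. sw H k (\<lambda>p q. \<phi> m q \<odot>\<^bsub>H\<^esub> ?Q k p m))"
    by (intro finsum_cong_raw sw_finsum[symmetric]) (simp_all add: B)
  also have "\<dots> = (\<Oplus>\<^bsub>H\<^esub>m\<in>B. \<Oplus>\<^bsub>H\<^esub>k\<in>B. sw H k (\<lambda>p q. \<phi> m q \<odot>\<^bsub>H\<^esub> ?Q k p m))"
    by (rule sum_swap) simp_all
  also have "\<dots> = (\<Oplus>\<^bsub>H\<^esub>m\<in>B. R m)"
  proof (intro finsum_cong_raw)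
    fix m assume m [simp]: "m \<in> B"
    let ?W = "x \<bullet> S (S m)" and ?\<Omega> = "\<lambda>a k. sw H k (\<lambda>p q. \<phi> m q \<odot>\<^bsub>H\<^esub> (a \<bullet> S p))"
    have W [simp]: "?W \<in> carrier H" by simp
    have sc: "c \<odot>\<^bsub>H\<^esub> sw H h F = sw H h (\<lambda>x y. c \<odot>\<^bsub>H\<^esub> F x y)"
      if "c \<in> carrier K" "h \<in> carrier H" "\<And>x y. x \<in> carrier H \<Longrightarrow> y \<in> carrier H \<Longrightarrow> F x y \<in> carrier H" for c h F
      by (rule sw_push[OF lin_smult_fun[OF lin_id]]) (use that in simp_all)
    have cc: "c \<odot>\<^bsub>H\<^esub> (d \<odot>\<^bsub>H\<^esub> z) = d \<odot>\<^bsub>H\<^esub> (c \<odot>\<^bsub>H\<^esub> z)" if "c \<in> carrier K" "d \<in> carrier K" "z \<in> carrier H" for c d z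
      using that by (simp add: K_comm flip: smult_assoc1)
    have "(\<Oplus>\<^bsub>H\<^esub>k\<in>B. sw H k (\<lambda>p q. \<phi> m q \<odot>\<^bsub>H\<^esub> ?Q k p m)) =
        (\<Oplus>\<^bsub>H\<^esub>k\<in>B. sw H k (\<lambda>p q. sw H ?W (\<lambda>a b. \<gamma> k b \<odot>\<^bsub>H\<^esub> (\<phi> m q \<odot>\<^bsub>H\<^esub> (a \<bullet> S p)))))"
      by (intro finsum_cong_raw sw_cong refl) (simp_all add: sc cc cong: sw_cong)
    also have "\<dots> = (\<Oplus>\<^bsub>H\<^esub>k\<in>B. sw H ?W (\<lambda>a b. sw H k (\<lambda>p q. \<gamma> k b \<odot>\<^bsub>H\<^esub> (\<phi> m q \<odot>\<^bsub>H\<^esub> (a \<bullet> S p)))))"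
      by (intro finsum_cong_raw sw_swap) simp_all
    also have "\<dots> = (\<Oplus>\<^bsub>H\<^esub>k\<in>B. sw H ?W (\<lambda>a b. \<gamma> k b \<odot>\<^bsub>H\<^esub> ?\<Omega> a k))"
      by (intro finsum_cong_raw sw_cong refl W) (simp_all add: sc)
    also have "\<dots> = sw H ?W (\<lambda>a b. \<Oplus>\<^bsub>H\<^esub>k\<in>B. \<gamma> k b \<odot>\<^bsub>H\<^esub> ?\<Omega> a k)"
      by (rule sw_finsum) (simp_all add: B)
    also have "\<dots> = sw H ?W (\<lambda>a b. sw H b (\<lambda>u v. \<phi> j v \<odot>\<^bsub>H\<^esub> ?\<Omega> a u))"
    proof (intro sw_cong refl W)
      fix a b assume [simp]: "a \<in> carrier H" "b \<in> carrier H"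
      have "(\<Oplus>\<^bsub>H\<^esub>k\<in>B. \<gamma> k b \<odot>\<^bsub>H\<^esub> ?\<Omega> a k) =
          (\<Oplus>\<^bsub>H\<^esub>k\<in>B. sw H b (\<lambda>u v. \<phi> k u \<odot>\<^bsub>H\<^esub> (\<phi> j v \<odot>\<^bsub>H\<^esub> ?\<Omega> a k)))"
        unfolding \<gamma>_def
        by (intro finsum_cong_raw) (simp add: sw_push[OF lin_scalar] smult_assoc1 cong: sw_cong)
      also have "\<dots> = sw H b (\<lambda>u v. \<Oplus>\<^bsub>H\<^esub>k\<in>B. \<phi> k u \<odot>\<^bsub>H\<^esub> (\<phi> j v \<odot>\<^bsub>H\<^esub> ?\<Omega> a k))"
        by (rule sw_finsum) (simp_all add: B)
      \<comment> \<open>The contraction: the coordinates of \<open>u\<close> reassemble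
        \<open>u\<close> inside the linear map \<open>?\<Omega> a\<close>.\<close>
      also have "\<dots> = sw H b (\<lambda>u v. \<phi> j v \<odot>\<^bsub>H\<^esub> ?\<Omega> a u)"
        by (intro sw_cong refl expand_lin[symmetric]) (simp_all add: hsimps phi_lin_fun \<phi>)
      finally show "(\<Oplus>\<^bsub>H\<^esub>k\<in>B. \<gamma> k b \<odot>\<^bsub>H\<^esub> ?\<Omega> a k) = sw H b (\<lambda>u v. \<phi> j v \<odot>\<^bsub>H\<^esub> ?\<Omega> a u)" .
    qed
    also have "\<dots> = sw H ?W (\<lambda>y v. sw H y (\<lambda>a u. \<phi> j v \<odot>\<^bsub>H\<^esub> ?\<Omega> a u))"
      by (rule sw_coassoc[symmetric]) (simp_all add: hsimps phi_lin_fun \<phi>)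
    also have "\<dots> = sw H ?W (\<lambda>y v. \<phi> j v \<odot>\<^bsub>H\<^esub> sw H y (\<lambda>a u. ?\<Omega> a u))"
      by (intro sw_cong refl W) (simp add: sc)
    also have "\<dots> = sw H ?W (\<lambda>y v. \<phi> j v \<odot>\<^bsub>H\<^esub> sw H y (\<lambda>z q. sw H z (\<lambda>a p. \<phi> m q \<odot>\<^bsub>H\<^esub> (a \<bullet> S p))))"
      by (intro sw_cong refl W arg_cong[of _ _ "smult H c" for c] sw_coassoc[symmetric])
        (simp_all add: hsimps phi_lin_fun \<phi>)
    also have "\<dots> = R m"
      unfolding R_def by (simp add: sc[symmetric] sw_mult_S cong: sw_cong)
    finally show "(\<Oplus>\<^bsub>H\<^esub>k\<in>B. sw H k (\<lambda>p q. \<phi> m q \<odot>\<^bsub>H\<^esub> ?Q k p m)) = R m" .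
  qed
  finally have eq: "sw H x (\<lambda>u v. trace_integral j v \<odot>\<^bsub>H\<^esub> u) = (\<Oplus>\<^bsub>H\<^esub>m\<in>B. R m)" .
  have "PL (R m) = R m" if [simp]: "m \<in> B" for m
    unfolding R_def
    by (simp add: sw_push[OF lin_PL] lin_smult[OF lin_PL] PL_PL cong: sw_cong)
  then show ?thesis
    unfolding eq by (subst lin_finsum_push[OF lin_PL module_C module_C B(1)]) (simp_all cong: finsum_cong_raw)
qed

end

end

lemma lin_opposite: "lin K (opposite A) G f = lin K A G f"
  by (simp add: lin_def module_hom_def)

context weak_hopf_algebra
begin

lemma integrals_right:
  assumes "field K" "vectorspace.fin_dim K H"
  obtains B t where "finite B" "B \<subseteq> carrier H" "\<And>j. j \<in> B \<Longrightarrow> lin K H KK (t j)"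
    "\<And>x. x \<in> carrier H \<Longrightarrow> (\<Oplus>\<^bsub>KK\<^esub>j\<in>B. t j (x \<bullet> S j)) = \<epsilon> x"
    "\<And>j x. j \<in> B \<Longrightarrow> x \<in> carrier H \<Longrightarrow>
      PL (sw H x (\<lambda>u v. t j v \<odot>\<^bsub>H\<^esub> u)) = sw H x (\<lambda>u v. t j v \<odot>\<^bsub>H\<^esub> u)"
proof -
  interpret V: vectorspace K H using assms(1) by (simp add: vectorspace_def module_C)
  show ?thesis
  proof (rule V.dual_basis[OF assms(2)])
    fix B \<phi>
    assume B: "finite B" "B \<subseteq> carrier H" "\<And>b. b \<in> B \<Longrightarrow> lin K H KK (\<phi> b)"
      "\<And>v. v \<in> carrier H \<Longrightarrow> (\<Oplus>\<^bsub>H\<^esub>b\<in>B. \<phi> b v \<odot>\<^bsub>H\<^esub> b) = v"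
    show ?thesis
      by (rule that[OF B(1,2) trace_integral_lin[OF B] trace_integral_sum[OF B] trace_integral_PL[OF B]])
  qed
qed

text \<open>\<open>integrals_right\<close> for the opposite algebra: \<open>PL\<close> becomes
  \<open>PB\<close>, and \<open>n j\<close> is \<open>S_inv j\<close>. This is where bijectivity of
  the antipode is used.\<close>

lemma integrals_left:
  assumes K: "field K" and fd: "vectorspace.fin_dim K H"
  obtains B n t where "finite B" "B \<subseteq> carrier H" "\<And>j. j \<in> B \<Longrightarrow> n j \<in> carrier H"
    "\<And>j. j \<in> B \<Longrightarrow> lin K H KK (t j)"
    "\<And>x. x \<in> carrier H \<Longrightarrow> (\<Oplus>\<^bsub>KK\<^esub>j\<in>B. t j (n j \<bullet> x)) = \<epsilon> x"
    "\<And>j x. j \<in> B \<Longrightarrow> x \<in> carrier H \<Longrightarrow>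
      PB (sw H x (\<lambda>u v. t j v \<odot>\<^bsub>H\<^esub> u)) = sw H x (\<lambda>u v. t j v \<odot>\<^bsub>H\<^esub> u)"
proof -
  have bij: "bij_betw S (carrier H) (carrier H)" by (rule S_bij[OF K fd])
  interpret op: weak_hopf_algebra K "opposite H" \<Delta> \<epsilon> S_inv by (rule weak_hopf_opposite[OF bij])
  interpret V: vectorspace K H using K by (simp add: vectorspace_def module_C)
  interpret V': vectorspace K "opposite H" using K by (simp add: vectorspace_def op.module_C)
  \<comment> \<open>The opposite algebra is another record, so finite dimension has to be carried
    over; linear combinations do not see the product.\<close>
  have "V'.fin_dim"
  proof -
    obtain A where A: "finite A" "A \<subseteq> carrier H" "gen_set A" using fd by (auto simp: V.fin_dim_def)
    have "op.lincomb a Z = lincomb a Z" for a Z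
    proof -
      have "finprod (add_monoid (opposite H)) h Y = finprod (add_monoid H) h Y" for h :: "'h \<Rightarrow> 'h" and Y
        by (simp add: finprod_def)
      then show ?thesis by (simp add: op.lincomb_def lincomb_def finsum_def)
    qed
    then have "op.gen_set A" using A(3) by (simp add: op.span_def span_def)
    then show ?thesis using A by (auto simp: V'.fin_dim_def)
  qed
  then show ?thesis
  proof (rule op.integrals_right[OF K])
    fix B t
    assume Bt: "finite B" "B \<subseteq> carrier (opposite H)"
      "\<And>j. j \<in> B \<Longrightarrow> lin K (opposite H) op.KK (t j)"
      "\<And>x. x \<in> carrier (opposite H) \<Longrightarrow> (\<Oplus>\<^bsub>op.KK\<^esub>j\<in>B. t j (op.hmul x (S_inv j))) = \<epsilon> x"
      "\<And>j x. j \<in> B \<Longrightarrow> x \<in> carrier (opposite H) \<Longrightarrow>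
        op.PL (op.sw (opposite H) x (\<lambda>u v. t j v \<odot>\<^bsub>opposite H\<^esub> u)) =
        op.sw (opposite H) x (\<lambda>u v. t j v \<odot>\<^bsub>opposite H\<^esub> u)"
    have sw: "op.sw (opposite H) x f = sw H x f" for x f
      by (simp add: op.sw_def sw_def tensor_sum_opposite)
    have PL: "PiL (opposite H) \<Delta> \<epsilon> h = PB h" for h
      by (simp add: PiL_def PB_def sw_def tensor_sum_opposite)
    show ?thesis
    proof (rule that[of B S_inv t])
      show "S_inv j \<in> carrier H" if "j \<in> B" for j
        using op.S_closed[of j] Bt(2) that by auto
      show "PB (sw H x (\<lambda>u v. t j v \<odot>\<^bsub>H\<^esub> u)) = sw H x (\<lambda>u v. t j v \<odot>\<^bsub>H\<^esub> u)"
        if "j \<in> B" "x \<in> carrier H" for j x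
        using Bt(5)[OF that(1)] that(2) by (simp only: sw PL opposite_simps)
    qed (use Bt in \<open>simp_all add: lin_opposite\<close>)
  qed
qed

end

section \<open>Comodule algebras\<close>

context comodule_algebra
begin

abbreviation amul (infixl "\<diamond>" 70) where "x \<diamond> y \<equiv> x \<otimes>\<^bsub>A\<^esub> y"
abbreviation KK where "KK \<equiv> regular_bimodule K"
abbreviation AH where "AH \<equiv> ktensor K A H"
abbreviation "PL \<equiv> PiL H \<Delta> \<epsilon>"

text \<open>\<open>rs G a F\<close> is \<open>\<Sum> F a\<^bsub>[0]\<^esub> a\<^bsub>[1]\<^esub>\<close>, computed in \<open>G\<close>.\<close>

definition rs :: "('k, 'g, 'w) module_scheme \<Rightarrow> 'a \<Rightarrow> ('a \<Rightarrow> 'h \<Rightarrow> 'g) \<Rightarrow> 'g" where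
  "rs G a F = tensor_sum G (\<rho> a) F"

lemma assoc_algebra_A [simp]: "assoc_algebra K A" by (rule A.assoc_algebra_axioms)

lemma module_A [simp]: "module K A" by (rule A.module_axioms)

lemma module_H [simp]: "module K H" by (rule H.module_C)

lemma module_AH [simp]: "module K AH" by (rule module_ktensor) simp_all

lemma ring_A: "ring A" using assoc_algebra_A by (simp add: assoc_algebra_def)

lemma A_mult_closed [simp]: "x \<in> carrier A \<Longrightarrow> y \<in> carrier A \<Longrightarrow> x \<diamond> y \<in> carrier A"
  and A_one_closed [simp]: "\<one>\<^bsub>A\<^esub> \<in> carrier A"
  and A_one_left [simp]: "x \<in> carrier A \<Longrightarrow> \<one>\<^bsub>A\<^esub> \<diamond> x = x"
  and A_one_right [simp]: "x \<in> carrier A \<Longrightarrow> x \<diamond> \<one>\<^bsub>A\<^esub> = x"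
  and A_assoc: "x \<in> carrier A \<Longrightarrow> y \<in> carrier A \<Longrightarrow> z \<in> carrier A \<Longrightarrow> (x \<diamond> y) \<diamond> z = x \<diamond> (y \<diamond> z)"
  using ring.ring_simprules[OF ring_A] by auto

lemma lin_amul:
  "lin K M A f \<Longrightarrow> a \<in> carrier A \<Longrightarrow> lin K M A (\<lambda>x. a \<diamond> f x)"
  "lin K M A f \<Longrightarrow> a \<in> carrier A \<Longrightarrow> lin K M A (\<lambda>x. f x \<diamond> a)"
  by (rule lin_amult; simp)+

lemma lin_coaction: "lin K A AH \<rho>"
  using coaction_linear by (simp add: lin_def)

lemma coaction_closed [simp]: "a \<in> carrier A \<Longrightarrow> \<rho> a \<in> carrier AH"
  by (rule lin_closed[OF lin_coaction])

lemma rs_cong: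
  "a = a' \<Longrightarrow> a' \<in> carrier A \<Longrightarrow>
   (\<And>x y. x \<in> carrier A \<Longrightarrow> y \<in> carrier H \<Longrightarrow> F x y = F' x y) \<Longrightarrow> rs G a F = rs G a' F'"
  unfolding rs_def by (simp, rule ktensor_sum_cong_raw[OF module_A module_H coaction_closed]) auto

lemma rs_closed [simp]:
  "module K G \<Longrightarrow> a \<in> carrier A \<Longrightarrow> (\<And>x y. x \<in> carrier A \<Longrightarrow> y \<in> carrier H \<Longrightarrow> F x y \<in> carrier G) \<Longrightarrow>
   rs G a F \<in> carrier G"
  unfolding rs_def by (rule ktensor_sum_closed[OF module_A module_H]) auto

lemma lin_rs_arg:
  assumes "lin K M A f" "bil K A H G F" "module K G"
  shows "lin K M G (\<lambda>x. rs G (f x) F)"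
  unfolding rs_def
  by (rule lin_compose[OF ktensor_sum_lin[OF module_A module_H assms(3,2)] lin_compose[OF lin_coaction assms(1)]])

lemma lin_rs_fun:
  assumes "a \<in> carrier A" "\<And>x y. x \<in> carrier A \<Longrightarrow> y \<in> carrier H \<Longrightarrow> lin K M G (\<lambda>p. F p x y)" "module K G"
  shows "lin K M G (\<lambda>p. rs G a (F p))"
  unfolding rs_def
  by (rule lin_ktensor_sum_fun[OF module_A module_H assms(3)]) (use assms in auto)

lemma rs_push:
  assumes "lin K G G' f" "module K G" "module K G'" "a \<in> carrier A"
    and "\<And>x y. x \<in> carrier A \<Longrightarrow> y \<in> carrier H \<Longrightarrow> F x y \<in> carrier G"
  shows "f (rs G a F) = rs G' a (\<lambda>x y. f (F x y))"
  unfolding rs_def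
  by (rule lin_ktensor_sum[OF module_A module_H]) (use assms in auto)

lemma rs_swap:
  assumes "module K G" "a \<in> carrier A" "b \<in> carrier A"
    and "\<And>x y u v. x \<in> carrier A \<Longrightarrow> y \<in> carrier H \<Longrightarrow> u \<in> carrier A \<Longrightarrow> v \<in> carrier H \<Longrightarrow> F x y u v \<in> carrier G"
  shows "rs G a (\<lambda>x y. rs G b (\<lambda>u v. F x y u v)) = rs G b (\<lambda>u v. rs G a (\<lambda>x y. F x y u v))"
  unfolding rs_def
  by (rule ktensor_sum_swap[OF module_A module_H module_A module_H]) (use assms in auto)

text \<open>As for \<open>sw_coassoc\<close>, with the evaluation map on
  \<open>(A \<otimes> H) \<otimes> H\<close>.\<close>

lemma rs_coassoc:
  assumes "module K G" "a \<in> carrier A" "tri K A H H G F"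
  shows "rs G a (\<lambda>x y. rs G x (\<lambda>u v. F u v y)) = rs G a (\<lambda>x y. H.sw G y (\<lambda>u v. F x u v))"
proof -
  let ?T = "ktensor K AH H"
  have mT: "module K ?T" by (intro module_ktensor) simp_all
  note pc = ktensor_pure_closed[OF module_AH module_H] ktensor_pure_closed[OF module_A module_H]
  note evA = lin_ktensor_sum[OF module_A module_H mT assms(1)
      tri_lin[OF module_A module_H module_H assms(1,3)]]
  note evH = lin_ktensor_sum[OF module_H module_H mT assms(1)
      tri_lin[OF module_A module_H module_H assms(1,3)]]
  note ep = tri_eval_pure[OF module_A module_H module_H assms(1,3)]
    tri_eval_inner[OF module_A module_H module_H assms(1,3)]
  let ?ev = "\<lambda>Y. tensor_sum G Y (\<lambda>t z. tensor_sum G t (\<lambda>u v. F u v z))"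
  have "rs G a (\<lambda>x y. rs G x (\<lambda>u v. F u v y)) =
      ?ev (tensor_sum ?T (\<rho> a) (\<lambda>x y. pure_tensor ?T (\<rho> x) y))"
    unfolding rs_def using assms(2)
    by (subst evA) (auto simp: pc ep intro!: ktensor_sum_cong_raw[OF module_A module_H])
  also have "\<dots> = ?ev (tensor_sum ?T (\<rho> a)
        (\<lambda>x y. tensor_sum ?T (\<Delta> y) (\<lambda>u v. pure_tensor ?T (pure_tensor AH x u) v)))"
    using coaction_coassoc[OF assms(2)] by simp
  also have "\<dots> = rs G a (\<lambda>x y. H.sw G y (\<lambda>u v. F x u v))"
    unfolding rs_def H.sw_def
    apply (subst evA)
      apply (use assms(2) in \<open>auto simp: pc intro!: ktensor_sum_closed[OF module_H module_H mT]\<close>)[2]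
    apply (rule ktensor_sum_cong_raw[OF module_A module_H])
     apply (use assms(2) in simp)
    apply (subst evH)
      apply (auto simp: pc ep intro!: ktensor_sum_cong_raw[OF module_H module_H])
    done
  finally show ?thesis .
qed

lemma rs_counit:
  assumes "module K G" "lin K A G f" "a \<in> carrier A"
  shows "rs G a (\<lambda>x y. \<epsilon> y \<odot>\<^bsub>G\<^esub> f x) = f a"
proof -
  have "f a = f (rs A a (\<lambda>x y. \<epsilon> y \<odot>\<^bsub>A\<^esub> x))"
    using coaction_counit[OF assms(3)] by (simp add: rs_def)
  also have "\<dots> = rs G a (\<lambda>x y. f (\<epsilon> y \<odot>\<^bsub>A\<^esub> x))"
    by (rule rs_push) (use assms in \<open>auto simp: H.module_smult_closed\<close>)
  also have "\<dots> = rs G a (\<lambda>x y. \<epsilon> y \<odot>\<^bsub>G\<^esub> f x)"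
    by (rule rs_cong) (use assms in \<open>auto simp: lin_smult[OF assms(2)]\<close>)
  finally show ?thesis ..
qed

lemma rs_mult:
  assumes G: "module K G" and a: "a \<in> carrier A" and b: "b \<in> carrier A" and F: "bil K A H G F"
  shows "rs G (a \<diamond> b) F = rs G a (\<lambda>x y. rs G b (\<lambda>u v. F (x \<diamond> u) (y \<bullet> v)))"
proof -
  note pc = ktensor_pure_closed[OF module_A module_H]
  note ev = lin_ktensor_sum[OF module_A module_H module_AH G ktensor_sum_lin[OF module_A module_H G F]]
  show ?thesis
    unfolding rs_def coaction_mult[OF a b]
    apply (subst ev)
      apply (use a b in \<open>auto simp: pc intro!: ktensor_sum_closed[OF module_A module_H module_AH]\<close>)[2]
    apply (rule ktensor_sum_cong_raw[OF module_A module_H])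
     apply (use a in simp)
    apply (subst ev)
      apply (use b in \<open>auto simp: pc ktensor_sum_pure[OF module_A module_H G F]
        intro!: ktensor_sum_cong_raw[OF module_A module_H]\<close>)
    done
qed

lemma rs_PL:
  assumes G: "module K G" and a: "a \<in> carrier A" and F: "bil K A H G F"
  shows "rs G a (\<lambda>x y. F x (PL y)) = rs G \<one>\<^bsub>A\<^esub> (\<lambda>u v. F (u \<diamond> a) v)"
proof -
  note pc = ktensor_pure_closed[OF module_A module_H]
  note ev = lin_ktensor_sum[OF module_A module_H module_AH G ktensor_sum_lin[OF module_A module_H G F]]
  note kc = ktensor_sum_cong_raw[OF module_A module_H] ktensor_sum_pure[OF module_A module_H G F]
  have "rs G a (\<lambda>x y. F x (PL y)) = tensor_sum G (tensor_sum AH (\<rho> a) (\<lambda>a0 a1. pure_tensor AH a0 (PL a1))) F"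
    unfolding rs_def using a by (subst ev) (auto simp: pc kc(2) intro!: kc(1))
  also have "\<dots> = rs G \<one>\<^bsub>A\<^esub> (\<lambda>u v. F (u \<diamond> a) v)"
    unfolding rs_def coaction_one[OF a] using a by (subst ev) (auto simp: pc kc(2) intro!: kc(1))
  finally show ?thesis .
qed

lemmas asimps = bil_def tri_def H.lin_rules H.lin_P lin_amul lin_rs_arg lin_rs_fun H.module_smult_closed

lemma rs_one_PL:
  "module K G \<Longrightarrow> bil K A H G F \<Longrightarrow> rs G \<one>\<^bsub>A\<^esub> (\<lambda>x y. F x (PL y)) = rs G \<one>\<^bsub>A\<^esub> F"
  by (simp add: rs_PL cong: rs_cong)

text \<open>\<open>a_0 \<otimes> PB a_1 = a 1_0 \<otimes> 1_1\<close>, the counterpart of the axiom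
  on \<open>PL\<close> with the unit on the right. A counit is inserted at \<open>a 1_0\<close>;
  since the second leg of \<open>\<rho> 1\<close> lies in the image of \<open>PL\<close>, its
  coproduct is known, and the two coactions then recombine to that of \<open>a 1\<close>.\<close>

lemma rs_PB:
  assumes G [simp]: "module K G" and a [simp]: "a \<in> carrier A" and F: "bil K A H G F"
  shows "rs G a (\<lambda>x y. F x (H.PB y)) = rs G \<one>\<^bsub>A\<^esub> (\<lambda>u v. F (a \<diamond> u) v)"
proof -
  note [simp] = bil_closed[OF F] and FF = bil_lin_fun[OF F] bil_lin[OF F]
  have "rs G \<one>\<^bsub>A\<^esub> (\<lambda>u v. F (a \<diamond> u) v) = rs G \<one>\<^bsub>A\<^esub> (\<lambda>u v. rs G (a \<diamond> u) (\<lambda>x y. \<epsilon> y \<odot>\<^bsub>G\<^esub> F x v))"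
    by (intro rs_cong refl A_one_closed rs_counit[symmetric]) (simp_all add: FF)
  also have "\<dots> = rs G \<one>\<^bsub>A\<^esub> (\<lambda>u v. rs G a (\<lambda>x y. rs G u (\<lambda>p q. \<epsilon> (y \<bullet> q) \<odot>\<^bsub>G\<^esub> F (x \<diamond> p) v)))"
    by (intro rs_cong refl A_one_closed rs_mult) (simp_all add: asimps FF)
  also have "\<dots> = rs G a (\<lambda>x y. rs G \<one>\<^bsub>A\<^esub> (\<lambda>u v. rs G u (\<lambda>p q. \<epsilon> (y \<bullet> q) \<odot>\<^bsub>G\<^esub> F (x \<diamond> p) v)))"
    by (rule rs_swap) (simp_all add: asimps)
  also have "\<dots> = rs G a (\<lambda>x y. rs G \<one>\<^bsub>A\<^esub> (\<lambda>p z. H.sw G z (\<lambda>q v. \<epsilon> (y \<bullet> q) \<odot>\<^bsub>G\<^esub> F (x \<diamond> p) v)))"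
    by (rule rs_cong[OF refl a], rule rs_coassoc) (simp_all add: asimps FF)
  also have "\<dots> = rs G a (\<lambda>x y. rs G \<one>\<^bsub>A\<^esub> (\<lambda>p z. H.sw G (PL z) (\<lambda>q v. \<epsilon> (y \<bullet> q) \<odot>\<^bsub>G\<^esub> F (x \<diamond> p) v)))"
    by (rule rs_cong[OF refl a], rule rs_one_PL[symmetric]) (simp_all add: asimps FF)
  also have "\<dots> = rs G a (\<lambda>x y. rs G \<one>\<^bsub>A\<^esub> (\<lambda>p z. H.sw G \<one>\<^bsub>H\<^esub> (\<lambda>q v. \<epsilon> (y \<bullet> (PL z \<bullet> q)) \<odot>\<^bsub>G\<^esub> F (x \<diamond> p) v)))"
    by (rule rs_cong[OF refl a], rule rs_cong[OF refl A_one_closed], rule H.sw_of_PL(1)) (simp_all add: asimps FF)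
  also have "\<dots> = rs G a (\<lambda>x y. rs G \<one>\<^bsub>A\<^esub> (\<lambda>p z. H.sw G \<one>\<^bsub>H\<^esub> (\<lambda>q v. \<epsilon> ((y \<bullet> z) \<bullet> q) \<odot>\<^bsub>G\<^esub> F (x \<diamond> p) v)))"
    by (rule rs_cong[OF refl a], subst rs_one_PL) (simp_all add: asimps FF H.H_assoc cong: rs_cong H.sw_cong)
  also have "\<dots> = rs G (a \<diamond> \<one>\<^bsub>A\<^esub>) (\<lambda>x y. H.sw G \<one>\<^bsub>H\<^esub> (\<lambda>q v. \<epsilon> (y \<bullet> q) \<odot>\<^bsub>G\<^esub> F x v))"
    by (rule rs_mult[symmetric]) (simp_all add: asimps FF)
  also have "\<dots> = rs G a (\<lambda>x y. F x (H.PB y))"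
    by (simp add: H.PB_def H.sw_push[OF bil_lin(1)[OF F]] lin_smult[OF bil_lin(1)[OF F]]
        H.module_smult_closed cong: rs_cong H.sw_cong)
  finally show ?thesis ..
qed

end

lemma (in abelian_group) finsum_Sigma:
  assumes "finite J" "\<And>j. j \<in> J \<Longrightarrow> finite (Z j)"
    and "\<And>j z. j \<in> J \<Longrightarrow> z \<in> Z j \<Longrightarrow> f j z \<in> carrier G"
  shows "(\<Oplus>j\<in>J. \<Oplus>z\<in>Z j. f j z) = (\<Oplus>p\<in>Sigma J Z. f (fst p) (snd p))"
  using assms
proof (induction J rule: finite_induct)
  case empty
  show ?case by simp
next
  case (insert a J)
  have fin: "finite (Z a)" "finite (Sigma J Z)" using insert.prems(1) insert.hyps(1) by auto
  have cl: "\<And>j z. j = a \<or> j \<in> J \<Longrightarrow> z \<in> Z j \<Longrightarrow> f j z \<in> carrier G" using insert.prems(2) by blast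
  have s: "Sigma (insert a J) Z = Pair a ` Z a \<union> Sigma J Z" by blast
  have IH: "(\<Oplus>j\<in>J. \<Oplus>z\<in>Z j. f j z) = (\<Oplus>p\<in>Sigma J Z. f (fst p) (snd p))"
    by (rule insert.IH) (use insert.prems in blast)+
  have "(\<Oplus>p\<in>Sigma (insert a J) Z. f (fst p) (snd p)) =
      (\<Oplus>p\<in>Pair a ` Z a. f (fst p) (snd p)) \<oplus> (\<Oplus>p\<in>Sigma J Z. f (fst p) (snd p))"
    unfolding s
  proof (rule finsum_Un_disjoint)
    show "Pair a ` Z a \<inter> Sigma J Z = {}" using insert.hyps(2) by blast
  qed (use fin cl in \<open>auto simp: Pi_iff\<close>)
  also have "(\<Oplus>p\<in>Pair a ` Z a. f (fst p) (snd p)) = (\<Oplus>z\<in>Z a. f (fst (a, z)) (snd (a, z)))"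
    by (rule finsum_reindex) (use cl in \<open>auto simp: inj_on_def Pi_iff\<close>)
  finally have "(\<Oplus>p\<in>Sigma (insert a J) Z. f (fst p) (snd p)) =
      (\<Oplus>z\<in>Z a. f a z) \<oplus> (\<Oplus>j\<in>J. \<Oplus>z\<in>Z j. f j z)" by (simp only: fst_conv snd_conv IH)
  moreover have "(\<Oplus>j\<in>insert a J. \<Oplus>z\<in>Z j. f j z) = (\<Oplus>z\<in>Z a. f a z) \<oplus> (\<Oplus>j\<in>J. \<Oplus>z\<in>Z j. f j z)"
    by (rule finsum_insert[OF insert.hyps]) (use cl in \<open>auto simp: Pi_iff\<close>)
  ultimately show ?case by (rule trans[rotated, OF sym])
qed

locale comodule_algebra_hopf = comodule_algebra K H \<Delta> \<epsilon> A \<rho> + HS: weak_hopf_algebra K H \<Delta> \<epsilon> S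
  for K :: "('k, 'x) ring_scheme" and H :: "('k, 'h, 'y) module_scheme"
    and \<Delta> and \<epsilon> and A :: "('k, 'a, 'z) module_scheme" and \<rho> and S

context comodule_algebra
begin

section \<open>Coinvariants and how functionals on H produce them\<close>

abbreviation "coinv \<equiv> coinvariants K H A \<rho>"

lemma pure_AH_closed [simp]: "x \<in> carrier A \<Longrightarrow> y \<in> carrier H \<Longrightarrow> pure_tensor AH x y \<in> carrier AH"
  by (rule ktensor_pure_closed[OF module_A module_H])

lemma bil_pure_AH: "bil K A H AH (pure_tensor AH)"
  by (rule bil_pure[OF module_A module_H])

lemmas pure_lin = bil_lin_fun[OF bil_pure_AH]

lemma bil_lmult: "a \<in> carrier A \<Longrightarrow> bil K A H AH (\<lambda>x y. pure_tensor AH (a \<diamond> x) y)"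
  by (simp add: asimps pure_lin bil_lin[OF bil_pure_AH])

lemma lmult_sum:
  assumes "a \<in> carrier A" "t \<in> carrier AH" "module K G" "bil K A H G F"
  shows "tensor_sum G (tensor_lmult K H A a t) F = tensor_sum G t (\<lambda>x y. F (a \<diamond> x) y)"
  unfolding tensor_lmult_def
  by (subst lin_ktensor_sum[OF module_A module_H module_AH assms(3) ktensor_sum_lin[OF module_A module_H assms(3,4)]])
    (use assms in \<open>auto simp: ktensor_sum_pure[OF module_A module_H assms(3,4)]
      intro!: ktensor_sum_cong_raw[OF module_A module_H]\<close>)

lemma coinv_closed [simp]: "b \<in> coinv \<Longrightarrow> b \<in> carrier A"
  unfolding coinvariants_def by blast

lemma rs_coinv_left:
  assumes "b \<in> coinv" "a \<in> carrier A" "module K G" "bil K A H G F"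
  shows "rs G (b \<diamond> a) F = rs G a (\<lambda>x y. F (b \<diamond> x) y)"
proof -
  have "\<rho> (b \<diamond> a) = tensor_lmult K H A b (\<rho> a)" using assms(1,2) unfolding coinvariants_def by blast
  then show ?thesis
    unfolding rs_def
    using lmult_sum[OF coinv_closed[OF assms(1)] coaction_closed[OF assms(2)] assms(3,4)] by (rule ssubst)
qed

text \<open>Coinvariance is a condition on left multiplication; the version with \<open>b\<close> on
  the right comes from the axiom \<open>1_0 b \<otimes> 1_1 = b_0 \<otimes> PL b_1\<close> and from
  \<open>PL\<close> fixing the second leg of \<open>\<rho> 1\<close>. It makes the coaction linear
  over the coinvariants on both sides.\<close>

lemma rs_coinv:
  assumes b [simp]: "b \<in> coinv" and G [simp]: "module K G" and F: "bil K A H G F"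
  shows "rs G b F = rs G \<one>\<^bsub>A\<^esub> (\<lambda>x y. F (b \<diamond> x) y)" "rs G b F = rs G \<one>\<^bsub>A\<^esub> (\<lambda>x y. F (x \<diamond> b) y)"
proof -
  note [simp] = bil_closed[OF F] and FF = bil_lin_fun[OF F] bil_lin[OF F]
  show 1: "rs G b F = rs G \<one>\<^bsub>A\<^esub> (\<lambda>x y. F (b \<diamond> x) y)"
    using rs_coinv_left[OF b A_one_closed G F] by simp
  have "rs G \<one>\<^bsub>A\<^esub> (\<lambda>x y. F (x \<diamond> b) y) = rs G b (\<lambda>x y. F x (PL y))"
    by (rule rs_PL[symmetric]) (simp_all add: F)
  also have "\<dots> = rs G (b \<diamond> \<one>\<^bsub>A\<^esub>) (\<lambda>x y. F x (PL y))" by simp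
  also have "\<dots> = rs G \<one>\<^bsub>A\<^esub> (\<lambda>x y. F (b \<diamond> x) (PL y))"
    by (rule rs_coinv_left) (simp_all add: asimps FF)
  also have "\<dots> = rs G \<one>\<^bsub>A\<^esub> (\<lambda>x y. F (b \<diamond> x) y)"
    by (rule rs_one_PL) (simp_all add: asimps FF)
  finally show "rs G b F = rs G \<one>\<^bsub>A\<^esub> (\<lambda>x y. F (x \<diamond> b) y)" using 1 by simp
qed

lemma rs_coinv_right:
  assumes b [simp]: "b \<in> coinv" and a [simp]: "a \<in> carrier A" and G [simp]: "module K G" and F: "bil K A H G F"
  shows "rs G (a \<diamond> b) F = rs G a (\<lambda>x y. F (x \<diamond> b) y)"
proof -
  note [simp] = bil_closed[OF F] and FF = bil_lin_fun[OF F] bil_lin[OF F]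
  have "rs G (a \<diamond> b) F = rs G a (\<lambda>x y. rs G b (\<lambda>u v. F (x \<diamond> u) (y \<bullet> v)))"
    by (rule rs_mult) (simp_all add: F)
  also have "\<dots> = rs G a (\<lambda>x y. rs G \<one>\<^bsub>A\<^esub> (\<lambda>u v. F ((x \<diamond> u) \<diamond> b) (y \<bullet> v)))"
    by (rule rs_cong[OF refl a], subst rs_coinv(2)) (simp_all add: asimps FF A_assoc cong: rs_cong)
  also have "\<dots> = rs G (a \<diamond> \<one>\<^bsub>A\<^esub>) (\<lambda>x y. F (x \<diamond> b) y)"
    by (rule rs_mult[symmetric]) (simp_all add: asimps FF)
  finally show ?thesis by simp
qed

lemma rs_self: "a \<in> carrier A \<Longrightarrow> rs AH a (pure_tensor AH) = \<rho> a"
  unfolding rs_def by (rule ktensor_sum_self[OF module_A module_H]) simp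

lemma lmult_coaction: "tensor_lmult K H A b (\<rho> a) = rs AH a (\<lambda>x y. pure_tensor AH (b \<diamond> x) y)"
  by (simp add: tensor_lmult_def rs_def)

text \<open>It is enough to test \<open>\<rho> b = b \<rho> 1\<close>, because
  \<open>\<rho> (b a) = \<rho> b \<rho> a\<close> and
  \<open>\<rho> 1 \<rho> a = \<rho> a\<close>.\<close>

lemma coinvI:
  assumes b [simp]: "b \<in> carrier A"
    and eq: "\<And>F. bil K A H AH F \<Longrightarrow> rs AH b F = rs AH \<one>\<^bsub>A\<^esub> (\<lambda>x y. F (b \<diamond> x) y)"
  shows "b \<in> coinv"
  unfolding coinvariants_def
proof (intro CollectI conjI ballI b)
  note FF = pure_lin bil_lin[OF bil_pure_AH]
  fix a assume a [simp]: "a \<in> carrier A"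
  have "\<rho> (b \<diamond> a) = rs AH (b \<diamond> a) (pure_tensor AH)" by (simp add: rs_self)
  also have "\<dots> = rs AH b (\<lambda>x y. rs AH a (\<lambda>u v. pure_tensor AH (x \<diamond> u) (y \<bullet> v)))"
    by (rule rs_mult) (simp_all add: bil_pure_AH)
  also have "\<dots> = rs AH \<one>\<^bsub>A\<^esub> (\<lambda>x y. rs AH a (\<lambda>u v. pure_tensor AH (b \<diamond> (x \<diamond> u)) (y \<bullet> v)))"
    by (subst eq) (simp_all add: asimps FF A_assoc cong: rs_cong)
  also have "\<dots> = rs AH (\<one>\<^bsub>A\<^esub> \<diamond> a) (\<lambda>x y. pure_tensor AH (b \<diamond> x) y)"
    by (rule rs_mult[symmetric]) (simp_all add: bil_lmult)
  finally show "\<rho> (b \<diamond> a) = tensor_lmult K H A b (\<rho> a)" by (simp add: lmult_coaction)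
qed

text \<open>The action on \<open>A\<close> of a functional on \<open>H\<close>, that is, of the dual
  algebra on a comodule; \<tau> of the overview for the functional \<open>t\<close>.\<close>

definition hat :: "('h \<Rightarrow> 'k) \<Rightarrow> 'a \<Rightarrow> 'a" where
  "hat t a = rs A a (\<lambda>x y. t y \<odot>\<^bsub>A\<^esub> x)"

context
  fixes t :: "'h \<Rightarrow> 'k"
  assumes t: "lin K H KK t"
begin

lemma t_closed: "y \<in> carrier H \<Longrightarrow> t y \<in> carrier K"
  using lin_closed[OF t] by simp

lemmas t_lin = lin_compose[OF t] t

lemma lin_hat: "lin K A A (hat t)"
  unfolding hat_def[abs_def] by (simp add: asimps t_lin t_closed)

lemma hat_closed: "a \<in> carrier A \<Longrightarrow> hat t a \<in> carrier A"
  by (rule lin_closed[OF lin_hat])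

text \<open>The coaction at \<open>hat t a\<close> has second leg \<open>a_1 t(a_2)\<close>, which
  by \<open>int\<close> may be replaced by its image under \<open>PB\<close>. Then
  \<open>rs_PB\<close>, applied to \<open>hat t a\<close> itself, gives the criterion of
  \<open>coinvI\<close>.\<close>

lemma hat_coinv:
  assumes int: "\<And>x. x \<in> carrier H \<Longrightarrow>
      H.PB (H.sw H x (\<lambda>u v. t v \<odot>\<^bsub>H\<^esub> u)) = H.sw H x (\<lambda>u v. t v \<odot>\<^bsub>H\<^esub> u)"
    and a [simp]: "a \<in> carrier A"
  shows "hat t a \<in> coinv"
proof (rule coinvI)
  show h [simp]: "hat t a \<in> carrier A" by (simp add: hat_closed)
  fix F assume F: "bil K A H AH F"
  note [simp] = bil_closed[OF F] t_closed and FF = bil_lin_fun[OF F] bil_lin[OF F] t_lin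
  have L: "lin K A AH (\<lambda>x. rs AH x F')" if "bil K A H AH F'" for F'
    by (rule lin_rs_arg[OF lin_id that module_AH])
  have *: "rs AH (hat t a) F' = rs AH a (\<lambda>p z. F' p (H.sw H z (\<lambda>q y. t y \<odot>\<^bsub>H\<^esub> q)))"
    if F': "bil K A H AH F'" for F'
  proof -
    note [simp] = bil_closed[OF F'] and FF' = bil_lin_fun[OF F'] bil_lin[OF F']
    have "rs AH (hat t a) F' = rs AH a (\<lambda>x y. rs AH x (\<lambda>p q. t y \<odot>\<^bsub>AH\<^esub> F' p q))"
      unfolding hat_def
      by (simp add: rs_push[OF L[OF F']] lin_smult[OF L[OF F']] H.module_smult_closed
          rs_push[OF lin_smult_fun[OF lin_id]] cong: rs_cong)
    also have "\<dots> = rs AH a (\<lambda>p z. H.sw AH z (\<lambda>q y. t y \<odot>\<^bsub>AH\<^esub> F' p q))"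
      by (rule rs_coassoc) (simp_all add: asimps FF FF')
    also have "\<dots> = rs AH a (\<lambda>p z. F' p (H.sw H z (\<lambda>q y. t y \<odot>\<^bsub>H\<^esub> q)))"
      by (simp add: H.sw_push[OF bil_lin(1)[OF F']] lin_smult[OF bil_lin(1)[OF F']]
          H.module_smult_closed cong: rs_cong H.sw_cong)
    finally show ?thesis .
  qed
  have "rs AH (hat t a) F = rs AH a (\<lambda>p z. F p (H.PB (H.sw H z (\<lambda>q y. t y \<odot>\<^bsub>H\<^esub> q))))"
    by (subst *[OF F]) (simp add: int cong: rs_cong)
  also have "\<dots> = rs AH (hat t a) (\<lambda>x y. F x (H.PB y))"
    by (rule *[symmetric]) (simp add: asimps FF)
  also have "\<dots> = rs AH \<one>\<^bsub>A\<^esub> (\<lambda>x y. F (hat t a \<diamond> x) y)"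
    by (rule rs_PB) (simp_all add: F)
  finally show "rs AH (hat t a) F = rs AH \<one>\<^bsub>A\<^esub> (\<lambda>x y. F (hat t a \<diamond> x) y)" .
qed

lemma hat_coinv_mult:
  assumes b [simp]: "b \<in> coinv" and a [simp]: "a \<in> carrier A"
  shows "hat t (b \<diamond> a) = b \<diamond> hat t a" "hat t (a \<diamond> b) = hat t a \<diamond> b"
proof -
  note [simp] = t_closed
  have L: "lin K A A (\<lambda>x. b \<diamond> x)" "lin K A A (\<lambda>x. x \<diamond> b)" by (simp_all add: asimps)
  show "hat t (b \<diamond> a) = b \<diamond> hat t a"
    unfolding hat_def
    by (subst rs_coinv_left) (simp_all add: asimps t_lin rs_push[OF L(1)] lin_smult[OF L(1)] cong: rs_cong)
  show "hat t (a \<diamond> b) = hat t a \<diamond> b"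
    unfolding hat_def
    by (subst rs_coinv_right) (simp_all add: asimps t_lin rs_push[OF L(2)] lin_smult[OF L(2)] cong: rs_cong)
qed

end

section \<open>The entwining map, the projection and the canonical map on generators\<close>

lemma psiR_rs: "psiR K H A \<rho> h a = rs AH a (\<lambda>x y. pure_tensor AH x (h \<bullet> y))"
  by (simp add: psiR_def rs_def)

lemma psiR_closed [simp]: "h \<in> carrier H \<Longrightarrow> a \<in> carrier A \<Longrightarrow> psiR K H A \<rho> h a \<in> carrier AH"
  unfolding psiR_rs by simp

lemma lin_lmult_arg: "a \<in> carrier A \<Longrightarrow> lin K AH AH (tensor_lmult K H A a)"
  unfolding tensor_lmult_def[abs_def] by (rule ktensor_sum_lin[OF module_A module_H module_AH bil_lmult])

lemma lmult_closed [simp]: "a \<in> carrier A \<Longrightarrow> t \<in> carrier AH \<Longrightarrow> tensor_lmult K H A a t \<in> carrier AH"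
  using lin_closed[OF lin_lmult_arg] .

lemma lmult_pure: "a \<in> carrier A \<Longrightarrow> x \<in> carrier A \<Longrightarrow> y \<in> carrier H \<Longrightarrow>
    tensor_lmult K H A a (pure_tensor AH x y) = pure_tensor AH (a \<diamond> x) y"
  unfolding tensor_lmult_def by (rule ktensor_sum_pure[OF module_A module_H module_AH bil_lmult])

lemma lmult_psiR: "a \<in> carrier A \<Longrightarrow> h \<in> carrier H \<Longrightarrow> b \<in> carrier A \<Longrightarrow>
    tensor_lmult K H A a (psiR K H A \<rho> h b) = rs AH b (\<lambda>x y. pure_tensor AH (a \<diamond> x) (h \<bullet> y))"
  unfolding psiR_rs by (subst rs_push[OF lin_lmult_arg]) (simp_all add: lmult_pure cong: rs_cong)

lemma lin_lmult_fun: "t \<in> carrier AH \<Longrightarrow> lin K A AH (\<lambda>a. tensor_lmult K H A a t)"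
  unfolding tensor_lmult_def
  by (rule lin_ktensor_sum_fun[OF module_A module_H module_AH])
    (simp_all add: asimps pure_lin)

lemma lin_psiR: "a \<in> carrier A \<Longrightarrow> lin K H AH (\<lambda>h. psiR K H A \<rho> h a)"
    "h \<in> carrier H \<Longrightarrow> lin K A AH (\<lambda>a. psiR K H A \<rho> h a)"
  unfolding psiR_rs by (simp_all add: asimps pure_lin bil_lin[OF bil_pure_AH])

lemma bil_psi: "b \<in> carrier A \<Longrightarrow> bil K A H AH (\<lambda>a h. tensor_lmult K H A a (psiR K H A \<rho> h b))"
  unfolding bil_def
  using lin_compose[OF lin_lmult_arg lin_psiR(1)] lin_lmult_fun[OF psiR_closed] by blast

lemma lin_pR: "lin K AH AH (pR K H A \<rho>)"
  unfolding pR_def[abs_def]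
  by (rule ktensor_sum_lin[OF module_A module_H module_AH bil_psi[OF A_one_closed]])

lemma pR_pure: "a \<in> carrier A \<Longrightarrow> h \<in> carrier H \<Longrightarrow>
    pR K H A \<rho> (pure_tensor AH a h) = rs AH \<one>\<^bsub>A\<^esub> (\<lambda>x y. pure_tensor AH (a \<diamond> x) (h \<bullet> y))"
  unfolding pR_def
  by (subst ktensor_sum_pure[OF module_A module_H module_AH bil_psi[OF A_one_closed]]) (simp_all add: lmult_psiR)

lemma can_pure_aux: "bil K A A AH (\<lambda>a b. tensor_lmult K H A a (\<rho> b))"
  unfolding bil_def
  using lin_compose[OF lin_lmult_arg lin_coaction] lin_lmult_fun[OF coaction_closed] by blast

end

section \<open>Projectivity\<close>

text \<open>Dual basis criterion: lifts \<open>m i\<close> of the elements \<open>f (c i)\<close>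
  are chosen once, and all linearity of the lifted map is carried by \<tau>.\<close>

lemma projective_left_moduleI:
  assumes P: "left_module R P act" and I: "finite I"
    and c: "\<And>i. i \<in> I \<Longrightarrow> c i \<in> carrier P"
    and \<tau>: "\<And>i p. i \<in> I \<Longrightarrow> p \<in> carrier P \<Longrightarrow> \<tau> i p \<in> carrier R"
    and \<tau>_add: "\<And>i p q. i \<in> I \<Longrightarrow> p \<in> carrier P \<Longrightarrow> q \<in> carrier P \<Longrightarrow> \<tau> i (p \<oplus>\<^bsub>P\<^esub> q) = \<tau> i p \<oplus>\<^bsub>R\<^esub> \<tau> i q"
    and \<tau>_act: "\<And>i r p. i \<in> I \<Longrightarrow> r \<in> carrier R \<Longrightarrow> p \<in> carrier P \<Longrightarrow> \<tau> i (act r p) = r \<otimes>\<^bsub>R\<^esub> \<tau> i p"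
    and expand: "\<And>p. p \<in> carrier P \<Longrightarrow> (\<Oplus>\<^bsub>P\<^esub>i\<in>I. act (\<tau> i p) (c i)) = p"
  shows "projective_left_module TYPE('m) TYPE('n) R P act"
  unfolding projective_left_module_def
proof (intro conjI P allI ballI impI, elim conjE)
  fix M :: "'m ring" and actM and N :: "'n ring" and actN g f
  assume g: "g \<in> left_module_hom R M actM N actN" and f: "f \<in> left_module_hom R P act N actN"
    and M: "left_module R M actM" and N: "left_module R N actN" and sur: "g ` carrier M = carrier N"
  interpret P: left_module R P act by (rule P)
  interpret M: left_module R M actM by (rule M)
  interpret N: left_module R N actN by (rule N)
  have g_act: "g (actM r x) = actN r (g x)" if "r \<in> carrier R" "x \<in> carrier M" for r x
    using g that by (simp add: left_module_hom_def)
  have f_act: "f (act r x) = actN r (f x)" if "r \<in> carrier R" "x \<in> carrier P" for r x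
    using f that by (simp add: left_module_hom_def)
  have f_closed: "f x \<in> carrier N" if "x \<in> carrier P" for x
    using f that by (auto simp: left_module_hom_def hom_def Pi_iff)
  have "\<forall>i\<in>I. \<exists>m\<in>carrier M. g m = f (c i)"
    using sur f_closed[OF c] by (metis imageE)
  then obtain m where m: "\<And>i. i \<in> I \<Longrightarrow> m i \<in> carrier M" "\<And>i. i \<in> I \<Longrightarrow> g (m i) = f (c i)" by metis
  define h where "h p = (\<Oplus>\<^bsub>M\<^esub>i\<in>I. actM (\<tau> i p) (m i))" for p
  have hc: "h p \<in> carrier M" if "p \<in> carrier P" for p
    unfolding h_def using that m \<tau> by (auto intro!: M.M.finsum_closed M.act_closed)
  show "\<exists>h\<in>left_module_hom R P act M actM. \<forall>p\<in>carrier P. g (h p) = f p"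
  proof (intro bexI ballI)
    fix p assume p: "p \<in> carrier P"
    have "g (h p) = (\<Oplus>\<^bsub>N\<^esub>i\<in>I. g (actM (\<tau> i p) (m i)))"
      unfolding h_def
      by (rule additive_finsum[OF M.M.abelian_group_axioms N.M.abelian_group_axioms _ I])
        (use p m \<tau> M.act_closed g in \<open>auto simp: left_module_hom_def\<close>)
    also have "\<dots> = (\<Oplus>\<^bsub>N\<^esub>i\<in>I. f (act (\<tau> i p) (c i)))"
      by (rule finsum_cong_raw) (use p m \<tau> c g_act f_act in simp)
    also have "\<dots> = f (\<Oplus>\<^bsub>P\<^esub>i\<in>I. act (\<tau> i p) (c i))"
      by (rule additive_finsum[OF P.M.abelian_group_axioms N.M.abelian_group_axioms _ I, symmetric])
        (use p c \<tau> P.act_closed f in \<open>auto simp: left_module_hom_def\<close>)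
    finally show "g (h p) = f p" using expand[OF p] by simp
  next
    have "h (p \<oplus>\<^bsub>P\<^esub> q) = h p \<oplus>\<^bsub>M\<^esub> h q" if pq: "p \<in> carrier P" "q \<in> carrier P" for p q
    proof -
      have "h (p \<oplus>\<^bsub>P\<^esub> q) = (\<Oplus>\<^bsub>M\<^esub>i\<in>I. actM (\<tau> i p) (m i) \<oplus>\<^bsub>M\<^esub> actM (\<tau> i q) (m i))"
        unfolding h_def by (rule finsum_cong_raw) (use pq m \<tau> \<tau>_add M.act_l_distr in auto)
      also have "\<dots> = h p \<oplus>\<^bsub>M\<^esub> h q"
        unfolding h_def by (rule M.M.finsum_addf) (use pq m \<tau> M.act_closed in auto)
      finally show ?thesis .
    qed
    moreover have "h (act r p) = actM r (h p)" if rp: "r \<in> carrier R" "p \<in> carrier P" for r p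
    proof -
      have cl: "actM (\<tau> i p) (m i) \<in> carrier M" if "i \<in> I" for i using rp that m \<tau> M.act_closed by auto
      have "(\<lambda>x. actM r x) \<in> hom (add_monoid M) (add_monoid M)"
        using rp by (auto intro!: homI simp: M.act_closed M.act_r_distr)
      note * = additive_finsum[OF M.M.abelian_group_axioms M.M.abelian_group_axioms this I cl]
      have "h (act r p) = (\<Oplus>\<^bsub>M\<^esub>i\<in>I. actM r (actM (\<tau> i p) (m i)))"
        unfolding h_def by (rule finsum_cong_raw) (use rp m \<tau> \<tau>_act M.act_assoc in auto)
      then show ?thesis using * by (simp add: h_def)
    qed
    ultimately show "h \<in> left_module_hom R P act M actM"
      using hc by (auto simp: left_module_hom_def hom_def)
  qed
qed

lemma right_module_opposite:
  fixes R :: "('r, 'x) ring_scheme"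
  assumes "ring R"
  shows "right_module R M act \<longleftrightarrow> left_module (R\<lparr>monoid.mult := \<lambda>x y. y \<otimes>\<^bsub>R\<^esub> x\<rparr>) M (\<lambda>r x. act x r)"
proof -
  interpret R: ring R by fact
  have "abelian_group (R\<lparr>monoid.mult := \<lambda>x y. y \<otimes>\<^bsub>R\<^esub> x\<rparr>)"
    by (rule abelian_group_target[OF R.abelian_group_axioms]) simp_all
  then have "ring (R\<lparr>monoid.mult := \<lambda>x y. y \<otimes>\<^bsub>R\<^esub> x\<rparr>)"
    by (rule ringI) (auto intro!: monoidI simp: R.m_assoc R.l_distr R.r_distr)
  then show ?thesis
    using assms by (auto simp: left_module_def left_module_axioms_def right_module_def right_module_axioms_def)
qed

text \<open>Right modules are left modules over the opposite ring, with the same homomorphisms, so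
  the lifting is inherited.\<close>

lemma projective_right_moduleI:
  fixes R :: "('r, 'x) ring_scheme"
  assumes R: "ring R" and P: "right_module R P act" and I: "finite I"
    and c: "\<And>i. i \<in> I \<Longrightarrow> c i \<in> carrier P"
    and \<tau>: "\<And>i p. i \<in> I \<Longrightarrow> p \<in> carrier P \<Longrightarrow> \<tau> i p \<in> carrier R"
    and \<tau>_add: "\<And>i p q. i \<in> I \<Longrightarrow> p \<in> carrier P \<Longrightarrow> q \<in> carrier P \<Longrightarrow> \<tau> i (p \<oplus>\<^bsub>P\<^esub> q) = \<tau> i p \<oplus>\<^bsub>R\<^esub> \<tau> i q"
    and \<tau>_act: "\<And>i r p. i \<in> I \<Longrightarrow> r \<in> carrier R \<Longrightarrow> p \<in> carrier P \<Longrightarrow> \<tau> i (act p r) = \<tau> i p \<otimes>\<^bsub>R\<^esub> r"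
    and expand: "\<And>p. p \<in> carrier P \<Longrightarrow> (\<Oplus>\<^bsub>P\<^esub>i\<in>I. act (c i) (\<tau> i p)) = p"
  shows "projective_right_module TYPE('m) TYPE('n) R P act"
proof -
  let ?R = "R\<lparr>monoid.mult := \<lambda>x y. y \<otimes>\<^bsub>R\<^esub> x\<rparr>"
  have "projective_left_module TYPE('m) TYPE('n) ?R P (\<lambda>r x. act x r)"
    by (rule projective_left_moduleI[of _ _ _ I c \<tau>])
      (use assms right_module_opposite[OF R, of P act] in auto)
  note L = this[unfolded projective_left_module_def, THEN conjunct2, rule_format]
  have hom: "right_module_hom R M a N b = left_module_hom ?R M (\<lambda>r x. a x r) N (\<lambda>r x. b x r)"
    for M :: "('m1, 'u) ring_scheme" and a and N :: "('n1, 'v) ring_scheme" and b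
    by (simp add: right_module_hom_def left_module_hom_def)
  show ?thesis
    unfolding projective_right_module_def
  proof (intro conjI P allI ballI impI, elim conjE)
    fix M :: "'m ring" and actM and N :: "'n ring" and actN g f
    assume "g \<in> right_module_hom R M actM N actN" "f \<in> right_module_hom R P act N actN"
      "right_module R M actM" "right_module R N actN" "g ` carrier M = carrier N"
    then show "\<exists>h\<in>right_module_hom R P act M actM. \<forall>p\<in>carrier P. g (h p) = f p"
      unfolding hom right_module_opposite[OF R] by (intro L conjI)
  qed
qed

context comodule_algebra
begin

section \<open>Surjectivity of the canonical map and dual bases\<close>

abbreviation AA where "AA \<equiv> ktensor K A A"
abbreviation can where "can \<equiv> can_map K H A \<rho>"

lemma module_AA [simp]: "module K AA" by (rule module_ktensor) simp_all

lemma lin_can: "lin K AA AH can"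
  unfolding can_map_def[abs_def] by (rule ktensor_sum_lin[OF module_A module_A module_AH can_pure_aux])

lemma can_pure: "a \<in> carrier A \<Longrightarrow> b \<in> carrier A \<Longrightarrow> can (pure_tensor AA a b) = tensor_lmult K H A a (\<rho> b)"
  unfolding can_map_def by (rule ktensor_sum_pure[OF module_A module_A module_AH can_pure_aux])

lemma can_sum:
  assumes s: "s \<in> carrier AA" and G: "module K G" and F: "bil K A H G F"
  shows "tensor_sum G (can s) F = tensor_sum G s (\<lambda>a b. rs G b (\<lambda>x y. F (a \<diamond> x) y))"
  unfolding can_map_def rs_def
  by (subst lin_ktensor_sum[OF module_A module_A module_AH G ktensor_sum_lin[OF module_A module_H G F] s])
    (auto simp: lmult_sum G F intro!: ktensor_sum_cong_raw[OF module_A module_A s])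

abbreviation EE' where "EE' \<equiv> entwining_bimodule K H A \<rho>"

lemma carrier_E: "carrier EE' = pR K H A \<rho> ` carrier AH"
  by (simp add: entwining_bimodule_def Let_def)

text \<open>Surjectivity at the element \<open>p_R (1 \<otimes> h)\<close>, already tested against
  bilinear maps into \<open>A\<close>, the target of all applications.\<close>

lemma can_preimage:
  assumes sur: "can ` carrier AA = carrier EE'" and h [simp]: "h \<in> carrier H"
  shows "\<exists>s\<in>carrier AA. \<forall>F. bil K A H A F \<longrightarrow>
    tensor_sum A s (\<lambda>a b. rs A b (\<lambda>x y. F (a \<diamond> x) y)) = rs A \<one>\<^bsub>A\<^esub> (\<lambda>x y. F x (h \<bullet> y))"
proof -
  have "pR K H A \<rho> (pure_tensor AH \<one>\<^bsub>A\<^esub> h) \<in> can ` carrier AA"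
    unfolding sur carrier_E by simp
  then obtain s where s: "s \<in> carrier AA" "can s = pR K H A \<rho> (pure_tensor AH \<one>\<^bsub>A\<^esub> h)" by force
  have "tensor_sum A s (\<lambda>a b. rs A b (\<lambda>x y. F (a \<diamond> x) y)) = rs A \<one>\<^bsub>A\<^esub> (\<lambda>x y. F x (h \<bullet> y))"
    if F: "bil K A H A F" for F
  proof -
    have "tensor_sum A s (\<lambda>a b. rs A b (\<lambda>x y. F (a \<diamond> x) y)) =
        tensor_sum A (rs AH \<one>\<^bsub>A\<^esub> (\<lambda>x y. pure_tensor AH (\<one>\<^bsub>A\<^esub> \<diamond> x) (h \<bullet> y))) F"
      using can_sum[OF s(1) module_A F] s(2) by (simp add: pR_pure)
    also have "\<dots> = rs A \<one>\<^bsub>A\<^esub> (\<lambda>x y. F x (h \<bullet> y))"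
      by (subst rs_push[OF ktensor_sum_lin[OF module_A module_H module_A F]])
        (simp_all add: ktensor_sum_pure[OF module_A module_H module_A F] cong: rs_cong)
    finally show ?thesis .
  qed
  then show ?thesis using s(1) by blast
qed

text \<open>\<open>hat t (b y)\<close> is the sum of \<open>b_0 y_0 t(b_1 y_1)\<close>. So the
  relation satisfied by \<open>s\<close> applies to the bilinear map sending \<open>x\<close> and
  \<open>z\<close> to \<open>x y_0 t(z y_1)\<close>, and the coaction at \<open>1 y\<close> absorbs
  what remains.\<close>

lemma right_expand:
  assumes s: "s \<in> carrier AA"
      "\<And>F. bil K A H A F \<Longrightarrow>
        tensor_sum A s (\<lambda>a b. rs A b (\<lambda>x y. F (a \<diamond> x) y)) = rs A \<one>\<^bsub>A\<^esub> (\<lambda>x y. F x (h \<bullet> y))"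
    and h [simp]: "h \<in> carrier H" and t: "lin K H KK t" and y [simp]: "y \<in> carrier A"
  shows "tensor_sum A s (\<lambda>a b. a \<diamond> hat t (b \<diamond> y)) = rs A y (\<lambda>p q. t (h \<bullet> q) \<odot>\<^bsub>A\<^esub> p)"
proof -
  note tl = lin_compose[OF t] t
  note [simp] = t_closed[OF t]
  have L: "lin K A A (\<lambda>x. a \<diamond> x)" if "a \<in> carrier A" for a using that by (simp add: asimps)
  have "tensor_sum A s (\<lambda>a b. a \<diamond> hat t (b \<diamond> y)) =
      tensor_sum A s (\<lambda>a b. rs A b (\<lambda>x z. rs A y (\<lambda>y0 y1. t (z \<bullet> y1) \<odot>\<^bsub>A\<^esub> ((a \<diamond> x) \<diamond> y0))))"
  proof (rule ktensor_sum_cong_raw[OF module_A module_A s(1)])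
    fix a b assume [simp]: "a \<in> carrier A" "b \<in> carrier A"
    have "hat t (b \<diamond> y) = rs A b (\<lambda>x z. rs A y (\<lambda>y0 y1. t (z \<bullet> y1) \<odot>\<^bsub>A\<^esub> (x \<diamond> y0)))"
      unfolding hat_def by (rule rs_mult) (simp_all add: asimps tl)
    then show "a \<diamond> hat t (b \<diamond> y) = rs A b (\<lambda>x z. rs A y (\<lambda>y0 y1. t (z \<bullet> y1) \<odot>\<^bsub>A\<^esub> ((a \<diamond> x) \<diamond> y0)))"
      by (simp add: rs_push[OF L] lin_smult[OF L] A_assoc H.module_smult_closed cong: rs_cong)
  qed
  also have "\<dots> = rs A \<one>\<^bsub>A\<^esub> (\<lambda>x z. rs A y (\<lambda>y0 y1. t ((h \<bullet> z) \<bullet> y1) \<odot>\<^bsub>A\<^esub> (x \<diamond> y0)))"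
    by (rule s(2)) (simp add: asimps tl)
  also have "\<dots> = rs A (\<one>\<^bsub>A\<^esub> \<diamond> y) (\<lambda>p q. t (h \<bullet> q) \<odot>\<^bsub>A\<^esub> p)"
    by (subst rs_mult) (simp_all add: asimps tl H.H_assoc cong: rs_cong)
  finally show ?thesis by simp
qed

end

context comodule_algebra_hopf
begin

text \<open>Moves a coaction from \<open>c\<close> to \<open>b\<close>: in the expansion, two legs
  of \<open>c\<close> meet as \<open>q S w\<close> and collapse to \<open>PL\<close>, and the
  comodule algebra axiom replaces \<open>c_0 \<otimes> PL c_1\<close> by
  \<open>1_0 c \<otimes> 1_1\<close>, whose unit is absorbed by \<open>b\<close>.\<close>

lemma rs_antipode:
  assumes b [simp]: "b \<in> carrier A" and c [simp]: "c \<in> carrier A" and G [simp]: "module K G" and F: "bil K A H G F"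
  shows "rs G c (\<lambda>x z. rs G (b \<diamond> x) (\<lambda>p q. F p (q \<bullet> S z))) = rs G b (\<lambda>x y. F (x \<diamond> c) y)"
proof -
  note [simp] = bil_closed[OF F] and FF = bil_lin_fun[OF F] bil_lin[OF F] HS.lin_S_fun HS.lin_S
  have "rs G c (\<lambda>x z. rs G (b \<diamond> x) (\<lambda>p q. F p (q \<bullet> S z))) =
      rs G c (\<lambda>x z. rs G b (\<lambda>b0 b1. rs G x (\<lambda>p q. F (b0 \<diamond> p) (b1 \<bullet> (q \<bullet> S z)))))"
    by (rule rs_cong[OF refl c], subst rs_mult) (simp_all add: asimps FF H.H_assoc cong: rs_cong)
  also have "\<dots> = rs G b (\<lambda>b0 b1. rs G c (\<lambda>x z. rs G x (\<lambda>p q. F (b0 \<diamond> p) (b1 \<bullet> (q \<bullet> S z)))))"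
    by (rule rs_swap) simp_all
  also have "\<dots> = rs G b (\<lambda>b0 b1. rs G c (\<lambda>p z. H.sw G z (\<lambda>q w. F (b0 \<diamond> p) (b1 \<bullet> (q \<bullet> S w)))))"
    by (rule rs_cong[OF refl b], rule rs_coassoc) (simp_all add: asimps FF)
  also have "\<dots> = rs G b (\<lambda>b0 b1. rs G c (\<lambda>p z. F (b0 \<diamond> p) (b1 \<bullet> PL z)))"
  proof (rule rs_cong[OF refl b], rule rs_cong[OF refl c])
    fix b0 b1 p z assume [simp]: "b0 \<in> carrier A" "b1 \<in> carrier H" "p \<in> carrier A" "z \<in> carrier H"
    have L: "lin K H G (\<lambda>v. F (b0 \<diamond> p) (b1 \<bullet> v))" by (simp add: asimps FF)
    show "H.sw G z (\<lambda>q w. F (b0 \<diamond> p) (b1 \<bullet> (q \<bullet> S w))) = F (b0 \<diamond> p) (b1 \<bullet> PL z)"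
      using H.sw_push[OF L, of z "\<lambda>q w. q \<bullet> S w"] by (simp add: HS.sw_mult_S)
  qed
  also have "\<dots> = rs G b (\<lambda>b0 b1. rs G \<one>\<^bsub>A\<^esub> (\<lambda>u v. F (b0 \<diamond> (u \<diamond> c)) (b1 \<bullet> v)))"
    by (rule rs_cong[OF refl b], rule rs_PL) (simp_all add: asimps FF)
  also have "\<dots> = rs G (b \<diamond> \<one>\<^bsub>A\<^esub>) (\<lambda>x y. F (x \<diamond> c) y)"
    by (subst rs_mult) (simp_all add: asimps FF A_assoc cong: rs_cong)
  finally show ?thesis by simp
qed

text \<open>The hypothesis on \<open>s = \<Sum> b \<otimes> c\<close> says \<open>\<Sum> b c\<^bsub>[0]\<^esub> \<otimes> c\<^bsub>[1]\<^esub> = \<Sum> 1\<^bsub>[0]\<^esub> \<otimes> h 1\<^bsub>[1]\<^esub>\<close>.  Applying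
  \<open>a \<otimes> g \<mapsto> \<Sum> a\<^bsub>[0]\<^esub> \<otimes> a\<^bsub>[1]\<^esub> S g\<close> to both sides moves the coaction from \<open>c\<close> to \<open>b\<close>.\<close>

lemma left_expand:
  assumes s: "s \<in> carrier AA"
      "\<And>F. bil K A H A F \<Longrightarrow>
        tensor_sum A s (\<lambda>a b. rs A b (\<lambda>x y. F (a \<diamond> x) y)) = rs A \<one>\<^bsub>A\<^esub> (\<lambda>x y. F x (h \<bullet> y))"
    and h [simp]: "h \<in> carrier H" and t: "lin K H KK t" and y [simp]: "y \<in> carrier A"
  shows "tensor_sum A s (\<lambda>b c. hat t (y \<diamond> b) \<diamond> c) = rs A y (\<lambda>p q. t (q \<bullet> S h) \<odot>\<^bsub>A\<^esub> p)"
proof -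
  note tl = lin_compose[OF t] t HS.lin_S_fun HS.lin_S
  note [simp] = t_closed[OF t]
  have L: "lin K A A (\<lambda>x. x \<diamond> a)" if "a \<in> carrier A" for a using that by (simp add: asimps)
  \<comment> \<open>The bilinear map that multiplies by the coaction at \<open>y\<close> on the left
    and then applies \<open>t\<close>; \<open>rs_antipode\<close> is used for it.\<close>
  let ?\<Psi> = "\<lambda>p w. rs A y (\<lambda>y0 y1. t (y1 \<bullet> w) \<odot>\<^bsub>A\<^esub> (y0 \<diamond> p))"
  have \<Psi>: "bil K A H A ?\<Psi>" by (simp add: asimps tl)
  have "tensor_sum A s (\<lambda>b c. hat t (y \<diamond> b) \<diamond> c) =
      tensor_sum A s (\<lambda>b c. rs A c (\<lambda>x z. rs A (b \<diamond> x) (\<lambda>p q. ?\<Psi> p (q \<bullet> S z))))"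
  proof (rule ktensor_sum_cong_raw[OF module_A module_A s(1)])
    fix b c assume [simp]: "b \<in> carrier A" "c \<in> carrier A"
    have "hat t (y \<diamond> b) = rs A y (\<lambda>y0 y1. rs A b (\<lambda>x z. t (y1 \<bullet> z) \<odot>\<^bsub>A\<^esub> (y0 \<diamond> x)))"
      unfolding hat_def by (rule rs_mult) (simp_all add: asimps tl)
    then have "hat t (y \<diamond> b) \<diamond> c = rs A y (\<lambda>y0 y1. rs A b (\<lambda>x z. t (y1 \<bullet> z) \<odot>\<^bsub>A\<^esub> (y0 \<diamond> (x \<diamond> c))))"
      by (simp add: rs_push[OF L] lin_smult[OF L] A_assoc H.module_smult_closed cong: rs_cong)
    also have "\<dots> = rs A b (\<lambda>x z. ?\<Psi> (x \<diamond> c) z)"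
      by (rule rs_swap) (simp_all add: H.module_smult_closed)
    also have "\<dots> = rs A c (\<lambda>x z. rs A (b \<diamond> x) (\<lambda>p q. ?\<Psi> p (q \<bullet> S z)))"
      by (rule rs_antipode[symmetric]) (simp_all add: \<Psi>)
    finally show "hat t (y \<diamond> b) \<diamond> c = rs A c (\<lambda>x z. rs A (b \<diamond> x) (\<lambda>p q. ?\<Psi> p (q \<bullet> S z)))" .
  qed
  also have "\<dots> = rs A \<one>\<^bsub>A\<^esub> (\<lambda>x z. rs A x (\<lambda>p q. ?\<Psi> p (q \<bullet> S (h \<bullet> z))))"
    by (rule s(2)) (simp add: asimps tl)
  \<comment> \<open>A unit is inserted so that \<open>rs_antipode\<close> applies once more, now
    with both elements equal to 1 and with \<open>S h\<close> as a fixed right factor.\<close>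
  also have "\<dots> = rs A \<one>\<^bsub>A\<^esub> (\<lambda>x z. rs A (\<one>\<^bsub>A\<^esub> \<diamond> x) (\<lambda>p q. ?\<Psi> p ((q \<bullet> S z) \<bullet> S h)))"
    by (simp add: HS.S_mult H.H_assoc H.module_smult_closed cong: rs_cong)
  also have "\<dots> = rs A \<one>\<^bsub>A\<^esub> (\<lambda>x z. ?\<Psi> (x \<diamond> \<one>\<^bsub>A\<^esub>) (z \<bullet> S h))"
    by (rule rs_antipode) (simp_all add: asimps tl)
  also have "\<dots> = rs A \<one>\<^bsub>A\<^esub> (\<lambda>x z. rs A y (\<lambda>y0 y1. t ((y1 \<bullet> z) \<bullet> S h) \<odot>\<^bsub>A\<^esub> (y0 \<diamond> x)))"
    by (simp add: H.H_assoc H.module_smult_closed cong: rs_cong)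
  also have "\<dots> = rs A y (\<lambda>y0 y1. rs A \<one>\<^bsub>A\<^esub> (\<lambda>x z. t ((y1 \<bullet> z) \<bullet> S h) \<odot>\<^bsub>A\<^esub> (y0 \<diamond> x)))"
    by (rule rs_swap) (simp_all add: H.module_smult_closed)
  also have "\<dots> = rs A (y \<diamond> \<one>\<^bsub>A\<^esub>) (\<lambda>p q. t (q \<bullet> S h) \<odot>\<^bsub>A\<^esub> p)"
    by (rule rs_mult[symmetric]) (simp_all add: asimps tl)
  finally show ?thesis by simp
qed

lemma sum_integrals:
  assumes J: "finite J" and t: "\<And>j. j \<in> J \<Longrightarrow> lin K H KK (u j)"
    and eps: "\<And>x. x \<in> carrier H \<Longrightarrow> (\<Oplus>\<^bsub>KK\<^esub>j\<in>J. u j x) = \<epsilon> x" and y [simp]: "y \<in> carrier A"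
  shows "(\<Oplus>\<^bsub>A\<^esub>j\<in>J. rs A y (\<lambda>p q. u j q \<odot>\<^bsub>A\<^esub> p)) = y"
proof -
  note [simp] = t_closed[OF t]
  have A: "abelian_group A" using module_A by (simp add: module_def)
  have "(\<Oplus>\<^bsub>A\<^esub>j\<in>J. rs A y (\<lambda>p q. u j q \<odot>\<^bsub>A\<^esub> p)) = rs A y (\<lambda>p q. \<Oplus>\<^bsub>A\<^esub>j\<in>J. u j q \<odot>\<^bsub>A\<^esub> p)"
    unfolding rs_def
    by (rule tensor_factors.tensor_sum_finsum[OF tensor_factors_ktensor[OF module_A module_H] A _ J, symmetric])
      (use coaction_closed[OF y] in \<open>auto simp: ktensor_simps H.module_smult_closed\<close>)
  also have "\<dots> = rs A y (\<lambda>p q. \<epsilon> q \<odot>\<^bsub>A\<^esub> p)"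
  proof (rule rs_cong[OF refl y])
    fix p q assume [simp]: "p \<in> carrier A" "q \<in> carrier H"
    show "(\<Oplus>\<^bsub>A\<^esub>j\<in>J. u j q \<odot>\<^bsub>A\<^esub> p) = \<epsilon> q \<odot>\<^bsub>A\<^esub> p"
      using lin_finsum_push[OF H.lin_scalar[OF module_A], of p J "\<lambda>j. u j q"] J eps[of q] by simp
  qed
  also have "\<dots> = y" using rs_counit[OF module_A lin_id y] .
  finally show ?thesis .
qed

text \<open>\<open>left_expand\<close> summed over the basis elements \<open>j\<close>, where the
  integrals add up to the counit. The preimages \<open>s j\<close> are opened into the pairs of a
  representative, so the index set consists of a basis element together with such a pair, and the
  integer coefficients go into the right factor.\<close>

lemma dual_basis_left:
  assumes K: "field K" and fd: "vectorspace.fin_dim K H" and sur: "can ` carrier AA = carrier EE'"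
  obtains I :: "('h \<times> 'a \<times> 'a) set" and T b c where "finite I"
    "\<And>i. i \<in> I \<Longrightarrow> lin K H KK (T i)" "\<And>i. i \<in> I \<Longrightarrow> b i \<in> carrier A" "\<And>i. i \<in> I \<Longrightarrow> c i \<in> carrier A"
    "\<And>i a. i \<in> I \<Longrightarrow> a \<in> carrier A \<Longrightarrow> hat (T i) a \<in> coinv"
    "\<And>y. y \<in> carrier A \<Longrightarrow> (\<Oplus>\<^bsub>A\<^esub>i\<in>I. hat (T i) (y \<diamond> b i) \<diamond> c i) = y"
proof (rule HS.integrals_right[OF K fd])
  fix J t
  assume J: "finite J" "J \<subseteq> carrier H" and t: "\<And>j. j \<in> J \<Longrightarrow> lin K H KK (t j)"
    and eps: "\<And>x. x \<in> carrier H \<Longrightarrow> (\<Oplus>\<^bsub>KK\<^esub>j\<in>J. t j (x \<bullet> S j)) = \<epsilon> x"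
    and int: "\<And>j x. j \<in> J \<Longrightarrow> x \<in> carrier H \<Longrightarrow>
      PL (H.sw H x (\<lambda>u v. t j v \<odot>\<^bsub>H\<^esub> u)) = H.sw H x (\<lambda>u v. t j v \<odot>\<^bsub>H\<^esub> u)"
  have Jc [simp]: "j \<in> J \<Longrightarrow> j \<in> carrier H" for j using J(2) by blast
  have coinv: "hat (t j) a \<in> coinv" if "j \<in> J" "a \<in> carrier A" for j a
  \<comment> \<open>The integrals are fixed by \<open>PL\<close>, whereas \<open>hat_coinv\<close>
    asks for \<open>PB\<close>; \<open>PB_PL\<close> bridges the two.\<close>
  proof (rule hat_coinv[OF t[OF that(1)] _ that(2)])
    fix x assume x: "x \<in> carrier H"
    have "H.sw H x (\<lambda>u v. t j v \<odot>\<^bsub>H\<^esub> u) \<in> carrier H"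
      using x t_closed[OF t[OF that(1)]] by (simp add: H.module_smult_closed)
    then show "H.PB (H.sw H x (\<lambda>u v. t j v \<odot>\<^bsub>H\<^esub> u)) = H.sw H x (\<lambda>u v. t j v \<odot>\<^bsub>H\<^esub> u)"
      using H.PB_PL[of "H.sw H x (\<lambda>u v. t j v \<odot>\<^bsub>H\<^esub> u)"] int[OF that(1) x] by simp
  qed
  have "\<forall>j\<in>J. \<exists>s\<in>carrier AA. \<forall>F. bil K A H A F \<longrightarrow>
      tensor_sum A s (\<lambda>a b. rs A b (\<lambda>x y. F (a \<diamond> x) y)) = rs A \<one>\<^bsub>A\<^esub> (\<lambda>x y. F x (j \<bullet> y))"
    using can_preimage[OF sur] by simp
  then obtain s where s: "\<And>j. j \<in> J \<Longrightarrow> s j \<in> carrier AA"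
      "\<And>j F. j \<in> J \<Longrightarrow> bil K A H A F \<Longrightarrow>
        tensor_sum A (s j) (\<lambda>a b. rs A b (\<lambda>x y. F (a \<diamond> x) y)) = rs A \<one>\<^bsub>A\<^esub> (\<lambda>x y. F x (j \<bullet> y))"
    by metis
  define Z where "Z j = Poly_Mapping.keys (SOME c. c \<in> s j)" for j
  define n where "n j z = Poly_Mapping.lookup (SOME c. c \<in> s j) z" for j z
  have Z: "z \<in> Z j \<Longrightarrow> fst z \<in> carrier A" "z \<in> Z j \<Longrightarrow> snd z \<in> carrier A" if "j \<in> J" for z j
    using tensor_factors.keys_some_rep[OF tensor_factors_ktensor[OF module_A module_A]] s(1)[OF that]
    by (auto simp: Z_def ktensor_simps)
  have fin: "finite (Z j)" for j by (simp add: Z_def)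
  have A: "abelian_group A" "ring A" using ring_A by (simp_all add: ring_def)
  have pc: "add_pow A (k::int) x \<in> carrier A" if "x \<in> carrier A" for k x
    using that group.int_pow_closed[OF abelian_group.a_group[OF A(1)]] by (simp add: add_pow_def)
  have hc: "hat (t j) a \<in> carrier A" if "j \<in> J" "a \<in> carrier A" for j a using coinv[OF that] by simp
  show thesis
  proof (rule that[of "Sigma J Z" "\<lambda>p. t (fst p)" "\<lambda>p. fst (snd p)" "\<lambda>p. add_pow A (n (fst p) (snd p)) (snd (snd p))"])
    fix y assume y [simp]: "y \<in> carrier A"
    have "(\<Oplus>\<^bsub>A\<^esub>p\<in>Sigma J Z. hat (t (fst p)) (y \<diamond> fst (snd p)) \<diamond> add_pow A (n (fst p) (snd p)) (snd (snd p))) =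
        (\<Oplus>\<^bsub>A\<^esub>j\<in>J. \<Oplus>\<^bsub>A\<^esub>z\<in>Z j. hat (t j) (y \<diamond> fst z) \<diamond> add_pow A (n j z) (snd z))"
      by (rule abelian_group.finsum_Sigma[OF A(1) J(1) fin, symmetric]) (simp add: hc Z pc)
    also have "\<dots> = (\<Oplus>\<^bsub>A\<^esub>j\<in>J. tensor_sum A (s j) (\<lambda>b c. hat (t j) (y \<diamond> b) \<diamond> c))"
      unfolding tensor_sum_def Let_def Z_def[symmetric] n_def[symmetric]
      by (intro finsum_cong_raw) (simp add: ring.add_pow_rdistr_int[OF A(2)] hc Z)
    also have "\<dots> = (\<Oplus>\<^bsub>A\<^esub>j\<in>J. rs A y (\<lambda>p q. t j (q \<bullet> S j) \<odot>\<^bsub>A\<^esub> p))"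
      by (intro finsum_cong_raw left_expand s) (simp_all add: t)
    also have "\<dots> = y"
      by (rule sum_integrals[OF J(1) _ eps y])
        (simp add: lin_compose[OF t] asimps)
    finally show "(\<Oplus>\<^bsub>A\<^esub>p\<in>Sigma J Z. hat (t (fst p)) (y \<diamond> fst (snd p)) \<diamond>
        add_pow A (n (fst p) (snd p)) (snd (snd p))) = y" .
  qed (use J fin t coinv Z pc in auto)
qed

text \<open>The same with \<open>right_expand\<close> and the integrals of the opposite algebra.
  Preimages are now taken of \<open>p_R (1 \<otimes> m j)\<close>, and the factors of the pairs
  exchange their roles.\<close>

lemma dual_basis_right:
  assumes K: "field K" and fd: "vectorspace.fin_dim K H" and sur: "can ` carrier AA = carrier EE'"
  obtains I :: "('h \<times> 'a \<times> 'a) set" and T b c where "finite I"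
    "\<And>i. i \<in> I \<Longrightarrow> lin K H KK (T i)" "\<And>i. i \<in> I \<Longrightarrow> b i \<in> carrier A" "\<And>i. i \<in> I \<Longrightarrow> c i \<in> carrier A"
    "\<And>i a. i \<in> I \<Longrightarrow> a \<in> carrier A \<Longrightarrow> hat (T i) a \<in> coinv"
    "\<And>y. y \<in> carrier A \<Longrightarrow> (\<Oplus>\<^bsub>A\<^esub>i\<in>I. c i \<diamond> hat (T i) (b i \<diamond> y)) = y"
proof (rule HS.integrals_left[OF K fd])
  fix J m t
  assume J: "finite J" "J \<subseteq> carrier H" and m [simp]: "\<And>j. j \<in> J \<Longrightarrow> m j \<in> carrier H"
    and t: "\<And>j. j \<in> J \<Longrightarrow> lin K H KK (t j)"
    and eps: "\<And>x. x \<in> carrier H \<Longrightarrow> (\<Oplus>\<^bsub>KK\<^esub>j\<in>J. t j (m j \<bullet> x)) = \<epsilon> x"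
    and int: "\<And>j x. j \<in> J \<Longrightarrow> x \<in> carrier H \<Longrightarrow>
      H.PB (H.sw H x (\<lambda>u v. t j v \<odot>\<^bsub>H\<^esub> u)) = H.sw H x (\<lambda>u v. t j v \<odot>\<^bsub>H\<^esub> u)"
  have coinv: "hat (t j) a \<in> coinv" if "j \<in> J" "a \<in> carrier A" for j a
    by (rule hat_coinv[OF t[OF that(1)] int[OF that(1)] that(2)])
  have "\<forall>j\<in>J. \<exists>s\<in>carrier AA. \<forall>F. bil K A H A F \<longrightarrow>
      tensor_sum A s (\<lambda>a b. rs A b (\<lambda>x y. F (a \<diamond> x) y)) = rs A \<one>\<^bsub>A\<^esub> (\<lambda>x y. F x (m j \<bullet> y))"
    using can_preimage[OF sur] by simp
  then obtain s where s: "\<And>j. j \<in> J \<Longrightarrow> s j \<in> carrier AA"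
      "\<And>j F. j \<in> J \<Longrightarrow> bil K A H A F \<Longrightarrow>
        tensor_sum A (s j) (\<lambda>a b. rs A b (\<lambda>x y. F (a \<diamond> x) y)) = rs A \<one>\<^bsub>A\<^esub> (\<lambda>x y. F x (m j \<bullet> y))"
    by metis
  define Z where "Z j = Poly_Mapping.keys (SOME c. c \<in> s j)" for j
  define n where "n j z = Poly_Mapping.lookup (SOME c. c \<in> s j) z" for j z
  have Z: "z \<in> Z j \<Longrightarrow> fst z \<in> carrier A" "z \<in> Z j \<Longrightarrow> snd z \<in> carrier A" if "j \<in> J" for z j
    using tensor_factors.keys_some_rep[OF tensor_factors_ktensor[OF module_A module_A]] s(1)[OF that]
    by (auto simp: Z_def ktensor_simps)
  have fin: "finite (Z j)" for j by (simp add: Z_def)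
  have A: "abelian_group A" "ring A" using ring_A by (simp_all add: ring_def)
  have pc: "add_pow A (k::int) x \<in> carrier A" if "x \<in> carrier A" for k x
    using that group.int_pow_closed[OF abelian_group.a_group[OF A(1)]] by (simp add: add_pow_def)
  have hc: "hat (t j) a \<in> carrier A" if "j \<in> J" "a \<in> carrier A" for j a using coinv[OF that] by simp
  show thesis
  proof (rule that[of "Sigma J Z" "\<lambda>p. t (fst p)" "\<lambda>p. snd (snd p)"
        "\<lambda>p. add_pow A (n (fst p) (snd p)) (fst (snd p))"])
    fix y assume y [simp]: "y \<in> carrier A"
    have "(\<Oplus>\<^bsub>A\<^esub>p\<in>Sigma J Z. add_pow A (n (fst p) (snd p)) (fst (snd p)) \<diamond> hat (t (fst p)) (snd (snd p) \<diamond> y)) =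
        (\<Oplus>\<^bsub>A\<^esub>j\<in>J. \<Oplus>\<^bsub>A\<^esub>z\<in>Z j. add_pow A (n j z) (fst z) \<diamond> hat (t j) (snd z \<diamond> y))"
      by (rule abelian_group.finsum_Sigma[OF A(1) J(1) fin, symmetric]) (simp add: hc Z pc)
    also have "\<dots> = (\<Oplus>\<^bsub>A\<^esub>j\<in>J. tensor_sum A (s j) (\<lambda>a b. a \<diamond> hat (t j) (b \<diamond> y)))"
      unfolding tensor_sum_def Let_def Z_def[symmetric] n_def[symmetric]
      by (intro finsum_cong_raw) (simp add: ring.add_pow_ldistr_int[OF A(2)] hc Z)
    also have "\<dots> = (\<Oplus>\<^bsub>A\<^esub>j\<in>J. rs A y (\<lambda>p q. t j (m j \<bullet> q) \<odot>\<^bsub>A\<^esub> p))"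
      by (intro finsum_cong_raw right_expand s) (simp_all add: t)
    also have "\<dots> = y"
      by (rule sum_integrals[OF J(1) _ eps y])
        (simp add: lin_compose[OF t] asimps)
    finally show "(\<Oplus>\<^bsub>A\<^esub>p\<in>Sigma J Z. add_pow A (n (fst p) (snd p)) (fst (snd p)) \<diamond>
        hat (t (fst p)) (snd (snd p) \<diamond> y)) = y" .
  qed (use J fin t coinv Z pc in auto)
qed

end

context comodule_algebra
begin

section \<open>The ring of coinvariants and its actions on A\<close>

lemma lmult_one: "t \<in> carrier AH \<Longrightarrow> tensor_lmult K H A \<one>\<^bsub>A\<^esub> t = t"
  unfolding tensor_lmult_def
  by (subst (2) ktensor_sum_self[OF module_A module_H, symmetric])
    (auto intro!: ktensor_sum_cong_raw[OF module_A module_H])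

lemma lmult_lmult:
  assumes [simp]: "a \<in> carrier A" "b \<in> carrier A" "t \<in> carrier AH"
  shows "tensor_lmult K H A a (tensor_lmult K H A b t) = tensor_lmult K H A (a \<diamond> b) t"
proof -
  have "tensor_lmult K H A a (tensor_lmult K H A b t) =
      tensor_sum AH t (\<lambda>x y. tensor_lmult K H A a (pure_tensor AH (b \<diamond> x) y))"
    unfolding tensor_lmult_def[of K H A b]
    by (rule lin_ktensor_sum[OF module_A module_H module_AH module_AH lin_lmult_arg]) simp_all
  also have "\<dots> = tensor_lmult K H A (a \<diamond> b) t"
    unfolding tensor_lmult_def[of K H A "a \<diamond> b"]
    by (rule ktensor_sum_cong_raw[OF module_A module_H]) (simp_all add: lmult_pure A_assoc)
  finally show ?thesis .
qed

lemma coinvD: "b \<in> coinv \<Longrightarrow> a \<in> carrier A \<Longrightarrow> \<rho> (b \<diamond> a) = tensor_lmult K H A b (\<rho> a)"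
  unfolding coinvariants_def by blast

lemma subring_coinv: "subring coinv A"
proof (rule ring.subringI[OF ring_A])
  interpret A: assoc_algebra K A by simp
  have L: "lin K A AH (\<lambda>b. \<rho> (b \<diamond> a))" "lin K A AH (\<lambda>b. tensor_lmult K H A b (\<rho> a))"
    if "a \<in> carrier A" for a
    using that lin_compose[OF lin_coaction lin_amul(2)[OF lin_id]] lin_lmult_fun by auto
  show "coinv \<subseteq> carrier A" by (auto dest: coinv_closed)
  show "\<one>\<^bsub>A\<^esub> \<in> coinv" unfolding coinvariants_def by (simp add: lmult_one)
  fix b assume b: "b \<in> coinv"
  \<comment> \<open>Negation as a scalar multiple, so that linearity of both sides of the
    coinvariance condition settles it.\<close>
  have neg: "\<ominus>\<^bsub>A\<^esub> b = (\<ominus>\<^bsub>K\<^esub> \<one>\<^bsub>K\<^esub>) \<odot>\<^bsub>A\<^esub> b"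
    using coinv_closed[OF b] A.smult_l_minus[of "\<one>\<^bsub>K\<^esub>" b] H.cring_K
    by (simp add: cring_def ring.ring_simprules)
  show "\<ominus>\<^bsub>A\<^esub> b \<in> coinv"
    unfolding coinvariants_def
  proof (intro CollectI conjI ballI)
    show "\<ominus>\<^bsub>A\<^esub> b \<in> carrier A" using b by simp
    fix a assume a: "a \<in> carrier A"
    show "\<rho> (\<ominus>\<^bsub>A\<^esub> b \<diamond> a) = tensor_lmult K H A (\<ominus>\<^bsub>A\<^esub> b) (\<rho> a)"
      unfolding neg using lin_smult[OF L(1)[OF a]] lin_smult[OF L(2)[OF a]] coinvD[OF b a] coinv_closed[OF b]
      by simp
  qed
  fix c assume c: "c \<in> coinv"
  show "b \<diamond> c \<in> coinv"
    unfolding coinvariants_def using b c by (simp add: A_assoc coinvD lmult_lmult)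
  show "b \<oplus>\<^bsub>A\<^esub> c \<in> coinv"
    unfolding coinvariants_def
    using b c lin_add[OF L(1)] lin_add[OF L(2)] by (simp add: coinvD)
qed

abbreviation "B \<equiv> A\<lparr>carrier := coinv\<rparr>"

lemma ring_B: "ring B" by (rule ring.subring_is_ring[OF ring_A subring_coinv])

lemma left_module_A: "left_module B A (\<lambda>b a. b \<diamond> a)"
  using ring_A ring_B ring.ring_simprules[OF ring_A]
  by (auto simp: left_module_def left_module_axioms_def ring_def)

lemma right_module_A: "right_module B A (\<lambda>a b. a \<diamond> b)"
  using ring_A ring_B ring.ring_simprules[OF ring_A]
  by (auto simp: right_module_def right_module_axioms_def ring_def)

end

context comodule_algebra_hopf
begin

lemma projective_left:
  assumes K: "field K" and fd: "vectorspace.fin_dim K H" and sur: "can ` carrier AA = carrier EE'"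
  shows "projective_left_module TYPE('m) TYPE('n) B A (\<lambda>b a. b \<diamond> a)"
proof (rule dual_basis_left[OF assms])
  fix I :: "('h \<times> 'a \<times> 'a) set" and T b c
  assume I: "finite I" and T: "\<And>i. i \<in> I \<Longrightarrow> lin K H KK (T i)"
    and b: "\<And>i. i \<in> I \<Longrightarrow> b i \<in> carrier A" and c: "\<And>i. i \<in> I \<Longrightarrow> c i \<in> carrier A"
    and hat: "\<And>i a. i \<in> I \<Longrightarrow> a \<in> carrier A \<Longrightarrow> hat (T i) a \<in> coinv"
    and e: "\<And>y. y \<in> carrier A \<Longrightarrow> (\<Oplus>\<^bsub>A\<^esub>i\<in>I. hat (T i) (y \<diamond> b i) \<diamond> c i) = y"
  show ?thesis
  proof (rule projective_left_moduleI[of B A _ I c "\<lambda>i y. hat (T i) (y \<diamond> b i)"])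
    show "\<And>i p q. i \<in> I \<Longrightarrow> p \<in> carrier A \<Longrightarrow> q \<in> carrier A \<Longrightarrow>
        hat (T i) ((p \<oplus>\<^bsub>A\<^esub> q) \<diamond> b i) = hat (T i) (p \<diamond> b i) \<oplus>\<^bsub>B\<^esub> hat (T i) (q \<diamond> b i)"
      using b by (simp add: ring.ring_simprules[OF ring_A] lin_add[OF lin_hat[OF T]])
    show "\<And>i r p. i \<in> I \<Longrightarrow> r \<in> carrier B \<Longrightarrow> p \<in> carrier A \<Longrightarrow>
        hat (T i) ((r \<diamond> p) \<diamond> b i) = r \<otimes>\<^bsub>B\<^esub> hat (T i) (p \<diamond> b i)"
      using b by (simp add: A_assoc hat_coinv_mult(1)[OF T])
  qed (use I b c hat e left_module_A in auto)
qed

lemma projective_right: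
  assumes K: "field K" and fd: "vectorspace.fin_dim K H" and sur: "can ` carrier AA = carrier EE'"
  shows "projective_right_module TYPE('m) TYPE('n) B A (\<lambda>a b. a \<diamond> b)"
proof (rule dual_basis_right[OF assms])
  fix I :: "('h \<times> 'a \<times> 'a) set" and T b c
  assume I: "finite I" and T: "\<And>i. i \<in> I \<Longrightarrow> lin K H KK (T i)"
    and b: "\<And>i. i \<in> I \<Longrightarrow> b i \<in> carrier A" and c: "\<And>i. i \<in> I \<Longrightarrow> c i \<in> carrier A"
    and hat: "\<And>i a. i \<in> I \<Longrightarrow> a \<in> carrier A \<Longrightarrow> hat (T i) a \<in> coinv"
    and e: "\<And>y. y \<in> carrier A \<Longrightarrow> (\<Oplus>\<^bsub>A\<^esub>i\<in>I. c i \<diamond> hat (T i) (b i \<diamond> y)) = y"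
  show ?thesis
  proof (rule projective_right_moduleI[of B A _ I c "\<lambda>i y. hat (T i) (b i \<diamond> y)"])
    show "\<And>i p q. i \<in> I \<Longrightarrow> p \<in> carrier A \<Longrightarrow> q \<in> carrier A \<Longrightarrow>
        hat (T i) (b i \<diamond> (p \<oplus>\<^bsub>A\<^esub> q)) = hat (T i) (b i \<diamond> p) \<oplus>\<^bsub>B\<^esub> hat (T i) (b i \<diamond> q)"
      using b by (simp add: ring.ring_simprules[OF ring_A] lin_add[OF lin_hat[OF T]])
    show "\<And>i r p. i \<in> I \<Longrightarrow> r \<in> carrier B \<Longrightarrow> p \<in> carrier A \<Longrightarrow>
        hat (T i) (b i \<diamond> (p \<diamond> r)) = hat (T i) (b i \<diamond> p) \<otimes>\<^bsub>B\<^esub> r"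
      using b by (simp add: hat_coinv_mult(2)[OF T] flip: A_assoc)
  qed (use I b c hat e right_module_A ring_B in auto)
qed

end

section \<open>Bimodules and corings\<close>

lemma additive_id: "(\<lambda>x. x) \<in> hom G G"
  by (simp add: hom_def)

lemma additive_compose:
  "f \<in> hom (add_monoid G) (add_monoid G') \<Longrightarrow> f' \<in> hom (add_monoid G') (add_monoid G'') \<Longrightarrow>
    (\<lambda>x. f' (f x)) \<in> hom (add_monoid G) (add_monoid G'')"
  by (auto simp: hom_def Pi_iff)

lemma additive_add:
  assumes "abelian_group G'" "f \<in> hom (add_monoid G) (add_monoid G')" "f' \<in> hom (add_monoid G) (add_monoid G')"
  shows "(\<lambda>x. f x \<oplus>\<^bsub>G'\<^esub> f' x) \<in> hom (add_monoid G) (add_monoid G')"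
proof -
  interpret G': abelian_group G' by fact
  show ?thesis using assms(2,3) by (auto simp: hom_def Pi_iff G'.a_ac)
qed

text \<open>The difference step of every induction below: equality of additive maps is inherited
  from generators.\<close>

lemma additive_eqD:
  assumes "abelian_group G" "abelian_group G'"
    and "f \<in> hom (add_monoid G) (add_monoid G')" "f' \<in> hom (add_monoid G) (add_monoid G')"
    and "s \<in> carrier G" "t \<in> carrier G" "f s = f' s" "f t = f' t"
  shows "f (s \<ominus>\<^bsub>G\<^esub> t) = f' (s \<ominus>\<^bsub>G\<^esub> t)"
  using additive_diff[OF assms(1,2), of f s t] additive_diff[OF assms(1,2), of f' s t] assms(3-)
  by (simp add: hom_def Pi_iff)

lemma additiveD:
  assumes "f \<in> hom (add_monoid G) (add_monoid G')"
  shows "x \<in> carrier G \<Longrightarrow> f x \<in> carrier G'"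
    and "x \<in> carrier G \<Longrightarrow> y \<in> carrier G \<Longrightarrow> f (x \<oplus>\<^bsub>G\<^esub> y) = f x \<oplus>\<^bsub>G'\<^esub> f y"
  using assms by (auto simp: hom_def)

lemma bimodule_regular:
  assumes "ring A"
  shows "bimodule A (regular_bimodule A)"
proof -
  interpret A: ring A by fact
  have "abelian_group (regular_bimodule A)"
    by (rule abelian_group_target[OF A.abelian_group_axioms]) (auto simp: regular_bimodule_def)
  then show ?thesis
    by (auto simp: bimodule_def left_module_def right_module_def left_module_axioms_def
        right_module_axioms_def bimodule_axioms_def assms A.m_assoc A.l_distr A.r_distr)
qed

context tensor_factors
begin

lemma tensor_sum_hom_arg:
  "abelian_group G \<Longrightarrow> balanced_map R M ract N lact G f \<Longrightarrow> (\<lambda>t. tensor_sum G t f) \<in> hom (add_monoid T) (add_monoid G)"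
  by (auto intro!: homI tensor_sum_closed tensor_sum_add simp: balanced_map_def)

end

text \<open>The ring \<open>R\<close> over which the tensor product is formed is kept apart from the
  ring \<open>A\<close> of the outer actions. \<open>R = A\<close> gives the targets of
  comultiplications, \<open>R\<close> the coinvariants gives the Sweedler coring.\<close>

locale bimodule_pair = M: bimodule A M + N: bimodule A N
  for A :: "('a, 'x) ring_scheme" and M :: "('a, 'm, 'y) bimodule_scheme" and N :: "('a, 'n, 'z) bimodule_scheme" +
  fixes R :: "('a, 'u) ring_scheme"
  assumes R_sub: "carrier R \<subseteq> carrier A"
begin

sublocale tensor_factors R M "rsmult M" N "smult N"
  by unfold_locales (use R_sub M.ract_closed N.act_closed in auto)

abbreviation "Q \<equiv> bitensor R M N"
abbreviation "pure \<equiv> pure_tensor Q"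

lemma Q_simps:
  "carrier Q = carrier T" "\<zero>\<^bsub>Q\<^esub> = \<zero>\<^bsub>T\<^esub>" "ring.add Q = ring.add T" "pure_tensor Q = pure_tensor T"
  by (auto simp: bitensor_def Let_def pure_tensor_def fun_eq_iff)

lemma Q_add_monoid: "hom (add_monoid Q) = hom (add_monoid T)" "hom G (add_monoid Q) = hom G (add_monoid T)"
  by (auto simp: hom_def fun_eq_iff Q_simps)

lemma Q_sum: "tensor_sum Q t f = tensor_sum T t f"
  by (rule tensor_sum_target_cong) (simp_all add: Q_simps)

lemma abelian_group_Q: "abelian_group Q"
  by (rule abelian_group_target[OF abelian_group_tensor]) (simp_all add: Q_simps)

sublocale Q: abelian_group Q by (rule abelian_group_Q)

lemma Q_pure: "x \<in> carrier M \<Longrightarrow> y \<in> carrier N \<Longrightarrow> pure x y \<in> carrier Q"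
  and Q_pure_add: "x \<in> carrier M \<Longrightarrow> x' \<in> carrier M \<Longrightarrow> y \<in> carrier N \<Longrightarrow>
    pure (x \<oplus>\<^bsub>M\<^esub> x') y = pure x y \<oplus>\<^bsub>Q\<^esub> pure x' y"
    "x \<in> carrier M \<Longrightarrow> y \<in> carrier N \<Longrightarrow> y' \<in> carrier N \<Longrightarrow>
    pure x (y \<oplus>\<^bsub>N\<^esub> y') = pure x y \<oplus>\<^bsub>Q\<^esub> pure x y'"
  and Q_pure_balanced: "x \<in> carrier M \<Longrightarrow> r \<in> carrier R \<Longrightarrow> y \<in> carrier N \<Longrightarrow>
    pure (x \<star>\<^bsub>M\<^esub> r) y = pure x (r \<odot>\<^bsub>N\<^esub> y)"
  by (simp_all add: Q_simps pure_carrier pure_add_left pure_add_right pure_balanced)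

lemma Q_induct [consumes 1, case_names pure minus]:
  assumes "t \<in> carrier Q"
    and "\<And>x y. x \<in> carrier M \<Longrightarrow> y \<in> carrier N \<Longrightarrow> P (pure x y)"
    and "\<And>s t. s \<in> carrier Q \<Longrightarrow> t \<in> carrier Q \<Longrightarrow> P s \<Longrightarrow> P t \<Longrightarrow> P (s \<ominus>\<^bsub>Q\<^esub> t)"
  shows "P t"
proof -
  have minus: "s \<ominus>\<^bsub>Q\<^esub> t = s \<ominus>\<^bsub>T\<^esub> t" for s t
    by (simp add: a_minus_def a_inv_def m_inv_def Q_simps)
  show ?thesis
    by (rule tensor_induct[of t P]) (use assms in \<open>simp_all add: Q_simps minus\<close>)
qed

lemma Q_eqI:
  assumes "abelian_group G" "f \<in> hom (add_monoid Q) (add_monoid G)" "f' \<in> hom (add_monoid Q) (add_monoid G)"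
    and "\<And>x y. x \<in> carrier M \<Longrightarrow> y \<in> carrier N \<Longrightarrow> f (pure x y) = f' (pure x y)" and "t \<in> carrier Q"
  shows "f t = f' t"
  using assms(5)
  by (induction t rule: Q_induct) (use assms additive_eqD[OF abelian_group_Q assms(1-3)] in auto)

lemma Q_sum_hom:
  "abelian_group G \<Longrightarrow> balanced_map R M (rsmult M) N (smult N) G f \<Longrightarrow>
    (\<lambda>t. tensor_sum G t f) \<in> hom (add_monoid Q) (add_monoid G)"
  unfolding Q_add_monoid by (rule tensor_sum_hom_arg)

lemma Q_sum_pure:
  "abelian_group G \<Longrightarrow> balanced_map R M (rsmult M) N (smult N) G f \<Longrightarrow> x \<in> carrier M \<Longrightarrow> y \<in> carrier N \<Longrightarrow>
    tensor_sum G (pure x y) f = f x y"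
  unfolding Q_simps by (rule tensor_sum_pure)

lemma Q_smult: "a \<odot>\<^bsub>Q\<^esub> t = tensor_sum Q t (\<lambda>x y. pure (a \<odot>\<^bsub>M\<^esub> x) y)"
  and Q_rsmult: "t \<star>\<^bsub>Q\<^esub> a = tensor_sum Q t (\<lambda>x y. pure x (y \<star>\<^bsub>N\<^esub> a))"
  unfolding Q_sum Q_simps by (simp_all add: bitensor_def Let_def)

lemma balanced_Q_smult:
  assumes "a \<in> carrier A"
  shows "balanced_map R M (rsmult M) N (smult N) Q (\<lambda>x y. pure (a \<odot>\<^bsub>M\<^esub> x) y)"
    and "balanced_map R M (rsmult M) N (smult N) Q (\<lambda>x y. pure x (y \<star>\<^bsub>N\<^esub> a))"
  using assms R_sub
  by (auto intro!: balanced_mapI simp: Q_pure Q_pure_add Q_pure_balanced M.act_closed M.act_r_distr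
      N.ract_closed N.ract_l_distr subset_iff simp flip: M.smult_rsmult
      , auto simp: Q_pure_balanced N.smult_rsmult N.ract_closed)

lemma Q_smult_pure:
  assumes "a \<in> carrier A" "x \<in> carrier M" "y \<in> carrier N"
  shows "a \<odot>\<^bsub>Q\<^esub> pure x y = pure (a \<odot>\<^bsub>M\<^esub> x) y" "pure x y \<star>\<^bsub>Q\<^esub> a = pure x (y \<star>\<^bsub>N\<^esub> a)"
  unfolding Q_smult Q_rsmult using assms
  by (simp_all add: Q_sum_pure[OF abelian_group_Q balanced_Q_smult(1)] Q_sum_pure[OF abelian_group_Q balanced_Q_smult(2)])

lemma Q_smult_hom:
  assumes "a \<in> carrier A"
  shows "(\<lambda>t. a \<odot>\<^bsub>Q\<^esub> t) \<in> hom (add_monoid Q) (add_monoid Q)" "(\<lambda>t. t \<star>\<^bsub>Q\<^esub> a) \<in> hom (add_monoid Q) (add_monoid Q)"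
  unfolding Q_smult Q_rsmult
  by (rule Q_sum_hom[OF abelian_group_Q balanced_Q_smult(1)[OF assms]]
      Q_sum_hom[OF abelian_group_Q balanced_Q_smult(2)[OF assms]])+

text \<open>Both sides of each law are additive in the tensor, so \<open>Q_eqI\<close> reduces the
  laws to pure tensors.\<close>

lemma bimodule_Q: "bimodule A Q"
proof -
  note eq = Q_eqI[OF abelian_group_Q]
  note hs = Q_smult_hom additive_add[OF abelian_group_Q] additive_compose additive_id
    M.R.m_closed M.R.add.m_closed M.R.one_closed
  note ps = Q_smult_pure Q_pure M.act_closed M.ract_closed N.act_closed N.ract_closed
  show ?thesis
    unfolding bimodule_def left_module_def right_module_def left_module_axioms_def
      right_module_axioms_def bimodule_axioms_def
  proof (intro conjI allI impI)
    fix r s t assume rst [simp]: "r \<in> carrier A" "s \<in> carrier A" "t \<in> carrier Q"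
    show "(r \<oplus>\<^bsub>A\<^esub> s) \<odot>\<^bsub>Q\<^esub> t = r \<odot>\<^bsub>Q\<^esub> t \<oplus>\<^bsub>Q\<^esub> s \<odot>\<^bsub>Q\<^esub> t"
      by (rule eq[of "\<lambda>t. (r \<oplus>\<^bsub>A\<^esub> s) \<odot>\<^bsub>Q\<^esub> t" "\<lambda>t. r \<odot>\<^bsub>Q\<^esub> t \<oplus>\<^bsub>Q\<^esub> s \<odot>\<^bsub>Q\<^esub> t"])
        (simp_all add: hs ps M.act_l_distr Q_pure_add)
    show "(r \<otimes>\<^bsub>A\<^esub> s) \<odot>\<^bsub>Q\<^esub> t = r \<odot>\<^bsub>Q\<^esub> (s \<odot>\<^bsub>Q\<^esub> t)"
      by (rule eq[of "\<lambda>t. (r \<otimes>\<^bsub>A\<^esub> s) \<odot>\<^bsub>Q\<^esub> t" "\<lambda>t. r \<odot>\<^bsub>Q\<^esub> (s \<odot>\<^bsub>Q\<^esub> t)"])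
        (simp_all add: hs additive_compose[OF Q_smult_hom(1) Q_smult_hom(1)] ps M.act_assoc)
    show "t \<star>\<^bsub>Q\<^esub> (r \<oplus>\<^bsub>A\<^esub> s) = t \<star>\<^bsub>Q\<^esub> r \<oplus>\<^bsub>Q\<^esub> t \<star>\<^bsub>Q\<^esub> s"
      by (rule eq[of "\<lambda>t. t \<star>\<^bsub>Q\<^esub> (r \<oplus>\<^bsub>A\<^esub> s)" "\<lambda>t. t \<star>\<^bsub>Q\<^esub> r \<oplus>\<^bsub>Q\<^esub> t \<star>\<^bsub>Q\<^esub> s"])
        (simp_all add: hs ps N.ract_r_distr Q_pure_add)
    show "t \<star>\<^bsub>Q\<^esub> (r \<otimes>\<^bsub>A\<^esub> s) = t \<star>\<^bsub>Q\<^esub> r \<star>\<^bsub>Q\<^esub> s"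
      by (rule eq[of "\<lambda>t. t \<star>\<^bsub>Q\<^esub> (r \<otimes>\<^bsub>A\<^esub> s)" "\<lambda>t. t \<star>\<^bsub>Q\<^esub> r \<star>\<^bsub>Q\<^esub> s"])
        (simp_all add: hs additive_compose[OF Q_smult_hom(2) Q_smult_hom(2)] ps N.ract_assoc)
    show "(r \<odot>\<^bsub>Q\<^esub> t) \<star>\<^bsub>Q\<^esub> s = r \<odot>\<^bsub>Q\<^esub> (t \<star>\<^bsub>Q\<^esub> s)"
      by (rule eq[of "\<lambda>t. (r \<odot>\<^bsub>Q\<^esub> t) \<star>\<^bsub>Q\<^esub> s" "\<lambda>t. r \<odot>\<^bsub>Q\<^esub> (t \<star>\<^bsub>Q\<^esub> s)"])
        (simp_all add: hs additive_compose[OF Q_smult_hom(1) Q_smult_hom(2)]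
          additive_compose[OF Q_smult_hom(2) Q_smult_hom(1)] ps)
  next
    fix t assume t [simp]: "t \<in> carrier Q"
    show "\<one>\<^bsub>A\<^esub> \<odot>\<^bsub>Q\<^esub> t = t"
      by (rule eq[of "\<lambda>t. \<one>\<^bsub>A\<^esub> \<odot>\<^bsub>Q\<^esub> t" "\<lambda>t. t"]) (simp_all add: hs ps M.act_one)
    show "t \<star>\<^bsub>Q\<^esub> \<one>\<^bsub>A\<^esub> = t"
      by (rule eq[of "\<lambda>t. t \<star>\<^bsub>Q\<^esub> \<one>\<^bsub>A\<^esub>" "\<lambda>t. t"]) (simp_all add: hs ps N.ract_one)
  qed (use additiveD[OF Q_smult_hom(1)] additiveD[OF Q_smult_hom(2)] abelian_group_Q M.R.ring_axioms in auto)
qed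

end

text \<open>A coring generated as a bimodule by one group-like element \<open>g\<close>: both \<open>A \<otimes>\<^sub>B A\<close>, with \<open>g = 1 \<otimes> 1\<close>, and
  \<open>E\<close>, with \<open>g = \<rho> 1\<close>, are of this kind.\<close>

locale generated_coring = bimodule A C
  for A :: "('a, 'x) ring_scheme" and C :: "('a, 'c, 'y) bimodule_scheme" +
  fixes \<Delta> :: "'c \<Rightarrow> ('c, 'c) tensor" and \<epsilon> :: "'c \<Rightarrow> 'a" and g :: 'c
  assumes g [simp]: "g \<in> carrier C"
    and generated: "c \<in> carrier C \<Longrightarrow>
      (\<And>a b. a \<in> carrier A \<Longrightarrow> b \<in> carrier A \<Longrightarrow> P (a \<odot>\<^bsub>C\<^esub> g \<star>\<^bsub>C\<^esub> b)) \<Longrightarrow>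
      (\<And>s t. s \<in> carrier C \<Longrightarrow> t \<in> carrier C \<Longrightarrow> P s \<Longrightarrow> P t \<Longrightarrow> P (s \<ominus>\<^bsub>C\<^esub> t)) \<Longrightarrow> P c"
    and \<Delta>_hom: "\<Delta> \<in> hom (add_monoid C) (add_monoid (bitensor A C C))"
    and \<Delta>_generator: "a \<in> carrier A \<Longrightarrow> b \<in> carrier A \<Longrightarrow>
      \<Delta> (a \<odot>\<^bsub>C\<^esub> g \<star>\<^bsub>C\<^esub> b) = pure_tensor (bitensor A C C) (a \<odot>\<^bsub>C\<^esub> g) (g \<star>\<^bsub>C\<^esub> b)"
    and \<epsilon>_hom: "\<epsilon> \<in> hom (add_monoid C) (add_monoid A)"
    and \<epsilon>_generator: "a \<in> carrier A \<Longrightarrow> b \<in> carrier A \<Longrightarrow> \<epsilon> (a \<odot>\<^bsub>C\<^esub> g \<star>\<^bsub>C\<^esub> b) = a \<otimes>\<^bsub>A\<^esub> b"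
begin

lemma generated_eqI:
  assumes "abelian_group G" "f \<in> hom (add_monoid C) (add_monoid G)" "f' \<in> hom (add_monoid C) (add_monoid G)"
    and "\<And>a b. a \<in> carrier A \<Longrightarrow> b \<in> carrier A \<Longrightarrow> f (a \<odot>\<^bsub>C\<^esub> g \<star>\<^bsub>C\<^esub> b) = f' (a \<odot>\<^bsub>C\<^esub> g \<star>\<^bsub>C\<^esub> b)"
    and "c \<in> carrier C"
  shows "f c = f' c"
  by (rule generated[OF assms(5)])
    (use assms(4) additive_eqD[OF M.abelian_group_axioms assms(1-3)] in auto)

sublocale CC: bimodule_pair A C C A
  by (simp add: bimodule_pair_def bimodule_pair_axioms_def bimodule_axioms)

abbreviation "CC \<equiv> bitensor A C C"
abbreviation "CCC \<equiv> bitensor A CC C"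

sublocale CCC: bimodule_pair A CC C A
  by (simp add: bimodule_pair_def bimodule_pair_axioms_def bimodule_axioms CC.bimodule_Q)

lemma smult_hom:
  assumes "a \<in> carrier A"
  shows "(\<lambda>x. a \<odot>\<^bsub>C\<^esub> x) \<in> hom (add_monoid C) (add_monoid C)" "(\<lambda>x. x \<star>\<^bsub>C\<^esub> a) \<in> hom (add_monoid C) (add_monoid C)"
  using assms by (auto intro!: homI simp: act_closed act_r_distr ract_closed ract_l_distr)

lemma gen_smult:
  assumes "r \<in> carrier A" "a \<in> carrier A" "b \<in> carrier A"
  shows "r \<odot>\<^bsub>C\<^esub> (a \<odot>\<^bsub>C\<^esub> g \<star>\<^bsub>C\<^esub> b) = (r \<otimes>\<^bsub>A\<^esub> a) \<odot>\<^bsub>C\<^esub> g \<star>\<^bsub>C\<^esub> b"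
    "(a \<odot>\<^bsub>C\<^esub> g \<star>\<^bsub>C\<^esub> b) \<star>\<^bsub>C\<^esub> r = a \<odot>\<^bsub>C\<^esub> g \<star>\<^bsub>C\<^esub> (b \<otimes>\<^bsub>A\<^esub> r)"
  using assms by (simp_all add: act_assoc ract_assoc act_closed smult_rsmult)

lemma \<Delta>_act:
  assumes r: "r \<in> carrier A" and c: "c \<in> carrier C"
  shows "\<Delta> (r \<odot>\<^bsub>C\<^esub> c) = r \<odot>\<^bsub>CC\<^esub> \<Delta> c" "\<Delta> (c \<star>\<^bsub>C\<^esub> r) = \<Delta> c \<star>\<^bsub>CC\<^esub> r"
proof -
  note h = additive_compose[OF smult_hom(1)[OF r] \<Delta>_hom] additive_compose[OF smult_hom(2)[OF r] \<Delta>_hom]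
    additive_compose[OF \<Delta>_hom CC.Q_smult_hom(1)[OF r]] additive_compose[OF \<Delta>_hom CC.Q_smult_hom(2)[OF r]]
  show "\<Delta> (r \<odot>\<^bsub>C\<^esub> c) = r \<odot>\<^bsub>CC\<^esub> \<Delta> c"
    by (rule generated_eqI[OF CC.abelian_group_Q h(1,3) _ c])
      (use r in \<open>simp add: gen_smult \<Delta>_generator CC.Q_smult_pure act_closed ract_closed flip: act_assoc\<close>)
  show "\<Delta> (c \<star>\<^bsub>C\<^esub> r) = \<Delta> c \<star>\<^bsub>CC\<^esub> r"
    by (rule generated_eqI[OF CC.abelian_group_Q h(2,4) _ c])
      (use r in \<open>simp add: gen_smult \<Delta>_generator CC.Q_smult_pure act_closed ract_closed flip: ract_assoc\<close>)
qed

lemma \<epsilon>_act: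
  assumes r: "r \<in> carrier A" and c: "c \<in> carrier C"
  shows "\<epsilon> (r \<odot>\<^bsub>C\<^esub> c) = r \<otimes>\<^bsub>A\<^esub> \<epsilon> c" "\<epsilon> (c \<star>\<^bsub>C\<^esub> r) = \<epsilon> c \<otimes>\<^bsub>A\<^esub> r"
proof -
  have A: "abelian_group A" by (rule R.abelian_group_axioms)
  have m: "(\<lambda>x. r \<otimes>\<^bsub>A\<^esub> x) \<in> hom (add_monoid A) (add_monoid A)" "(\<lambda>x. x \<otimes>\<^bsub>A\<^esub> r) \<in> hom (add_monoid A) (add_monoid A)"
    using r by (auto intro!: homI simp: R.l_distr R.r_distr)
  note h = additive_compose[OF smult_hom(1)[OF r] \<epsilon>_hom] additive_compose[OF smult_hom(2)[OF r] \<epsilon>_hom]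
    additive_compose[OF \<epsilon>_hom m(1)] additive_compose[OF \<epsilon>_hom m(2)]
  show "\<epsilon> (r \<odot>\<^bsub>C\<^esub> c) = r \<otimes>\<^bsub>A\<^esub> \<epsilon> c"
    by (rule generated_eqI[OF A h(1,3) _ c]) (use r in \<open>simp add: gen_smult \<epsilon>_generator R.m_assoc\<close>)
  show "\<epsilon> (c \<star>\<^bsub>C\<^esub> r) = \<epsilon> c \<otimes>\<^bsub>A\<^esub> r"
    by (rule generated_eqI[OF A h(2,4) _ c]) (use r in \<open>simp add: gen_smult \<epsilon>_generator R.m_assoc\<close>)
qed

lemmas \<Delta>_closed = additiveD(1)[OF \<Delta>_hom] and \<Delta>_add = additiveD(2)[OF \<Delta>_hom]
  and \<epsilon>_closed = additiveD(1)[OF \<epsilon>_hom] and \<epsilon>_add = additiveD(2)[OF \<epsilon>_hom]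

lemma \<Delta>_generator_one:
  "a \<in> carrier A \<Longrightarrow> \<Delta> (a \<odot>\<^bsub>C\<^esub> g) = CC.pure (a \<odot>\<^bsub>C\<^esub> g) g"
  "a \<in> carrier A \<Longrightarrow> \<Delta> (g \<star>\<^bsub>C\<^esub> a) = CC.pure g (g \<star>\<^bsub>C\<^esub> a)"
  "a \<in> carrier A \<Longrightarrow> \<epsilon> (a \<odot>\<^bsub>C\<^esub> g) = a" "a \<in> carrier A \<Longrightarrow> \<epsilon> (g \<star>\<^bsub>C\<^esub> a) = a"
  using \<Delta>_generator[of a "\<one>\<^bsub>A\<^esub>"] \<Delta>_generator[of "\<one>\<^bsub>A\<^esub>" a] \<epsilon>_generator[of a "\<one>\<^bsub>A\<^esub>"] \<epsilon>_generator[of "\<one>\<^bsub>A\<^esub>" a]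
  by (simp_all add: act_closed ract_one act_one)

lemma balanced_left: "balanced_map A C (rsmult C) C (smult C) CCC (\<lambda>x y. CCC.pure (\<Delta> x) y)"
  by (rule balanced_mapI)
    (simp_all add: \<Delta>_closed \<Delta>_add \<Delta>_act CCC.Q_pure CCC.Q_pure_add CCC.Q_pure_balanced)

lemma balanced_inner:
  "x \<in> carrier C \<Longrightarrow> balanced_map A C (rsmult C) C (smult C) CCC (\<lambda>u v. CCC.pure (CC.pure x u) v)"
  by (rule balanced_mapI)
    (simp_all add: CC.Q_pure CC.Q_pure_add CCC.Q_pure CCC.Q_pure_add
      flip: CC.Q_smult_pure(2) CCC.Q_pure_balanced)

text \<open>The inner sum is moved across the balancing relation by left linearity of \<Delta>,
  which is why \<open>\<Delta>_act\<close> has to come before coassociativity.\<close>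

lemma balanced_right: "balanced_map A C (rsmult C) C (smult C) CCC
    (\<lambda>x y. tensor_sum CCC (\<Delta> y) (\<lambda>u v. CCC.pure (CC.pure x u) v))"
proof -
  note h = CC.Q_sum_hom[OF CCC.abelian_group_Q balanced_inner]
  show ?thesis
  proof (rule balanced_mapI)
    fix x x' y assume [simp]: "x \<in> carrier C" "x' \<in> carrier C" "y \<in> carrier C"
    have [simp]: "\<Delta> y \<in> carrier CC" by (simp add: \<Delta>_closed)
    show "tensor_sum CCC (\<Delta> y) (\<lambda>u v. CCC.pure (CC.pure (x \<oplus>\<^bsub>C\<^esub> x') u) v) =
        tensor_sum CCC (\<Delta> y) (\<lambda>u v. CCC.pure (CC.pure x u) v) \<oplus>\<^bsub>CCC\<^esub>
        tensor_sum CCC (\<Delta> y) (\<lambda>u v. CCC.pure (CC.pure x' u) v)"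
      by (rule CC.Q_eqI[where f = "\<lambda>t. tensor_sum CCC t (\<lambda>u v. CCC.pure (CC.pure (x \<oplus>\<^bsub>C\<^esub> x') u) v)"
            and f' = "\<lambda>t. tensor_sum CCC t (\<lambda>u v. CCC.pure (CC.pure x u) v) \<oplus>\<^bsub>CCC\<^esub>
              tensor_sum CCC t (\<lambda>u v. CCC.pure (CC.pure x' u) v)", OF CCC.abelian_group_Q])
        (simp_all add: h additive_add CCC.abelian_group_Q
          CC.Q_sum_pure[OF CCC.abelian_group_Q balanced_inner] CC.Q_pure_add CC.Q_pure CCC.Q_pure_add)
  next
    fix x r y assume [simp]: "x \<in> carrier C" "r \<in> carrier A" "y \<in> carrier C"
    have [simp]: "\<Delta> y \<in> carrier CC" by (simp add: \<Delta>_closed)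
    show "tensor_sum CCC (\<Delta> y) (\<lambda>u v. CCC.pure (CC.pure (x \<star>\<^bsub>C\<^esub> r) u) v) =
        tensor_sum CCC (\<Delta> (r \<odot>\<^bsub>C\<^esub> y)) (\<lambda>u v. CCC.pure (CC.pure x u) v)"
      unfolding \<Delta>_act(1)[OF \<open>r \<in> carrier A\<close> \<open>y \<in> carrier C\<close>]
      by (rule CC.Q_eqI[where f = "\<lambda>t. tensor_sum CCC t (\<lambda>u v. CCC.pure (CC.pure (x \<star>\<^bsub>C\<^esub> r) u) v)"
            and f' = "\<lambda>t. tensor_sum CCC (r \<odot>\<^bsub>CC\<^esub> t) (\<lambda>u v. CCC.pure (CC.pure x u) v)", OF CCC.abelian_group_Q])
        (simp_all add: h additive_compose[OF CC.Q_smult_hom(1) h] ract_closed act_closed CC.Q_smult_pure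
          CC.Q_sum_pure[OF CCC.abelian_group_Q balanced_inner] CC.Q_pure_balanced)
  qed (simp_all add: additiveD[OF h] \<Delta>_closed \<Delta>_add)
qed

lemma balanced_counit:
  "balanced_map A C (rsmult C) C (smult C) C (\<lambda>x y. \<epsilon> x \<odot>\<^bsub>C\<^esub> y)"
  "balanced_map A C (rsmult C) C (smult C) C (\<lambda>x y. x \<star>\<^bsub>C\<^esub> \<epsilon> y)"
  by (auto intro!: balanced_mapI simp: \<epsilon>_closed \<epsilon>_add \<epsilon>_act act_closed act_l_distr act_r_distr act_assoc
      ract_closed ract_l_distr ract_r_distr ract_assoc)

text \<open>On \<open>a g b\<close> both sides of coassociativity are
  \<open>a g \<otimes> g \<otimes> g b\<close>, and both counit laws return
  \<open>a g b\<close>.\<close>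

lemma coring: "coring A C \<Delta> \<epsilon>"
proof (rule coring.intro[OF bimodule_axioms coring_axioms.intro])
  note ag = CCC.abelian_group_Q M.abelian_group_axioms
  note h = additive_compose[OF \<Delta>_hom CC.Q_sum_hom[OF ag(1) balanced_left]]
    additive_compose[OF \<Delta>_hom CC.Q_sum_hom[OF ag(1) balanced_right]]
    additive_compose[OF \<Delta>_hom CC.Q_sum_hom[OF ag(2) balanced_counit(1)]]
    additive_compose[OF \<Delta>_hom CC.Q_sum_hom[OF ag(2) balanced_counit(2)]]
  note p = CC.Q_sum_pure[OF ag(1) balanced_left] CC.Q_sum_pure[OF ag(1) balanced_right]
    CC.Q_sum_pure[OF ag(1) balanced_inner] CC.Q_sum_pure[OF ag(2) balanced_counit(1)]
    CC.Q_sum_pure[OF ag(2) balanced_counit(2)]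
  note s = \<Delta>_generator \<Delta>_generator_one act_closed ract_closed p
  show "\<Delta> \<in> bimodule_hom A C CC"
    using \<Delta>_hom by (simp add: bimodule_hom_def left_module_hom_def right_module_hom_def \<Delta>_act)
  show "\<epsilon> \<in> bimodule_hom A C (regular_bimodule A)"
    using \<epsilon>_hom by (simp add: bimodule_hom_def left_module_hom_def right_module_hom_def \<epsilon>_act hom_def)
  fix c assume c: "c \<in> carrier C"
  show "tensor_sum CCC (\<Delta> c) (\<lambda>x y. CCC.pure (\<Delta> x) y) =
      tensor_sum CCC (\<Delta> c) (\<lambda>x y. tensor_sum CCC (\<Delta> y) (\<lambda>u v. CCC.pure (CC.pure x u) v))"
    by (rule generated_eqI[OF ag(1) h(1,2) _ c]) (simp add: s)
  show "tensor_sum C (\<Delta> c) (\<lambda>x y. \<epsilon> x \<odot>\<^bsub>C\<^esub> y) = c"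
    by (rule generated_eqI[OF ag(2) h(3) additive_id _ c]) (simp add: s flip: smult_rsmult)
  show "tensor_sum C (\<Delta> c) (\<lambda>x y. x \<star>\<^bsub>C\<^esub> \<epsilon> y) = c"
    by (rule generated_eqI[OF ag(2) h(4) additive_id _ c]) (simp add: s)
qed

end

text \<open>A bimodule map with \<open>f g = g'\<close> sends \<open>a g b\<close> to
  \<open>a g' b\<close>; there both comultiplications give \<open>a g' \<otimes> g' b\<close> and
  both counits give the product of \<open>a\<close> and \<open>b\<close>.\<close>

lemma generated_coring_iso:
  assumes C: "generated_coring A C \<Delta>C \<epsilon>C g" and D: "generated_coring A D \<Delta>D \<epsilon>D g'"
    and f: "f \<in> bimodule_hom A C D" and bij: "bij_betw f (carrier C) (carrier D)" and fg: "f g = g'"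
  shows "coring_iso A C \<Delta>C \<epsilon>C D \<Delta>D \<epsilon>D f"
proof -
  interpret C: generated_coring A C \<Delta>C \<epsilon>C g by (rule C)
  interpret D: generated_coring A D \<Delta>D \<epsilon>D g' by (rule D)
  have hom: "f \<in> hom (add_monoid C) (add_monoid D)"
    using f by (simp add: bimodule_hom_def left_module_hom_def)
  have act: "f (a \<odot>\<^bsub>C\<^esub> x) = a \<odot>\<^bsub>D\<^esub> f x" "f (x \<star>\<^bsub>C\<^esub> a) = f x \<star>\<^bsub>D\<^esub> a" if "a \<in> carrier A" "x \<in> carrier C" for a x
    using f that by (simp_all add: bimodule_hom_def left_module_hom_def right_module_hom_def)
  have bal: "balanced_map A C (rsmult C) C (smult C) D.CC (\<lambda>x y. D.CC.pure (f x) (f y))"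
    by (rule balanced_mapI) (simp_all add: additiveD[OF hom] act D.CC.Q_pure D.CC.Q_pure_add D.CC.Q_pure_balanced)
  note h = additive_compose[OF hom D.\<Delta>_hom] additive_compose[OF C.\<Delta>_hom C.CC.Q_sum_hom[OF D.CC.abelian_group_Q bal]]
    additive_compose[OF hom D.\<epsilon>_hom]
  have gen: "f (a \<odot>\<^bsub>C\<^esub> g \<star>\<^bsub>C\<^esub> b) = a \<odot>\<^bsub>D\<^esub> g' \<star>\<^bsub>D\<^esub> b" if "a \<in> carrier A" "b \<in> carrier A" for a b
    using that by (simp add: act C.act_closed fg)
  have "\<Delta>D (f c) = tensor_sum D.CC (\<Delta>C c) (\<lambda>x y. D.CC.pure (f x) (f y))" if "c \<in> carrier C" for c
    by (rule C.generated_eqI[OF D.CC.abelian_group_Q h(1,2) _ that])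
      (simp add: gen C.\<Delta>_generator D.\<Delta>_generator C.CC.Q_sum_pure[OF D.CC.abelian_group_Q bal]
        C.act_closed C.ract_closed act fg)
  moreover have "\<epsilon>D (f c) = \<epsilon>C c" if "c \<in> carrier C" for c
    by (rule C.generated_eqI[OF C.R.abelian_group_axioms h(3) C.\<epsilon>_hom _ that])
      (simp add: gen C.\<epsilon>_generator D.\<epsilon>_generator)
  ultimately show ?thesis
    unfolding coring_iso_def using C.coring D.coring f bij by (intro conjI ballI)
qed

text \<open>Here \<open>a (1 \<otimes> 1) b\<close> is \<open>a \<otimes> b\<close>, so the defining
  formulas are those on generators and only their balancedness over \<open>B\<close> needs an
  argument.\<close>

lemma sweedler_generated:
  assumes A: "ring A" and B: "B \<subseteq> carrier A"
  shows "generated_coring A (sweedler_bimodule A B) (sweedler_comult A B) (sweedler_counit A)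
    (pure_tensor (sweedler_bimodule A B) \<one>\<^bsub>A\<^esub> \<one>\<^bsub>A\<^esub>)"
proof -
  interpret A: ring A by (rule A)
  let ?R = "regular_bimodule A" and ?B = "A\<lparr>carrier := B\<rparr>"
  interpret Q: bimodule_pair A ?R ?R ?B
    using bimodule_regular[OF A] B by (simp add: bimodule_pair_def bimodule_pair_axioms_def)
  let ?C = "bitensor ?B ?R ?R"
  interpret CC: bimodule_pair A ?C ?C A
    using Q.bimodule_Q by (simp add: bimodule_pair_def bimodule_pair_axioms_def)
  interpret C: bimodule A ?C by (rule Q.bimodule_Q)
  have Bc: "r \<in> B \<Longrightarrow> r \<in> carrier A" for r using B by blast
  have gen: "Q.pure a \<one>\<^bsub>A\<^esub> \<star>\<^bsub>?C\<^esub> b = Q.pure a b" "a \<odot>\<^bsub>?C\<^esub> Q.pure \<one>\<^bsub>A\<^esub> \<one>\<^bsub>A\<^esub> = Q.pure a \<one>\<^bsub>A\<^esub>"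
    "Q.pure \<one>\<^bsub>A\<^esub> \<one>\<^bsub>A\<^esub> \<star>\<^bsub>?C\<^esub> b = Q.pure \<one>\<^bsub>A\<^esub> b"
    if "a \<in> carrier A" "b \<in> carrier A" for a b
    using that by (simp_all add: Q.Q_smult_pure)
  have bal: "balanced_map ?B ?R (rsmult ?R) ?R (smult ?R) CC.Q (\<lambda>a a'. CC.pure (Q.pure a \<one>\<^bsub>A\<^esub>) (Q.pure \<one>\<^bsub>A\<^esub> a'))"
  proof (rule balanced_mapI)
    fix x r y assume "x \<in> carrier ?R" "r \<in> carrier ?B" "y \<in> carrier ?R"
    then have xry: "x \<in> carrier A" "r \<in> B" "r \<in> carrier A" "y \<in> carrier A" using Bc by auto
    \<comment> \<open>For \<open>r\<close> in \<open>B\<close>,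
      \<open>x r \<otimes> 1 = x \<otimes> r\<close> is the right action of \<open>r\<close> on
      \<open>x \<otimes> 1\<close>; through the tensor product over \<open>A\<close> it becomes a
      left action on \<open>1 \<otimes> y\<close>.\<close>
    have "Q.pure (x \<otimes>\<^bsub>A\<^esub> r) \<one>\<^bsub>A\<^esub> = Q.pure x \<one>\<^bsub>A\<^esub> \<star>\<^bsub>?C\<^esub> r"
      using Q.Q_pure_balanced[of x r "\<one>\<^bsub>A\<^esub>"] xry by (simp add: Q.Q_smult_pure)
    moreover have "Q.pure \<one>\<^bsub>A\<^esub> (r \<otimes>\<^bsub>A\<^esub> y) = r \<odot>\<^bsub>?C\<^esub> Q.pure \<one>\<^bsub>A\<^esub> y"
      using Q.Q_pure_balanced[of "\<one>\<^bsub>A\<^esub>" r y] xry by (simp add: Q.Q_smult_pure)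
    ultimately show "CC.pure (Q.pure (x \<star>\<^bsub>?R\<^esub> r) \<one>\<^bsub>A\<^esub>) (Q.pure \<one>\<^bsub>A\<^esub> y) =
        CC.pure (Q.pure x \<one>\<^bsub>A\<^esub>) (Q.pure \<one>\<^bsub>A\<^esub> (r \<odot>\<^bsub>?R\<^esub> y))"
      using xry by (simp add: Q.Q_pure CC.Q_pure_balanced)
  qed (use Q.Q_pure_add in \<open>simp_all add: Q.Q_pure CC.Q_pure CC.Q_pure_add\<close>)
  have bal': "balanced_map ?B ?R (rsmult ?R) ?R (smult ?R) A (\<lambda>a a'. a \<otimes>\<^bsub>A\<^esub> a')"
    by (rule balanced_mapI) (auto simp: A.m_assoc A.l_distr A.r_distr Bc)
  note h = Q.Q_sum_hom[OF CC.abelian_group_Q bal] Q.Q_sum_hom[OF A.abelian_group_axioms bal']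
  note p = Q.Q_sum_pure[OF CC.abelian_group_Q bal] Q.Q_sum_pure[OF A.abelian_group_axioms bal']
  show ?thesis
    unfolding sweedler_bimodule_def sweedler_comult_def[abs_def] sweedler_counit_def[abs_def] Let_def
  proof (rule generated_coring.intro[OF Q.bimodule_Q generated_coring_axioms.intro])
    show "P c" if "c \<in> carrier ?C"
      "\<And>a b. a \<in> carrier A \<Longrightarrow> b \<in> carrier A \<Longrightarrow> P (a \<odot>\<^bsub>?C\<^esub> Q.pure \<one>\<^bsub>A\<^esub> \<one>\<^bsub>A\<^esub> \<star>\<^bsub>?C\<^esub> b)"
      "\<And>s t. s \<in> carrier ?C \<Longrightarrow> t \<in> carrier ?C \<Longrightarrow> P s \<Longrightarrow> P t \<Longrightarrow> P (s \<ominus>\<^bsub>?C\<^esub> t)" for c P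
      using that(1)
    proof (induction c rule: Q.Q_induct)
      case (pure x y)
      then show ?case using that(2)[of x y] by (simp add: gen)
    qed (rule that(3))
  qed (use h in \<open>simp_all add: Q.Q_pure gen p\<close>)
qed

text \<open>Scalars act through multiples of the unit of \<open>A\<close>. This turns modules over
  \<open>A\<close> into targets for Sweedler sums, which are developed for modules over
  \<open>K\<close>.\<close>

lemma module_restrict_scalars:
  assumes A: "assoc_algebra K A" and Q: "left_module A Q act"
  shows "module K \<lparr>carrier = carrier Q, monoid.mult = monoid.mult Q, one = one Q, ring.zero = ring.zero Q,
    ring.add = ring.add Q, smult = \<lambda>c t. act (c \<odot>\<^bsub>A\<^esub> \<one>\<^bsub>A\<^esub>) t\<rparr>" (is "module K ?W")
proof -
  interpret A: assoc_algebra K A by (rule A)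
  interpret Q: left_module A Q act by (rule Q)
  have "abelian_group ?W"
    by (rule abelian_group_target[OF Q.M.abelian_group_axioms]) simp_all
  moreover have "(c \<otimes>\<^bsub>K\<^esub> d) \<odot>\<^bsub>A\<^esub> \<one>\<^bsub>A\<^esub> = (c \<odot>\<^bsub>A\<^esub> \<one>\<^bsub>A\<^esub>) \<otimes>\<^bsub>A\<^esub> (d \<odot>\<^bsub>A\<^esub> \<one>\<^bsub>A\<^esub>)" if "c \<in> carrier K" "d \<in> carrier K" for c d
    using that by (simp add: A.smult_mult_left A.smult_assoc1)
  ultimately show ?thesis
    by (intro moduleI) (auto simp: A.is_cring Q.act_closed A.smult_l_distr Q.act_l_distr Q.act_r_distr
        Q.act_assoc Q.act_one)
qed

section \<open>The canonical map\<close>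

context comodule_algebra
begin

lemma E_simps: "\<zero>\<^bsub>EE'\<^esub> = \<zero>\<^bsub>AH\<^esub>" "ring.add EE' = ring.add AH" "smult EE' = tensor_lmult K H A"
  "t \<star>\<^bsub>EE'\<^esub> b = tensor_sum AH t (\<lambda>a h. tensor_lmult K H A a (psiR K H A \<rho> h b))"
  by (simp_all add: entwining_bimodule_def Let_def)

lemma E_AH: "t \<in> carrier EE' \<Longrightarrow> t \<in> carrier AH"
  using lin_closed[OF lin_pR] by (auto simp: carrier_E)

lemma abelian_group_E: "abelian_group EE'"
proof -
  interpret AH: module K AH by simp
  note l = lin_add[OF lin_pR, symmetric]
  have z: "pR K H A \<rho> \<zero>\<^bsub>AH\<^esub> = \<zero>\<^bsub>AH\<^esub>"
    using l[of "\<zero>\<^bsub>AH\<^esub>" "\<zero>\<^bsub>AH\<^esub>"] lin_closed[OF lin_pR, of "\<zero>\<^bsub>AH\<^esub>"] by (simp add: AH.M.add.l_cancel_one)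
  show ?thesis
  proof (rule abelian_groupI, unfold E_simps)
    fix x assume "x \<in> carrier EE'"
    then obtain s where s: "s \<in> carrier AH" "x = pR K H A \<rho> s" by (auto simp: carrier_E)
    show "\<exists>y\<in>carrier EE'. y \<oplus>\<^bsub>AH\<^esub> x = \<zero>\<^bsub>AH\<^esub>"
      by (rule bexI[of _ "pR K H A \<rho> (\<ominus>\<^bsub>AH\<^esub> s)"]) (use s z in \<open>simp_all add: l AH.M.l_neg carrier_E\<close>)
  next
    fix x y assume "x \<in> carrier EE'" "y \<in> carrier EE'"
    then show "x \<oplus>\<^bsub>AH\<^esub> y \<in> carrier EE'" by (auto simp: carrier_E l)
    show "x \<oplus>\<^bsub>AH\<^esub> y = y \<oplus>\<^bsub>AH\<^esub> x"
      using \<open>x \<in> carrier EE'\<close> \<open>y \<in> carrier EE'\<close> by (simp add: E_AH AH.M.a_comm)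
  next
    show "\<zero>\<^bsub>AH\<^esub> \<in> carrier EE'" unfolding carrier_E by (rule image_eqI[of _ _ "\<zero>\<^bsub>AH\<^esub>"]) (simp_all add: z)
  qed (simp_all add: E_AH AH.M.a_assoc)
qed

lemma E_minus: "s \<in> carrier EE' \<Longrightarrow> t \<in> carrier EE' \<Longrightarrow> s \<ominus>\<^bsub>EE'\<^esub> t = s \<ominus>\<^bsub>AH\<^esub> t"
  using additive_diff[OF abelian_group_E, of AH "\<lambda>x. x"] module_AH E_AH
  by (simp add: module_def E_simps)

lemma lin_E_hom: "lin K AH G f \<Longrightarrow> f \<in> hom (add_monoid EE') (add_monoid G)"
  by (auto intro!: homI simp: E_AH E_simps lin_closed lin_add)

text \<open>Multiplicativity of the coaction. With \<open>b = 1\<close> it shows how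
  \<open>\<rho> 1\<close> generates, and with \<open>c = 1\<close> that the projection fixes every
  \<open>a \<rho>(b)\<close>.\<close>

lemma star_lmult_coaction:
  assumes [simp]: "a \<in> carrier A" "b \<in> carrier A" "c \<in> carrier A"
  shows "tensor_lmult K H A a (\<rho> b) \<star>\<^bsub>EE'\<^esub> c = tensor_lmult K H A a (\<rho> (b \<diamond> c))"
proof -
  note FF = pure_lin bil_lin[OF bil_pure_AH]
  have "tensor_lmult K H A a (\<rho> b) \<star>\<^bsub>EE'\<^esub> c =
      rs AH b (\<lambda>x y. rs AH c (\<lambda>u v. pure_tensor AH (a \<diamond> (x \<diamond> u)) (y \<bullet> v)))"
    unfolding E_simps
    by (subst lmult_sum) (simp_all add: bil_psi lmult_psiR A_assoc rs_def[symmetric] cong: rs_cong)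
  also have "\<dots> = rs AH (b \<diamond> c) (\<lambda>x y. pure_tensor AH (a \<diamond> x) y)"
    by (rule rs_mult[symmetric]) (simp_all add: bil_lmult)
  finally show ?thesis by (simp add: lmult_coaction)
qed

lemma lin_star: "b \<in> carrier A \<Longrightarrow> lin K AH AH (\<lambda>t. t \<star>\<^bsub>EE'\<^esub> b)"
  unfolding E_simps by (rule ktensor_sum_lin[OF module_A module_H module_AH bil_psi])

lemma lin_star_fun: "t \<in> carrier AH \<Longrightarrow> lin K A AH (\<lambda>b. t \<star>\<^bsub>EE'\<^esub> b)"
  unfolding E_simps
  by (rule lin_ktensor_sum_fun[OF module_A module_H module_AH]) (simp_all add: lin_compose[OF lin_lmult_arg lin_psiR(2)])

lemma pR_star: "pR K H A \<rho> t = t \<star>\<^bsub>EE'\<^esub> \<one>\<^bsub>A\<^esub>"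
  by (simp add: pR_def E_simps)

lemma lmult_pR: "a \<in> carrier A \<Longrightarrow> x \<in> carrier A \<Longrightarrow> h \<in> carrier H \<Longrightarrow>
    tensor_lmult K H A a (pR K H A \<rho> (pure_tensor AH x h)) = pR K H A \<rho> (pure_tensor AH (a \<diamond> x) h)"
  by (simp add: pR_pure rs_push[OF lin_lmult_arg] lmult_pure A_assoc cong: rs_cong)

lemma smult_AH: "c \<in> carrier K \<Longrightarrow> t \<in> carrier AH \<Longrightarrow> c \<odot>\<^bsub>AH\<^esub> t = tensor_lmult K H A (c \<odot>\<^bsub>A\<^esub> \<one>\<^bsub>A\<^esub>) t"
  using lin_smult[OF lin_lmult_fun, of t c "\<one>\<^bsub>A\<^esub>"] by (simp add: lmult_one)

context
  assumes sur: "can ` carrier AA = carrier EE'"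
begin

lemma can_E: "s \<in> carrier AA \<Longrightarrow> can s \<in> carrier EE'"
  using sur by blast

lemma lmult_coaction_E [simp]: "a \<in> carrier A \<Longrightarrow> b \<in> carrier A \<Longrightarrow> tensor_lmult K H A a (\<rho> b) \<in> carrier EE'"
  using can_E[OF ktensor_pure_closed[OF module_A module_A, of a b]] by (simp add: can_pure)

text \<open>Surjectivity of \<open>can\<close> as an induction principle: \<open>E\<close> is
  generated by the elements \<open>a \<rho>(b)\<close>, for which \<open>lmult_lmult\<close> and
  \<open>star_lmult_coaction\<close> compute both actions.\<close>

lemma E_induct [consumes 1, case_names gen minus]:
  assumes "c \<in> carrier EE'"
    and gen: "\<And>a b. a \<in> carrier A \<Longrightarrow> b \<in> carrier A \<Longrightarrow> P (tensor_lmult K H A a (\<rho> b))"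
    and minus: "\<And>s t. s \<in> carrier EE' \<Longrightarrow> t \<in> carrier EE' \<Longrightarrow> P s \<Longrightarrow> P t \<Longrightarrow> P (s \<ominus>\<^bsub>EE'\<^esub> t)"
  shows "P c"
proof -
  obtain s where s: "s \<in> carrier AA" "c = can s" using assms(1) sur by blast
  have AA: "abelian_group AA" using module_AA by (simp add: module_def)
  have "P (can s)" using s(1)
  proof (induction s rule: ktensor_induct[OF module_A module_A, consumes 1, case_names pure minus])
    case (minus s t)
    have "can (s \<ominus>\<^bsub>AA\<^esub> t) = can s \<ominus>\<^bsub>EE'\<^esub> can t"
      by (rule additive_diff[OF AA abelian_group_E]) (use minus in \<open>simp_all add: can_E lin_add[OF lin_can] E_simps\<close>)
    then show ?case using assms(3)[OF can_E can_E] minus by simp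
  qed (simp add: can_pure gen)
  then show ?thesis using s by simp
qed

lemma E_eqI:
  assumes "abelian_group G" "f \<in> hom (add_monoid EE') (add_monoid G)" "f' \<in> hom (add_monoid EE') (add_monoid G)"
    and "\<And>a b. a \<in> carrier A \<Longrightarrow> b \<in> carrier A \<Longrightarrow> f (tensor_lmult K H A a (\<rho> b)) = f' (tensor_lmult K H A a (\<rho> b))"
    and "c \<in> carrier EE'"
  shows "f c = f' c"
  by (rule E_induct[OF assms(5)]) (use assms(4) additive_eqD[OF abelian_group_E assms(1-3)] in auto)

lemma lin_E_closed:
  assumes f: "lin K AH AH f"
    and "\<And>a b. a \<in> carrier A \<Longrightarrow> b \<in> carrier A \<Longrightarrow> f (tensor_lmult K H A a (\<rho> b)) \<in> carrier EE'"
    and "c \<in> carrier EE'"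
  shows "f c \<in> carrier EE'"
  using assms(3)
proof (induction c rule: E_induct)
  case (minus s t)
  interpret E: abelian_group EE' by (rule abelian_group_E)
  have AH: "abelian_group AH" using module_AH by (simp add: module_def)
  have "f (s \<ominus>\<^bsub>AH\<^esub> t) = f s \<ominus>\<^bsub>AH\<^esub> f t"
    by (rule additive_diff[OF AH AH]) (use minus in \<open>simp_all add: E_AH lin_add[OF f] lin_closed[OF f]\<close>)
  then show ?case
    using E.minus_closed[OF minus(3,4)] by (simp add: E_minus minus)
qed (rule assms(2))

lemma lmult_E: "a \<in> carrier A \<Longrightarrow> t \<in> carrier EE' \<Longrightarrow> tensor_lmult K H A a t \<in> carrier EE'"
  by (rule lin_E_closed[OF lin_lmult_arg]) (simp_all add: lmult_lmult)

lemma star_E: "a \<in> carrier A \<Longrightarrow> t \<in> carrier EE' \<Longrightarrow> t \<star>\<^bsub>EE'\<^esub> a \<in> carrier EE'"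
  by (rule lin_E_closed[OF lin_star]) (simp_all add: star_lmult_coaction)

lemma bimodule_E: "bimodule A EE'"
proof -
  have AH: "abelian_group AH" using module_AH by (simp add: module_def)
  note eq = E_eqI[OF AH]
  note L = lin_E_hom[OF lin_star] lin_E_hom[OF lin_lmult_arg] lin_E_hom[OF lin_id]
    lin_E_hom[OF lin_compose[OF lin_star lin_star]] lin_E_hom[OF lin_compose[OF lin_star lin_lmult_arg]]
    lin_E_hom[OF lin_compose[OF lin_lmult_arg lin_star]]
  note st = star_lmult_coaction lmult_lmult
  show ?thesis
    unfolding bimodule_def left_module_def right_module_def left_module_axioms_def
      right_module_axioms_def bimodule_axioms_def E_simps(1-3)
  proof (intro conjI allI impI ring_A abelian_group_E)
    fix r s t assume [simp]: "r \<in> carrier A" "s \<in> carrier A" and t: "t \<in> carrier EE'"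
    show "t \<star>\<^bsub>EE'\<^esub> (r \<diamond> s) = t \<star>\<^bsub>EE'\<^esub> r \<star>\<^bsub>EE'\<^esub> s"
      by (rule eq[of "\<lambda>t. t \<star>\<^bsub>EE'\<^esub> (r \<diamond> s)" "\<lambda>t. t \<star>\<^bsub>EE'\<^esub> r \<star>\<^bsub>EE'\<^esub> s", OF L(1,4) _ t]) (simp_all add: st A_assoc)
    show "tensor_lmult K H A r t \<star>\<^bsub>EE'\<^esub> s = tensor_lmult K H A r (t \<star>\<^bsub>EE'\<^esub> s)"
      by (rule eq[of "\<lambda>t. tensor_lmult K H A r t \<star>\<^bsub>EE'\<^esub> s" "\<lambda>t. tensor_lmult K H A r (t \<star>\<^bsub>EE'\<^esub> s)", OF L(5,6) _ t])
        (simp_all add: st A_assoc)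
  next
    fix t assume t: "t \<in> carrier EE'"
    show "t \<star>\<^bsub>EE'\<^esub> \<one>\<^bsub>A\<^esub> = t"
      by (rule eq[of "\<lambda>t. t \<star>\<^bsub>EE'\<^esub> \<one>\<^bsub>A\<^esub>" "\<lambda>t. t", OF L(1,3) _ t]) (simp_all add: st)
  qed (simp_all add: lmult_E star_E E_AH lmult_lmult lmult_one lin_add[OF lin_lmult_arg] lin_add[OF lin_lmult_fun]
      lin_add[OF lin_star] lin_add[OF lin_star_fun])
qed

end

context
  assumes sur: "can ` carrier AA = carrier EE'"
begin

abbreviation "EE2 \<equiv> bitensor A EE' EE'"

lemma bimodule_pair_E: "bimodule_pair A EE' EE' A"
  using bimodule_E[OF sur] by (simp add: bimodule_pair_def bimodule_pair_axioms_def)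

text \<open>Views \<open>E\<close> and \<open>E \<otimes>\<^sub>A E\<close> as modules over \<open>K\<close>, so that Sweedler sums can be taken in them.\<close>

definition EK :: "('k, ('a, 'h) tensor) module" where
  "EK = \<lparr>carrier = carrier EE', monoid.mult = monoid.mult AH, one = one AH, ring.zero = ring.zero AH,
    ring.add = ring.add AH, smult = smult AH\<rparr>"

definition EE2K :: "('k, (('a, 'h) tensor, ('a, 'h) tensor) tensor) module" where
  "EE2K = \<lparr>carrier = carrier EE2, monoid.mult = monoid.mult EE2, one = one EE2, ring.zero = ring.zero EE2,
    ring.add = ring.add EE2, smult = \<lambda>c t. (c \<odot>\<^bsub>A\<^esub> \<one>\<^bsub>A\<^esub>) \<odot>\<^bsub>EE2\<^esub> t\<rparr>"

lemma module_EE2K [simp]: "module K EE2K"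
proof -
  interpret P: bimodule_pair A EE' EE' A by (rule bimodule_pair_E)
  interpret Q: bimodule A EE2 by (rule P.bimodule_Q)
  show ?thesis unfolding EE2K_def by (rule module_restrict_scalars[OF assoc_algebra_A Q.left_module_axioms])
qed

lemma sum_EE2K: "tensor_sum EE2 t f = tensor_sum EE2K t f"
  by (rule tensor_sum_target_cong) (simp_all add: EE2K_def)

text \<open>On \<open>E\<close> the right action of a scalar multiple of 1 is the scalar action.
  Hence scalars pass through the tensor product over \<open>A\<close>, and
  \<open>pure_tensor EE2\<close> becomes bilinear over \<open>K\<close>.\<close>

lemma star_scalar:
  assumes c: "c \<in> carrier K" and t: "t \<in> carrier EE'"
  shows "t \<star>\<^bsub>EE'\<^esub> (c \<odot>\<^bsub>A\<^esub> \<one>\<^bsub>A\<^esub>) = c \<odot>\<^bsub>AH\<^esub> t"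
proof -
  interpret A: assoc_algebra K A by simp
  have AH: "abelian_group AH" using module_AH by (simp add: module_def)
  have c1: "c \<odot>\<^bsub>A\<^esub> \<one>\<^bsub>A\<^esub> \<in> carrier A" using c by simp
  show ?thesis
    by (rule E_eqI[OF sur AH lin_E_hom[OF lin_star[OF c1]] lin_E_hom[OF lin_smult_fun[OF lin_id c module_AH]] _ t])
      (use c c1 in \<open>simp add: star_lmult_coaction A.smult_mult_right lin_smult[OF lin_coaction] lin_smult[OF lin_lmult_arg]\<close>)
qed

lemma bil_pure_E: "bil K EK EK EE2K (pure_tensor EE2)"
proof -
  interpret P: bimodule_pair A EE' EE' A by (rule bimodule_pair_E)
  interpret A: assoc_algebra K A by simp
  have sm: "pure_tensor EE2 (c \<odot>\<^bsub>AH\<^esub> u) v = (c \<odot>\<^bsub>A\<^esub> \<one>\<^bsub>A\<^esub>) \<odot>\<^bsub>EE2\<^esub> pure_tensor EE2 u v"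
    "pure_tensor EE2 u (c \<odot>\<^bsub>AH\<^esub> v) = (c \<odot>\<^bsub>A\<^esub> \<one>\<^bsub>A\<^esub>) \<odot>\<^bsub>EE2\<^esub> pure_tensor EE2 u v"
    if "c \<in> carrier K" "u \<in> carrier EE'" "v \<in> carrier EE'" for c u v
  proof -
    have c1: "c \<odot>\<^bsub>A\<^esub> \<one>\<^bsub>A\<^esub> \<in> carrier A" using that by simp
    show 1: "pure_tensor EE2 (c \<odot>\<^bsub>AH\<^esub> u) v = (c \<odot>\<^bsub>A\<^esub> \<one>\<^bsub>A\<^esub>) \<odot>\<^bsub>EE2\<^esub> pure_tensor EE2 u v"
      using that c1 by (simp add: P.Q_smult_pure smult_AH E_AH E_simps)
    have "pure_tensor EE2 u (c \<odot>\<^bsub>AH\<^esub> v) = pure_tensor EE2 (u \<star>\<^bsub>EE'\<^esub> (c \<odot>\<^bsub>A\<^esub> \<one>\<^bsub>A\<^esub>)) v"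
      using that c1 P.Q_pure_balanced[of u "c \<odot>\<^bsub>A\<^esub> \<one>\<^bsub>A\<^esub>" v] by (simp add: smult_AH E_AH E_simps(3))
    then show "pure_tensor EE2 u (c \<odot>\<^bsub>AH\<^esub> v) = (c \<odot>\<^bsub>A\<^esub> \<one>\<^bsub>A\<^esub>) \<odot>\<^bsub>EE2\<^esub> pure_tensor EE2 u v"
      using 1 that by (simp add: star_scalar)
  qed
  show ?thesis
    unfolding bil_def
    using P.Q_pure_add
    by (auto intro!: linI simp: EK_def EE2K_def P.Q_pure sm E_simps(2))
qed

lemmas pure_E_lin = bil_lin_fun[OF bil_pure_E]

lemma lin_pR_EK: "lin K M AH f \<Longrightarrow> lin K M EK (\<lambda>x. pR K H A \<rho> (f x))"
  using lin_compose[OF lin_pR, of M f] lin_closed[of K M AH f]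
  by (fastforce simp: lin_def module_hom_def EK_def carrier_E)

lemma carrier_EK: "carrier EK = carrier EE'"
  by (simp add: EK_def)

lemma pR_EK [simp]: "t \<in> carrier AH \<Longrightarrow> pR K H A \<rho> t \<in> carrier EK"
  by (simp add: carrier_EK carrier_E)

lemma pR_coaction: "a \<in> carrier A \<Longrightarrow> b \<in> carrier A \<Longrightarrow>
    pR K H A \<rho> (tensor_lmult K H A a (\<rho> b)) = tensor_lmult K H A a (\<rho> b)"
  by (simp add: pR_star star_lmult_coaction)

lemma entwining_comult_sw: "entwining_comult K H \<Delta> A \<rho> t =
    tensor_sum EE2K t (\<lambda>a h. H.sw EE2K h (\<lambda>u v.
      pure_tensor EE2 (pR K H A \<rho> (pure_tensor AH a u)) (pR K H A \<rho> (pure_tensor AH \<one>\<^bsub>A\<^esub> v))))"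
  by (simp add: entwining_comult_def Let_def sum_EE2K H.sw_def)

lemma bil_comult: "bil K A H EE2K (\<lambda>a h. H.sw EE2K h (\<lambda>u v.
      pure_tensor EE2 (pR K H A \<rho> (pure_tensor AH a u)) (pR K H A \<rho> (pure_tensor AH \<one>\<^bsub>A\<^esub> v))))"
  by (simp add: asimps pure_E_lin lin_pR_EK pure_lin bil_lin[OF bil_pure_AH])

lemma entwining_comult_hom: "entwining_comult K H \<Delta> A \<rho> \<in> hom (add_monoid EE') (add_monoid EE2)"
proof -
  have "entwining_comult K H \<Delta> A \<rho> \<in> hom (add_monoid EE') (add_monoid EE2K)"
    unfolding entwining_comult_sw[abs_def]
    by (rule lin_E_hom[OF ktensor_sum_lin[OF module_A module_H module_EE2K bil_comult]])
  then show ?thesis by (simp add: EE2K_def hom_def)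
qed

text \<open>By coassociativity the left factor becomes
  \<open>p_R (a \<rho>(b_0)) = a \<rho>(b_0)\<close>, which is \<open>a \<rho>(1)\<close> acted on
  by \<open>b_0\<close> from the right. So \<open>b_0\<close> crosses the tensor sign and completes
  the right factor to \<open>p_R (\<rho> b) = \<rho> b\<close>.\<close>

lemma entwining_comult_gen:
  assumes [simp]: "a \<in> carrier A" "b \<in> carrier A"
  shows "entwining_comult K H \<Delta> A \<rho> (tensor_lmult K H A a (\<rho> b)) =
    pure_tensor EE2 (tensor_lmult K H A a (\<rho> \<one>\<^bsub>A\<^esub>)) (\<rho> b)"
proof -
  interpret P: bimodule_pair A EE' EE' A by (rule bimodule_pair_E)
  let ?p = "\<lambda>x h. pR K H A \<rho> (pure_tensor AH x h)"
  note ll = asimps pure_E_lin lin_pR_EK pure_lin bil_lin[OF bil_pure_AH]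
  have E [simp]: "tensor_lmult K H A x (\<rho> y) \<in> carrier EK" if "x \<in> carrier A" "y \<in> carrier A" for x y
    using that by (simp add: carrier_EK lmult_coaction_E[OF sur])
  have E1 [simp]: "\<rho> y \<in> carrier EK" if "y \<in> carrier A" for y
    using E[OF A_one_closed that] that by (simp add: lmult_one)
  have "entwining_comult K H \<Delta> A \<rho> (tensor_lmult K H A a (\<rho> b)) =
      rs EE2K b (\<lambda>x y. H.sw EE2K y (\<lambda>u v. pure_tensor EE2 (?p (a \<diamond> x) u) (?p \<one>\<^bsub>A\<^esub> v)))"
    unfolding entwining_comult_sw rs_def
    by (rule lmult_sum[OF _ _ module_EE2K bil_comult]) simp_all
  also have "\<dots> = rs EE2K b (\<lambda>x y. rs EE2K x (\<lambda>u v. pure_tensor EE2 (?p (a \<diamond> u) v) (?p \<one>\<^bsub>A\<^esub> y)))"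
    by (rule rs_coassoc[symmetric]) (simp_all add: ll)
  also have "\<dots> = rs EE2K b (\<lambda>x y. pure_tensor EE2 (tensor_lmult K H A a (\<rho> \<one>\<^bsub>A\<^esub>)) (?p x y))"
  proof (rule rs_cong[OF refl assms(2)])
    fix x y assume [simp]: "x \<in> carrier A" "y \<in> carrier H"
    have L: "lin K AH EE2K (\<lambda>t. pure_tensor EE2 (pR K H A \<rho> t) (?p \<one>\<^bsub>A\<^esub> y))"
      by (simp add: ll)
    have "rs EE2K x (\<lambda>u v. pure_tensor EE2 (?p (a \<diamond> u) v) (?p \<one>\<^bsub>A\<^esub> y)) =
        pure_tensor EE2 (pR K H A \<rho> (tensor_lmult K H A a (\<rho> x))) (?p \<one>\<^bsub>A\<^esub> y)"
      unfolding lmult_coaction by (rule rs_push[OF L, symmetric]) simp_all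
    also have "\<dots> = pure_tensor EE2 (tensor_lmult K H A a (\<rho> \<one>\<^bsub>A\<^esub>) \<star>\<^bsub>EE'\<^esub> x) (?p \<one>\<^bsub>A\<^esub> y)"
      by (simp add: pR_coaction star_lmult_coaction)
    also have "\<dots> = pure_tensor EE2 (tensor_lmult K H A a (\<rho> \<one>\<^bsub>A\<^esub>)) (x \<odot>\<^bsub>EE'\<^esub> ?p \<one>\<^bsub>A\<^esub> y)"
      by (rule P.Q_pure_balanced) (use E in \<open>simp_all flip: carrier_EK\<close>)
    also have "\<dots> = pure_tensor EE2 (tensor_lmult K H A a (\<rho> \<one>\<^bsub>A\<^esub>)) (?p x y)"
      by (simp add: E_simps lmult_pR)
    finally show "rs EE2K x (\<lambda>u v. pure_tensor EE2 (?p (a \<diamond> u) v) (?p \<one>\<^bsub>A\<^esub> y)) =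
        pure_tensor EE2 (tensor_lmult K H A a (\<rho> \<one>\<^bsub>A\<^esub>)) (?p x y)" .
  qed
  also have "\<dots> = pure_tensor EE2 (tensor_lmult K H A a (\<rho> \<one>\<^bsub>A\<^esub>)) (pR K H A \<rho> (rs AH b (pure_tensor AH)))"
  proof (rule rs_push[symmetric])
    show "lin K AH EE2K (\<lambda>t. pure_tensor EE2 (tensor_lmult K H A a (\<rho> \<one>\<^bsub>A\<^esub>)) (pR K H A \<rho> t))"
      by (simp add: ll)
  qed simp_all
  also have "\<dots> = pure_tensor EE2 (tensor_lmult K H A a (\<rho> \<one>\<^bsub>A\<^esub>)) (\<rho> b)"
    using pR_coaction[of "\<one>\<^bsub>A\<^esub>" b] by (simp add: rs_self lmult_one)
  finally show ?thesis .
qed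

lemma bil_counit: "bil K A H A (\<lambda>a h. \<epsilon> h \<odot>\<^bsub>A\<^esub> a)"
  by (simp add: asimps)

lemma entwining_generated:
  "generated_coring A EE' (entwining_comult K H \<Delta> A \<rho>) (entwining_counit A \<epsilon>) (\<rho> \<one>\<^bsub>A\<^esub>)"
proof (rule generated_coring.intro[OF bimodule_E[OF sur] generated_coring_axioms.intro])
  have act: "tensor_lmult K H A a (\<rho> \<one>\<^bsub>A\<^esub>) \<star>\<^bsub>EE'\<^esub> b = tensor_lmult K H A a (\<rho> b)" "a \<odot>\<^bsub>EE'\<^esub> \<rho> \<one>\<^bsub>A\<^esub> = tensor_lmult K H A a (\<rho> \<one>\<^bsub>A\<^esub>)"
    "\<rho> \<one>\<^bsub>A\<^esub> \<star>\<^bsub>EE'\<^esub> b = \<rho> b"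
    if "a \<in> carrier A" "b \<in> carrier A" for a b
    using that star_lmult_coaction[of a "\<one>\<^bsub>A\<^esub>" b] star_lmult_coaction[of "\<one>\<^bsub>A\<^esub>" "\<one>\<^bsub>A\<^esub>" b]
    by (simp_all add: E_simps(3) lmult_one)
  show "\<rho> \<one>\<^bsub>A\<^esub> \<in> carrier EE'"
    using lmult_coaction_E[OF sur, of "\<one>\<^bsub>A\<^esub>" "\<one>\<^bsub>A\<^esub>"] by (simp add: lmult_one)
  show "P c" if "c \<in> carrier EE'"
      "\<And>a b. a \<in> carrier A \<Longrightarrow> b \<in> carrier A \<Longrightarrow> P (a \<odot>\<^bsub>EE'\<^esub> \<rho> \<one>\<^bsub>A\<^esub> \<star>\<^bsub>EE'\<^esub> b)"
      "\<And>s t. s \<in> carrier EE' \<Longrightarrow> t \<in> carrier EE' \<Longrightarrow> P s \<Longrightarrow> P t \<Longrightarrow> P (s \<ominus>\<^bsub>EE'\<^esub> t)" for c P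
    using that(1)
  proof (induction c rule: E_induct[OF sur, consumes 1, case_names gen minus])
    case (gen a b)
    then show ?case using that(2)[of a b] by (simp add: act)
  qed (rule that(3))
  show "entwining_comult K H \<Delta> A \<rho> \<in> hom (add_monoid EE') (add_monoid EE2)"
    by (rule entwining_comult_hom)
  show "entwining_counit A \<epsilon> \<in> hom (add_monoid EE') (add_monoid A)"
    unfolding entwining_counit_def[abs_def]
    by (rule lin_E_hom[OF ktensor_sum_lin[OF module_A module_H module_A bil_counit]])
  fix a b assume ab [simp]: "a \<in> carrier A" "b \<in> carrier A"
  show "entwining_comult K H \<Delta> A \<rho> (a \<odot>\<^bsub>EE'\<^esub> \<rho> \<one>\<^bsub>A\<^esub> \<star>\<^bsub>EE'\<^esub> b) =
      pure_tensor EE2 (a \<odot>\<^bsub>EE'\<^esub> \<rho> \<one>\<^bsub>A\<^esub>) (\<rho> \<one>\<^bsub>A\<^esub> \<star>\<^bsub>EE'\<^esub> b)"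
    unfolding act[OF ab] by (rule entwining_comult_gen[OF ab])
  have "entwining_counit A \<epsilon> (tensor_lmult K H A a (\<rho> b)) = rs A b (\<lambda>x y. \<epsilon> y \<odot>\<^bsub>A\<^esub> (a \<diamond> x))"
    unfolding entwining_counit_def rs_def by (rule lmult_sum[OF _ _ module_A bil_counit]) simp_all
  also have "\<dots> = a \<diamond> b" by (rule rs_counit) (simp_all add: asimps)
  finally show "entwining_counit A \<epsilon> (a \<odot>\<^bsub>EE'\<^esub> \<rho> \<one>\<^bsub>A\<^esub> \<star>\<^bsub>EE'\<^esub> b) = a \<diamond> b"
    unfolding act[OF ab] .
qed

end

end

context comodule_algebra_hopf
begin

text \<open>Given the comparison of generated corings, only bijectivity and bimodule linearity
  remain. Surjectivity passes from the map on the tensor square over \<open>K\<close>, since both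
  maps take the values \<open>a \<rho>(b)\<close> on pure tensors.\<close>

lemma galois:
  assumes K: "field K" and fd: "vectorspace.fin_dim K H" and sur: "can ` carrier AA = carrier EE'"
  shows "weak_hopf_galois_extension K H \<Delta> \<epsilon> A \<rho>"
proof -
  let ?R = "regular_bimodule A"
  interpret A: assoc_algebra K A by simp
  have sub: "coinv \<subseteq> carrier A" by (auto dest: coinv_closed)
  interpret Q: bimodule_pair A ?R ?R B
    using bimodule_regular[OF ring_A] sub by (simp add: bimodule_pair_def bimodule_pair_axioms_def)
  interpret E: abelian_group EE' by (rule abelian_group_E)
  have AH: "abelian_group AH" using module_AH by (simp add: module_def)
  note ab = A.abelian_group_axioms
  have Q: "sweedler_bimodule A coinv = Q.Q" by (simp add: sweedler_bimodule_def)
  let ?f = "\<lambda>a b. tensor_lmult K H A a (\<rho> b)"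
  \<comment> \<open>Balancedness over \<open>B\<close> is the definition of coinvariance. Both
    targets are treated because \<open>can\<close> sums in \<open>A \<otimes> H\<close>, while its
    values must be located in \<open>E\<close>.\<close>
  have bal: "balanced_map B ?R (rsmult ?R) ?R (smult ?R) EE' ?f"
    "balanced_map B ?R (rsmult ?R) ?R (smult ?R) AH ?f"
    by (rule balanced_mapI; simp add: lmult_coaction_E[OF sur] E_simps lin_add[OF lin_lmult_fun]
        lin_add[OF lin_lmult_arg] lin_add[OF lin_coaction] coinvD lmult_lmult)+
  have can_AH: "can \<in> hom (add_monoid Q.Q) (add_monoid AH)"
    unfolding can_map_def[abs_def] by (rule Q.Q_sum_hom[OF AH bal(2)])
  have can_EE: "can t \<in> carrier EE'" if "t \<in> carrier Q.Q" for t
  proof -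
    \<comment> \<open>The inclusion of \<open>E\<close> into \<open>A \<otimes> H\<close> is
      additive, so summing in either group gives the same element.\<close>
    have "tensor_sum EE' t ?f = can t"
      unfolding can_map_def
      by (rule Q.tensor_sum_additive[OF abelian_group_E AH _ lin_E_hom[OF lin_id]])
        (use that in \<open>simp_all add: lmult_coaction_E[OF sur] Q.Q_simps\<close>)
    then show ?thesis using additiveD(1)[OF Q.Q_sum_hom[OF abelian_group_E bal(1)] that] by simp
  qed
  have can_hom: "can \<in> hom (add_monoid Q.Q) (add_monoid EE')"
    using can_AH can_EE by (auto simp: hom_def E_simps)
  have can_Q: "can (Q.pure a b) = ?f a b" if "a \<in> carrier A" "b \<in> carrier A" for a b
    unfolding can_map_def using that by (simp add: Q.Q_sum_pure[OF AH bal(2)])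
  have bim: "can \<in> bimodule_hom A Q.Q EE'"
    unfolding bimodule_hom_def left_module_hom_def right_module_hom_def
  proof (intro IntI CollectI conjI ballI can_hom)
    fix r t assume r [simp]: "r \<in> carrier A" and t: "t \<in> carrier Q.Q"
    note c = additive_compose[OF Q.Q_smult_hom(1)[OF r] can_AH] additive_compose[OF Q.Q_smult_hom(2)[OF r] can_AH]
      additive_compose[OF can_AH lin_hom[OF lin_lmult_arg[OF r]]] additive_compose[OF can_AH lin_hom[OF lin_star[OF r]]]
    show "can (r \<odot>\<^bsub>Q.Q\<^esub> t) = r \<odot>\<^bsub>EE'\<^esub> can t"
      unfolding E_simps(3)
      by (rule Q.Q_eqI[OF AH c(1,3) _ t]) (simp add: Q.Q_smult_pure can_Q lmult_lmult)
    show "can (t \<star>\<^bsub>Q.Q\<^esub> r) = can t \<star>\<^bsub>EE'\<^esub> r"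
      by (rule Q.Q_eqI[OF AH c(2,4) _ t]) (simp add: Q.Q_smult_pure can_Q star_lmult_coaction)
  qed
  have surj: "x \<in> can ` carrier Q.Q" if "x \<in> carrier EE'" for x
    using that
  proof (induction x rule: E_induct[OF sur, consumes 1, case_names gen minus])
    case (gen a b)
    then show ?case using can_Q[of a b] Q.Q_pure[of a b] by (metis imageI regular_simps(1))
  next
    case (minus s t)
    then obtain u v where uv: "u \<in> carrier Q.Q" "v \<in> carrier Q.Q" "s = can u" "t = can v" by blast
    then have "can (u \<ominus>\<^bsub>Q.Q\<^esub> v) = s \<ominus>\<^bsub>EE'\<^esub> t"
      using additive_diff[OF Q.abelian_group_Q abelian_group_E, of can u v] additiveD[OF can_hom] by simp
    then show ?case using uv Q.Q.minus_closed[of u v] by (metis imageI)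
  qed
  have inj: "inj_on can (carrier Q.Q)"
  proof (rule dual_basis_left[OF K fd sur])
    fix I :: "('h \<times> 'a \<times> 'a) set" and T b c
    assume I: "finite I" and T: "\<And>i. i \<in> I \<Longrightarrow> lin K H KK (T i)"
      and b: "\<And>i. i \<in> I \<Longrightarrow> b i \<in> carrier A" and c: "\<And>i. i \<in> I \<Longrightarrow> c i \<in> carrier A"
      and hat: "\<And>i a. i \<in> I \<Longrightarrow> a \<in> carrier A \<Longrightarrow> hat (T i) a \<in> coinv"
      and e: "\<And>y. y \<in> carrier A \<Longrightarrow> (\<Oplus>\<^bsub>A\<^esub>i\<in>I. hat (T i) (y \<diamond> b i) \<diamond> c i) = y"
    \<comment> \<open>The \<open>i\<close>-th component of the left inverse announced in the
      overview, with \<open>T i\<close> as functional and \<open>b i\<close>, \<open>c i\<close>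
      from the dual basis.\<close>
    define F where "F i a h = rs A (b i) (\<lambda>b0 b1. T i (h \<bullet> b1) \<odot>\<^bsub>A\<^esub> (a \<diamond> b0))" for i a h
    have F: "bil K A H A (F i)" if "i \<in> I" for i
      unfolding F_def using that b[OF that] t_closed[OF T[OF that]]
      by (simp add: asimps lin_compose[OF T[OF that]] T)
    have F_val: "tensor_sum A (?f x y) (F i) = x \<diamond> hat (T i) (y \<diamond> b i)"
      if i: "i \<in> I" and [simp]: "x \<in> carrier A" "y \<in> carrier A" for i x y
    proof -
      note [simp] = t_closed[OF T[OF i]] b[OF i]
      have L: "lin K A A (\<lambda>z. x \<diamond> z)" by (simp add: asimps)
      have "tensor_sum A (?f x y) (F i) = rs A y (\<lambda>p q. F i (x \<diamond> p) q)"
        unfolding rs_def by (rule lmult_sum[OF _ _ module_A F[OF i]]) simp_all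
      also have "\<dots> = x \<diamond> hat (T i) (y \<diamond> b i)"
        unfolding hat_def F_def
        by (subst rs_mult) (simp_all add: asimps lin_compose[OF T[OF i]] T[OF i] rs_push[OF L] lin_smult[OF L]
            A_assoc cong: rs_cong)
      finally show ?thesis .
    qed
    \<comment> \<open>Defined on all of \<open>A \<otimes> H\<close>, where additivity comes from
      \<open>K\<close>-linearity of each component.\<close>
    define \<Theta> where "\<Theta> t = (\<Oplus>\<^bsub>Q.Q\<^esub>i\<in>I. Q.pure (tensor_sum A t (F i)) (c i))" for t
    have lF: "lin K AH A (\<lambda>t. tensor_sum A t (F i))" if "i \<in> I" for i
      by (rule ktensor_sum_lin[OF module_A module_H module_A F[OF that]])
    have \<Theta>: "\<Theta> \<in> hom (add_monoid AH) (add_monoid Q.Q)"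
    proof (rule homI)
      fix s t assume "s \<in> carrier (add_monoid AH)" "t \<in> carrier (add_monoid AH)"
      then have st: "s \<in> carrier AH" "t \<in> carrier AH" by simp_all
      have cl: "Q.pure (tensor_sum A u (F i)) (c i) \<in> carrier Q.Q" if "i \<in> I" "u \<in> carrier AH" for i u
        using lin_closed[OF lF] that c by (simp add: Q.Q_pure)
      then show "\<Theta> s \<in> carrier (add_monoid Q.Q)"
        unfolding \<Theta>_def using st by (simp add: Q.Q.finsum_closed)
      have "\<Theta> (s \<oplus>\<^bsub>AH\<^esub> t) = (\<Oplus>\<^bsub>Q.Q\<^esub>i\<in>I. Q.pure (tensor_sum A s (F i)) (c i) \<oplus>\<^bsub>Q.Q\<^esub> Q.pure (tensor_sum A t (F i)) (c i))"
        unfolding \<Theta>_def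
        by (rule finsum_cong_raw)
          (use st lin_closed[OF lF] c Q.Q_pure_add(1) in \<open>simp add: lin_add[OF lF]\<close>)
      also have "\<dots> = \<Theta> s \<oplus>\<^bsub>Q.Q\<^esub> \<Theta> t"
        unfolding \<Theta>_def by (rule Q.Q.finsum_addf) (use st cl in auto)
      finally show "\<Theta> (s \<otimes>\<^bsub>add_monoid AH\<^esub> t) = \<Theta> s \<otimes>\<^bsub>add_monoid Q.Q\<^esub> \<Theta> t" by simp
    qed
    have "\<Theta> (can t) = t" if t: "t \<in> carrier Q.Q" for t
    proof (rule Q.Q_eqI[OF Q.abelian_group_Q additive_compose[OF can_AH \<Theta>] additive_id _ t])
      fix x y assume "x \<in> carrier ?R" "y \<in> carrier ?R"
      then have [simp]: "x \<in> carrier A" "y \<in> carrier A" by simp_all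
      have "\<Theta> (can (Q.pure x y)) = (\<Oplus>\<^bsub>Q.Q\<^esub>i\<in>I. Q.pure x (hat (T i) (y \<diamond> b i) \<diamond> c i))"
        unfolding \<Theta>_def
      proof (rule finsum_cong_raw)
        \<comment> \<open>The value of \<open>hat\<close> lies in \<open>B\<close> and therefore
          crosses the tensor sign; the dual basis identity can then be applied in the second
          factor.\<close>
        fix i assume i: "i \<in> I"
        then show "Q.pure (tensor_sum A (can (Q.pure x y)) (F i)) (c i) = Q.pure x (hat (T i) (y \<diamond> b i) \<diamond> c i)"
          using Q.Q_pure_balanced[of x "hat (T i) (y \<diamond> b i)" "c i"] b c hat by (simp add: can_Q F_val)
      qed
      also have "\<dots> = Q.pure x (\<Oplus>\<^bsub>A\<^esub>i\<in>I. hat (T i) (y \<diamond> b i) \<diamond> c i)"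
        by (rule additive_finsum[OF ab Q.abelian_group_Q _ I, symmetric])
          (use Q.Q_pure_add(2)[of x] hat b c in \<open>auto intro!: homI simp: Q.Q_pure\<close>)
      finally show "\<Theta> (can (Q.pure x y)) = Q.pure x y" by (simp add: e)
    qed
    then show ?thesis by (rule inj_on_inverseI)
  qed
  have "coring_iso A (sweedler_bimodule A coinv) (sweedler_comult A coinv) (sweedler_counit A)
      EE' (entwining_comult K H \<Delta> A \<rho>) (entwining_counit A \<epsilon>) can"
  proof (rule generated_coring_iso[OF sweedler_generated[OF ring_A sub] entwining_generated[OF sur]])
    show "bij_betw can (carrier (sweedler_bimodule A coinv)) (carrier EE')"
      unfolding Q bij_betw_def using inj can_EE surj by blast
    show "can (pure_tensor (sweedler_bimodule A coinv) \<one>\<^bsub>A\<^esub> \<one>\<^bsub>A\<^esub>) = \<rho> \<one>\<^bsub>A\<^esub>"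
      by (simp add: Q can_Q lmult_one)
  qed (use bim Q in simp)
  then show ?thesis by (simp add: weak_hopf_galois_extension_def)
qed

end

theorem corollary6p2:
  fixes K :: "'k ring" and H :: "('k, 'h) module" and A :: "('k, 'a) module"
    and \<Delta> :: "'h \<Rightarrow> ('h, 'h) tensor" and \<epsilon> :: "'h \<Rightarrow> 'k" and S :: "'h \<Rightarrow> 'h"
    and \<rho> :: "'a \<Rightarrow> ('a, 'h) tensor"
  assumes "field K"
    and "weak_hopf_algebra K H \<Delta> \<epsilon> S"
    and "vectorspace.fin_dim K H"
    and "comodule_algebra K H \<Delta> \<epsilon> A \<rho>"
    and "can_map K H A \<rho> ` carrier (ktensor K A A) = carrier (entwining_bimodule K H A \<rho>)"
  shows "let B = coinvariants K H A \<rho> in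
    weak_hopf_galois_extension K H \<Delta> \<epsilon> A \<rho> \<and>
    projective_left_module TYPE('m) TYPE('n) (A\<lparr>carrier := B\<rparr>) A (\<lambda>b a. b \<otimes>\<^bsub>A\<^esub> a) \<and>
    projective_right_module TYPE('m) TYPE('n) (A\<lparr>carrier := B\<rparr>) A (\<lambda>a b. a \<otimes>\<^bsub>A\<^esub> b)"
proof -
  interpret comodule_algebra_hopf K H \<Delta> \<epsilon> A \<rho> S
    using assms(2,4) by (simp add: comodule_algebra_hopf_def)
  show ?thesis
    unfolding Let_def
    using galois[OF assms(1,3,5)] projective_left[OF assms(1,3,5)] projective_right[OF assms(1,3,5)] by blast
qed

end
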